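(* Let $s\ge2$ be an integer. The $3^{\mathrm{rd}}$-order weight-$1$ automatic degeneracy of the planar ICIS germ $y^2-x^s\in k[[x,y]]$ is $$\mathrm{AD}^3_{(1)}(y^2-x^s)=\begin{cases}6&\text{if } s=2,\\ 8&\text{if } s=3,\\ 3s&\text{if } s\ge4.\end{cases}$$ In particular, the number of $3^{\mathrm{rd}}$-order weight-$1$ inflection points limiting to this singularity in a general $1$-parameter deformation is equal to $6$ if $s=2$, $8$ if $s=3$, and $3s$ if $s\ge4$.
   Context: $k$ is an algebraically closed field of characteristic $0$. A planar ICIS germ is $f\in k[[x,y]]$, $f(0)=0$, defining an isolated curve singularity; $A=k[[x,y]]/(f)$. Deformations: let $\delta_1,\dots,\delta_d\in k[[x,y]]$ represent a $k$-basis of $\mathrm{Def}^1(f)=\mathrm{Ext}^1_A(\Omega^1_{A/k},A)$ (a quotient of $A$). A $1$-parameter deformation $X/B$ of $f$, given by $(a_i)\in k^d$, has $\mathscr O_B=k[[t]]$, $\mathscr O_X=k[[x,y]][[t]]/(f+t\sum_i a_i\delta_i)$; $X_0$ is the fiber $t=0$, with ideal $I_{X_0}=(t)\subset\mathscr O_X$. Principal parts: $\mathscr P^m_{X/B}=(\mathscr O_X\widehat\otimes_{\mathscr O_B}\mathscr O_X)/I_\Delta^m$, $I_\Delta$ the ideal of the diagonal, regarded as an $\mathscr O_X$-module via the left factor. For a general deformation its dual is free of rank $m$; let $e_1,\dots,e_m$ be a basis of it. For a list $\overline\tau=(\tau_1,\dots,\tau_m)$ of elements of $\mathscr P^m_{X/B}$,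 let $I^m_{\overline\tau}\subset\mathscr O_X$ be the ideal generated by the determinant of the $m\times m$ matrix $(e_i(\tau_j))$. Automatic degeneracy: $\mathrm{AD}^m_{(1)}(f)=\min_{X/B}\min_{\overline\tau}\dim_k\mathscr O_X/(I_{X_0}+I^m_{\overline\tau})$, the minimum over $1$-parameter deformations $X/B$ of $f$ (with $(\mathscr P^m_{X/B})^\vee$ free of rank $m$) and lists $\overline\tau$ of $m$ elements of $\mathscr P^m_{X/B}$. Limiting inflection points: for a general $1$-parameter deformation $X/B$ (parameters in a suitable dense Zariski-open subset) and a list $\overline\tau$ of $m$ elements attaining the minimum defining $\mathrm{AD}^m_{(1)}(f)$, the number of $m^{\mathrm{th}}$-order weight-$1$ inflection points limiting to the singularity in a general $1$-parameter deformation is $\dim_{K}\big((\mathscr O_X/I^m_{\overline\tau})\otimes_{k[[t]]}K\big)$, where $K$ is an algebraic closure of $k((t))$. *)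

theory Defs
  imports
    "HOL-Algebra.Algebra"
    "HOL-Algebra.Algebraic_Closure_Type"
    "HOL-Computational_Algebra.Formal_Laurent_Series"
    "HOL-Combinatorics.Permutations"
    "HOL-Library.Extended_Nat"
    "Jordan_Normal_Form.Missing_VectorSpace"
begin

abbreviation type_ring :: "'a::comm_ring_1 ring" where
  "type_ring \<equiv> ring_of_type_algebra"

definition vdim :: "('c, 'r) ring_scheme \<Rightarrow> ('c, 'v, 'z) module_scheme \<Rightarrow> enat" where
  "vdim K V = (if vectorspace.fin_dim K V then enat (vectorspace.dim K V) else \<infinity>)"

definition free_basis ::
    "('c, 'r) ring_scheme \<Rightarrow> ('c, 'v, 'z) module_scheme \<Rightarrow> nat \<Rightarrow> (nat \<Rightarrow> 'v) \<Rightarrow> bool" where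
  "free_basis R M n e \<longleftrightarrow>
     e ` {..<n} \<subseteq> carrier M \<and> inj_on e {..<n} \<and>
     \<not> module.lin_dep R M (e ` {..<n}) \<and> module.span R M (e ` {..<n}) = carrier M"

definition restrict_scalars :: "('c \<Rightarrow> 'q) \<Rightarrow> ('q, 'z) ring_scheme \<Rightarrow> ('c, 'q) module" where
  "restrict_scalars h Q =
     \<lparr>carrier = carrier Q, monoid.mult = monoid.mult Q, one = one Q, ring.zero = ring.zero Q, add = add Q,
      module.smult = (\<lambda>c x. h c \<otimes>\<^bsub>Q\<^esub> x)\<rparr>"

text \<open>In the next three module records the fields \<open>mult\<close> and \<open>one\<close> carry no meaning; they are
  only there because a module record extends a ring record.\<close>

definition dual_module ::
    "('c, 'r) ring_scheme \<Rightarrow> ('c, 'v, 'z) module_scheme \<Rightarrow> ('c, 'v \<Rightarrow> 'c) module" where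
  "dual_module R M =
     \<lparr>carrier = module_hom R M (restrict_scalars (\<lambda>c. c) R) \<inter> extensional (carrier M),
      monoid.mult = (\<lambda>_ _. \<lambda>x\<in>carrier M. \<zero>\<^bsub>R\<^esub>), one = (\<lambda>x\<in>carrier M. \<zero>\<^bsub>R\<^esub>),
      ring.zero = (\<lambda>x\<in>carrier M. \<zero>\<^bsub>R\<^esub>),
      add = (\<lambda>\<phi> \<psi>. \<lambda>x\<in>carrier M. \<phi> x \<oplus>\<^bsub>R\<^esub> \<psi> x),
      module.smult = (\<lambda>c \<phi>. \<lambda>x\<in>carrier M. c \<otimes>\<^bsub>R\<^esub> \<phi> x)\<rparr>"

definition quot_module :: "('c, 'v, 'z) module_scheme \<Rightarrow> 'v set \<Rightarrow> ('c, 'v set) module" where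
  "quot_module M N =
     \<lparr>carrier = a_rcosets\<^bsub>M\<^esub> N, monoid.mult = (\<lambda>_ _. N), one = N, ring.zero = N, add = set_add M,
      module.smult = (\<lambda>c C. \<Union>x\<in>C. N +>\<^bsub>M\<^esub> (c \<odot>\<^bsub>M\<^esub> x))\<rparr>"

definition free_module :: "('c, 'r) ring_scheme \<Rightarrow> 'b set \<Rightarrow> ('c, 'b \<Rightarrow> 'c) module" where
  "free_module K B =
     \<lparr>carrier = {\<phi>. range \<phi> \<subseteq> carrier K \<and> finite {x. \<phi> x \<noteq> \<zero>\<^bsub>K\<^esub>} \<and> {x. \<phi> x \<noteq> \<zero>\<^bsub>K\<^esub>} \<subseteq> B},
      monoid.mult = (\<lambda>_ _ _. \<zero>\<^bsub>K\<^esub>), one = (\<lambda>_. \<zero>\<^bsub>K\<^esub>),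
      ring.zero = (\<lambda>_. \<zero>\<^bsub>K\<^esub>),
      add = (\<lambda>\<phi> \<psi> x. \<phi> x \<oplus>\<^bsub>K\<^esub> \<psi> x),
      module.smult = (\<lambda>c \<phi> x. c \<otimes>\<^bsub>K\<^esub> \<phi> x)\<rparr>"

definition free_gen :: "('c, 'r) ring_scheme \<Rightarrow> 'b \<Rightarrow> 'b \<Rightarrow> 'c" where
  "free_gen K x = (\<lambda>y. if y = x then \<one>\<^bsub>K\<^esub> else \<zero>\<^bsub>K\<^esub>)"

text \<open>\<open>base_change R K h M\<close> is \<open>M \<otimes>\<^sub>R K\<close>, where \<open>K\<close> is an \<open>R\<close>-algebra through \<open>h\<close>: the free
  \<open>K\<close>-module on the symbols \<open>m \<otimes> 1\<close> modulo additivity in \<open>m\<close> and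
  \<open>r m \<otimes> 1 = h r (m \<otimes> 1)\<close>.\<close>

definition base_change ::
    "('c, 'r) ring_scheme \<Rightarrow> ('d, 's) ring_scheme \<Rightarrow> ('c \<Rightarrow> 'd) \<Rightarrow> ('c, 'v, 'z) module_scheme
      \<Rightarrow> ('d, ('v \<Rightarrow> 'd) set) module" where
  "base_change R K h M =
     (let L = free_module K (carrier M);
          rels =
            {(free_gen K (x \<oplus>\<^bsub>M\<^esub> y) \<ominus>\<^bsub>L\<^esub> free_gen K x) \<ominus>\<^bsub>L\<^esub> free_gen K y | x y.
               x \<in> carrier M \<and> y \<in> carrier M} \<union>
            {free_gen K (r \<odot>\<^bsub>M\<^esub> x) \<ominus>\<^bsub>L\<^esub> (h r \<odot>\<^bsub>L\<^esub> free_gen K x) | r x.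
               r \<in> carrier R \<and> x \<in> carrier M}
      in quot_module L (module.span K L rels))"

definition ring_det :: "('c, 'r) ring_scheme \<Rightarrow> nat \<Rightarrow> (nat \<Rightarrow> nat \<Rightarrow> 'c) \<Rightarrow> 'c" where
  "ring_det R n M =
     (\<Oplus>\<^bsub>R\<^esub> p \<in> {p. p permutes {..<n}}. add_pow R (sign p :: int) (\<Otimes>\<^bsub>R\<^esub> i \<in> {..<n}. M i (p i)))"

text \<open>\<open>k[[x,y]]\<close> is \<open>'k fps fps\<close>; \<open>x\<close> is the variable of the inner and \<open>y\<close> that of the outer
  series. The coefficient ring is left polymorphic because the same convention is used below for
  the second pair of variables \<open>x'\<close>, \<open>y'\<close>.\<close>

definition var_x :: "'r::comm_ring_1 fps fps" where "var_x = fps_const fps_X"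
definition var_y :: "'r::comm_ring_1 fps fps" where "var_y = fps_X"

definition deriv_x :: "'r::comm_ring_1 fps fps \<Rightarrow> 'r fps fps" where
  "deriv_x g = Abs_fps (\<lambda>j. fps_deriv (g $ j))"
definition deriv_y :: "'r::comm_ring_1 fps fps \<Rightarrow> 'r fps fps" where
  "deriv_y g = fps_deriv g"

definition germ_ring :: "'k::field fps fps \<Rightarrow> 'k fps fps set ring" where
  "germ_ring f = type_ring Quot (Idl\<^bsub>type_ring\<^esub> {f})"

definition germ_class :: "'k::field fps fps \<Rightarrow> 'k fps fps \<Rightarrow> 'k fps fps set" where
  "germ_class f g = Idl\<^bsub>type_ring\<^esub> {f} +>\<^bsub>type_ring\<^esub> g"

text \<open>\<open>Ext\<^sup>1\<^sub>A(\<Omega>\<^sub>A, A)\<close>, computed from the free resolution \<open>0 \<rightarrow> A \<rightarrow> A\<^sup>2 \<rightarrow> \<Omega>\<^sub>A \<rightarrow> 0\<close> (the conormal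
  sequence of a reduced plane curve germ, whose first map is \<open>(f\<^sub>x, f\<^sub>y)\<close>): the cokernel of the dual
  map \<open>A\<^sup>2 \<rightarrow> A\<close> is \<open>A / (f\<^sub>x, f\<^sub>y)\<close>.\<close>

definition Def1_ideal :: "'k::field fps fps \<Rightarrow> 'k fps fps set set" where
  "Def1_ideal f = Idl\<^bsub>germ_ring f\<^esub> {germ_class f (deriv_x f), germ_class f (deriv_y f)}"

definition Def1_class :: "'k::field fps fps \<Rightarrow> 'k fps fps \<Rightarrow> 'k fps fps set set" where
  "Def1_class f g = Def1_ideal f +>\<^bsub>germ_ring f\<^esub> germ_class f g"

definition Def1 :: "'k::field fps fps \<Rightarrow> ('k, 'k fps fps set set) module" where
  "Def1 f = restrict_scalars (\<lambda>c. Def1_class f (fps_const (fps_const c)))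
              (germ_ring f Quot Def1_ideal f)"

definition represents_Def1_basis :: "'k::field fps fps \<Rightarrow> 'k fps fps list \<Rightarrow> bool" where
  "represents_Def1_basis f \<delta> \<longleftrightarrow>
     free_basis type_ring (Def1 f) (length \<delta>) (\<lambda>i. Def1_class f (\<delta> ! i))"

definition deformation_eqn ::
    "'k::field fps fps \<Rightarrow> 'k fps fps list \<Rightarrow> 'k list \<Rightarrow> 'k fps fps fps" where
  "deformation_eqn f \<delta> a =
     fps_const f + fps_X * fps_const (\<Sum>i<length \<delta>. fps_const (fps_const (a ! i)) * \<delta> ! i)"

text \<open>From here on a family \<open>X/B\<close> is given by its equation \<open>F \<in> k[[x,y]][[t]]\<close>, an element of
  \<open>'k fps fps fps\<close>, where the outermost variable is \<open>t\<close>.\<close>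

definition OX :: "'k::field fps fps fps \<Rightarrow> 'k fps fps fps set ring" where
  "OX F = type_ring Quot (Idl\<^bsub>type_ring\<^esub> {F})"

definition OX_class :: "'k::field fps fps fps \<Rightarrow> 'k fps fps fps \<Rightarrow> 'k fps fps fps set" where
  "OX_class F g = Idl\<^bsub>type_ring\<^esub> {F} +>\<^bsub>type_ring\<^esub> g"

definition OB_embed :: "'k::field fps \<Rightarrow> 'k fps fps fps" where
  "OB_embed c = Abs_fps (\<lambda>n. fps_const (fps_const (c $ n)))"

definition closed_fiber_ideal :: "'k::field fps fps fps \<Rightarrow> 'k fps fps fps set set" where
  "closed_fiber_ideal F = Idl\<^bsub>OX F\<^esub> {OX_class F fps_X}"

text \<open>\<open>k[[x,y]][[t]]\<close> completed-tensored with itself over \<open>k[[t]]\<close> is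
  \<open>k[[x,y]][[t]][[x',y']]\<close>, so that \<open>O\<^sub>X\<close> completed-tensored with itself over \<open>O\<^sub>B\<close> is the quotient
  of that ring by the two copies \<open>F(x,y,t)\<close>, \<open>F(x',y',t)\<close> of the equation. The left factor consists
  of the constants with respect to \<open>x'\<close>, \<open>y'\<close>; \<open>right_copy\<close> renames \<open>x, y\<close> to \<open>x', y'\<close> and makes
  \<open>t\<close> a part of the coefficients.\<close>

definition left_copy :: "'k::field fps fps fps \<Rightarrow> 'k fps fps fps fps fps" where
  "left_copy g = fps_const (fps_const g)"

definition right_copy :: "'k::field fps fps fps \<Rightarrow> 'k fps fps fps fps fps" where
  "right_copy g = Abs_fps (\<lambda>j. Abs_fps (\<lambda>i. OB_embed (Abs_fps (\<lambda>n. g $ n $ j $ i))))"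

definition OXX_ideal :: "'k::field fps fps fps \<Rightarrow> 'k fps fps fps fps fps set" where
  "OXX_ideal F = Idl\<^bsub>type_ring\<^esub> {left_copy F, right_copy F}"

definition OXX :: "'k::field fps fps fps \<Rightarrow> 'k fps fps fps fps fps set ring" where
  "OXX F = type_ring Quot OXX_ideal F"

definition OXX_class ::
    "'k::field fps fps fps \<Rightarrow> 'k fps fps fps fps fps \<Rightarrow> 'k fps fps fps fps fps set" where
  "OXX_class F h = OXX_ideal F +>\<^bsub>type_ring\<^esub> h"

definition diagonal_ideal :: "'k::field fps fps fps \<Rightarrow> 'k fps fps fps fps fps set set" where
  "diagonal_ideal F =
     Idl\<^bsub>OXX F\<^esub> {OXX_class F (right_copy (fps_const v) - left_copy (fps_const v)) | v.
                  v \<in> {var_x, var_y}}"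

definition diagonal_power ::
    "nat \<Rightarrow> 'k::field fps fps fps \<Rightarrow> 'k fps fps fps fps fps set set" where
  "diagonal_power m F = diagonal_ideal F [^]\<^bsub>ideals_set (OXX F)\<^esub> m"

text \<open>The choice of the representative of the coset \<open>c\<close> does not matter, since \<open>left_copy\<close> maps the
  ideal \<open>(F)\<close> into \<open>OXX_ideal F\<close>.\<close>

definition left_factor ::
    "nat \<Rightarrow> 'k::field fps fps fps \<Rightarrow> 'k fps fps fps set \<Rightarrow> 'k fps fps fps fps fps set set" where
  "left_factor m F c =
     diagonal_power m F +>\<^bsub>OXX F\<^esub> OXX_class F (left_copy (SOME g. g \<in> c))"

definition principal_parts ::
    "nat \<Rightarrow> 'k::field fps fps fps \<Rightarrow>
      ('k fps fps fps set, 'k fps fps fps fps fps set set) module" where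
  "principal_parts m F =
     restrict_scalars (left_factor m F) (OXX F Quot diagonal_power m F)"

definition dual_basis ::
    "nat \<Rightarrow> 'k::field fps fps fps \<Rightarrow>
      (nat \<Rightarrow> 'k fps fps fps fps fps set set \<Rightarrow> 'k fps fps fps set) \<Rightarrow> bool" where
  "dual_basis m F e \<longleftrightarrow> free_basis (OX F) (dual_module (OX F) (principal_parts m F)) m e"

definition inflection_ideal ::
    "nat \<Rightarrow> 'k::field fps fps fps \<Rightarrow>
      (nat \<Rightarrow> 'k fps fps fps fps fps set set \<Rightarrow> 'k fps fps fps set) \<Rightarrow>
      (nat \<Rightarrow> 'k fps fps fps fps fps set set) \<Rightarrow> 'k fps fps fps set set" where
  "inflection_ideal m F e \<tau> = Idl\<^bsub>OX F\<^esub> {ring_det (OX F) m (\<lambda>i j. e i (\<tau> j))}"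

definition closed_fiber_dim ::
    "'k::field fps fps fps \<Rightarrow> 'k fps fps fps set set \<Rightarrow> enat" where
  "closed_fiber_dim F I =
     (let J = closed_fiber_ideal F <+>\<^bsub>OX F\<^esub> I
      in vdim (type_ring :: 'k ring)
           (restrict_scalars
             (\<lambda>c. J +>\<^bsub>OX F\<^esub> OX_class F (fps_const (fps_const (fps_const c))))
             (OX F Quot J)))"

text \<open>An infimum in \<^typ>\<open>enat\<close> which is finite is attained, so this is a minimum.\<close>

definition automatic_degeneracy ::
    "nat \<Rightarrow> 'k::field fps fps \<Rightarrow> 'k fps fps list \<Rightarrow> enat" where
  "automatic_degeneracy m f \<delta> =
     Inf {closed_fiber_dim F (inflection_ideal m F e \<tau>) | F a e \<tau>.
            length a = length \<delta> \<and> F = deformation_eqn f \<delta> a \<and> dual_basis m F e \<and>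
            \<tau> \<in> {..<m} \<rightarrow> carrier (principal_parts m F)}"

text \<open>The dimension of \<open>O\<^sub>X/I \<otimes> K\<close> over the algebraic closure \<open>K\<close> of \<open>k((t))\<close>.\<close>

definition geometric_generic_dim ::
    "'k::field fps fps fps \<Rightarrow> 'k fps fps fps set set \<Rightarrow> enat" where
  "geometric_generic_dim F I =
     vdim (type_ring :: 'k fls alg_closure ring)
       (base_change (type_ring :: 'k fps ring) (type_ring :: 'k fls alg_closure ring)
         (\<lambda>c. to_ac (fps_to_fls c))
         (restrict_scalars (\<lambda>c. I +>\<^bsub>OX F\<^esub> OX_class F (OB_embed c)) (OX F Quot I)))"

text \<open>Points of \<open>k\<^sup>d\<close> are lists of length \<open>d\<close>.\<close>

inductive_set poly_funs :: "nat \<Rightarrow> ('k::field list \<Rightarrow> 'k) set" for d where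
  const: "(\<lambda>_. c) \<in> poly_funs d"
| coord: "i < d \<Longrightarrow> (\<lambda>a. a ! i) \<in> poly_funs d"
| add: "p \<in> poly_funs d \<Longrightarrow> q \<in> poly_funs d \<Longrightarrow> (\<lambda>a. p a + q a) \<in> poly_funs d"
| mult: "p \<in> poly_funs d \<Longrightarrow> q \<in> poly_funs d \<Longrightarrow> (\<lambda>a. p a * q a) \<in> poly_funs d"

definition zariski_open :: "nat \<Rightarrow> 'k::field list set \<Rightarrow> bool" where
  "zariski_open d U \<longleftrightarrow>
     (\<exists>P \<subseteq> poly_funs d. U = {a. length a = d \<and> (\<exists>p\<in>P. p a \<noteq> 0)})"

definition zariski_dense :: "nat \<Rightarrow> 'k::field list set \<Rightarrow> bool" where
  "zariski_dense d U \<longleftrightarrow> (\<forall>V. zariski_open d V \<and> V \<noteq> {} \<longrightarrow> U \<inter> V \<noteq> {})"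

definition attains_degeneracy ::
    "nat \<Rightarrow> 'k::field fps fps \<Rightarrow> 'k fps fps list \<Rightarrow> 'k list \<Rightarrow>
      (nat \<Rightarrow> 'k fps fps fps fps fps set set \<Rightarrow> 'k fps fps fps set) \<Rightarrow>
      (nat \<Rightarrow> 'k fps fps fps fps fps set set) \<Rightarrow> bool" where
  "attains_degeneracy m f \<delta> a e \<tau> \<longleftrightarrow>
     (let F = deformation_eqn f \<delta> a
      in dual_basis m F e \<and> \<tau> \<in> {..<m} \<rightarrow> carrier (principal_parts m F) \<and>
         closed_fiber_dim F (inflection_ideal m F e \<tau>) = automatic_degeneracy m f \<delta>)"

text \<open>The first conjunct under the quantifier over \<open>U\<close> says that the minimum is attained on a general
  deformation, so that the second one is not vacuous.\<close>

definition limiting_inflection_number ::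
    "nat \<Rightarrow> 'k::field fps fps \<Rightarrow> 'k fps fps list \<Rightarrow> enat \<Rightarrow> bool" where
  "limiting_inflection_number m f \<delta> N \<longleftrightarrow>
     (\<exists>U. zariski_open (length \<delta>) U \<and> zariski_dense (length \<delta>) U \<and>
       (\<forall>a\<in>U.
          (\<exists>e \<tau>. attains_degeneracy m f \<delta> a e \<tau>) \<and>
          (\<forall>e \<tau>. attains_degeneracy m f \<delta> a e \<tau> \<longrightarrow>
             (let F = deformation_eqn f \<delta> a
              in geometric_generic_dim F (inflection_ideal m F e \<tau>) = N))))"

end

theory Submission
  imports Defs
begin

text \<open>A coordinate change \<open>y \<mapsto> y - \<beta>(x, t)\<close> brings a family into the form \<open>y\<^sup>2 = p(x, t)\<close> with
  \<open>p(x, 0) = x\<^sup>s\<close>. The dual of the third principal parts consists of the differential operators of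
  order at most two on \<open>O\<^sub>X\<close>; it contains \<open>1\<close>, \<open>H\<close> and \<open>H\<^sup>2/2\<close>, where \<open>H = 2 y \<partial>\<^sub>x + p' \<partial>\<^sub>y\<close>. These form a
  basis if \<open>p\<close> is squarefree, which holds as soon as the coefficient of \<open>t\<close> in the equation is a unit; and
  if \<open>l\<^sup>2\<close> divides \<open>p\<close>, reduction modulo \<open>l\<close> shows that the dual is not free. So, whenever the dual is
  free, the restriction of the ideal of \<open>\<tau>\<close> to the closed fiber is generated by the determinant of the
  values of this frame on \<open>\<tau>\<close>, which is a combination of the \<open>3 \<times> 3\<close> minors of the coefficient matrix of
  \<open>1, H, H\<^sup>2/2\<close> at \<open>t = 0\<close>. The colength of \<open>P + Q y\<close> on \<open>y\<^sup>2 = x\<^sup>s\<close> is the order of the norm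
  \<open>P\<^sup>2 - x\<^sup>s Q\<^sup>2\<close>, and this bounds it from below for every combination of the minors; suitable \<open>\<tau>\<close> attain the
  bound. A determinant of finite colength is a nonzerodivisor on the closed fiber, hence the quotient of
  \<open>O\<^sub>X\<close> by it is free over \<open>k[[t]]\<close>, and its dimension at the geometric generic point is the same.\<close>

section \<open>Operators on a double cover\<close>

text \<open>The third principal parts are jets of order two, so a functional on them is a vector of
  six values subject to three congruences modulo the equation \<open>F\<close>, and freeness of the
  dual becomes a statement about this kernel. Rings and modules are quotients; the computations take
  place on representatives, with divisibility by \<open>F\<close> in place of equality. The obstacle
  is that the minimum ranges over all deformations with free dual, not only over general ones: the
  frame has to be a basis for each of them. The numbers come from two minors. On
  \<open>y^2 = x^s\<close> one is \<open>s (s - 2) x^(2s - 2)\<close>, with norm of order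
  \<open>4s - 4\<close>, and the other is \<open>8 y^3 = 8 x^s y\<close>, with norm of order
  \<open>3s\<close>. The first one wins only for \<open>s = 3\<close>: it vanishes for
  \<open>s = 2\<close>, and \<open>3s \<le> 4s - 4\<close> from \<open>s = 4\<close> on.\<close>

lemma prime_elem_linear_relation:
  fixes l :: "'r::comm_ring_1"
  assumes l: "prime_elem l"
  shows "finite J \<Longrightarrow> finite I \<Longrightarrow> card J < card I \<Longrightarrow>
    \<exists>c. (\<exists>i\<in>I. \<not> l dvd c i) \<and> (\<forall>j\<in>J. l dvd (\<Sum>i\<in>I. c i * v i j))"
proof (induction J arbitrary: I v rule: finite_induct)
  case empty
  then obtain i where i: "i \<in> I" by fastforce
  have "\<not> l dvd 1" using l by (auto simp: prime_elem_def)
  then show ?case using i by (intro exI[of _ "\<lambda>_. 1"]) auto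
next
  case (insert j J)
  show ?case
  proof (cases "\<forall>i\<in>I. l dvd v i j")
    case True
    have "card J < card I" using insert.prems insert.hyps by simp
    from insert.IH[OF insert.prems(1) this, of v] obtain c
      where c: "\<exists>i\<in>I. \<not> l dvd c i" "\<forall>j\<in>J. l dvd (\<Sum>i\<in>I. c i * v i j)" by blast
    have "l dvd (\<Sum>i\<in>I. c i * v i j)" using True by (intro dvd_sum) auto
    then show ?thesis using c by blast
  next
    case False
    then obtain k where k: "k \<in> I" "\<not> l dvd v k j" by blast
    define I' where "I' = I - {k}"
    have fin: "finite I'" and card: "card J < card I'"
      using insert.prems insert.hyps k by (auto simp: I'_def)
    \<comment> \<open>Elimination of coordinate \<open>j\<close> with the pivot
      \<open>v k j\<close>. The rows are cross-multiplied because the pivot need not be invertible;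
      as \<open>l\<close> is prime, multiplication by the pivot keeps coefficients nonzero modulo
      \<open>l\<close>.\<close>
    define w where "w = (\<lambda>i j'. v k j * v i j' - v i j * v k j')"
    from insert.IH[OF fin card, of w] obtain c
      where c: "\<exists>i\<in>I'. \<not> l dvd c i" "\<forall>j\<in>J. l dvd (\<Sum>i\<in>I'. c i * w i j)" by blast
    define d where "d = (\<lambda>i. if i = k then - (\<Sum>i\<in>I'. c i * v i j) else c i * v k j)"
    have sum: "(\<Sum>i\<in>I. d i * v i j') = (\<Sum>i\<in>I'. c i * w i j')" for j'
    proof -
      have "(\<Sum>i\<in>I. d i * v i j') = d k * v k j' + (\<Sum>i\<in>I'. d i * v i j')"
        unfolding I'_def using k insert.prems by (simp add: sum.remove)
      also have "(\<Sum>i\<in>I'. d i * v i j') = (\<Sum>i\<in>I'. c i * v k j * v i j')"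
        by (intro sum.cong) (auto simp: d_def I'_def)
      also have "d k * v k j' + \<dots> = (\<Sum>i\<in>I'. c i * w i j')"
        by (simp add: d_def w_def sum_distrib_left sum_subtractf algebra_simps)
      finally show ?thesis .
    qed
    have "\<exists>i\<in>I. \<not> l dvd d i"
    proof -
      from c obtain i where i: "i \<in> I'" "\<not> l dvd c i" by blast
      have "\<not> l dvd c i * v k j" using i k l by (simp add: prime_elem_dvd_mult_iff)
      then show ?thesis using i by (intro bexI[of _ i]) (auto simp: d_def I'_def)
    qed
    moreover have "(\<Sum>i\<in>I'. c i * w i j) = 0" by (simp add: w_def algebra_simps)
    ultimately show ?thesis using sum c by (intro exI[of _ d]) auto
  qed
qed

text \<open>Certificates: an equation follows from given ones once its difference is written as an
  explicit combination of theirs. The coefficients \<open>ca\<close>, \<open>cb\<close>, ... are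
  supplied at each use, and ring normalization checks the identity.\<close>

lemma eq_by_lincomb:
  fixes a b :: "'r::comm_ring_1"
  shows "x1 = y1 \<Longrightarrow> a - b = ca * (x1 - y1) \<Longrightarrow> a = b"
    and "x1 = y1 \<Longrightarrow> x2 = y2 \<Longrightarrow> a - b = ca * (x1 - y1) + cb * (x2 - y2) \<Longrightarrow> a = b"
    and "x1 = y1 \<Longrightarrow> x2 = y2 \<Longrightarrow> x3 = y3 \<Longrightarrow>
      a - b = ca * (x1 - y1) + cb * (x2 - y2) + cc * (x3 - y3) \<Longrightarrow> a = b"
    and "x1 = y1 \<Longrightarrow> x2 = y2 \<Longrightarrow> x3 = y3 \<Longrightarrow> x4 = y4 \<Longrightarrow>
      a - b = ca * (x1 - y1) + cb * (x2 - y2) + cc * (x3 - y3) + cd * (x4 - y4) \<Longrightarrow> a = b"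
  by simp_all

lemma All_less_6: "(\<forall>m<6. P m) \<longleftrightarrow> P (0::nat) \<and> P 1 \<and> P 2 \<and> P 3 \<and> P 4 \<and> P 5"
  by (auto simp: eval_nat_numeral All_less_Suc)

lemma All_less_3: "(\<forall>m<3. P m) \<longleftrightarrow> P (0::nat) \<and> P 1 \<and> P 2"
  by (auto simp: eval_nat_numeral All_less_Suc)

lemma sum_less_3: "(\<Sum>i<3. g i) = g (0::nat) + g 1 + (g 2 :: 'a::comm_monoid_add)"
  by (simp add: lessThan_nat_numeral add.commute add.left_commute)

text \<open>The six entries of an operator are its values on the jet monomials 1, dX, dY, dX^2, dX
  dY, dY^2, in this order (compare \<open>jet_monomial\<close>).\<close>

definition vec6 :: "'a \<Rightarrow> 'a \<Rightarrow> 'a \<Rightarrow> 'a \<Rightarrow> 'a \<Rightarrow> 'a \<Rightarrow> nat \<Rightarrow> 'a" where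
  "vec6 a b c d e f m = [a, b, c, d, e, f] ! m"

lemma vec6_simps [simp]:
  "vec6 a b c d e f 0 = a" "vec6 a b c d e f (Suc 0) = b" "vec6 a b c d e f 2 = c"
  "vec6 a b c d e f 3 = d" "vec6 a b c d e f 4 = e" "vec6 a b c d e f 5 = f"
  by (simp_all add: vec6_def)

text \<open>\<open>M\<close> is a submodule of the free module of rank six over the ring modulo \<open>F\<close>, given by representatives.\<close>

definition basis_mod :: "'o::comm_ring_1 \<Rightarrow> ((nat \<Rightarrow> 'o) \<Rightarrow> bool) \<Rightarrow> (nat \<Rightarrow> nat \<Rightarrow> 'o) \<Rightarrow> bool" where
  "basis_mod F M D \<longleftrightarrow> (\<forall>i<3. M (D i)) \<and>
     (\<forall>v. M v \<longrightarrow> (\<exists>c. \<forall>m<6. F dvd v m - (\<Sum>i<3. c i * D i m))) \<and>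
     (\<forall>c. (\<forall>m<6. F dvd (\<Sum>i<3. c i * D i m)) \<longrightarrow> (\<forall>i<3. F dvd c i))"

lemma basis_mod_independent:
  "basis_mod F M D \<Longrightarrow> (\<And>m. m < 6 \<Longrightarrow> F dvd (\<Sum>i<3. c i * D i m)) \<Longrightarrow> \<forall>i<3. F dvd c i"
  unfolding basis_mod_def by simp

text \<open>Modulo \<open>F\<close> the ring is free over \<open>'r\<close> on 1 and
  \<open>\<eta>\<close>, and the square of \<open>\<eta>\<close> is \<open>p\<close>. The parameters
  \<open>p1\<close> and \<open>q2\<close> stand for the derivative of \<open>p\<close> and half of
  its second derivative; the kernel uses them only as ring elements, so no derivation
  appears.\<close>

locale quadratic_cover =
  fixes \<iota> :: "'r::idom \<Rightarrow> 'o::comm_ring_1" and F \<eta> :: 'o and p p1 q2 h :: 'r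
  assumes \<iota>_add: "\<iota> (a + b) = \<iota> a + \<iota> b" and \<iota>_mult: "\<iota> (a * b) = \<iota> a * \<iota> b" and \<iota>_1: "\<iota> 1 = 1"
    and decomp: "\<exists>a b. F dvd z - (\<iota> a + \<iota> b * \<eta>)"
    and unique: "F dvd \<iota> a + \<iota> b * \<eta> \<Longrightarrow> a = 0 \<and> b = 0"
    and eta2: "F dvd \<eta> * \<eta> - \<iota> p"
    and half: "2 * h = 1"
    and p_nz: "p \<noteq> 0"
begin

lemma \<iota>_0: "\<iota> 0 = 0" using \<iota>_add[of 0 0] by simp
lemma \<iota>_minus: "\<iota> (- a) = - \<iota> a" using \<iota>_add[of a "- a"] by (simp add: \<iota>_0 eq_neg_iff_add_eq_0 add.commute)
lemma \<iota>_diff: "\<iota> (a - b) = \<iota> a - \<iota> b" using \<iota>_add[of a "- b"] by (simp add: \<iota>_minus)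
lemma \<iota>_2: "\<iota> 2 = 2" using \<iota>_add[of 1 1] by (simp add: \<iota>_1)
lemmas \<iota>_simps = \<iota>_0 \<iota>_1 \<iota>_add \<iota>_mult \<iota>_minus \<iota>_diff

definition rep :: "'o \<Rightarrow> 'r \<Rightarrow> 'r \<Rightarrow> bool" where
  "rep z a b \<longleftrightarrow> F dvd z - (\<iota> a + \<iota> b * \<eta>)"

lemma rep_ex: obtains a b where "rep z a b"
  using decomp unfolding rep_def by blast

lemma rep_add: "rep x a b \<Longrightarrow> rep y c d \<Longrightarrow> rep (x + y) (a + c) (b + d)"
  unfolding rep_def by (drule (1) dvd_add) (simp add: \<iota>_simps algebra_simps)

lemma rep_minus: "rep x a b \<Longrightarrow> rep (- x) (- a) (- b)"
  unfolding rep_def by (subst dvd_minus_iff[symmetric]) (simp add: \<iota>_simps algebra_simps)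

lemma rep_diff: "rep x a b \<Longrightarrow> rep y c d \<Longrightarrow> rep (x - y) (a - c) (b - d)"
  using rep_add[OF _ rep_minus] by force

lemma rep_mult:
  assumes "rep x a b" "rep y c d"
  shows "rep (x * y) (a * c + p * b * d) (a * d + b * c)"
proof -
  have "x * y - (\<iota> (a * c + p * b * d) + \<iota> (a * d + b * c) * \<eta>) =
     (x - (\<iota> a + \<iota> b * \<eta>)) * y + (\<iota> a + \<iota> b * \<eta>) * (y - (\<iota> c + \<iota> d * \<eta>)) + \<iota> b * \<iota> d * (\<eta> * \<eta> - \<iota> p)"
    by (simp add: \<iota>_simps algebra_simps)
  then show ?thesis using assms eta2 unfolding rep_def by (simp add: dvd_add)
qed

lemma rep_\<iota>: "rep (\<iota> a) a 0" by (simp add: rep_def \<iota>_0)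
lemma rep_\<eta>: "rep \<eta> 0 1" by (simp add: rep_def \<iota>_0 \<iota>_1)
lemma rep_0: "rep 0 0 0" by (simp add: rep_def \<iota>_0)
lemma rep_1: "rep 1 1 0" using rep_\<iota>[of 1] by (simp add: \<iota>_1)
lemma rep_numeral: "rep (numeral n) (numeral n) 0"
proof (induction n)
  case One then show ?case using rep_1 by simp
next
  case (Bit0 n) then show ?case using rep_add[OF Bit0 Bit0] by (simp add: numeral_Bit0)
next
  case (Bit1 n) then show ?case using rep_add[OF rep_add[OF Bit1 Bit1] rep_1] by (simp add: numeral_Bit1)
qed

lemmas rep_intros = rep_add rep_minus rep_diff rep_mult rep_\<iota> rep_\<eta> rep_0 rep_1 rep_numeral

lemma rep_unique: "rep x a b \<Longrightarrow> rep y c d \<Longrightarrow> F dvd x - y \<longleftrightarrow> a = c \<and> b = d"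
proof -
  assume r: "rep x a b" "rep y c d"
  from rep_diff[OF this] have *: "F dvd (x - y) - (\<iota> (a - c) + \<iota> (b - d) * \<eta>)" by (simp add: rep_def)
  show ?thesis
  proof
    assume "F dvd x - y"
    with * have "F dvd (x - y) - ((x - y) - (\<iota> (a - c) + \<iota> (b - d) * \<eta>))" using dvd_diff by blast
    then show "a = c \<and> b = d" using unique[of "a - c" "b - d"] by simp
  next
    assume "a = c \<and> b = d"
    then show "F dvd x - y" using * by (simp add: \<iota>_0)
  qed
qed

lemma rep_0_iff: "rep x a b \<Longrightarrow> F dvd x \<longleftrightarrow> a = 0 \<and> b = 0"
  using rep_unique[OF _ rep_0] by simp

text \<open>The three conditions annihilate the equation \<open>\<eta>^2 - p\<close>, written in the
  second pair of variables, and its products with dX and dY. The factors are its Taylor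
  coefficients: \<open>- p1\<close>, \<open>2 \<eta>\<close>, \<open>- q2\<close>, 0 and 1.\<close>

definition ker :: "(nat \<Rightarrow> 'o) \<Rightarrow> bool" where
  "ker D \<longleftrightarrow> F dvd - \<iota> p1 * D 1 + 2 * \<eta> * D 2 - \<iota> q2 * D 3 + D 5 \<and>
     F dvd - \<iota> p1 * D 3 + 2 * \<eta> * D 4 \<and> F dvd - \<iota> p1 * D 4 + 2 * \<eta> * D 5"

lemma ker_rep:
  assumes "\<And>i. i < 6 \<Longrightarrow> rep (D i) (a i) (b i)"
  shows "ker D \<longleftrightarrow> - p1 * a 1 + 2 * p * b 2 - q2 * a 3 + a 5 = 0 \<and>
    - p1 * b 1 + 2 * a 2 - q2 * b 3 + b 5 = 0 \<and>
    - p1 * a 3 + 2 * p * b 4 = 0 \<and> - p1 * b 3 + 2 * a 4 = 0 \<and>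
    - p1 * a 4 + 2 * p * b 5 = 0 \<and> - p1 * b 4 + 2 * a 5 = 0"
proof -
  have r: "rep (D 1) (a 1) (b 1)" "rep (D 2) (a 2) (b 2)" "rep (D 3) (a 3) (b 3)"
    "rep (D 4) (a 4) (b 4)" "rep (D 5) (a 5) (b 5)" using assms by auto
  note i = rep_intros r
  \<comment> \<open>The nested \<open>back_subst\<close> leaves both coordinates open, so that
    \<open>rep_intros\<close> compute them; the comparison with the stated ones is left to
    \<open>algebra_simps\<close>.\<close>
  have 1: "rep (- \<iota> p1 * D 1 + 2 * \<eta> * D 2 - \<iota> q2 * D 3 + D 5)
    (- p1 * a 1 + 2 * p * b 2 - q2 * a 3 + a 5) (- p1 * b 1 + 2 * a 2 - q2 * b 3 + b 5)"
    by (rule back_subst[of "\<lambda>x. rep _ x _", OF back_subst[of "\<lambda>x. rep _ _ x"]])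
      (rule i | simp add: algebra_simps)+
  have 2: "rep (- \<iota> p1 * D 3 + 2 * \<eta> * D 4) (- p1 * a 3 + 2 * p * b 4) (- p1 * b 3 + 2 * a 4)"
    by (rule back_subst[of "\<lambda>x. rep _ x _", OF back_subst[of "\<lambda>x. rep _ _ x"]])
      (rule i | simp add: algebra_simps)+
  have 3: "rep (- \<iota> p1 * D 4 + 2 * \<eta> * D 5) (- p1 * a 4 + 2 * p * b 5) (- p1 * b 4 + 2 * a 5)"
    by (rule back_subst[of "\<lambda>x. rep _ x _", OF back_subst[of "\<lambda>x. rep _ _ x"]])
      (rule i | simp add: algebra_simps)+
  show ?thesis unfolding ker_def rep_0_iff[OF 1] rep_0_iff[OF 2] rep_0_iff[OF 3] by blast
qed

text \<open>The operators 1, \<open>H\<close> and \<open>H^2/2\<close> evaluated on the jet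
  monomials, where \<open>H\<close> is \<open>2 \<eta> \<partial>x + p1 \<partial>y\<close>. The
  pure second derivatives take the value 2 on the squares, which cancels the factor one
  half.\<close>

definition E :: "nat \<Rightarrow> nat \<Rightarrow> 'o" where
  "E k = [vec6 1 0 0 0 0 0, vec6 0 (2 * \<eta>) (\<iota> p1) 0 0 0,
     vec6 0 (\<iota> p1) (2 * \<iota> q2 * \<eta>) (4 * (\<eta> * \<eta>)) (2 * \<iota> p1 * \<eta>) (\<iota> p1 * \<iota> p1)] ! k"

lemma E_simps [simp]:
  "E 0 = vec6 1 0 0 0 0 0" "E (Suc 0) = vec6 0 (2 * \<eta>) (\<iota> p1) 0 0 0"
  "E 2 = vec6 0 (\<iota> p1) (2 * \<iota> q2 * \<eta>) (4 * (\<eta> * \<eta>)) (2 * \<iota> p1 * \<eta>) (\<iota> p1 * \<iota> p1)"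
  by (simp_all add: E_def)

lemma ker_E: "k < 3 \<Longrightarrow> ker (E k)"
proof -
  have "2 * p1 = p1 * 2" "ker (E 2)" by (simp_all add: ker_def algebra_simps)
  moreover have "ker (E 0)" "ker (E 1)" by (simp_all add: ker_def algebra_simps)
  ultimately show "k < 3 \<Longrightarrow> ker (E k)" by (auto simp: numeral_eq_Suc less_Suc_eq)
qed

lemma two_cancel: "2 * (a::'r) = 0 \<longleftrightarrow> a = 0" "2 * a = 2 * b \<longleftrightarrow> a = b"
proof -
  have "(2::'r) \<noteq> 0" using half by auto
  then show "2 * (a::'r) = 0 \<longleftrightarrow> a = 0" "2 * a = 2 * b \<longleftrightarrow> a = b" by auto
qed

text \<open>Triangularity: entry 3 involves only \<open>E 2\<close>, and then entry 1 only
  \<open>E 1\<close>. The factors \<open>4 \<eta>^2\<close> and \<open>2 \<eta>\<close> cancel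
  because \<open>p\<close> is nonzero in a domain in which 2 is invertible.\<close>

lemma E_independent:
  assumes "\<forall>m<6. F dvd (\<Sum>i<3. c i * E i m)"
  shows "\<forall>i<3. F dvd c i"
proof -
  from assms have 0: "F dvd c 0" and 1: "F dvd c 1 * (2 * \<eta>) + c 2 * \<iota> p1" and 3: "F dvd c 2 * (4 * (\<eta> * \<eta>))"
    by (auto simp: All_less_6 sum_less_3)
  obtain a b where r: "rep (c 2) a b" by (rule rep_ex)
  have "rep (c 2 * (4 * (\<eta> * \<eta>))) (4 * p * a) (4 * p * b)"
    by (rule back_subst[of "\<lambda>x. rep _ x _", OF back_subst[of "\<lambda>x. rep _ _ x"]])
      (rule rep_intros r | simp add: algebra_simps)+
  with 3 have "2 * (2 * (p * a)) = 0" "2 * (2 * (p * b)) = 0" by (auto simp: rep_0_iff algebra_simps)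
  then have "a = 0" "b = 0" using p_nz by (simp_all only: two_cancel) auto
  with r have 2: "F dvd c 2" by (simp add: rep_0_iff)
  with 1 have 1: "F dvd c 1 * (2 * \<eta>)" by (metis dvd_add_left_iff dvd_mult2)
  obtain a b where r: "rep (c 1) a b" by (rule rep_ex)
  have "rep (c 1 * (2 * \<eta>)) (2 * (p * b)) (2 * a)"
    by (rule back_subst[of "\<lambda>x. rep _ x _", OF back_subst[of "\<lambda>x. rep _ _ x"]])
      (rule rep_intros r | simp add: algebra_simps)+
  with 1 have "2 * (p * b) = 0" "2 * a = 0" by (auto simp: rep_0_iff)
  then have "a = 0" "b = 0" using p_nz by (simp_all only: two_cancel) auto
  with r have "F dvd c 1" by (simp add: rep_0_iff)
  with 0 2 show ?thesis by (auto simp: All_less_3)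
qed

text \<open>Coprimality of \<open>p1\<close> and \<open>p\<close> makes the entry for dX^2 divisible
  by \<open>p\<close>: at once for its constant coordinate, after two cancellations for its
  \<open>\<eta>\<close>-coordinate. This yields the coefficient of \<open>E 2\<close>; the same
  argument for what remains of entry 1 yields that of \<open>E 1\<close>.\<close>

lemma E_span:
  assumes coprime: "\<And>z. p dvd p1 * z \<Longrightarrow> p dvd z" and D: "ker D"
  shows "\<exists>c. \<forall>m<6. F dvd D m - (\<Sum>i<3. c i * E i m)"
proof -
  have "\<forall>i. \<exists>a b. rep (D i) a b" using rep_ex by metis
  then obtain a b where r: "\<And>i. rep (D i) (a i) (b i)" by metis
  have k1: "- p1 * a 1 + 2 * p * b 2 - q2 * a 3 + a 5 = 0" and k2: "- p1 * b 1 + 2 * a 2 - q2 * b 3 + b 5 = 0"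
    and k3: "- p1 * a 3 + 2 * p * b 4 = 0" and k4: "- p1 * b 3 + 2 * a 4 = 0"
    and k5: "- p1 * a 4 + 2 * p * b 5 = 0" and k6: "- p1 * b 4 + 2 * a 5 = 0"
    using D[unfolded ker_rep[of D a b, OF r]] by blast+
  have "p dvd p1 * a 3" using k3 by (intro dvdI[of _ _ "2 * b 4"]) (simp add: algebra_simps)
  then obtain z where z: "a 3 = p * z" using coprime by (blast elim: dvdE)
  have "p * (p1 * z) - p * (2 * b 4) = - (- p1 * a 3 + 2 * p * b 4)" by (simp add: z algebra_simps)
  then have "p * (p1 * z) = p * (2 * b 4)" unfolding k3 by simp
  then have b4: "p1 * z = 2 * b 4" using p_nz by simp
  have "p1 * (p1 * b 3) - p * (4 * b 5) = - p1 * (- p1 * b 3 + 2 * a 4) - 2 * (- p1 * a 4 + 2 * p * b 5)"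
    by (simp add: algebra_simps)
  then have "p1 * (p1 * b 3) = p * (4 * b 5)" unfolding k4 k5 by simp
  then have "p dvd p1 * (p1 * b 3)" by simp
  then obtain y where y: "b 3 = p * y" using coprime by (blast elim: dvdE)
  have "p * (p1 * p1 * y) = p * (4 * b 5)"
    by (rule eq_by_lincomb(3)[where ca = "- p1" and cb = "- 2" and cc = "- p1 * p1", OF k4 k5 y]) (simp add: algebra_simps)
  then have b5: "p1 * p1 * y = 4 * b 5" using p_nz by simp
  \<comment> \<open>The entry for dX^2 is \<open>p (z + y \<eta>)\<close>, against
    \<open>4 p\<close> in \<open>E 2\<close>; so \<open>A + B \<eta>\<close> is the coefficient of
    \<open>E 2\<close>.\<close>
  define A B where "A = h * h * z" and "B = h * h * y"
  have A: "4 * A = z" unfolding A_def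
    by (rule eq_by_lincomb(1)[where ca = "(2 * h + 1) * z", OF half]) (simp add: algebra_simps)
  have B: "4 * B = y" unfolding B_def
    by (rule eq_by_lincomb(1)[where ca = "(2 * h + 1) * y", OF half]) (simp add: algebra_simps)
  have e1: "p1 * (a 1 - p1 * A) = p * (2 * (b 2 - 2 * q2 * A))"
  proof -
    have 4: "4 * a 5 = p1 * p1 * z"
      by (rule eq_by_lincomb(2)[where ca = "2" and cb = "- p1", OF k6 b4]) (simp add: algebra_simps)
    have "2 * (2 * (p1 * (a 1 - p1 * A))) = 2 * (2 * (p * (2 * (b 2 - 2 * q2 * A))))" 
      by (rule eq_by_lincomb(4)[where ca = "1" and cb = "- 4" and cc = "- 4 * q2" and cd = "4 * p * q2 - p1 * p1", OF 4 k1 z A]) (simp add: algebra_simps)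
    then show ?thesis by (simp only: two_cancel)
  qed
  then have "p dvd p1 * (a 1 - p1 * A)" by simp
  then obtain w where w: "a 1 - p1 * A = p * w" using coprime by (blast elim: dvdE)
  have "p * (p1 * w) = p * (2 * (b 2 - 2 * q2 * A))"
    by (rule eq_by_lincomb(2)[where ca = "1" and cb = "- p1", OF e1 w]) (simp add: algebra_simps)
  then have b2: "p1 * w = 2 * (b 2 - 2 * q2 * A)" using p_nz by simp
  have a2: "p1 * (b 1 - p1 * B) = 2 * (a 2 - 2 * q2 * p * B)"
  proof -
    have "2 * (2 * (p1 * (b 1 - p1 * B))) = 2 * (2 * (2 * (a 2 - 2 * q2 * p * B)))" 
      by (rule eq_by_lincomb(4)[where ca = "- 4" and cb = "- 4 * q2" and cc = "4 * p * q2 - p1 * p1" and cd = "- 1", OF k2 y B b5]) (simp add: algebra_simps)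
    then show ?thesis by (simp only: two_cancel)
  qed
  \<comment> \<open>After removal of \<open>E 2\<close>, entry 1 is \<open>p w + b \<eta>\<close>
    with \<open>b = b 1 - p1 B\<close>, which is \<open>\<eta> (b + w \<eta>)\<close>. Entry 1 of
    \<open>E 1\<close> is \<open>2 \<eta>\<close>, hence the coefficient
    \<open>h (b + w \<eta>)\<close>.\<close>
  define c where "c = vec6 (D 0) (\<iota> (h * (b 1 - p1 * B)) + \<iota> (h * w) * \<eta>) (\<iota> A + \<iota> B * \<eta>) 0 0 0"
  have rc: "rep (c 1) (h * (b 1 - p1 * B)) (h * w)" "rep (c 2) A B" by (simp_all add: c_def rep_def)
  note i = rep_intros rc
  have "F dvd D 1 - (c 1 * (2 * \<eta>) + c 2 * \<iota> p1)"
  proof (subst rep_unique[OF r])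
    show "rep (c 1 * (2 * \<eta>) + c 2 * \<iota> p1) (2 * h * (p * w) + A * p1) (2 * h * (b 1 - p1 * B) + B * p1)"
      by (rule back_subst[of "\<lambda>x. rep _ x _", OF back_subst[of "\<lambda>x. rep _ _ x"]])
        (rule i | simp add: algebra_simps)+
    have "a 1 = 2 * h * (p * w) + A * p1"
      by (rule eq_by_lincomb(2)[where ca = "- p * w" and cb = "1", OF half w]) (simp add: algebra_simps)
    moreover have "b 1 = 2 * h * (b 1 - p1 * B) + B * p1"
      by (rule eq_by_lincomb(1)[where ca = "- (b 1 - p1 * B)", OF half]) (simp add: algebra_simps)
    ultimately show "a 1 = 2 * h * (p * w) + A * p1 \<and> b 1 = 2 * h * (b 1 - p1 * B) + B * p1" ..
  qed
  moreover have "F dvd D 2 - (c 1 * \<iota> p1 + c 2 * (2 * \<iota> q2 * \<eta>))"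
  proof (subst rep_unique[OF r])
    show "rep (c 1 * \<iota> p1 + c 2 * (2 * \<iota> q2 * \<eta>)) (h * (b 1 - p1 * B) * p1 + 2 * q2 * p * B) (h * w * p1 + 2 * q2 * A)"
      by (rule back_subst[of "\<lambda>x. rep _ x _", OF back_subst[of "\<lambda>x. rep _ _ x"]])
        (rule i | simp add: algebra_simps)+
    have "a 2 = h * (b 1 - p1 * B) * p1 + 2 * q2 * p * B"
      by (rule eq_by_lincomb(2)[where ca = "- (a 2 - 2 * q2 * p * B)" and cb = "- h", OF half a2]) (simp add: algebra_simps)
    moreover have "b 2 = h * w * p1 + 2 * q2 * A"
      by (rule eq_by_lincomb(2)[where ca = "- (b 2 - 2 * q2 * A)" and cb = "- h", OF half b2]) (simp add: algebra_simps)
    ultimately show "a 2 = h * (b 1 - p1 * B) * p1 + 2 * q2 * p * B \<and> b 2 = h * w * p1 + 2 * q2 * A" ..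
  qed
  moreover have "F dvd D 3 - c 2 * (4 * (\<eta> * \<eta>))"
  proof (subst rep_unique[OF r])
    show "rep (c 2 * (4 * (\<eta> * \<eta>))) (4 * A * p) (4 * B * p)"
      by (rule back_subst[of "\<lambda>x. rep _ x _", OF back_subst[of "\<lambda>x. rep _ _ x"]])
        (rule i | simp add: algebra_simps)+
    show "a 3 = 4 * A * p \<and> b 3 = 4 * B * p" using z y A B by (simp add: mult.commute)
  qed
  moreover have "F dvd D 4 - c 2 * (2 * \<iota> p1 * \<eta>)"
  proof (subst rep_unique[OF r])
    show "rep (c 2 * (2 * \<iota> p1 * \<eta>)) (2 * p1 * B * p) (2 * p1 * A)"
      by (rule back_subst[of "\<lambda>x. rep _ x _", OF back_subst[of "\<lambda>x. rep _ _ x"]])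
        (rule i | simp add: algebra_simps)+
    have "2 * a 4 = 2 * (2 * p1 * B * p)"
      by (rule eq_by_lincomb(3)[where ca = "1" and cb = "p1" and cc = "- p1 * p", OF k4 y B]) (simp add: algebra_simps)
    moreover have "2 * b 4 = 2 * (2 * p1 * A)"
      by (rule eq_by_lincomb(2)[where ca = "- 1" and cb = "- p1", OF b4 A]) (simp add: algebra_simps)
    ultimately show "a 4 = 2 * p1 * B * p \<and> b 4 = 2 * p1 * A" by (simp only: two_cancel)
  qed
  moreover have "F dvd D 5 - c 2 * (\<iota> p1 * \<iota> p1)"
  proof (subst rep_unique[OF r])
    show "rep (c 2 * (\<iota> p1 * \<iota> p1)) (p1 * p1 * A) (p1 * p1 * B)"
      by (rule back_subst[of "\<lambda>x. rep _ x _", OF back_subst[of "\<lambda>x. rep _ _ x"]])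
        (rule i | simp add: algebra_simps)+
    have "2 * (2 * a 5) = 2 * (2 * (p1 * p1 * A))"
      by (rule eq_by_lincomb(3)[where ca = "2" and cb = "- p1" and cc = "- p1 * p1", OF k6 b4 A]) (simp add: algebra_simps)
    moreover have "2 * (2 * b 5) = 2 * (2 * (p1 * p1 * B))"
      by (rule eq_by_lincomb(2)[where ca = "- 1" and cb = "- p1 * p1", OF b5 B]) (simp add: algebra_simps)
    ultimately show "a 5 = p1 * p1 * A \<and> b 5 = p1 * p1 * B" by (simp only: two_cancel)
  qed
  ultimately have "\<forall>m<6. F dvd D m - (\<Sum>i<3. c i * E i m)"
    by (simp add: All_less_6 sum_less_3) (simp add: c_def)
  then show ?thesis by blast
qed

lemma basis_mod_E:
  assumes "\<And>z. p dvd p1 * z \<Longrightarrow> p dvd z"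
  shows "basis_mod F ker E"
  unfolding basis_mod_def using E_span[OF assms] E_independent ker_E by blast

lemma dvd_coords:
  assumes "rep x a b" "F dvd x - \<iota> l * u"
  shows "l dvd a" "l dvd b"
proof -
  obtain c d where r: "rep u c d" by (rule rep_ex)
  from rep_mult[OF rep_\<iota> r, of l] have "rep (\<iota> l * u) (l * c) (l * d)" by simp
  with assms rep_unique show "l dvd a" "l dvd b" by auto
qed

text \<open>In the basis, \<open>\<eta> V = l z\<close> becomes \<open>\<eta> c j = l g j\<close>
  modulo \<open>F\<close> for each coefficient. The \<open>\<eta>\<close>-coordinate of
  \<open>\<eta> c j\<close> is the constant coordinate of \<open>c j\<close>, which is therefore
  divisible by \<open>l\<close>.\<close>

lemma basis_coords_dvd:
  assumes D: "basis_mod F ker D" and V: "ker V" and z: "ker z" and l: "l dvd p"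
    and eq: "\<And>m. m < 6 \<Longrightarrow> F dvd \<eta> * V m - \<iota> l * z m"
  shows "\<exists>x y. \<forall>m<6. F dvd V m - (\<Sum>j<3. (\<iota> l * \<iota> (x j) + \<iota> (y j) * \<eta>) * D j m)"
proof -
  obtain c where c: "\<And>m. m < 6 \<Longrightarrow> F dvd V m - (\<Sum>j<3. c j * D j m)"
    using D V unfolding basis_mod_def by blast
  obtain g where g: "\<And>m. m < 6 \<Longrightarrow> F dvd z m - (\<Sum>j<3. g j * D j m)"
    using D z unfolding basis_mod_def by blast
  have "F dvd (\<Sum>j<3. (\<eta> * c j - \<iota> l * g j) * D j m)" if m: "m < 6" for m
  proof -
    have "(\<Sum>j<3. (\<eta> * c j - \<iota> l * g j) * D j m) =
       (\<eta> * V m - \<iota> l * z m) - \<eta> * (V m - (\<Sum>j<3. c j * D j m)) + \<iota> l * (z m - (\<Sum>j<3. g j * D j m))"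
      by (simp add: sum_less_3 algebra_simps)
    then show ?thesis using c[OF m] g[OF m] eq[OF m] by (simp add: dvd_diff)
  qed
  then have *: "\<forall>j<3. F dvd \<eta> * c j - \<iota> l * g j"
    by (rule basis_mod_independent[OF D])
  have "\<forall>j. \<exists>a b. rep (c j) a b" using rep_ex by metis
  then obtain a b where ab: "\<And>j. rep (c j) (a j) (b j)" by metis
  have "l dvd a j" if "j < 3" for j
  proof -
    have "rep (\<eta> * c j) (p * b j) (a j)" using rep_mult[OF rep_\<eta> ab] by simp
    with * that show ?thesis using dvd_coords(2) by blast
  qed
  then have "\<forall>j. \<exists>x. j < 3 \<longrightarrow> a j = l * x" by (blast elim: dvdE)
  then obtain x where x: "\<And>j. j < 3 \<Longrightarrow> a j = l * x j" by metis
  have "F dvd V m - (\<Sum>j<3. (\<iota> l * \<iota> (x j) + \<iota> (b j) * \<eta>) * D j m)" if m: "m < 6" for m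
  proof -
    have "F dvd (\<Sum>j<3. (c j - (\<iota> (a j) + \<iota> (b j) * \<eta>)) * D j m)"
      using ab unfolding rep_def by (intro dvd_sum) auto
    moreover have "V m - (\<Sum>j<3. (\<iota> l * \<iota> (x j) + \<iota> (b j) * \<eta>) * D j m) =
      (V m - (\<Sum>j<3. c j * D j m)) + (\<Sum>j<3. (c j - (\<iota> (a j) + \<iota> (b j) * \<eta>)) * D j m)"
      by (simp add: sum_less_3 x \<iota>_mult algebra_simps)
    ultimately show ?thesis using c[OF m] by (simp only: dvd_add)
  qed
  then show ?thesis by blast
qed

text \<open>If \<open>l\<^sup>2\<close> divides \<open>p\<close>, four elements of \<open>M = ker\<close> independent modulo the prime \<open>l\<close> become
  divisible by \<open>l\<close> after multiplication by \<open>\<eta>\<close>. As \<open>\<eta>\<^sup>2\<close> vanishes modulo \<open>l\<close>, in a module free of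
  rank three they would all lie in the span of \<open>\<eta> D 0, \<eta> D 1, \<eta> D 2\<close> modulo \<open>l\<close>.\<close>

lemma ker_not_free:
  assumes l: "prime_elem l" and p: "p = l * l * L * v" and p1: "p1 = l * L * w"
    and v: "\<not> l dvd v" and w: "\<not> l dvd w" and \<xi>: "l dvd 4 * q2 * v - w * w * L"
  shows "\<not> basis_mod F ker D"
proof
  assume D: "basis_mod F ker D"
  define \<xi> where "\<xi> = h * (q2 * v - h * h * w * w * L)"
  have "8 * \<xi> = 2 * h * (4 * q2 * v - (2 * h) * (2 * h) * (w * w * L))"
    unfolding \<xi>_def by (simp add: algebra_simps)
  then have "8 * \<xi> = 4 * q2 * v - w * w * L" by (simp add: half)
  then have "l dvd (h * h * h) * (8 * \<xi>)" using \<xi> by simp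
  also have "(h * h * h) * (8 * \<xi>) = (2 * h) * (2 * h) * (2 * h) * \<xi>" by (simp add: algebra_simps)
  finally have "l dvd \<xi>" by (simp add: half)
  then obtain \<xi>' where \<xi>': "\<xi> = l * \<xi>'" ..
  \<comment> \<open>Formally, \<open>V 0\<close> is \<open>\<eta>\<close>, \<open>V 1\<close> is
    \<open>\<eta> H / (l L)\<close>, \<open>V 2\<close> is \<open>H\<close>, and \<open>V 3\<close>
    is \<open>\<eta>\<close> times \<open>H^2/2\<close> divided by \<open>4 l^2 L\<close>, minus
    \<open>w H / (8 l)\<close>. The subtracted term removes the entry with denominator
    \<open>l\<close> and leaves \<open>\<xi>\<close> in the entry for dY.\<close>
  define Va where "Va i = [vec6 0 0 0 0 0 0, vec6 0 (2 * l * v) 0 0 0 0, vec6 0 0 p1 0 0 0,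
     vec6 0 0 \<xi> 0 (h * v * p1) 0] ! i" for i
  define Vb where "Vb i = [vec6 1 0 0 0 0 0, vec6 0 0 w 0 0 0, vec6 0 2 0 0 0 0,
     vec6 0 0 0 v 0 (h * h * w * w * L)] ! i" for i
  \<comment> \<open>\<open>Z i\<close> is \<open>\<eta> V i\<close> divided by \<open>l\<close>.
    That it is integral uses the square of \<open>l\<close> in \<open>p\<close> and the divisibility
    of \<open>\<xi>\<close> by \<open>l\<close>.\<close>
  define Za where "Za i = [vec6 (l * L * v) 0 0 0 0 0, vec6 0 0 (v * p1) 0 0 0, vec6 0 (L * 2 * l * v) 0 0 0 0,
     vec6 0 0 0 (l * L * v * v) 0 (h * h * w * w * L * l * L * v)] ! i" for i
  define Zb where "Zb i = [vec6 0 0 0 0 0 0, vec6 0 (2 * v) 0 0 0 0, vec6 0 0 (L * w) 0 0 0,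
     vec6 0 0 \<xi>' 0 (h * v * L * w) 0] ! i" for i
  define V where "V i m = \<iota> (Va i m) + \<iota> (Vb i m) * \<eta>" for i m
  define Z where "Z i m = \<iota> (Za i m) + \<iota> (Zb i m) * \<eta>" for i m
  have rV: "rep (V i m) (Va i m) (Vb i m)" and rZ: "rep (Z i m) (Za i m) (Zb i m)" for i m
    by (simp_all add: V_def Z_def rep_def)
  have V2: "2 * \<xi> - q2 * v + h * h * w * w * L = 0"
  proof -
    have "2 * \<xi> - q2 * v + h * h * w * w * L = (2 * h - 1) * (q2 * v - h * h * w * w * L)"
      by (simp add: \<xi>_def algebra_simps)
    then show ?thesis by (simp add: half)
  qed
  have V3: "- p1 * v + 2 * (h * v * p1) = 0"
    by (rule eq_by_lincomb(1)[where ca = "p1 * v", OF half]) (simp add: algebra_simps)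
  have V4: "- p1 * (h * v * p1) + 2 * p * (h * h * w * w * L) = 0"
    unfolding p p1 by (rule eq_by_lincomb(1)[where ca = "l * l * L * L * w * w * v * h", OF half]) (simp add: algebra_simps)
  have Z2: "2 * p * \<xi>' - q2 * (l * L * v * v) + h * h * w * w * L * l * L * v = 0"
  proof -
    have "2 * p * \<xi>' - q2 * (l * L * v * v) + h * h * w * w * L * l * L * v =
      l * L * v * (2 * (l * \<xi>') - q2 * v + h * h * w * w * L)" by (simp add: p algebra_simps)
    then show ?thesis using V2 by (simp add: \<xi>')
  qed
  have Z3: "- p1 * (l * L * v * v) + 2 * p * (h * v * L * w) = 0"
    unfolding p p1 by (rule eq_by_lincomb(1)[where ca = "l * l * L * L * w * v * v", OF half]) (simp add: algebra_simps)
  have Z4: "- p1 * (h * v * L * w) + 2 * (h * h * w * w * L * l * L * v) = 0"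
    unfolding p1 by (rule eq_by_lincomb(1)[where ca = "l * L * L * w * w * v * h", OF half]) (simp add: algebra_simps)
  have kV: "ker (V i)" and kZ: "ker (Z i)" if "i < 4" for i
  proof -
    have D1: "- p1 * (2 * l * v) + 2 * p * w = 0" and D2: "- p1 * (L * 2 * l * v) + 2 * p * (L * w) = 0"
      and D3: "- p1 * (2 * v) + 2 * (v * p1) = 0"
      by (simp_all add: p p1 algebra_simps)
    have i: "i = 0 \<or> i = 1 \<or> i = 2 \<or> i = 3" using that by auto
    show "ker (V i)" unfolding ker_rep[of "V i", OF rV]
      using i V2 V3 V4 D1 by (elim disjE) (simp_all add: Va_def Vb_def)
    show "ker (Z i)" unfolding ker_rep[of "Z i", OF rZ]
      using i Z2 Z3 Z4 D2 D3 by (elim disjE) (simp_all add: Za_def Zb_def)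
  qed
  have eta: "F dvd \<eta> * V i m - \<iota> l * Z i m" if "i < 4" "m < 6" for i m
  proof -
    have i: "i = 0 \<or> i = 1 \<or> i = 2 \<or> i = 3" and m: "m = 0 \<or> m = 1 \<or> m = 2 \<or> m = 3 \<or> m = 4 \<or> m = 5"
      using that by auto
    have *: "p * Vb i m = l * Za i m \<and> Va i m = l * Zb i m"
      using i m by (elim disjE) (simp_all add: Va_def Vb_def Za_def Zb_def p p1 \<xi>' mult_ac)
    have "rep (\<eta> * V i m) (p * Vb i m) (Va i m)" "rep (\<iota> l * Z i m) (l * Za i m) (l * Zb i m)"
      using rep_mult[OF rep_\<eta> rV] rep_mult[OF rep_\<iota> rZ] by simp_all
    from rep_unique[OF this] show ?thesis using * by simp
  qed
  have "l dvd p" by (simp add: p mult.assoc)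
  from basis_coords_dvd[OF D kV kZ this eta]
  have "\<forall>i. \<exists>x y. i < 4 \<longrightarrow> (\<forall>m<6. F dvd V i m - (\<Sum>j<3. (\<iota> l * \<iota> (x j) + \<iota> (y j) * \<eta>) * D j m))"
    by blast
  from choice[OF this] obtain x where "\<forall>i. \<exists>y. i < 4 \<longrightarrow>
      (\<forall>m<6. F dvd V i m - (\<Sum>j<3. (\<iota> l * \<iota> (x i j) + \<iota> (y j) * \<eta>) * D j m))" ..
  from choice[OF this] obtain y where "\<forall>i. i < 4 \<longrightarrow>
      (\<forall>m<6. F dvd V i m - (\<Sum>j<3. (\<iota> l * \<iota> (x i j) + \<iota> (y i j) * \<eta>) * D j m))" ..
  then have xy: "\<And>i m. i < 4 \<Longrightarrow> m < 6 \<Longrightarrow>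
      F dvd V i m - (\<Sum>j<3. (\<iota> l * \<iota> (x i j) + \<iota> (y i j) * \<eta>) * D j m)" by simp
  \<comment> \<open>Modulo \<open>l\<close>, each \<open>V i\<close> is a combination of the three
    vectors \<open>\<eta> D j\<close> with coefficients \<open>y i j\<close>. Four vectors in three
    coordinates admit a nontrivial relation modulo \<open>l\<close>.\<close>
  obtain k where k: "\<exists>i\<in>{..<4::nat}. \<not> l dvd k i" "\<forall>j\<in>{..<3::nat}. l dvd (\<Sum>i<4. k i * y i j)"
    using prime_elem_linear_relation[OF l, of "{..<3::nat}" "{..<4::nat}" y] by auto
  have "\<forall>j. \<exists>z. j < 3 \<longrightarrow> (\<Sum>i<4. k i * y i j) = l * z" using k(2) by (auto elim: dvdE)
  then obtain z where z: "\<And>j. j < 3 \<Longrightarrow> (\<Sum>i<4. k i * y i j) = l * z j" by metis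
  have sum4: "(\<Sum>i<4. g i) = g (0::nat) + g 1 + g 2 + (g 3 :: 'b::comm_monoid_add)" for g
    by (simp add: lessThan_nat_numeral add.commute add.left_commute)
  have kd: "l dvd (\<Sum>i<4. k i * Va i m)" "l dvd (\<Sum>i<4. k i * Vb i m)" if m: "m < 6" for m
  proof -
    have r: "rep (\<Sum>i<4. \<iota> (k i) * V i m) (\<Sum>i<4. k i * Va i m) (\<Sum>i<4. k i * Vb i m)"
      unfolding sum4 using rep_mult[OF rep_\<iota> rV] by (intro rep_add) simp_all
    define U where "U = (\<Sum>j<3. ((\<Sum>i<4. \<iota> (k i) * \<iota> (x i j)) + \<iota> (z j) * \<eta>) * D j m)"
    have zz: "\<iota> (k 0) * \<iota> (y 0 j) + \<iota> (k 1) * \<iota> (y 1 j) + \<iota> (k 2) * \<iota> (y 2 j) + \<iota> (k 3) * \<iota> (y 3 j) = \<iota> l * \<iota> (z j)"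
      if "j < 3" for j
      using arg_cong[OF z[OF that], of \<iota>] by (simp add: sum4 \<iota>_simps)
    have "(\<Sum>i<4. \<iota> (k i) * (\<Sum>j<3. (\<iota> l * \<iota> (x i j) + \<iota> (y i j) * \<eta>) * D j m)) =
       (\<Sum>j<3. \<Sum>i<4. \<iota> (k i) * ((\<iota> l * \<iota> (x i j) + \<iota> (y i j) * \<eta>) * D j m))"
      unfolding sum_distrib_left by (rule sum.swap)
    also have "\<dots> = (\<Sum>j<3. (\<iota> l * (\<Sum>i<4. \<iota> (k i) * \<iota> (x i j)) + (\<iota> (k 0) * \<iota> (y 0 j) + \<iota> (k 1) * \<iota> (y 1 j) + \<iota> (k 2) * \<iota> (y 2 j) + \<iota> (k 3) * \<iota> (y 3 j)) * \<eta>) * D j m)"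
      by (intro sum.cong refl) (simp add: sum4 algebra_simps)
    also have "\<dots> = (\<Sum>j<3. (\<iota> l * (\<Sum>i<4. \<iota> (k i) * \<iota> (x i j)) + \<iota> l * \<iota> (z j) * \<eta>) * D j m)"
      by (intro sum.cong refl) (use zz in simp)
    also have "\<dots> = \<iota> l * U"
      by (simp add: U_def sum_distrib_left mult.assoc algebra_simps)
    finally have "(\<Sum>i<4. \<iota> (k i) * V i m) - \<iota> l * U =
      (\<Sum>i<4. \<iota> (k i) * (V i m - (\<Sum>j<3. (\<iota> l * \<iota> (x i j) + \<iota> (y i j) * \<eta>) * D j m)))"
      by (simp add: right_diff_distrib sum_subtractf)
    also have "F dvd \<dots>" using xy m by (intro dvd_sum dvd_mult) auto
    finally show "l dvd (\<Sum>i<4. k i * Va i m)" "l dvd (\<Sum>i<4. k i * Vb i m)"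
      using dvd_coords[OF r] by blast+
  qed
  \<comment> \<open>In the \<open>\<eta>\<close>-coordinates, entries 0, 3, 1 and 2 isolate
    \<open>k 0\<close>, \<open>k 3\<close>, \<open>k 2\<close> and \<open>k 1\<close>, with the
    factors \<open>1\<close>, \<open>v\<close>, \<open>2\<close> and \<open>w\<close>, none of which
    is divisible by \<open>l\<close>.\<close>
  have k0: "l dvd k 0" using kd(2)[of 0] by (simp add: sum4 Vb_def)
  have "l dvd k 3 * v" using kd(2)[of 3] by (simp add: sum4 Vb_def)
  then have k3: "l dvd k 3" using l v by (simp add: prime_elem_dvd_mult_iff)
  have "l dvd k 2 * 2" using kd(2)[of 1] by (simp add: sum4 Vb_def)
  then have "l dvd k 2 * 2 * h" by simp
  then have k2: "l dvd k 2" using half by (simp add: mult.assoc)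
  have "l dvd k 1 * w" using kd(2)[of 2] k3 by (simp add: sum4 Vb_def)
  then have k1: "l dvd k 1" using l w by (simp add: prime_elem_dvd_mult_iff)
  have "l dvd k i" if "i < 4" for i
  proof -
    have "i \<in> {0, 1, 2, 3}" using that by auto
    then show ?thesis using k0 k1 k2 k3 by auto
  qed
  then show False using k(1) by auto
qed

end

section \<open>Division in power series rings\<close>

fun division_seq :: "('a::comm_ring_1 \<Rightarrow> 'a \<times> 'a) \<Rightarrow> 'a fps \<Rightarrow> 'a fps \<Rightarrow> 'a fps \<Rightarrow> nat \<Rightarrow> 'a \<times> 'a" where
  "division_seq d F H G n = d (G $ n - (\<Sum>i<n. F $ (n - i) * fst (division_seq d F H G i)
     + H $ (n - i) * snd (division_seq d F H G i)))"

declare division_seq.simps [simp del]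

lemma fps_mult_nth_split: "(F * Q) $ n = F $ 0 * Q $ n + (\<Sum>i<n. F $ (n - i) * (Q $ i :: 'a::comm_ring_1))"
proof -
  have "(F * Q) $ n = (\<Sum>i=0..n. Q $ i * F $ (n - i))" by (subst mult.commute) (simp add: fps_mult_nth)
  also have "{0..n} = insert n {..<n}" by auto
  finally show ?thesis by (simp add: mult.commute)
qed

text \<open>The quotients are found one coefficient at a time: \<open>d\<close> divides the current
  coefficient, corrected by the earlier ones, by the pair \<open>F $ 0\<close>,
  \<open>H $ 0\<close>. The set \<open>S\<close> of admissible remainders is arbitrary, so that the
  same recursion serves several division theorems.\<close>

lemma fps_division2:
  fixes F H G :: "'a::comm_ring_1 fps"
  assumes "\<And>g. \<exists>q q'. g - F $ 0 * q - H $ 0 * q' \<in> S"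
  shows "\<exists>Q Q'. \<forall>n. (G - F * Q - H * Q') $ n \<in> S"
proof -
  have "\<forall>g. \<exists>d. g - F $ 0 * fst d - H $ 0 * snd d \<in> S" using assms by simp
  from choice[OF this] obtain d where d: "\<And>g. g - F $ 0 * fst (d g) - H $ 0 * snd (d g) \<in> S" by blast
  define Q Q' where "Q = Abs_fps (\<lambda>n. fst (division_seq d F H G n))"
    and "Q' = Abs_fps (\<lambda>n. snd (division_seq d F H G n))"
  have "(G - F * Q - H * Q') $ n \<in> S" for n
  proof -
    define g where "g = G $ n - (\<Sum>i<n. F $ (n - i) * Q $ i + H $ (n - i) * Q' $ i)"
    have "division_seq d F H G n = d g"
      by (subst division_seq.simps) (simp add: g_def Q_def Q'_def)
    then have "(G - F * Q - H * Q') $ n = g - F $ 0 * fst (d g) - H $ 0 * snd (d g)"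
      unfolding fps_sub_nth fps_mult_nth_split[of F] fps_mult_nth_split[of H]
      by (simp add: g_def sum.distrib) (simp add: Q_def Q'_def)
    then show ?thesis using d by simp
  qed
  then show ?thesis by blast
qed

lemma fps_division:
  fixes F G :: "'a::comm_ring_1 fps"
  assumes "\<And>g. \<exists>q. g - F $ 0 * q \<in> S"
  shows "\<exists>Q. \<forall>n. (G - F * Q) $ n \<in> S"
proof -
  have "\<exists>Q Q'. \<forall>n. (G - F * Q - 0 * Q') $ n \<in> S"
    by (rule fps_division2) (use assms in simp)
  then show ?thesis by simp
qed

lemma fps_eq_X_mult: "(A::'a::comm_ring_1 fps) $ 0 = 0 \<Longrightarrow> A = fps_X * fps_shift 1 A"
  by (rule fps_ext) (simp add: fps_eq_iff)

lemma fps_division_unique: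
  fixes F Q :: "'a::comm_ring_1 fps"
  assumes S: "\<And>q. F $ 0 * q \<in> S \<Longrightarrow> q = 0" and Q: "\<And>n. (F * Q) $ n \<in> S"
  shows "Q = 0"
proof (rule fps_ext)
  fix n show "Q $ n = 0 $ n"
  proof (induction n rule: less_induct)
    case (less n)
    then have "(F * Q) $ n = F $ 0 * Q $ n" by (simp add: fps_mult_nth_split)
    then show ?case using S Q[of n] by simp
  qed
qed

text \<open>The hypothesis admits only Koszul relations between the lowest coefficients. Subtracting
  the Koszul relation of \<open>F\<close> and \<open>H\<close> with factor \<open>c\<close> does not
  change the combination and makes both cofactors divisible by the variable, which gives the
  induction on the coefficient.\<close>

lemma fps_division2_unique:
  fixes F H :: "'a::comm_ring_1 fps"
  assumes S: "\<And>a b. F $ 0 * a + H $ 0 * b \<in> S \<Longrightarrow> \<exists>c. b = F $ 0 * c \<and> a = - (H $ 0 * c)"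
    and coeffs: "\<And>n. (F * A + H * B) $ n \<in> S"
  shows "F * A + H * B = 0"
proof (rule fps_ext)
  have "(F * A + H * B) $ n = 0" if "\<forall>m. (F * A + H * B) $ m \<in> S" for n A B
    using that
  proof (induction n arbitrary: A B)
    case 0
    then have "F $ 0 * A $ 0 + H $ 0 * B $ 0 \<in> S" by (metis fps_add_nth fps_mult_nth_0)
    from S[OF this] show ?case by (auto simp: algebra_simps)
  next
    case (Suc n)
    then have "F $ 0 * A $ 0 + H $ 0 * B $ 0 \<in> S" by (metis fps_add_nth fps_mult_nth_0)
    from S[OF this] obtain c where c: "B $ 0 = F $ 0 * c" "A $ 0 = - (H $ 0 * c)" by blast
    define A' B' where "A' = A + fps_const c * H" and "B' = B - fps_const c * F"
    have eq: "F * A + H * B = F * A' + H * B'" by (simp add: A'_def B'_def algebra_simps)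
    have "A' = fps_X * fps_shift 1 A'" "B' = fps_X * fps_shift 1 B'"
      by (rule fps_eq_X_mult; simp add: A'_def B'_def c mult.commute)+
    from arg_cong2[OF this, of "\<lambda>a b. F * a + H * b"]
    have "F * A' + H * B' = fps_X * (F * fps_shift 1 A' + H * fps_shift 1 B')"
      by (simp only: distrib_left mult.left_commute[of _ fps_X])
    then have sh: "(F * A + H * B) $ Suc m = (F * fps_shift 1 A' + H * fps_shift 1 B') $ m" for m
      unfolding eq by (metis fps_X_mult_nth diff_Suc_1 nat.distinct(1))
    then have "\<forall>m. (F * fps_shift 1 A' + H * fps_shift 1 B') $ m \<in> S" using Suc.prems by metis
    from Suc.IH[OF this] show ?case by (simp only: sh)
  qed
  then show "(F * A + H * B) $ n = 0 $ n" for n using coeffs by (metis fps_zero_nth)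
qed

lemma fps_dvd_1: "(V::'a::comm_ring_1 fps) $ 0 = 1 \<Longrightarrow> V dvd 1"
proof -
  assume V: "V $ 0 = 1"
  have "\<exists>Q. \<forall>n. (1 - V * Q) $ n \<in> {0}"
    by (rule fps_division) (use V in \<open>auto intro: exI[of _ g for g]\<close>)
  then obtain Q where "1 - V * Q = 0" by (auto simp: fps_eq_iff)
  then show ?thesis by (intro dvdI[of _ _ Q]) simp
qed

lemma fps_is_unit_ring:
  fixes V :: "'a::comm_ring_1 fps"
  assumes "V $ 0 dvd 1"
  shows "V dvd 1"
proof -
  obtain u where "1 = V $ 0 * u" using assms ..
  then have "V * fps_const u dvd 1" by (intro fps_dvd_1) simp
  then show ?thesis by (rule dvd_mult_left)
qed

section \<open>Coefficientwise ring homomorphisms and derivations\<close>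

definition fps_map :: "('a \<Rightarrow> 'b) \<Rightarrow> 'a fps \<Rightarrow> 'b fps" where
  "fps_map g r = Abs_fps (\<lambda>n. g (r $ n))"

lemma fps_map_nth [simp]: "fps_map g r $ n = g (r $ n)"
  by (simp add: fps_map_def)

definition is_ring_hom :: "('a::comm_ring_1 \<Rightarrow> 'b::comm_ring_1) \<Rightarrow> bool" where
  "is_ring_hom g \<longleftrightarrow> g 1 = 1 \<and> (\<forall>a b. g (a + b) = g a + g b) \<and> (\<forall>a b. g (a * b) = g a * g b)"

definition is_derivation :: "('a::comm_ring_1 \<Rightarrow> 'a) \<Rightarrow> bool" where
  "is_derivation d \<longleftrightarrow> (\<forall>a b. d (a + b) = d a + d b) \<and> (\<forall>a b. d (a * b) = d a * b + a * d b)"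

lemma is_ring_homD:
  assumes "is_ring_hom g"
  shows "g 1 = 1" "g (a + b) = g a + g b" "g (a * b) = g a * g b" "g 0 = 0" "g (- a) = - g a"
    "g (a - b) = g a - g b" "g (\<Sum>x\<in>I. v x) = (\<Sum>x\<in>I. g (v x))" "g (a ^ n) = g a ^ n"
proof -
  note h = assms[unfolded is_ring_hom_def]
  show "g 1 = 1" "g (a + b) = g a + g b" "g (a * b) = g a * g b" using h by auto
  have "g 0 + g 0 = g 0 + 0" using h by (metis add_0_right)
  then show 0: "g 0 = 0" by simp
  have minus: "g (- a) = - g a" for a
  proof -
    have "g a + g (- a) = 0" using h 0 by (metis add.right_inverse)
    then show ?thesis by (simp add: add_eq_0_iff)
  qed
  then show "g (- a) = - g a" .
  show "g (a - b) = g a - g b" using h minus by (metis diff_conv_add_uminus)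
  show "g (\<Sum>x\<in>I. v x) = (\<Sum>x\<in>I. g (v x))"
    by (induction I rule: infinite_finite_induct) (use h 0 in auto)
  show "g (a ^ n) = g a ^ n" by (induction n) (use h in auto)
qed

lemma is_ring_hom_of_nat: "is_ring_hom g \<Longrightarrow> g (of_nat n) = of_nat n"
  by (induction n) (simp_all add: is_ring_homD)

lemma is_ring_hom_numeral: "is_ring_hom g \<Longrightarrow> g (numeral n) = numeral n"
  using is_ring_hom_of_nat[of g "numeral n"] by simp

lemma is_derivationD:
  assumes "is_derivation d"
  shows "d (a + b) = d a + d b" "d (a * b) = d a * b + a * d b" "d 0 = 0" "d 1 = 0" "d (- a) = - d a"
    "d (a - b) = d a - d b" "d (\<Sum>x\<in>I. v x) = (\<Sum>x\<in>I. d (v x))"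
proof -
  note h = assms[unfolded is_derivation_def]
  show "d (a + b) = d a + d b" "d (a * b) = d a * b + a * d b" using h by auto
  have "d 0 + d 0 = d 0 + 0" using h by (metis add_0_right)
  then show 0: "d 0 = 0" by simp
  have "d (1 * 1) = d 1 * 1 + 1 * d 1" using h by blast
  then show "d 1 = 0" by simp
  have minus: "d (- a) = - d a" for a
  proof -
    have "d a + d (- a) = 0" using h 0 by (metis add.right_inverse)
    then show ?thesis by (simp add: add_eq_0_iff)
  qed
  then show "d (- a) = - d a" .
  show "d (a - b) = d a - d b" using h minus by (metis diff_conv_add_uminus)
  show "d (\<Sum>x\<in>I. v x) = (\<Sum>x\<in>I. d (v x))"
    by (induction I rule: infinite_finite_induct) (use h 0 in auto)
qed

lemma is_ring_hom_fps_const: "is_ring_hom fps_const"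
  by (auto simp: is_ring_hom_def)

lemma is_ring_hom_fps_map: "is_ring_hom g \<Longrightarrow> is_ring_hom (fps_map g)"
  unfolding is_ring_hom_def[of "fps_map g"]
  by (auto simp: fps_eq_iff is_ring_homD fps_mult_nth)

lemma is_ring_hom_comp: "is_ring_hom g \<Longrightarrow> is_ring_hom g' \<Longrightarrow> is_ring_hom (\<lambda>x. g (g' x))"
  by (simp add: is_ring_hom_def)

lemma is_derivation_fps_deriv: "is_derivation fps_deriv"
  by (auto simp: is_derivation_def algebra_simps)

lemma is_derivation_fps_map: "is_derivation d \<Longrightarrow> is_derivation (fps_map d)"
  unfolding is_derivation_def[of "fps_map d"]
  by (auto simp: fps_eq_iff is_derivationD fps_mult_nth sum.distrib)

text \<open>The solution is \<open>b i = \<Sum>l. x^(s l) a (i + l)\<close>, written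
  coefficientwise; each coefficient is a finite sum because \<open>s > 0\<close>.\<close>

lemma X_power_series_solution: "\<exists>b. \<forall>i::nat. b i = a i + fps_X ^ s * (b (Suc i) :: 'k::comm_ring_1 fps)" if "s > 0"
proof -
  define b where "b i = Abs_fps (\<lambda>n. \<Sum>l | s * l \<le> n. a (i + l) $ (n - s * l))" for i
  have "b i = a i + fps_X ^ s * b (Suc i)" for i
  proof (rule fps_ext)
    fix n
    have "l \<le> n" if "s * l \<le> n" for l
      using \<open>s > 0\<close> that by (cases s) auto
    then have fin: "finite {l. s * l \<le> n}"
      by (metis (mono_tags, lifting) finite_nat_set_iff_bounded_le mem_Collect_eq)
    have set: "{l. s * l \<le> n} = (if n < s then {0} else insert 0 (Suc ` {l. s * l \<le> n - s}))"
    proof (cases "n < s")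
      case True
      then have "l = 0" if "s * l \<le> n" for l
      proof (cases l)
        case (Suc m)
        then have "s \<le> s * l" by simp
        then show ?thesis using that True by linarith
      qed simp
      then show ?thesis using True by auto
    next
      case False
      show ?thesis
      proof (rule Set.set_eqI)
        fix l show "l \<in> {l. s * l \<le> n} \<longleftrightarrow> l \<in> (if n < s then {0} else insert 0 (Suc ` {l. s * l \<le> n - s}))"
          using False by (cases l) (auto simp: image_iff)
      qed
    qed
    show "b i $ n = (a i + fps_X ^ s * b (Suc i)) $ n"
    proof (cases "n < s")
      case True
      then show ?thesis by (simp add: b_def set fps_X_power_mult_nth)
    next
      case False
      have fin': "finite {l. s * l \<le> n - s}"
        by (rule finite_subset[OF _ fin]) auto
      have "b i $ n = a i $ n + (\<Sum>l | s * l \<le> n - s. a (i + Suc l) $ (n - s * Suc l))"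
        using False fin' by (simp add: b_def set sum.reindex)
      also have "(\<Sum>l | s * l \<le> n - s. a (i + Suc l) $ (n - s * Suc l)) = (\<Sum>l | s * l \<le> n - s. a (Suc i + l) $ (n - s - s * l))"
        by (intro sum.cong) auto
      finally show ?thesis using False by (simp add: b_def fps_X_power_mult_nth)
    qed
  qed
  then show ?thesis by blast
qed

lemma fps_X_power_dvd_imp_0: "(\<And>n. fps_X ^ n dvd c) \<Longrightarrow> c = (0::'k::comm_ring_1 fps)"
proof (rule fps_ext)
  fix n assume "\<And>n. fps_X ^ n dvd c"
  then obtain d where "c = fps_X ^ Suc n * d" by blast
  then show "c $ n = 0 $ n" by (simp only: fps_X_power_mult_nth) simp
qed

section \<open>Division by the equation of the singularity\<close>

definition cusp :: "nat \<Rightarrow> 'k::comm_ring_1 fps fps" where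
  "cusp s = fps_X ^ 2 - fps_const (fps_X ^ s)"

lemma cusp_mult_nth:
  "(cusp s * q) $ n = (if n < 2 then 0 else q $ (n - 2)) - fps_X ^ s * (q $ n)"
  by (simp add: cusp_def left_diff_distrib fps_X_power_mult_nth)

lemma cusp_nth: "cusp s $ 0 = - (fps_X ^ s)" "cusp s $ Suc 0 = 0"
  by (simp_all add: cusp_def power2_eq_square)

text \<open>The constant coefficient of \<open>cusp s\<close> in \<open>y\<close> is not a unit, so
  the quotient cannot be built upwards from index 0. Its coefficients satisfy
  \<open>q_j = g_(j+2) + x^s q_(j+2)\<close>, a recursion towards higher indices that converges
  x-adically.\<close>

lemma cusp_division:
  assumes "s > 0"
  shows "\<exists>q r0 r1. g = cusp s * q + (fps_const r0 + fps_const r1 * fps_X)"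
proof -
  have "\<forall>c. \<exists>b. \<forall>i. b i = g $ (2 * i + 2 + c) + fps_X ^ s * b (Suc i)" for c :: nat
    by (intro allI X_power_series_solution[OF assms])
  then have "\<forall>c. \<exists>b. \<forall>i. b i = g $ (2 * i + 2 + c) + fps_X ^ s * b (Suc i)" by blast
  from choice[OF this] obtain b where b: "\<And>c i. b c i = g $ (2 * i + 2 + c) + fps_X ^ s * b c (Suc i)"
    by blast
  \<comment> \<open>The recursion preserves the parity of the index: \<open>b c i\<close> is the
    coefficient of the quotient at index \<open>2 i + c\<close>.\<close>
  define q where "q = Abs_fps (\<lambda>j. b (j mod 2) (j div 2))"
  have q: "q $ j = g $ (j + 2) + fps_X ^ s * q $ (j + 2)" for j
  proof -
    have "2 * (j div 2) + 2 + j mod 2 = j + 2" by presburger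
    then have "g $ (2 * (j div 2) + 2 + j mod 2) = g $ (j + 2)" by (rule arg_cong)
    moreover have "(j + 2) mod 2 = j mod 2" "(j + 2) div 2 = Suc (j div 2)" by simp_all
    ultimately show ?thesis unfolding q_def fps_nth_Abs_fps by (subst b) (simp only:)
  qed
  define r0 r1 where "r0 = g $ 0 + fps_X ^ s * q $ 0" and "r1 = g $ 1 + fps_X ^ s * q $ 1"
  have "g = cusp s * q + (fps_const r0 + fps_const r1 * fps_X)"
  proof (rule fps_ext)
    fix n :: nat
    consider "n = 0" | "n = 1" | "n \<ge> 2" by linarith
    then show "g $ n = (cusp s * q + (fps_const r0 + fps_const r1 * fps_X)) $ n"
    proof cases
      case 3
      define m where "m = n - 2"
      with 3 have m: "n = m + 2" by simp
      have "g $ (m + 2) = q $ m - fps_X ^ s * q $ (m + 2)" by (subst q[of m]) (rule add_diff_cancel_right'[symmetric])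
      then show ?thesis unfolding m by (simp add: cusp_mult_nth)
    qed (simp_all add: cusp_nth r0_def r1_def)
  qed
  then show ?thesis by blast
qed

text \<open>Comparing coefficients gives \<open>q_j = x^s q_(j+2)\<close>, so every coefficient of
  \<open>q\<close> is divisible by all powers of \<open>x\<close>.\<close>

lemma cusp_mult_linear:
  assumes "s > 0" and eq: "cusp s * q = fps_const r0 + fps_const r1 * fps_X"
  shows "q = 0"
proof (rule fps_ext)
  fix j
  have q: "q $ j = fps_X ^ s * q $ (j + 2)" for j
    using arg_cong[OF eq, of "\<lambda>z. z $ (j + 2)"] by (simp add: cusp_mult_nth)
  have "\<exists>d. q $ j = fps_X ^ n * d" for n j
  proof (induction n arbitrary: j)
    case (Suc n)
    then obtain d where "q $ (j + 2) = fps_X ^ n * d" by blast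
    then have "q $ j = fps_X ^ s * (fps_X ^ n * d)" using q[of j] by simp
    moreover obtain s' where "s = Suc s'" using assms(1) gr0_conv_Suc by blast
    ultimately have "q $ j = fps_X ^ Suc n * (fps_X ^ s' * d)"
      by (simp only: power_Suc mult_ac)
    then show ?case by blast
  qed simp
  then show "q $ j = 0 $ j" using fps_X_power_dvd_imp_0[of "q $ j"] by (auto simp: dvd_def)
qed

lemma linear_eq_0: "fps_const r0 + fps_const r1 * fps_X = 0 \<longleftrightarrow> r0 = 0 \<and> r1 = (0::'a::comm_ring_1)"
proof
  assume "fps_const r0 + fps_const r1 * fps_X = 0"
  then have "(fps_const r0 + fps_const r1 * fps_X) $ 0 = 0" "(fps_const r0 + fps_const r1 * fps_X) $ 1 = 0"
    by simp_all
  then show "r0 = 0 \<and> r1 = 0" by simp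
qed simp

section \<open>Normal forms modulo the equation of a family\<close>

abbreviation \<iota> :: "'k::comm_ring_1 fps fps \<Rightarrow> 'k fps fps fps" where
  "\<iota> \<equiv> fps_map fps_const"

abbreviation y_coord :: "'k::comm_ring_1 fps fps fps" where
  "y_coord \<equiv> fps_const fps_X"

lemmas \<iota>_hom = is_ring_hom_fps_map[OF is_ring_hom_fps_const]

lemma family_division:
  fixes F :: "'k::comm_ring_1 fps fps fps"
  assumes F: "F $ 0 = cusp s" and s: "s > 0"
  shows "\<exists>r0 r1. F dvd z - (\<iota> r0 + \<iota> r1 * y_coord)"
proof -
  have "\<exists>Q. \<forall>n. (z - F * Q) $ n \<in> {fps_const r0 + fps_const r1 * fps_X | r0 r1. True}"
  proof (rule fps_division)
    fix g :: "'k fps fps"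
    obtain q r0 r1 where "g = cusp s * q + (fps_const r0 + fps_const r1 * fps_X)"
      using cusp_division[OF s] by blast
    then have "g - F $ 0 * q = fps_const r0 + fps_const r1 * fps_X" by (simp add: F)
    then show "\<exists>q. g - F $ 0 * q \<in> {fps_const r0 + fps_const r1 * fps_X | r0 r1. True}" by blast
  qed
  then obtain Q where "\<forall>n. \<exists>r. (z - F * Q) $ n = fps_const (fst r) + fps_const (snd r) * fps_X" by force
  from choice[OF this] obtain r where "\<And>n. (z - F * Q) $ n = fps_const (fst (r n)) + fps_const (snd (r n)) * fps_X" by blast
  then have "z - F * Q = \<iota> (Abs_fps (\<lambda>n. fst (r n))) + \<iota> (Abs_fps (\<lambda>n. snd (r n))) * y_coord"
    by (intro fps_ext) simp
  then have "z - (\<iota> (Abs_fps (\<lambda>n. fst (r n))) + \<iota> (Abs_fps (\<lambda>n. snd (r n))) * y_coord) = F * Q"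
    by (simp only: diff_eq_eq) (simp only: add_ac)
  then show ?thesis by (metis dvd_triv_left)
qed

lemma family_division_unique:
  assumes F: "F $ 0 = cusp s" and s: "s > 0" and dvd: "F dvd \<iota> r0 + \<iota> r1 * y_coord"
  shows "r0 = 0 \<and> r1 = 0"
proof -
  from dvd obtain Q where Q: "\<iota> r0 + \<iota> r1 * y_coord = F * Q" ..
  have "Q = 0"
  proof (rule fps_division_unique)
    show "(F * Q) $ n \<in> {fps_const r0 + fps_const r1 * fps_X | r0 r1. True}" for n
      unfolding Q[symmetric] by auto
    show "q = 0" if "F $ 0 * q \<in> {fps_const r0 + fps_const r1 * fps_X | r0 r1. True}" for q
      using that cusp_mult_linear[OF s] unfolding F by blast
  qed
  with Q have "(\<iota> r0 + \<iota> r1 * y_coord) $ n = 0" for n by simp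
  then have "fps_const (r0 $ n) + fps_const (r1 $ n) * fps_X = 0" for n by simp
  then show ?thesis unfolding linear_eq_0 by (simp add: fps_eq_iff)
qed

lemma cusp_eq_imp:
  assumes s: "s > 0" and eq: "cusp s * q = fps_X ^ 2 - fps_const c - fps_const b * fps_X"
  shows "b = 0" "c = fps_X ^ s" "q = 1"
proof -
  have "cusp s * (q - 1) = fps_const (fps_X ^ s - c) + fps_const (- b) * fps_X"
    by (simp add: right_diff_distrib eq) (simp add: cusp_def fps_const_sub[symmetric] fps_const_neg[symmetric]
      del: fps_const_sub fps_const_neg)
  moreover from cusp_mult_linear[OF s this] have "q - 1 = 0" .
  ultimately have "fps_const (fps_X ^ s - c) + fps_const (- b) * fps_X = 0" by simp
  then show "b = 0" "c = fps_X ^ s" "q = 1" using \<open>q - 1 = 0\<close> unfolding linear_eq_0 by auto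
qed

text \<open>Completing the square in the Weierstrass equation of the family.\<close>

lemma family_weierstrass:
  fixes F :: "'k::field_char_0 fps fps fps"
  assumes F: "F $ 0 = cusp s" and s: "s > 0"
  obtains \<beta> p V where "F * V = (y_coord - \<iota> \<beta>)\<^sup>2 - \<iota> p" "V $ 0 = 1" "\<beta> $ 0 = 0" "p $ 0 = fps_X ^ s"
proof -
  obtain c b where cb: "F dvd y_coord\<^sup>2 - (\<iota> c + \<iota> b * y_coord)" using family_division[OF F s] by blast
  then obtain V where V: "y_coord\<^sup>2 - (\<iota> c + \<iota> b * y_coord) = F * V" ..
  define h :: "'k fps fps" where "h = fps_const (fps_const (1/2))"
  have "2 * h = 1" by (simp add: h_def numeral_fps_const)
  then have h4: "b = 2 * (h * b)" by (simp add: mult.assoc[symmetric])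
  \<comment> \<open>At \<open>t = 0\<close>, dividing \<open>y^2\<close> by \<open>y^2 - x^s\<close>
    leaves quotient 1 and remainder \<open>x^s\<close>; this makes \<open>V\<close> a unit and
    \<open>\<beta>\<close> vanish at \<open>t = 0\<close>.\<close>
  have "cusp s * V $ 0 = fps_X ^ 2 - fps_const (c $ 0) - fps_const (b $ 0) * fps_X"
    using arg_cong[OF V, of "\<lambda>z. z $ 0"] by (simp add: F diff_diff_eq)
  from cusp_eq_imp[OF s this] have 0: "b $ 0 = 0" "c $ 0 = fps_X ^ s" "V $ 0 = 1" .
  have "F * V = (y_coord - \<iota> (h * b))\<^sup>2 - \<iota> (c + (h * b)\<^sup>2)"
    unfolding V[symmetric] by (subst h4) (simp add: is_ring_homD[OF \<iota>_hom] is_ring_hom_numeral[OF \<iota>_hom] power2_eq_square algebra_simps)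
  then show thesis by (rule that) (simp_all add: 0 power2_eq_square)
qed

lemma quadratic_cover_family:
  fixes F :: "'k::field_char_0 fps fps fps"
  assumes F: "F $ 0 = cusp s" and s: "s > 0" and eq: "F * V = (y_coord - \<iota> \<beta>)\<^sup>2 - \<iota> p"
    and p: "p $ 0 = fps_X ^ s"
  shows "quadratic_cover \<iota> F (y_coord - \<iota> \<beta>) p (fps_const (fps_const (1/2)))"
proof
  show "\<exists>a b. F dvd z - (\<iota> a + \<iota> b * (y_coord - \<iota> \<beta>))" for z
  proof -
    obtain a b where "F dvd z - (\<iota> a + \<iota> b * y_coord)" using family_division[OF F s] by blast
    then have "F dvd z - (\<iota> (a + b * \<beta>) + \<iota> b * (y_coord - \<iota> \<beta>))"
      by (simp add: is_ring_homD[OF \<iota>_hom] algebra_simps)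
    then show ?thesis by blast
  qed
  show "a = 0 \<and> b = 0" if "F dvd \<iota> a + \<iota> b * (y_coord - \<iota> \<beta>)" for a b
  proof -
    have "F dvd \<iota> (a - b * \<beta>) + \<iota> b * y_coord"
      using that by (simp add: is_ring_homD[OF \<iota>_hom] algebra_simps)
    from family_division_unique[OF F s this] show ?thesis by auto
  qed
  show "F dvd (y_coord - \<iota> \<beta>) * (y_coord - \<iota> \<beta>) - \<iota> p"
    using eq by (metis dvd_triv_left power2_eq_square)
  show "2 * fps_const (fps_const (1/2)) = (1 :: 'k fps fps)" by (simp add: numeral_fps_const)
  show "p \<noteq> 0" using p by auto
qed (simp_all add: is_ring_homD[OF \<iota>_hom])

section \<open>Weierstrass polynomials\<close>

text \<open>With this sort for the coefficients k[[t]], polynomials over them have gcds and prime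
  factorizations.\<close>

instance fps :: (field) semiring_gcd_mult_normalize ..

text \<open>The polynomial is in \<open>x\<close> over k[[t]], whereas in the series
  \<open>t\<close> is the outer variable; the two indices are exchanged.\<close>

definition poly_series :: "'k::field_char_0 fps poly \<Rightarrow> 'k fps fps" where
  "poly_series P = Abs_fps (\<lambda>n. Abs_fps (\<lambda>i. coeff P i $ n))"

lemma poly_series_nth [simp]: "poly_series P $ n $ i = coeff P i $ n"
  by (simp add: poly_series_def)

lemma poly_series_hom: "is_ring_hom poly_series"
proof -
  have "poly_series (P * Q) = poly_series P * poly_series Q" for P Q :: "'a fps poly"
  proof (intro fps_ext)
    fix n i
    have "poly_series (P * Q) $ n $ i = (\<Sum>j\<le>i. \<Sum>m=0..n. coeff P j $ m * coeff Q (i - j) $ (n - m))"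
      by (simp add: coeff_mult fps_sum_nth fps_mult_nth)
    also have "\<dots> = (\<Sum>m=0..n. \<Sum>j\<le>i. coeff P j $ m * coeff Q (i - j) $ (n - m))"
      by (rule sum.swap)
    also have "\<dots> = (poly_series P * poly_series Q) $ n $ i"
      by (simp add: fps_mult_nth fps_sum_nth atMost_atLeast0)
    finally show "poly_series (P * Q) $ n $ i = (poly_series P * poly_series Q) $ n $ i" .
  qed
  then show ?thesis by (auto simp: is_ring_hom_def fps_eq_iff coeff_1 fps_one_nth)
qed

lemmas poly_series_simps = is_ring_homD[OF poly_series_hom]

lemma poly_series_dvd: "P dvd Q \<Longrightarrow> poly_series P dvd poly_series Q"
  by (auto simp: dvd_def poly_series_simps)

abbreviation dx :: "'k::comm_ring_1 fps fps \<Rightarrow> 'k fps fps" where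
  "dx \<equiv> fps_map fps_deriv"

lemmas dx_derivation = is_derivation_fps_map[OF is_derivation_fps_deriv]
lemmas dx_simps = is_derivationD[OF dx_derivation]

lemma dx_poly_series: "dx (poly_series P) = poly_series (pderiv P)"
  by (intro fps_ext) (simp add: coeff_pderiv fps_mult_of_nat_nth del: of_nat_Suc)

lemma poly_of_coeffs: "\<exists>P :: 'a::comm_ring_1 poly. \<forall>i. coeff P i = (if i < d then c i else 0)"
  by (rule exI[of _ "\<Sum>i<d. monom (c i) i"]) (simp add: coeff_sum if_distrib cong: if_cong)

text \<open>Weierstrass division with respect to \<open>x\<close>: at \<open>t = 0\<close> the
  divisor is a constant times \<open>x^d\<close>, so the remainder can be cut off at degree
  \<open>d\<close>, coefficient by coefficient in \<open>t\<close>.\<close>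

lemma x_division:
  fixes D :: "'k::field_char_0 fps fps"
  assumes D: "D $ 0 = fps_const c * fps_X ^ d" and c: "c \<noteq> 0"
  shows "\<exists>P. (\<forall>i\<ge>d. coeff P i = 0) \<and> D dvd z - poly_series P"
proof -
  have "\<exists>Q. \<forall>n. (z - D * Q) $ n \<in> {r. \<forall>i\<ge>d. r $ i = 0}"
  proof (rule fps_division)
    fix g :: "'k fps"
    have "(g - D $ 0 * (fps_const (1 / c) * fps_shift d g)) $ i = 0" if "i \<ge> d" for i
    proof -
      have "D $ 0 * (fps_const (1 / c) * fps_shift d g) = (fps_const c * fps_const (1 / c)) * (fps_X ^ d * fps_shift d g)"
        by (simp only: D mult_ac)
      also have "\<dots> = fps_X ^ d * fps_shift d g" using c by simp
      finally show ?thesis using that by (simp only: fps_sub_nth fps_X_power_mult_nth) simp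
    qed
    then show "\<exists>q. g - D $ 0 * q \<in> {r. \<forall>i\<ge>d. r $ i = 0}" by blast
  qed
  then obtain Q where Q: "\<And>n i. i \<ge> d \<Longrightarrow> (z - D * Q) $ n $ i = 0" by auto
  obtain P where P: "\<And>i. coeff P i = (if i < d then Abs_fps (\<lambda>n. (z - D * Q) $ n $ i) else 0)"
    using poly_of_coeffs[of d "\<lambda>i. Abs_fps (\<lambda>n. (z - D * Q) $ n $ i)"] by blast
  have "z - D * Q = poly_series P"
  proof (intro fps_ext)
    show "(z - D * Q) $ n $ i = poly_series P $ n $ i" for n i
      using Q[of i n] by (simp add: P)
  qed
  then have "z - poly_series P = D * Q" by (simp add: algebra_simps)
  then show ?thesis using P by (intro exI[of _ P]) auto
qed

lemma x_division_unique:
  fixes D :: "'k::field_char_0 fps fps"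
  assumes D: "D $ 0 = fps_const c * fps_X ^ d" and c: "c \<noteq> 0"
    and P: "\<And>i. i \<ge> d \<Longrightarrow> coeff P i = 0" and dvd: "D dvd poly_series P"
  shows "P = 0"
proof -
  from dvd obtain Q where Q: "poly_series P = D * Q" ..
  have "Q = 0"
  proof (rule fps_division_unique)
    show "(D * Q) $ n \<in> {r. \<forall>i\<ge>d. r $ i = 0}" for n
      unfolding Q[symmetric] using P by auto
    show "q = 0" if "D $ 0 * q \<in> {r. \<forall>i\<ge>d. r $ i = 0}" for q
    proof (rule fps_ext)
      fix i
      have "(D $ 0 * q) $ (i + d) = 0" using that by auto
      then have "c * q $ i = 0" by (simp add: D mult.assoc fps_X_power_mult_nth)
      then show "q $ i = 0 $ i" using c by simp
    qed
  qed
  with Q have "poly_series P $ n $ i = 0" for n i by simp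
  then show ?thesis by (simp add: poly_eq_iff fps_eq_iff)
qed

text \<open>Pseudo-division by \<open>l\<close> leaves a remainder of smaller degree which is
  divisible by \<open>l\<close> as a series, hence zero by uniqueness of Weierstrass division. The
  power of the leading coefficient introduced on the way is a unit.\<close>

lemma poly_series_dvd_iff:
  assumes D: "poly_series l $ 0 = fps_const c * fps_X ^ degree l" and c: "c \<noteq> 0"
    and lc: "lead_coeff l dvd 1"
  shows "poly_series l dvd poly_series P \<longleftrightarrow> l dvd P"
proof
  assume dvd: "poly_series l dvd poly_series P"
  have l: "l \<noteq> 0" using lc by auto
  obtain Q r where qr: "pseudo_divmod P l = (Q, r)" by fastforce
  let ?k = "Suc (degree P) - degree l"
  have eq: "smult (lead_coeff l ^ ?k) P = l * Q + r" and r: "r = 0 \<or> degree r < degree l"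
    using pseudo_divmod[OF l qr] by auto
  have "poly_series l dvd poly_series (smult (lead_coeff l ^ ?k) P)"
    using dvd poly_series_simps(3)[of "[:lead_coeff l ^ ?k:]" P] by simp
  then have "poly_series l dvd poly_series r"
    unfolding eq by (simp add: poly_series_simps dvd_add_right_iff)
  then have "r = 0"
    using r by (intro x_division_unique[OF D c, of r]) (auto simp: coeff_eq_0)
  then have dvd': "l dvd smult (lead_coeff l ^ ?k) P" using eq by simp
  obtain u where u: "lead_coeff l ^ ?k * u = 1"
    using lc by (metis dvd_def is_unit_power_iff dvd_power_same power_one)
  from dvd' have "l dvd smult u (smult (lead_coeff l ^ ?k) P)" by (rule dvd_smult)
  also have "smult u (smult (lead_coeff l ^ ?k) P) = smult (lead_coeff l ^ ?k * u) P"
    by (simp add: mult.commute)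
  finally show "l dvd P" unfolding u by simp
qed (rule poly_series_dvd)

text \<open>The polynomial is \<open>x^s\<close> minus its remainder modulo
  \<open>p\<close>.\<close>

lemma Weierstrass_preparation:
  fixes p :: "'k::field_char_0 fps fps"
  assumes p: "p $ 0 = fps_X ^ s"
  obtains W U where "poly_series W = p * U" "U $ 0 = 1" "lead_coeff W = 1" "degree W = s"
proof -
  have p': "p $ 0 = fps_const 1 * fps_X ^ s" using p by simp
  obtain P where P: "\<And>i. i \<ge> s \<Longrightarrow> coeff P i = 0" and dvd: "p dvd poly_series (monom 1 s) - poly_series P"
    using x_division[OF p'] by fastforce
  define W where "W = monom 1 s - P"
  have c: "coeff W s = 1" and c': "\<And>i. i > s \<Longrightarrow> coeff W i = 0" using P by (auto simp: W_def)
  then have deg: "degree W = s" by (metis degree_le le_antisym le_degree one_neq_zero)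
  from dvd obtain U where U: "poly_series W = p * U" unfolding W_def by (auto simp: poly_series_simps)
  have *: "poly_series W $ 0 = fps_X ^ s * U $ 0" by (simp add: U p)
  have "U $ 0 = 1"
  proof (rule fps_ext)
    fix i
    have "poly_series W $ 0 $ (i + s) = U $ 0 $ i" unfolding * by (simp add: fps_X_power_mult_nth)
    then show "U $ 0 $ i = 1 $ i" using c c' by (cases "i = 0") auto
  qed
  with U deg c show thesis using that by auto
qed

text \<open>At \<open>t = 0\<close> each of the two factors has order in \<open>x\<close> at most
  its degree, because its leading coefficient is a unit. Orders and degrees both add up to
  \<open>s\<close>, so they agree for each factor.\<close>

lemma Weierstrass_factor:
  fixes W :: "'k::field_char_0 fps poly"
  assumes W: "poly_series W = p * U" "U $ 0 = 1" "lead_coeff W = 1" "degree W = s" "p $ 0 = fps_X ^ s"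
    and l: "l dvd W"
  obtains c where "c \<noteq> 0" "poly_series l $ 0 = fps_const c * fps_X ^ degree l" "lead_coeff l dvd 1"
proof -
  from l obtain m where m: "W = l * m" ..
  have nz: "l \<noteq> 0" "m \<noteq> 0" using W m by auto
  have lc: "lead_coeff l * lead_coeff m = 1" using W m by (simp add: lead_coeff_mult)
  then have "lead_coeff l $ 0 * lead_coeff m $ 0 = 1" by (metis fps_mult_nth_0 fps_one_nth)
  then have lc0: "coeff l (degree l) $ 0 \<noteq> 0" "coeff m (degree m) $ 0 \<noteq> 0" by auto
  have deg: "degree l + degree m = s" using W m nz by (simp add: degree_mult_eq)
  let ?A = "poly_series l $ 0" and ?B = "poly_series m $ 0"
  have AB: "?A * ?B = fps_X ^ s"
    using W m by (metis fps_mult_nth_0 mult.right_neutral poly_series_simps(3))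
  have "subdegree ?A \<le> degree l" "subdegree ?B \<le> degree m"
    using lc0 by (auto intro: subdegree_leI)
  moreover have "subdegree ?A + subdegree ?B = s"
  proof -
    have "?A * ?B \<noteq> 0" unfolding AB by simp
    then show ?thesis using AB by (metis fps_X_power_subdegree mult_eq_0_iff subdegree_mult)
  qed
  ultimately have sub: "subdegree ?A = degree l" using deg by linarith
  have "?A = fps_const (coeff l (degree l) $ 0) * fps_X ^ degree l"
  proof (rule fps_ext)
    fix i
    show "?A $ i = (fps_const (coeff l (degree l) $ 0) * fps_X ^ degree l) $ i"
      using nth_less_subdegree_zero[of i ?A] unfolding sub
      by (cases i "degree l" rule: linorder_cases) (auto simp: fps_X_power_nth coeff_eq_0)
  qed
  with lc0 lc show thesis by (intro that) (auto intro: dvdI[of _ _ "lead_coeff m"])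
qed

lemma pderiv_not_dvd: "degree l > 0 \<Longrightarrow> \<not> l dvd pderiv (l :: 'k::field_char_0 fps poly)"
proof
  assume d: "degree l > 0" and "l dvd pderiv l"
  moreover have "pderiv l \<noteq> 0" using d by (simp add: pderiv_eq_0_iff)
  ultimately have "degree l \<le> degree (pderiv l)" by (intro dvd_imp_degree_le)
  then show False using d by (simp add: degree_pderiv)
qed

lemma dx_power: "dx (a ^ Suc n) = of_nat (Suc n) * a ^ n * dx (a :: 'k::comm_ring_1 fps fps)"
  by (induction n) (simp_all add: dx_simps algebra_simps)

text \<open>Every series is congruent modulo \<open>l\<close> to a polynomial in \<open>x\<close>,
  so divisibility of a product can be tested in k[[t]][x], where \<open>l\<close> is prime.\<close>

lemma prime_poly_series:
  assumes D: "poly_series l $ 0 = fps_const c * fps_X ^ degree l" and c: "c \<noteq> 0"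
    and lc: "lead_coeff l dvd 1" and l: "prime_elem l"
  shows "prime_elem (poly_series l)" "degree l > 0"
proof -
  note iff = poly_series_dvd_iff[OF D c lc]
  show deg: "degree l > 0"
  proof (rule ccontr)
    assume "\<not> degree l > 0"
    then obtain a where "l = [:a:]" by (metis degree_eq_zeroE gr0I)
    moreover from this lc obtain b where "1 = a * b" by (metis coeff_pCons_0 degree_pCons_0 dvd_def)
    ultimately have "1 = l * [:b:]" by (simp add: one_pCons mult.commute)
    then have "l dvd 1" ..
    then show False using l by (simp add: prime_elem_def)
  qed
  show "prime_elem (poly_series l)"
  proof (rule prime_elemI)
    show "poly_series l \<noteq> 0" using iff[of 1] D c by auto
    have "\<not> l dvd 1" using l by (simp add: prime_elem_def)
    then show "\<not> poly_series l dvd 1" using iff[of 1] by (simp add: poly_series_simps)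
    fix a b assume ab: "poly_series l dvd a * b"
    obtain A B where A: "poly_series l dvd a - poly_series A" and B: "poly_series l dvd b - poly_series B"
      using x_division[OF D c] by blast
    have "poly_series (A * B) = a * b - (a - poly_series A) * b - poly_series A * (b - poly_series B)"
      by (simp add: poly_series_simps algebra_simps)
    then have "poly_series l dvd poly_series (A * B)" using A B ab by (metis dvd_diff dvd_mult dvd_mult2)
    then have "l dvd A \<or> l dvd B" using iff l by (simp add: prime_elem_dvd_mult_iff)
    then show "poly_series l dvd a \<or> poly_series l dvd b"
    proof
      assume "l dvd A"
      then have "poly_series l dvd (a - poly_series A) + poly_series A" using A poly_series_dvd by (intro dvd_add)
      then show ?thesis by simp
    next
      assume "l dvd B"
      then have "poly_series l dvd (b - poly_series B) + poly_series B" using B poly_series_dvd by (intro dvd_add)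
      then show ?thesis by simp
    qed
  qed
qed

text \<open>The gcd of the Weierstrass polynomial of \<open>p\<close> and its derivative decides. If
  it is a unit, the derivative cancels modulo \<open>p\<close>; otherwise a common prime factor
  occurs with some multiplicity \<open>j + 2\<close>, and \<open>L\<close> is its
  \<open>j\<close>-th power. The second alternative is shaped as the hypotheses of
  \<open>ker_not_free\<close>.\<close>

lemma coprime_or_square:
  fixes p q2 :: "'k::field_char_0 fps fps"
  assumes p: "p $ 0 = fps_X ^ s" and q2: "2 * q2 = dx (dx p)"
  shows "(\<forall>z. p dvd dx p * z \<longrightarrow> p dvd z) \<or>
    (\<exists>l L v w. prime_elem l \<and> p = l * l * L * v \<and> dx p = l * L * w \<and> \<not> l dvd v \<and> \<not> l dvd w \<and>
      l dvd 4 * q2 * v - w * w * L)"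
proof -
  obtain W U where W: "poly_series W = p * U" "U $ 0 = 1" "lead_coeff W = 1" "degree W = s"
    using Weierstrass_preparation[OF p] .
  obtain U1 where U1: "U * U1 = 1" using fps_dvd_1[OF W(2)] by (metis dvdE)
  have pW: "p = poly_series W * U1" using W(1) U1 by (simp add: mult.assoc)
  have W0: "W \<noteq> 0" using W(3) by auto
  show ?thesis
  proof (cases "gcd W (pderiv W) dvd 1")
    case True
    have "p dvd z" if "p dvd dx p * z" for z
    proof -
      obtain c where c: "c \<noteq> 0" "poly_series W $ 0 = fps_const c * fps_X ^ degree W" "lead_coeff W dvd 1"
        using Weierstrass_factor[OF W p dvd_refl] .
      obtain Z where Z: "poly_series W dvd z - poly_series Z" using x_division[OF c(2,1)] by blast
      have "poly_series (pderiv W) = dx p * U + p * dx U"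
        unfolding dx_poly_series[symmetric] W(1) by (simp add: dx_simps)
      then have "poly_series (pderiv W) * z = U * (dx p * z) + p * (dx U * z)" by (simp add: algebra_simps)
      then have "p dvd poly_series (pderiv W) * z" using that by simp
      then have "p * U dvd (poly_series (pderiv W) * z) * U" by (rule mult_dvd_mono) simp
      then have "p * U dvd ((poly_series (pderiv W) * z) * U) * U1" by (rule dvd_mult2)
      then have "p * U dvd poly_series (pderiv W) * z" by (simp only: mult.assoc U1 mult_1_right)
      then have 1: "poly_series W dvd poly_series (pderiv W) * z" by (simp add: W(1))
      have "poly_series (pderiv W * Z) = poly_series (pderiv W) * z - poly_series (pderiv W) * (z - poly_series Z)"
        by (simp add: poly_series_simps algebra_simps)
      then have "poly_series W dvd poly_series (pderiv W * Z)" using 1 Z by simp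
      then have "W dvd pderiv W * Z" using poly_series_dvd_iff[OF c(2,1,3)] by blast
      then have "W dvd gcd (Z * W) (Z * pderiv W)" by (simp add: mult.commute)
      then have "W dvd Z * gcd W (pderiv W)" by (simp only: gcd_mult_left dvd_normalize_iff)
      then have "W dvd Z" using True by (simp add: dvd_mult_unit_iff)
      then have "poly_series W dvd poly_series Z" by (rule poly_series_dvd)
      from dvd_add[OF Z this] have "poly_series W dvd z" by simp
      then show "p dvd z" using W(1) by (metis dvd_mult_left)
    qed
    then show ?thesis by blast
  next
    case False
    moreover have "gcd W (pderiv W) \<noteq> 0" using W0 by simp
    ultimately obtain l where l: "normalization_semidom_class.prime l" "l dvd gcd W (pderiv W)"
      using prime_divisor_exists by blast
    then have lW: "l dvd W" "l dvd pderiv W" and pr: "prime_elem l" by auto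
    obtain c where c: "c \<noteq> 0" "poly_series l $ 0 = fps_const c * fps_X ^ degree l" "lead_coeff l dvd 1"
      using Weierstrass_factor[OF W p lW(1)] .
    note iff = poly_series_dvd_iff[OF c(2,1,3)]
    note prime = prime_poly_series[OF c(2,1,3) pr]
    obtain v0 where v0: "W = l ^ multiplicity l W * v0" "\<not> l dvd v0"
      using multiplicity_decompose'[of W l] W0 pr by (auto simp: prime_elem_def)
    have nl: "\<not> l dvd pderiv l" by (rule pderiv_not_dvd[OF prime(2)])
    have "multiplicity l W \<noteq> 0" using lW(1) v0 by (metis mult_1 power_0)
    \<comment> \<open>A simple factor \<open>l\<close> of \<open>W\<close> that divides
      \<open>pderiv W\<close> would divide \<open>pderiv l\<close>, which degrees forbid in
      characteristic 0.\<close>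
    moreover have "multiplicity l W \<noteq> 1"
    proof
      assume "multiplicity l W = 1"
      with v0 have "W = l * v0" by simp
      then have "pderiv W = l * pderiv v0 + v0 * pderiv l" by (simp add: pderiv_mult)
      with lW(2) have "l dvd v0 * pderiv l" by (simp add: dvd_add_right_iff)
      then show False using nl v0(2) pr by (simp add: prime_elem_dvd_mult_iff)
    qed
    ultimately obtain j where j: "multiplicity l W = Suc (Suc j)" by (metis One_nat_def not0_implies_Suc)
    \<comment> \<open>The unit between \<open>p\<close> and \<open>W\<close> is absorbed in
      \<open>v\<close>; \<open>w\<close> is the derivative of \<open>p\<close> divided by
      \<open>a^(j+1)\<close>.\<close>
    define a L v w where "a = poly_series l" and "L = a ^ j" and "v = poly_series v0 * U1"
      and "w = of_nat (j + 2) * dx a * v + a * dx v"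
    have pa: "p = a ^ Suc (Suc j) * v"
      unfolding pW v_def a_def by (subst v0(1)) (simp add: j poly_series_simps mult.assoc)
    have a: "prime_elem a" using prime by (simp add: a_def)
    have av: "\<not> a dvd v"
    proof
      assume "a dvd v"
      then have "a dvd v * U" by simp
      then have "a dvd poly_series v0" using U1 by (simp add: v_def mult.assoc mult.commute[of U1])
      then show False using iff v0(2) by (simp add: a_def)
    qed
    have ada: "\<not> a dvd dx a" using nl iff by (simp add: a_def dx_poly_series)
    have unit: "of_nat (j + 2) * fps_const (fps_const (1 / of_nat (j + 2))) = (1 :: 'k fps fps)"
    proof -
      have "(of_nat (j + 2) :: 'k) \<noteq> 0" by (subst of_nat_eq_0_iff) simp
      then show ?thesis by (simp add: fps_of_nat[symmetric] del: of_nat_add fps_of_nat)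
    qed
    have aw: "\<not> a dvd w"
    proof
      assume "a dvd w"
      then have "a dvd of_nat (j + 2) * dx a * v" unfolding w_def by (simp add: dvd_add_left_iff)
      then have "a dvd fps_const (fps_const (1 / of_nat (j + 2))) * (of_nat (j + 2) * dx a * v)" by (rule dvd_mult)
      also have "\<dots> = (of_nat (j + 2) * fps_const (fps_const (1 / of_nat (j + 2)))) * (dx a * v)" by (simp only: mult_ac)
      finally have "a dvd dx a * v" unfolding unit by simp
      then show False using a av ada by (simp add: prime_elem_dvd_mult_iff)
    qed
    have dp: "dx p = a * L * w"
      unfolding pa dx_simps dx_power by (simp add: L_def w_def algebra_simps)
    have d2: "dx (dx p) = dx a * L * w + a * (dx L * w + L * dx w)"
      unfolding dp dx_simps by (simp add: algebra_simps)
    have "4 * q2 * v - w * w * L = 2 * dx (dx p) * v - w * w * L" by (simp add: q2[symmetric] mult.assoc)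
    \<comment> \<open>For \<open>j > 0\<close> both terms are multiples of \<open>a\<close>. For
      \<open>j = 0\<close>, modulo \<open>a\<close>, the second derivative is
      \<open>dx a * w\<close> and \<open>w\<close> is \<open>2 * dx a * v\<close>, so the terms
      \<open>2 * dx a * w * v\<close> and \<open>w * w\<close> cancel.\<close>
    also have "a dvd \<dots>"
    proof (cases j)
      case 0
      then have L: "L = 1" by (simp add: L_def)
      have "2 * dx (dx p) * v - w * w * L = a * (2 * (dx L * w + L * dx w) * v - w * dx v)"
        unfolding d2 by (simp add: L dx_simps) (simp add: w_def 0 algebra_simps)
      then show ?thesis by simp
    next
      case (Suc i)
      then have "a dvd L" by (simp add: L_def)
      then show ?thesis unfolding d2 by simp
    qed
    finally have "a dvd 4 * q2 * v - w * w * L" .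
    moreover have "p = a * a * L * v" by (simp add: pa L_def mult_ac)
    ultimately show ?thesis using a av aw dp by blast
  qed
qed

section \<open>Operators on the family\<close>

text \<open>\<open>A\<close> and \<open>B\<close> act on representatives, so compatibility with
  reduction modulo \<open>F\<close> is a hypothesis of its own, and linearity is asked in the forms
  that the two halves of the proof meet.\<close>

lemma basis_mod_transport:
  assumes D: "basis_mod F M D"
    and A0: "\<And>v. (\<forall>m<6. F dvd v m) \<Longrightarrow> \<forall>m<6. F dvd A v m"
    and B0: "\<And>v. (\<forall>m<6. F dvd v m) \<Longrightarrow> \<forall>m<6. F dvd B v m"
    and A1: "\<And>v c D m. m < 6 \<Longrightarrow> A (\<lambda>m. v m - (\<Sum>i<3::nat. c i * D i m)) m = A v m - (\<Sum>i<3. c i * A (D i) m)"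
    and B1: "\<And>c D m. m < 6 \<Longrightarrow> B (\<lambda>m. \<Sum>i<3::nat. c i * D i m) m = (\<Sum>i<3. c i * B (D i) m)"
    and AB: "\<And>v m. m < 6 \<Longrightarrow> A (B v) m = v m" and BA: "\<And>v m. m < 6 \<Longrightarrow> B (A v) m = v m"
    and M: "\<And>v. M v \<Longrightarrow> M' (A v)" and M': "\<And>v. M' v \<Longrightarrow> M (B v)"
  shows "basis_mod F M' (\<lambda>i. A (D i))"
  unfolding basis_mod_def
proof (intro conjI allI impI)
  show "M' (A (D i))" if "i < 3" for i using D that M by (simp add: basis_mod_def)
next
  fix v assume "M' v"
  then have "M (B v)" by (rule M')
  then obtain c where c: "\<forall>m<6. F dvd B v m - (\<Sum>i<3. c i * D i m)"
    using D unfolding basis_mod_def by blast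
  have "F dvd v m - (\<Sum>i<3. c i * A (D i) m)" if m: "m < 6" for m
  proof -
    have "F dvd A (\<lambda>m. B v m - (\<Sum>i<3. c i * D i m)) m" using A0[OF c] m by blast
    then show ?thesis unfolding A1[OF m] AB[OF m] .
  qed
  then show "\<exists>c. \<forall>m<6. F dvd v m - (\<Sum>i<3. c i * A (D i) m)" by blast
next
  fix c :: "nat \<Rightarrow> 'a" and i :: nat assume c: "\<forall>m<6. F dvd (\<Sum>i<3. c i * A (D i) m)" and i: "i < 3"
  have *: "F dvd (\<Sum>i<3. c i * D i m)" if m: "m < 6" for m
  proof -
    have "F dvd B (\<lambda>m. \<Sum>i<3. c i * A (D i) m) m" using B0[OF c] m by blast
    then show ?thesis unfolding B1[OF m] BA[OF m] .
  qed
  then show "F dvd c i" using basis_mod_independent[OF D, of c] i by blast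
qed

section \<open>The relations between the six jet coordinates\<close>

abbreviation Dx :: "'k::comm_ring_1 fps fps fps \<Rightarrow> 'k fps fps fps" where
  "Dx \<equiv> fps_map (fps_map fps_deriv)"

abbreviation Dy :: "'k::comm_ring_1 fps fps fps \<Rightarrow> 'k fps fps fps" where
  "Dy \<equiv> fps_map fps_deriv"

lemmas Dx_derivation = is_derivation_fps_map[OF dx_derivation]
lemmas Dy_derivation = dx_derivation[where 'a = "'k::comm_ring_1 fps"]
lemmas Dx_simps = is_derivationD[OF Dx_derivation]
lemmas Dy_simps = is_derivationD[OF Dy_derivation]

lemma D_coords:
  "Dx (\<iota> r) = \<iota> (dx r)" "Dy (\<iota> r) = 0" "Dx y_coord = 0" "Dy y_coord = 1"
  by (auto simp: fps_eq_iff fps_one_nth)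

abbreviation half :: "'k::field_char_0 fps fps" where
  "half \<equiv> fps_const (fps_const (1 / 2))"

lemma two_half: "2 * \<iota> half = (1 :: 'k::field_char_0 fps fps fps)"
proof -
  have "2 * half = (1 :: 'k fps fps)" by (simp add: numeral_fps_const)
  from arg_cong[OF this, of \<iota>] show ?thesis
    by (simp only: is_ring_homD[OF \<iota>_hom] is_ring_hom_numeral[OF \<iota>_hom])
qed

text \<open>The analogue of \<open>ker\<close> with the Taylor coefficients of an arbitrary equation
  \<open>G\<close>. The modulus \<open>F\<close> and the equation \<open>G\<close> are kept apart so
  that \<open>G\<close> can be a unit multiple of \<open>F\<close>.\<close>

definition jet_ker :: "'k::field_char_0 fps fps fps \<Rightarrow> 'k fps fps fps \<Rightarrow> (nat \<Rightarrow> 'k fps fps fps) \<Rightarrow> bool" where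
  "jet_ker F G D \<longleftrightarrow>
     F dvd Dx G * D 1 + Dy G * D 2 + \<iota> half * Dx (Dx G) * D 3 + Dx (Dy G) * D 4 + \<iota> half * Dy (Dy G) * D 5 \<and>
     F dvd Dx G * D 3 + Dy G * D 4 \<and> F dvd Dx G * D 4 + Dy G * D 5"

lemma dvd_unit_mult_iff:
  fixes F V :: "'a::comm_ring_1"
  assumes "V dvd 1"
  shows "F dvd V * z \<longleftrightarrow> F dvd z"
proof
  obtain U where U: "1 = V * U" using assms ..
  assume "F dvd V * z"
  then have "F dvd U * (V * z)" by (rule dvd_mult)
  also have "U * (V * z) = z" using U by (metis mult.assoc mult.commute mult_1)
  finally show "F dvd z" .
qed simp

lemma dvd_congr: "F dvd a - b \<Longrightarrow> F dvd a \<longleftrightarrow> F dvd (b :: 'a::comm_ring_1)"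
  by (metis diff_add_cancel dvd_add dvd_add_right_iff)

text \<open>By the Leibniz rule the conditions for \<open>F * V\<close> are, modulo
  \<open>F\<close>, those for \<open>F\<close> multiplied by \<open>V\<close>, the first one up to
  multiples of the other two.\<close>

lemma jet_ker_unit:
  assumes V: "V dvd 1"
  shows "jet_ker F (F * V) D \<longleftrightarrow> jet_ker F F D"
proof -
  let ?K1 = "Dx F * D 1 + Dy F * D 2 + \<iota> half * Dx (Dx F) * D 3 + Dx (Dy F) * D 4 + \<iota> half * Dy (Dy F) * D 5"
  let ?K2 = "Dx F * D 3 + Dy F * D 4" and ?K3 = "Dx F * D 4 + Dy F * D 5"
  let ?G = "F * V"
  have 2: "(F dvd Dx ?G * D 3 + Dy ?G * D 4) = (F dvd V * ?K2)"
    by (rule dvd_congr, rule dvdI[of _ _ "Dx V * D 3 + Dy V * D 4"]) (simp add: Dx_simps Dy_simps algebra_simps)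
  have 3: "(F dvd Dx ?G * D 4 + Dy ?G * D 5) = (F dvd V * ?K3)"
    by (rule dvd_congr, rule dvdI[of _ _ "Dx V * D 4 + Dy V * D 5"]) (simp add: Dx_simps Dy_simps algebra_simps)
  have 1: "(F dvd Dx ?G * D 1 + Dy ?G * D 2 + \<iota> half * Dx (Dx ?G) * D 3 + Dx (Dy ?G) * D 4 + \<iota> half * Dy (Dy ?G) * D 5) =
    (F dvd V * ?K1 + Dx V * ?K2 + Dy V * ?K3)"
  proof (rule dvd_congr, rule dvdI)
    \<comment> \<open>The factor \<open>2 * \<iota> half - 1\<close>, which is zero, collects the
      mixed terms in the second derivatives of the product.\<close>
    have "Dx ?G * D 1 + Dy ?G * D 2 + \<iota> half * Dx (Dx ?G) * D 3 + Dx (Dy ?G) * D 4 + \<iota> half * Dy (Dy ?G) * D 5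
      - (V * ?K1 + Dx V * ?K2 + Dy V * ?K3) =
      F * (Dx V * D 1 + Dy V * D 2 + \<iota> half * Dx (Dx V) * D 3 + Dx (Dy V) * D 4 + \<iota> half * Dy (Dy V) * D 5)
      + (2 * \<iota> half - 1) * (Dx F * Dx V * D 3 + Dy F * Dy V * D 5)"
      by (simp add: Dx_simps Dy_simps algebra_simps)
    then show "Dx ?G * D 1 + Dy ?G * D 2 + \<iota> half * Dx (Dx ?G) * D 3 + Dx (Dy ?G) * D 4 + \<iota> half * Dy (Dy ?G) * D 5
      - (V * ?K1 + Dx V * ?K2 + Dy V * ?K3) =
      F * (Dx V * D 1 + Dy V * D 2 + \<iota> half * Dx (Dx V) * D 3 + Dx (Dy V) * D 4 + \<iota> half * Dy (Dy V) * D 5)"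
      unfolding two_half by simp
  qed
  have "(F dvd V * ?K1 + Dx V * ?K2 + Dy V * ?K3) = (F dvd ?K1)" if "F dvd ?K2" "F dvd ?K3"
    using that dvd_unit_mult_iff[OF V, of F ?K1] by (simp add: dvd_add_left_iff)
  then show ?thesis unfolding jet_ker_def 1 2 3 dvd_unit_mult_iff[OF V] by blast
qed

text \<open>The coordinate change \<open>y \<mapsto> y - \<beta>(x, t)\<close> on second order operators and its inverse.\<close>

definition shear :: "'k::field_char_0 fps fps \<Rightarrow> (nat \<Rightarrow> 'k fps fps fps) \<Rightarrow> nat \<Rightarrow> 'k fps fps fps" where
  "shear \<beta> D = vec6 (D 0) (D 1) (D 2 - \<iota> (dx \<beta>) * D 1 - \<iota> half * \<iota> (dx (dx \<beta>)) * D 3) (D 3)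
     (D 4 - \<iota> (dx \<beta>) * D 3) (D 5 - 2 * \<iota> (dx \<beta>) * D 4 + \<iota> (dx \<beta>) * \<iota> (dx \<beta>) * D 3)"

definition unshear :: "'k::field_char_0 fps fps \<Rightarrow> (nat \<Rightarrow> 'k fps fps fps) \<Rightarrow> nat \<Rightarrow> 'k fps fps fps" where
  "unshear \<beta> D = vec6 (D 0) (D 1) (D 2 + \<iota> (dx \<beta>) * D 1 + \<iota> half * \<iota> (dx (dx \<beta>)) * D 3) (D 3)
     (D 4 + \<iota> (dx \<beta>) * D 3) (D 5 + 2 * \<iota> (dx \<beta>) * D 4 + \<iota> (dx \<beta>) * \<iota> (dx \<beta>) * D 3)"

lemma less_6_cases: "m < (6::nat) \<Longrightarrow> m = 0 \<or> m = 1 \<or> m = 2 \<or> m = 3 \<or> m = 4 \<or> m = 5"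
  by auto

lemma shear_linear:
  "(\<forall>m<6. F dvd v m) \<Longrightarrow> \<forall>m<6. F dvd shear \<beta> v m"
  "m < 6 \<Longrightarrow> shear \<beta> (\<lambda>m. v m - (\<Sum>i<3::nat. c i * D i m)) m = shear \<beta> v m - (\<Sum>i<3::nat. c i * shear \<beta> (D i) m)"
  "m < 6 \<Longrightarrow> shear \<beta> (\<lambda>m. \<Sum>i<3::nat. c i * D i m) m = (\<Sum>i<3::nat. c i * shear \<beta> (D i) m)"
  "(\<forall>m<6. F dvd v m) \<Longrightarrow> \<forall>m<6. F dvd unshear \<beta> v m"
  "m < 6 \<Longrightarrow> unshear \<beta> (\<lambda>m. v m - (\<Sum>i<3::nat. c i * D i m)) m = unshear \<beta> v m - (\<Sum>i<3::nat. c i * unshear \<beta> (D i) m)"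
  "m < 6 \<Longrightarrow> unshear \<beta> (\<lambda>m. \<Sum>i<3::nat. c i * D i m) m = (\<Sum>i<3::nat. c i * unshear \<beta> (D i) m)"
       apply (simp_all add: All_less_6)
       apply (simp_all add: shear_def unshear_def)
     apply (drule less_6_cases, elim disjE; simp add: sum_less_3 algebra_simps)+
  done

lemma shear_unshear: "m < 6 \<Longrightarrow> shear \<beta> (unshear \<beta> v) m = v m" "m < 6 \<Longrightarrow> unshear \<beta> (shear \<beta> v) m = v m"
  by (drule less_6_cases, elim disjE; simp add: shear_def unshear_def algebra_simps)+

context
  fixes F V :: "'k::field_char_0 fps fps fps" and \<beta> p :: "'k fps fps" and s :: nat
  assumes F0: "F $ 0 = cusp s" and s: "s > 0" and FV: "F * V = (y_coord - \<iota> \<beta>)\<^sup>2 - \<iota> p"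
    and V0: "V $ 0 = 1" and \<beta>0: "\<beta> $ 0 = 0" and p0: "p $ 0 = fps_X ^ s"
begin

interpretation Q: quadratic_cover \<iota> F "y_coord - \<iota> \<beta>" p "dx p" "half * dx (dx p)" half
  by (rule quadratic_cover_family[OF F0 s FV p0])

text \<open>\<open>F\<close> can be replaced by its unit multiple \<open>\<eta>^2 - p\<close>. By
  the chain rule the conditions become those of the double cover, except that the third one acquires
  a multiple of the second, which does not affect the conjunction.\<close>

lemma jet_ker_shear: "jet_ker F F D \<longleftrightarrow> Q.ker (shear \<beta> D)"
proof -
  define \<eta> where "\<eta> = y_coord - \<iota> \<beta>"
  define b1 b2 where "b1 = \<iota> (dx \<beta>)" and "b2 = \<iota> (dx (dx \<beta>))"
  define P1 P2 where "P1 = \<iota> (dx p)" and "P2 = \<iota> (dx (dx p))"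
  have \<eta>: "Dx \<eta> = - b1" "Dy \<eta> = 1" by (simp_all add: \<eta>_def Dx_simps Dy_simps D_coords b1_def)
  have b: "Dx b1 = b2" "Dy b1 = 0" "Dx P1 = P2" "Dy P1 = 0" by (simp_all add: b1_def b2_def P1_def P2_def D_coords)
  have two: "Dx 2 = 0" "Dy 2 = 0"
    using is_derivationD(1)[OF Dx_derivation, of 1 1] is_derivationD(1)[OF Dy_derivation, of 1 1]
    by (simp_all add: Dx_simps Dy_simps)
  have FV': "F * V = \<eta> * \<eta> - \<iota> p" by (simp add: FV \<eta>_def power2_eq_square)
  have G1: "Dx (F * V) = - (2 * \<eta> * b1) - P1" "Dy (F * V) = 2 * \<eta>"
    unfolding FV' by (simp_all add: Dx_simps Dy_simps \<eta> D_coords P1_def algebra_simps)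
  have G2: "Dx (- (2 * \<eta> * b1) - P1) = 2 * b1 * b1 - 2 * \<eta> * b2 - P2" "Dx (2 * \<eta>) = - 2 * b1"
    "Dy (2 * \<eta>) = 2"
    by (simp_all add: Dx_simps Dy_simps \<eta> b two algebra_simps)
  have hp: "\<iota> (half * dx (dx p)) = \<iota> half * P2" by (simp only: is_ring_homD[OF \<iota>_hom] P2_def)
  have sh: "shear \<beta> D 1 = D 1" "shear \<beta> D 2 = D 2 - b1 * D 1 - \<iota> half * b2 * D 3" "shear \<beta> D 3 = D 3"
    "shear \<beta> D 4 = D 4 - b1 * D 3" "shear \<beta> D 5 = D 5 - 2 * b1 * D 4 + b1 * b1 * D 3"
    by (simp_all add: shear_def b1_def b2_def)
  define h where "h = \<iota> (half :: 'k fps fps)"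
  have h: "2 * h = 1" unfolding h_def by (rule two_half)
  have K1: "(- (2 * \<eta> * b1) - P1) * D 1 + 2 * \<eta> * D 2 + h * (2 * b1 * b1 - 2 * \<eta> * b2 - P2) * D 3 +
      (- 2 * b1) * D 4 + h * 2 * D 5 =
    - P1 * D 1 + 2 * \<eta> * (D 2 - b1 * D 1 - h * b2 * D 3) - h * P2 * D 3 + (D 5 - 2 * b1 * D 4 + b1 * b1 * D 3)"
    by (rule eq_by_lincomb(1)[where ca = "b1 * b1 * D 3 + D 5", OF h]) (simp add: algebra_simps)
  have K2: "(- (2 * \<eta> * b1) - P1) * D 3 + 2 * \<eta> * D 4 = - P1 * D 3 + 2 * \<eta> * (D 4 - b1 * D 3)"
    by (simp add: algebra_simps)
  have K3: "(- (2 * \<eta> * b1) - P1) * D 4 + 2 * \<eta> * D 5 =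
     (- P1 * (D 4 - b1 * D 3) + 2 * \<eta> * (D 5 - 2 * b1 * D 4 + b1 * b1 * D 3)) + b1 * (- P1 * D 3 + 2 * \<eta> * (D 4 - b1 * D 3))"
    by (simp add: algebra_simps)
  have "jet_ker F F D \<longleftrightarrow> jet_ker F (F * V) D"
    by (rule jet_ker_unit[symmetric]) (rule fps_dvd_1[OF V0])
  also have "\<dots> \<longleftrightarrow> F dvd - P1 * D 1 + 2 * \<eta> * (D 2 - b1 * D 1 - h * b2 * D 3) - h * P2 * D 3 + (D 5 - 2 * b1 * D 4 + b1 * b1 * D 3) \<and>
      F dvd - P1 * D 3 + 2 * \<eta> * (D 4 - b1 * D 3) \<and>
      F dvd (- P1 * (D 4 - b1 * D 3) + 2 * \<eta> * (D 5 - 2 * b1 * D 4 + b1 * b1 * D 3)) + b1 * (- P1 * D 3 + 2 * \<eta> * (D 4 - b1 * D 3))"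
    unfolding jet_ker_def G1 G2 h_def[symmetric] K1 K2 K3 ..
  also have "\<dots> \<longleftrightarrow> Q.ker (shear \<beta> D)"
    unfolding Q.ker_def unfolding sh hp \<eta>_def[symmetric] P1_def[symmetric] h_def[symmetric]
    by (auto simp: dvd_add_left_iff)
  finally show ?thesis .
qed

text \<open>Comparison of the coefficients of \<open>t\<close> in the Weierstrass equation:
  \<open>\<beta>\<close> starts with \<open>t\<close>, so it contributes only a multiple of
  \<open>y\<close>, and the term with \<open>x^s\<close> vanishes at \<open>x = 0\<close>. This
  carries a condition on the deformation over to \<open>p\<close>.\<close>

lemma p_origin: "p $ 1 $ 0 = - (F $ 1 $ 0 $ 0)"
proof -
  have "((y_coord - \<iota> \<beta>) * (y_coord - \<iota> \<beta>)) $ 1 = 2 * (fps_X * - fps_const (\<beta> $ 1))"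
    by (simp add: fps_mult_nth_1 \<beta>0 algebra_simps)
  then have "((y_coord - \<iota> \<beta>)\<^sup>2 - \<iota> p) $ 1 $ 0 = - (p $ 1)" by (simp add: power2_eq_square)
  moreover have "(F * V) $ 1 $ 0 = - (fps_X ^ s) * V $ 1 $ 0 + F $ 1 $ 0"
    by (simp add: fps_mult_nth_1 F0 V0 cusp_nth)
  ultimately have "- (fps_X ^ s) * V $ 1 $ 0 + F $ 1 $ 0 = - (p $ 1)" using FV by simp
  from arg_cong[OF this, of "\<lambda>z. z $ 0"] show ?thesis using s by (simp add: fps_X_power_nth)
qed

definition frame :: "nat \<Rightarrow> nat \<Rightarrow> 'k fps fps fps" where
  "frame k = unshear \<beta> (Q.E k)"

text \<open>At \<open>t = 0\<close> the shear disappears because \<open>\<beta>\<close> vanishes,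
  and \<open>p\<close> becomes \<open>x^s\<close>; the reduction is the same for all
  deformations.\<close>

lemma frame_closed_fiber:
  defines "a1 \<equiv> fps_const (fps_deriv (fps_X ^ s))" and "a2 \<equiv> fps_const (fps_deriv (fps_deriv (fps_X ^ s)))"
  assumes "m < 6"
  shows "frame 0 m $ 0 = vec6 1 0 0 0 0 0 m"
    and "frame 1 m $ 0 = vec6 0 (2 * fps_X) a1 0 0 0 m"
    and "frame 2 m $ 0 = vec6 0 a1 (a2 * fps_X) (4 * (fps_X * fps_X)) (2 * a1 * fps_X) (a1 * a1) m"
proof -
  have c: "(2 :: 'k fps fps fps) $ 0 = 2" "(4 :: 'k fps fps fps) $ 0 = 4" by (simp_all add: numeral_fps_const)
  have h: "2 * (\<iota> half * z) = (z :: 'k fps fps fps)" for z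
    by (simp only: mult.assoc[symmetric] two_half mult_1_left)
  have hp: "2 * \<iota> (half * dx (dx p)) = \<iota> (dx (dx p))"
    by (simp only: is_ring_homD[OF \<iota>_hom] h)
  have E2: "Q.E 2 = vec6 0 (\<iota> (dx p)) (\<iota> (dx (dx p)) * (y_coord - \<iota> \<beta>))
     (4 * ((y_coord - \<iota> \<beta>) * (y_coord - \<iota> \<beta>))) (2 * \<iota> (dx p) * (y_coord - \<iota> \<beta>)) (\<iota> (dx p) * \<iota> (dx p))"
    by (simp only: Q.E_simps hp)
  note simps = frame_def unshear_def \<beta>0 p0 a1_def a2_def c fps_mult_nth_0
  show "frame 0 m $ 0 = vec6 1 0 0 0 0 0 m"
    using less_6_cases[OF assms(3)] by (elim disjE; simp add: simps)
  show "frame 1 m $ 0 = vec6 0 (2 * fps_X) a1 0 0 0 m"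
    using less_6_cases[OF assms(3)] by (elim disjE; simp add: simps)
  show "frame 2 m $ 0 = vec6 0 a1 (a2 * fps_X) (4 * (fps_X * fps_X)) (2 * a1 * fps_X) (a1 * a1) m"
    using less_6_cases[OF assms(3)] by (elim disjE; simp add: simps E2 del: Q.E_simps)
qed

lemma two_half_q: "2 * (half * dx (dx p)) = dx (dx p)"
  by (simp add: mult.assoc[symmetric] numeral_fps_const)

lemma coprime_imp_basis:
  assumes "\<And>z. p dvd dx p * z \<Longrightarrow> p dvd z"
  shows "basis_mod F (jet_ker F F) frame"
proof -
  have frame: "frame = (\<lambda>k. unshear \<beta> (Q.E k))" by (simp add: fun_eq_iff frame_def)
  show ?thesis unfolding frame
  proof (rule basis_mod_transport[where A = "unshear \<beta>" and B = "shear \<beta>" and M = Q.ker and D = Q.E])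
  show "basis_mod F Q.ker Q.E" by (rule Q.basis_mod_E) (rule assms)
  show "Q.ker v \<Longrightarrow> jet_ker F F (unshear \<beta> v)" for v
    unfolding jet_ker_shear by (simp add: Q.ker_def shear_unshear)
  show "jet_ker F F v \<Longrightarrow> Q.ker (shear \<beta> v)" for v by (simp only: jet_ker_shear)
  qed (fact shear_linear shear_unshear)+
qed

lemma basis_imp_coprime:
  assumes D: "basis_mod F (jet_ker F F) D" and z: "p dvd dx p * z"
  shows "p dvd z"
proof -
  have "basis_mod F Q.ker (\<lambda>i. shear \<beta> (D i))"
  proof (rule basis_mod_transport[where B = "unshear \<beta>", OF D])
    show "Q.ker v \<Longrightarrow> jet_ker F F (unshear \<beta> v)" for v
      unfolding jet_ker_shear by (simp add: Q.ker_def shear_unshear)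
    show "jet_ker F F v \<Longrightarrow> Q.ker (shear \<beta> v)" for v by (simp only: jet_ker_shear)
  qed (fact shear_linear shear_unshear)+
  then show ?thesis using coprime_or_square[OF p0 two_half_q] Q.ker_not_free z by blast
qed

text \<open>If any basis exists, the frame is one. This is what extends the lower bound to
  deformations that are not general.\<close>

lemma basis_imp_basis: "basis_mod F (jet_ker F F) D \<Longrightarrow> basis_mod F (jet_ker F F) frame"
  by (rule coprime_imp_basis) (rule basis_imp_coprime)

text \<open>The square of a nonunit has no linear term at the origin, whereas \<open>p\<close>
  contains \<open>t\<close> there with a nonzero coefficient; so no prime occurs twice in
  \<open>p\<close>.\<close>

lemma general_basis:
  assumes "F $ 1 $ 0 $ 0 \<noteq> 0"
  shows "basis_mod F (jet_ker F F) frame"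
proof -
  have False if l: "prime_elem l" and p: "p = l * l * L * v" for l L v
  proof -
    have "l $ 0 $ 0 = 0"
    proof (rule ccontr)
      assume "l $ 0 $ 0 \<noteq> 0"
      then have "l dvd 1" by (intro fps_is_unit_ring) (simp add: dvd_field_iff)
      then show False using l by (simp add: prime_elem_def)
    qed
    then have "p $ 1 $ 0 = 0" unfolding p by (simp add: fps_mult_nth_1)
    then show False using p_origin assms by simp
  qed
  then show ?thesis using coprime_or_square[OF p0 two_half_q] coprime_imp_basis by blast
qed

end

section \<open>Bases and quotient rings\<close>

text \<open>Independence of an indexed family instead of a set, so that coefficients and
  representatives can be chosen index by index. Together with \<open>family_gen\<close> it matches
  \<open>free_basis\<close> over a nontrivial ring (\<open>free_basis_iff\<close>).\<close>

definition family_indep :: "('c, 'r) ring_scheme \<Rightarrow> ('c, 'v, 'z) module_scheme \<Rightarrow> nat \<Rightarrow> (nat \<Rightarrow> 'v) \<Rightarrow> bool" where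
  "family_indep R M n e \<longleftrightarrow> (\<forall>c\<in>{..<n} \<rightarrow> carrier R.
     finsum M (\<lambda>i. c i \<odot>\<^bsub>M\<^esub> e i) {..<n} = \<zero>\<^bsub>M\<^esub> \<longrightarrow> (\<forall>i<n. c i = \<zero>\<^bsub>R\<^esub>))"

definition family_gen :: "('c, 'r) ring_scheme \<Rightarrow> ('c, 'v, 'z) module_scheme \<Rightarrow> nat \<Rightarrow> (nat \<Rightarrow> 'v) \<Rightarrow> bool" where
  "family_gen R M n e \<longleftrightarrow> (\<forall>v\<in>carrier M. \<exists>c\<in>{..<n} \<rightarrow> carrier R.
     v = finsum M (\<lambda>i. c i \<odot>\<^bsub>M\<^esub> e i) {..<n})"

lemma family_indepD:
  "family_indep R M n e \<Longrightarrow> c \<in> {..<n} \<rightarrow> carrier R \<Longrightarrow>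
    finsum M (\<lambda>i. c i \<odot>\<^bsub>M\<^esub> e i) {..<n} = \<zero>\<^bsub>M\<^esub> \<Longrightarrow> i < n \<Longrightarrow> c i = \<zero>\<^bsub>R\<^esub>"
  unfolding family_indep_def by simp

lemma family_genE:
  assumes "family_gen R M n e" "v \<in> carrier M"
  obtains c where "c \<in> {..<n} \<rightarrow> carrier R" "v = finsum M (\<lambda>i. c i \<odot>\<^bsub>M\<^esub> e i) {..<n}"
  using assms unfolding family_gen_def by (elim ballE bexE) auto

context module
begin

lemma lincomb_image:
  assumes "e ` {..<n} \<subseteq> carrier M" "inj_on e {..<n::nat}" "a \<in> e ` {..<n} \<rightarrow> carrier R"
  shows "lincomb a (e ` {..<n}) = finsum M (\<lambda>i. a (e i) \<odot>\<^bsub>M\<^esub> e i) {..<n}"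
  unfolding lincomb_def by (rule finsum_reindex) (use assms in auto)

lemma family_indep_inj:
  assumes e: "e ` {..<n} \<subseteq> carrier M" and ind: "family_indep R M n e" and nz: "\<one> \<noteq> \<zero>"
  shows "inj_on e {..<n}"
proof (rule inj_onI, rule ccontr)
  fix i j assume ij: "i \<in> {..<n}" "j \<in> {..<n}" "e i = e j" "i \<noteq> j"
  define c where "c = (\<lambda>k. if k = i then \<one> else if k = j then \<ominus> \<one> else \<zero>)"
  have c: "c \<in> {..<n} \<rightarrow> carrier R" by (auto simp: c_def)
  have ec: "e k \<in> carrier M" if "k < n" for k using e that by auto
  have "finsum M (\<lambda>k. c k \<odot>\<^bsub>M\<^esub> e k) {..<n} = finsum M (\<lambda>k. c k \<odot>\<^bsub>M\<^esub> e k) (insert i (insert j ({..<n} - {i, j})))"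
    using ij by (intro arg_cong[of _ _ "finsum M _"]) auto
  also have "\<dots> = c i \<odot>\<^bsub>M\<^esub> e i \<oplus>\<^bsub>M\<^esub> (c j \<odot>\<^bsub>M\<^esub> e j \<oplus>\<^bsub>M\<^esub> finsum M (\<lambda>k. c k \<odot>\<^bsub>M\<^esub> e k) ({..<n} - {i, j}))"
    using ij ec by (subst finsum_insert; (subst finsum_insert)?) (auto simp: c_def)
  also have "finsum M (\<lambda>k. c k \<odot>\<^bsub>M\<^esub> e k) ({..<n} - {i, j}) = finsum M (\<lambda>k. \<zero>\<^bsub>M\<^esub>) ({..<n} - {i, j})"
    using ec by (intro finsum_cong') (auto simp: c_def)
  also have "\<dots> = \<zero>\<^bsub>M\<^esub>" by simp
  also have "c i \<odot>\<^bsub>M\<^esub> e i \<oplus>\<^bsub>M\<^esub> (c j \<odot>\<^bsub>M\<^esub> e j \<oplus>\<^bsub>M\<^esub> \<zero>\<^bsub>M\<^esub>) = \<zero>\<^bsub>M\<^esub>"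
  proof -
    have "c i \<odot>\<^bsub>M\<^esub> e i = e j" using ij(3) ec[of j] ij(2) by (simp add: c_def)
    moreover have "c j \<odot>\<^bsub>M\<^esub> e j = \<ominus>\<^bsub>M\<^esub> e j" using ij(4) ec[of j] ij(2) by (simp add: c_def smult_l_minus)
    ultimately show ?thesis using ec[of j] ij(2) by (simp add: M.r_neg)
  qed
  finally have "finsum M (\<lambda>k. c k \<odot>\<^bsub>M\<^esub> e k) {..<n} = \<zero>\<^bsub>M\<^esub>" .
  from family_indepD[OF ind c this, of i] have "c i = \<zero>" using ij(1) by simp
  then show False using nz by (simp add: c_def)
qed

lemma family_indep_iff:
  assumes e: "e ` {..<n} \<subseteq> carrier M" and inj: "inj_on e {..<n}"
  shows "family_indep R M n e \<longleftrightarrow> lin_indpt (e ` {..<n})"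
proof
  assume ind: "family_indep R M n e"
  show "lin_indpt (e ` {..<n})"
  proof (rule finite_lin_indpt2)
    fix a assume a: "a \<in> e ` {..<n} \<rightarrow> carrier R" and 0: "lincomb a (e ` {..<n}) = \<zero>\<^bsub>M\<^esub>"
    have "(\<lambda>i. a (e i)) \<in> {..<n} \<rightarrow> carrier R" using a by auto
    from family_indepD[OF ind this 0[unfolded lincomb_image[OF e inj a]]]
    show "\<forall>v\<in>e ` {..<n}. a v = \<zero>" by auto
  qed (use e in auto)
next
  assume li: "lin_indpt (e ` {..<n})"
  show "family_indep R M n e"
    unfolding family_indep_def
  proof (intro ballI impI allI)
    fix c i assume c: "c \<in> {..<n} \<rightarrow> carrier R" and 0: "finsum M (\<lambda>i. c i \<odot>\<^bsub>M\<^esub> e i) {..<n} = \<zero>\<^bsub>M\<^esub>" and i: "i < n"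
    define a where "a = (\<lambda>v. c (the_inv_into {..<n} e v))"
    have ae: "a (e j) = c j" if "j < n" for j using that inj by (simp add: a_def the_inv_into_f_f)
    have a: "a \<in> e ` {..<n} \<rightarrow> carrier R" using c ae by auto
    have "lincomb a (e ` {..<n}) = \<zero>\<^bsub>M\<^esub>"
      unfolding lincomb_image[OF e inj a] 0[symmetric] using e c ae by (intro finsum_cong') auto
    then have "a (e i) = \<zero>" using lin_dep_crit[OF _ subset_refl a, of "e i"] li i by blast
    then show "c i = \<zero>" using ae i by simp
  qed
qed

lemma finsum_in_span:
  assumes e: "e ` {..<n::nat} \<subseteq> carrier M" and c: "c \<in> {..<n} \<rightarrow> carrier R"
  shows "finsum M (\<lambda>i. c i \<odot>\<^bsub>M\<^esub> e i) {..<n} \<in> span (e ` {..<n})"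
proof -
  interpret S: submodule R "span (e ` {..<n})" M by (rule span_is_submodule[OF e])
  have ce: "c j \<odot>\<^bsub>M\<^esub> e j \<in> carrier M" if "j < n" for j
    using e c that by (auto intro!: smult_closed)
  have "m \<le> n \<Longrightarrow> finsum M (\<lambda>i. c i \<odot>\<^bsub>M\<^esub> e i) {..<m} \<in> span (e ` {..<n})" for m
  proof (induction m)
    case (Suc m)
    have "e m \<in> span (e ` {..<n})" using in_own_span[OF e] Suc.prems by auto
    moreover have "finsum M (\<lambda>i. c i \<odot>\<^bsub>M\<^esub> e i) {..<Suc m} = c m \<odot>\<^bsub>M\<^esub> e m \<oplus>\<^bsub>M\<^esub> finsum M (\<lambda>i. c i \<odot>\<^bsub>M\<^esub> e i) {..<m}"
      unfolding lessThan_Suc using ce Suc.prems by (subst finsum_insert) auto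
    moreover have "c m \<in> carrier R" using c Suc.prems by auto
    ultimately show ?case using Suc.IH Suc.prems by simp
  qed simp
  then show ?thesis by blast
qed

lemma family_gen_imp_span:
  assumes e: "e ` {..<n} \<subseteq> carrier M" and gen: "family_gen R M n e"
  shows "span (e ` {..<n}) = carrier M"
proof
  show "span (e ` {..<n}) \<subseteq> carrier M" by (rule span_is_subset2[OF e])
  show "carrier M \<subseteq> span (e ` {..<n})"
  proof
    fix v assume "v \<in> carrier M"
    with gen obtain c where "c \<in> {..<n} \<rightarrow> carrier R" "v = finsum M (\<lambda>i. c i \<odot>\<^bsub>M\<^esub> e i) {..<n}"
      by (rule family_genE)
    then show "v \<in> span (e ` {..<n})" using finsum_in_span[OF e] by simp
  qed
qed

lemma span_imp_family_gen:
  assumes e: "e ` {..<n} \<subseteq> carrier M" and inj: "inj_on e {..<n}" and span: "span (e ` {..<n}) = carrier M"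
  shows "family_gen R M n e"
  unfolding family_gen_def
proof
  fix v assume "v \<in> carrier M"
  then have "v \<in> span (e ` {..<n})" using span by simp
  then obtain a where a: "a \<in> e ` {..<n} \<rightarrow> carrier R" "lincomb a (e ` {..<n}) = v"
    using finite_in_span[OF _ e] by auto
  then show "\<exists>c\<in>{..<n} \<rightarrow> carrier R. v = finsum M (\<lambda>i. c i \<odot>\<^bsub>M\<^esub> e i) {..<n}"
    using lincomb_image[OF e inj a(1)] by (intro bexI[of _ "\<lambda>i. a (e i)"]) auto
qed

lemma free_basis_iff:
  assumes nz: "\<one> \<noteq> \<zero>"
  shows "free_basis R M n e \<longleftrightarrow> e ` {..<n} \<subseteq> carrier M \<and> family_indep R M n e \<and> family_gen R M n e"
  unfolding free_basis_def
  using family_indep_inj[OF _ _ nz] family_indep_iff family_gen_imp_span span_imp_family_gen by metis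

end

context vectorspace
begin

lemma vdim_ge:
  assumes e: "e ` {..<n} \<subseteq> carrier V" and ind: "family_indep K V n e"
  shows "enat n \<le> vdim K V"
proof -
  have inj: "inj_on e {..<n}" by (rule family_indep_inj[OF e ind]) simp
  have "lin_indpt (e ` {..<n})" using family_indep_iff[OF e inj] ind by simp
  then have "fin_dim \<Longrightarrow> card (e ` {..<n}) \<le> dim" using li_le_dim(2) e by blast
  then show ?thesis by (simp add: vdim_def card_image[OF inj])
qed

lemma vdim_le:
  assumes e: "e ` {..<n} \<subseteq> carrier V" and gen: "family_gen K V n e"
  shows "vdim K V \<le> enat n"
proof -
  have s: "span (e ` {..<n}) = carrier V" by (rule family_gen_imp_span[OF e gen])
  then have "fin_dim" unfolding fin_dim_def using e by (intro exI[of _ "e ` {..<n}"]) auto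
  moreover have "dim \<le> card (e ` {..<n})" by (rule gen_ge_dim) (use e s in auto)
  moreover have "card (e ` {..<n}) \<le> n" using card_image_le[of "{..<n}" e] by simp
  ultimately show ?thesis by (simp add: vdim_def)
qed

lemma vdim_basis:
  assumes "vdim K V = enat n"
  obtains e where "e ` {..<n} \<subseteq> carrier V" "family_indep K V n e" "family_gen K V n e"
proof -
  have fd: fin_dim and d: "dim = n" using assms by (auto simp: vdim_def split: if_splits)
  obtain b where b: "finite b" "basis b" using finite_basis_exists[OF fd] by blast
  have "card b = n" using dim_basis[OF b] d by simp
  then obtain e where e: "bij_betw e {..<n} b" using ex_bij_betw_nat_finite[OF b(1)] by (auto simp: atLeast0LessThan)
  have eb: "e ` {..<n} = b" and inj: "inj_on e {..<n}" using e by (auto simp: bij_betw_def)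
  have "b \<subseteq> carrier V" "lin_indpt b" "span b = carrier V" using b by (auto simp: basis_def)
  then show thesis
    using that[of e] family_indep_iff[of e n] span_imp_family_gen[of e n] eb inj by auto
qed

end

section \<open>Ideals and quotient rings on representatives\<close>

lemma type_ring_simps [simp]:
  "carrier (type_ring :: 'a::comm_ring_1 ring) = UNIV" "\<zero>\<^bsub>type_ring\<^esub> = (0::'a)" "\<one>\<^bsub>type_ring\<^esub> = (1::'a)"
  "(a::'a) \<oplus>\<^bsub>type_ring\<^esub> b = a + b" "a \<otimes>\<^bsub>type_ring\<^esub> b = a * b"
  by (simp_all add: ring_of_type_algebra_def)

lemma cring_type_ring: "cring (type_ring :: 'a::comm_ring_1 ring)"
  by (rule cring_from_type_algebra)

lemma field_type_ring: "field (type_ring :: 'a::field ring)"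
  by (rule field_from_type_algebra)

text \<open>\<open>quot_map Q q Z\<close>: the ring \<open>Q\<close> is the quotient of the type \<open>'a\<close> by the ideal \<open>Z\<close>, through \<open>q\<close>.\<close>

definition quot_map :: "('q, 'z) ring_scheme \<Rightarrow> ('a::comm_ring_1 \<Rightarrow> 'q) \<Rightarrow> 'a set \<Rightarrow> bool" where
  "quot_map Q q Z \<longleftrightarrow> cring Q \<and> range q = carrier Q \<and> (\<forall>a b. q (a + b) = q a \<oplus>\<^bsub>Q\<^esub> q b) \<and>
     (\<forall>a b. q (a * b) = q a \<otimes>\<^bsub>Q\<^esub> q b) \<and> q 1 = \<one>\<^bsub>Q\<^esub> \<and> (\<forall>a. q a = \<zero>\<^bsub>Q\<^esub> \<longleftrightarrow> a \<in> Z)"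

lemma quot_mapD:
  assumes "quot_map Q q Z"
  shows "cring Q" "range q = carrier Q" "q (a + b) = q a \<oplus>\<^bsub>Q\<^esub> q b" "q (a * b) = q a \<otimes>\<^bsub>Q\<^esub> q b"
    "q 1 = \<one>\<^bsub>Q\<^esub>" "q a = \<zero>\<^bsub>Q\<^esub> \<longleftrightarrow> a \<in> Z" "q a \<in> carrier Q" "q 0 = \<zero>\<^bsub>Q\<^esub>" "q (- a) = \<ominus>\<^bsub>Q\<^esub> q a"
    "q a = q b \<longleftrightarrow> a - b \<in> Z" "q (a - b) = q a \<ominus>\<^bsub>Q\<^esub> q b"
proof -
  interpret cring Q using assms by (simp add: quot_map_def)
  show "cring Q" by (rule is_cring)
  show 2: "range q = carrier Q" and 3: "q (a + b) = q a \<oplus>\<^bsub>Q\<^esub> q b" and "q (a * b) = q a \<otimes>\<^bsub>Q\<^esub> q b"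
    and "q 1 = \<one>\<^bsub>Q\<^esub>" and 6: "q a = \<zero>\<^bsub>Q\<^esub> \<longleftrightarrow> a \<in> Z" for a b
    using assms by (auto simp: quot_map_def)
  show 7: "q a \<in> carrier Q" for a using 2 by auto
  have "q 0 \<oplus>\<^bsub>Q\<^esub> q 0 = q 0" using 3[of 0 0] by simp
  then show 8: "q 0 = \<zero>\<^bsub>Q\<^esub>" using 7 by (metis add.r_cancel_one)
  show 9: "q (- a) = \<ominus>\<^bsub>Q\<^esub> q a" for a
    using 3[of a "- a"] 7 8 by (metis add.inv_equality add.right_inverse add.m_comm)
  show 11: "q (a - b) = q a \<ominus>\<^bsub>Q\<^esub> q b" for a b using 3[of a "- b"] 9 by (simp add: a_minus_def)
  show "q a = q b \<longleftrightarrow> a - b \<in> Z" using 6[of "a - b"] 11 7 by (simp add: r_right_minus_eq)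
qed

lemma quot_map_id: "quot_map type_ring (\<lambda>a. a) {0}"
  by (simp add: quot_map_def cring_type_ring)

lemma quot_map_Quot:
  assumes q: "quot_map Q q Z" and J: "ideal J Q"
  shows "quot_map (Q Quot J) (\<lambda>a. J +>\<^bsub>Q\<^esub> q a) {a. q a \<in> J}"
proof -
  interpret cring Q by (rule quot_mapD(1)[OF q])
  interpret J: ideal J Q by (rule J)
  interpret S: abelian_subgroup J Q by (rule abelian_subgroupI3[OF J.is_additive_subgroup is_abelian_group])
  have hom: "(+>\<^bsub>Q\<^esub>) J \<in> ring_hom Q (Q Quot J)" by (rule J.rcos_ring_hom)
  have "cring (Q Quot J)" by (rule J.quotient_is_cring[OF is_cring])
  moreover have "range (\<lambda>a. J +>\<^bsub>Q\<^esub> q a) = carrier (Q Quot J)"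
    unfolding FactRing_def A_RCOSETS_def' by (simp add: quot_mapD(2)[OF q, symmetric]) blast
  moreover have "J +>\<^bsub>Q\<^esub> q a = \<zero>\<^bsub>Q Quot J\<^esub> \<longleftrightarrow> q a \<in> J" for a
  proof
    assume "J +>\<^bsub>Q\<^esub> q a = \<zero>\<^bsub>Q Quot J\<^esub>"
    then have "J +>\<^bsub>Q\<^esub> q a = J" by (simp add: FactRing_def)
    then show "q a \<in> J" using quot_mapD(7)[OF q] by (metis J.a_rcos_self)
  next
    assume "q a \<in> J"
    then show "J +>\<^bsub>Q\<^esub> q a = \<zero>\<^bsub>Q Quot J\<^esub>" by (simp add: J.a_rcos_const FactRing_def)
  qed
  ultimately show ?thesis
    unfolding quot_map_def
    using ring_hom_memE[OF hom] quot_mapD(3,4,5,7)[OF q] by auto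
qed

text \<open>For an ideal \<open>Z\<close> and a finite set \<open>G\<close> this is the ideal
  generated by both; for infinite \<open>G\<close> the sum would be 0.\<close>

definition ideal_gen :: "'a::comm_ring_1 set \<Rightarrow> 'a set \<Rightarrow> 'a set" where
  "ideal_gen Z G = {z + (\<Sum>g\<in>G. u g * g) | z u. z \<in> Z}"

lemma ideal_genI: "z \<in> Z \<Longrightarrow> z + (\<Sum>g\<in>G. u g * g) \<in> ideal_gen Z G"
  by (auto simp: ideal_gen_def)

definition is_ideal :: "'a::comm_ring_1 set \<Rightarrow> bool" where
  "is_ideal Z \<longleftrightarrow> 0 \<in> Z \<and> (\<forall>a\<in>Z. \<forall>b\<in>Z. a + b \<in> Z) \<and> (\<forall>a\<in>Z. \<forall>c. c * a \<in> Z)"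

lemma is_idealD:
  assumes "is_ideal Z"
  shows "0 \<in> Z" "a \<in> Z \<Longrightarrow> b \<in> Z \<Longrightarrow> a + b \<in> Z" "a \<in> Z \<Longrightarrow> c * a \<in> Z" "a \<in> Z \<Longrightarrow> a * c \<in> Z" "a \<in> Z \<Longrightarrow> - a \<in> Z"
    "a \<in> Z \<Longrightarrow> b \<in> Z \<Longrightarrow> a - b \<in> Z" "(\<And>i. i \<in> I \<Longrightarrow> w i \<in> Z) \<Longrightarrow> sum w I \<in> Z"
proof -
  note Z = assms[unfolded is_ideal_def]
  show "0 \<in> Z" and 2: "a \<in> Z \<Longrightarrow> b \<in> Z \<Longrightarrow> a + b \<in> Z" and 3: "a \<in> Z \<Longrightarrow> c * a \<in> Z" for a b c using Z by auto
  show "a \<in> Z \<Longrightarrow> a * c \<in> Z" using 3[of a c] by (simp add: mult.commute)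
  show m: "a \<in> Z \<Longrightarrow> - a \<in> Z" for a using 3[of a "- 1"] by simp
  show "a \<in> Z \<Longrightarrow> b \<in> Z \<Longrightarrow> a - b \<in> Z" using 2[OF _ m] by force
  show "(\<And>i. i \<in> I \<Longrightarrow> w i \<in> Z) \<Longrightarrow> sum w I \<in> Z"
    by (induction I rule: infinite_finite_induct) (use Z in auto)
qed

lemma quot_map_is_ideal: assumes q: "quot_map Q q Z" shows "is_ideal Z"
proof -
  interpret cring Q by (rule quot_mapD(1)[OF q])
  note D = quot_mapD[OF q]
  show ?thesis unfolding is_ideal_def
    using D(3,4,6,7,8) by (metis l_zero r_null)
qed

lemma ideal_gen_is_ideal: assumes "is_ideal Z" shows "is_ideal (ideal_gen Z G)"
  unfolding is_ideal_def
proof (intro conjI ballI allI)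
  show "0 \<in> ideal_gen Z G" using ideal_genI[OF is_idealD(1)[OF assms], of "\<lambda>_. 0" G] by simp
next
  fix a b assume "a \<in> ideal_gen Z G" "b \<in> ideal_gen Z G"
  then obtain z u z' u' where "z \<in> Z" "z' \<in> Z" "a = z + (\<Sum>g\<in>G. u g * g)" "b = z' + (\<Sum>g\<in>G. u' g * g)"
    by (auto simp: ideal_gen_def)
  then show "a + b \<in> ideal_gen Z G"
    using ideal_genI[of "z + z'" Z "\<lambda>g. u g + u' g" G] is_idealD(2)[OF assms]
    by (simp add: sum.distrib algebra_simps)
next
  fix a c assume "a \<in> ideal_gen Z G"
  then obtain z u where "z \<in> Z" "a = z + (\<Sum>g\<in>G. u g * g)" by (auto simp: ideal_gen_def)
  then show "c * a \<in> ideal_gen Z G"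
    using ideal_genI[of "c * z" Z "\<lambda>g. c * u g" G] is_idealD(3)[OF assms]
    by (simp add: sum_distrib_left algebra_simps)
qed

lemma ideal_gen_supset: "is_ideal Z \<Longrightarrow> finite G \<Longrightarrow> Z \<subseteq> ideal_gen Z G \<and> G \<subseteq> ideal_gen Z G"
proof (intro conjI subsetI)
  fix a assume "is_ideal Z" "finite G"
  show "a \<in> Z \<Longrightarrow> a \<in> ideal_gen Z G" using ideal_genI[of a Z "\<lambda>_. 0" G] by simp
  assume "a \<in> G"
  have "(\<Sum>g\<in>G. (if g = a then 1 else 0) * g) = (\<Sum>g\<in>G. if g = a then g else 0)"
    by (intro sum.cong) auto
  also have "\<dots> = a" using \<open>finite G\<close> \<open>a \<in> G\<close> by simp
  finally show "a \<in> ideal_gen Z G"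
    using ideal_genI[OF is_idealD(1)[OF \<open>is_ideal Z\<close>], of "\<lambda>g. if g = a then 1 else 0" G] by simp
qed

lemma ideal_gen_minimal: "is_ideal Z' \<Longrightarrow> Z \<subseteq> Z' \<Longrightarrow> G \<subseteq> Z' \<Longrightarrow> ideal_gen Z G \<subseteq> Z'"
proof
  fix a assume Z': "is_ideal Z'" and "Z \<subseteq> Z'" "G \<subseteq> Z'" "a \<in> ideal_gen Z G"
  then obtain z u where a: "z \<in> Z'" "a = z + (\<Sum>g\<in>G. u g * g)" by (auto simp: ideal_gen_def)
  have "(\<Sum>g\<in>G. u g * g) \<in> Z'" using \<open>G \<subseteq> Z'\<close> by (intro is_idealD(7)[OF Z'] is_idealD(3)[OF Z']) auto
  then show "a \<in> Z'" using a is_idealD(2)[OF Z'] by simp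
qed

lemma image_ideal:
  assumes q: "quot_map Q q Z" and W: "is_ideal W"
  shows "ideal (q ` W) Q"
proof -
  interpret cring Q by (rule quot_mapD(1)[OF q])
  note D = quot_mapD[OF q]
  show ?thesis
  proof (rule idealI)
    show "ring Q" by (rule ring_axioms)
    show "subgroup (q ` W) (add_monoid Q)"
    proof (rule subgroup.intro)
      show "q ` W \<subseteq> carrier (add_monoid Q)" using D(7) by auto
      show "x \<otimes>\<^bsub>add_monoid Q\<^esub> y \<in> q ` W" if "x \<in> q ` W" "y \<in> q ` W" for x y
        using that is_idealD(2)[OF W] by (auto simp: D(3)[symmetric])
      show "\<one>\<^bsub>add_monoid Q\<^esub> \<in> q ` W" using is_idealD(1)[OF W] D(8) by force
      show "inv\<^bsub>add_monoid Q\<^esub> x \<in> q ` W" if "x \<in> q ` W" for x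
      proof -
        from that obtain w where w: "w \<in> W" "x = q w" by auto
        have "inv\<^bsub>add_monoid Q\<^esub> x = q (- w)" using D(9) w by (simp add: a_inv_def)
        then show ?thesis using is_idealD(5)[OF W w(1)] by simp
      qed
    qed
    fix a x assume a: "a \<in> q ` W" and x: "x \<in> carrier Q"
    obtain c where c: "x = q c" using x D(2) by (metis rangeE)
    show "x \<otimes>\<^bsub>Q\<^esub> a \<in> q ` W" "a \<otimes>\<^bsub>Q\<^esub> x \<in> q ` W"
      using a c is_idealD(3,4)[OF W] by (auto simp: D(4)[symmetric])
  qed
qed

lemma image_mem_iff:
  assumes q: "quot_map Q q Z" and W: "is_ideal W" and Z: "Z \<subseteq> W"
  shows "q a \<in> q ` W \<longleftrightarrow> a \<in> W"
proof
  assume "q a \<in> q ` W"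
  then obtain b where b: "b \<in> W" "q a = q b" by auto
  then have "a - b \<in> W" using quot_mapD(10)[OF q] Z by blast
  then have "(a - b) + b \<in> W" using b is_idealD(2)[OF W] by blast
  then show "a \<in> W" by simp
qed auto

lemma genideal_quot:
  assumes q: "quot_map Q q Z" and G: "finite G"
  shows "Idl\<^bsub>Q\<^esub> (q ` G) = q ` ideal_gen Z G"
proof
  interpret cring Q by (rule quot_mapD(1)[OF q])
  note Z = quot_map_is_ideal[OF q]
  show "Idl\<^bsub>Q\<^esub> (q ` G) \<subseteq> q ` ideal_gen Z G"
    using image_ideal[OF q ideal_gen_is_ideal[OF Z]] ideal_gen_supset[OF Z G] by (intro genideal_minimal) auto
  have sub: "q ` G \<subseteq> carrier Q" using quot_mapD(7)[OF q] by auto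
  interpret I: ideal "Idl\<^bsub>Q\<^esub> (q ` G)" Q by (rule genideal_ideal[OF sub])
  have "is_ideal {a. q a \<in> Idl\<^bsub>Q\<^esub> (q ` G)}"
    unfolding is_ideal_def using quot_mapD(3,4,7,8)[OF q] by (auto intro: I.I_l_closed)
  moreover have "Z \<subseteq> {a. q a \<in> Idl\<^bsub>Q\<^esub> (q ` G)}" 
    by (intro subsetI CollectI) (simp only: quot_mapD(6)[OF q, THEN iffD2] I.zero_closed)
  moreover have "G \<subseteq> {a. q a \<in> Idl\<^bsub>Q\<^esub> (q ` G)}" using genideal_self[OF sub] by auto
  ultimately show "q ` ideal_gen Z G \<subseteq> Idl\<^bsub>Q\<^esub> (q ` G)" using ideal_gen_minimal by blast
qed

text \<open>Products are brought into the ideal of the products of generators by minimality of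
  \<open>ideal_gen\<close>, used once in the second factor for a fixed generator of the first, and
  once in the first factor.\<close>

lemma ideal_prod_quot:
  assumes q: "quot_map Q q Z" and G: "finite G" and H: "finite H"
  shows "ideal_prod Q (q ` ideal_gen Z G) (q ` ideal_gen Z H) = q ` ideal_gen Z {g * h | g h. g \<in> G \<and> h \<in> H}"
proof
  interpret cring Q by (rule quot_mapD(1)[OF q])
  note Z = quot_map_is_ideal[OF q]
  note D = quot_mapD[OF q]
  let ?GH = "{g * h | g h. g \<in> G \<and> h \<in> H}"
  have fin: "finite ?GH" using finite_image_set2[of "\<lambda>g. g \<in> G" "\<lambda>h. h \<in> H" "(*)"] G H by simp
  note W = ideal_gen_is_ideal[OF Z, of ?GH]
  note sup = ideal_gen_supset[OF Z fin]
  have prod: "a * b \<in> ideal_gen Z ?GH" if a: "a \<in> ideal_gen Z G" and b: "b \<in> ideal_gen Z H" for a b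
  proof -
    have "is_ideal {b. g * b \<in> ideal_gen Z ?GH}" for g
      unfolding is_ideal_def using is_idealD(1,2)[OF W] is_idealD(3)[OF W, of "g * _"]
      by (auto simp: distrib_left mult.left_commute[of g])
    then have 1: "ideal_gen Z H \<subseteq> {b. g * b \<in> ideal_gen Z ?GH}" if "g \<in> G" for g
      using sup that is_idealD(3)[OF Z] by (intro ideal_gen_minimal) blast+
    have "is_ideal {a. a * b \<in> ideal_gen Z ?GH}"
      unfolding is_ideal_def using is_idealD(1,2)[OF W] is_idealD(3)[OF W, of "_ * b"]
      by (auto simp: distrib_right mult.assoc)
    then have "ideal_gen Z G \<subseteq> {a. a * b \<in> ideal_gen Z ?GH}"
      using sup 1 b is_idealD(4)[OF Z] by (intro ideal_gen_minimal) blast+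
    then show ?thesis using a by blast
  qed
  show "ideal_prod Q (q ` ideal_gen Z G) (q ` ideal_gen Z H) \<subseteq> q ` ideal_gen Z ?GH"
  proof
    fix x assume "x \<in> ideal_prod Q (q ` ideal_gen Z G) (q ` ideal_gen Z H)"
    then show "x \<in> q ` ideal_gen Z ?GH"
    proof induction
      case (prod i j)
      then obtain a b where ab: "a \<in> ideal_gen Z G" "b \<in> ideal_gen Z H" "i = q a" "j = q b" by blast
      then have "i \<otimes>\<^bsub>Q\<^esub> j = q (a * b)" by (simp add: D(4))
      then show ?case using \<open>\<And>b a. a \<in> ideal_gen Z G \<Longrightarrow> b \<in> ideal_gen Z H \<Longrightarrow> a * b \<in> ideal_gen Z ?GH\<close> ab by blast
    next
      case (sum s1 s2)
      then obtain a b where "a \<in> ideal_gen Z ?GH" "b \<in> ideal_gen Z ?GH" "s1 = q a" "s2 = q b" by blast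
      then have "s1 \<oplus>\<^bsub>Q\<^esub> s2 = q (a + b)" and "a + b \<in> ideal_gen Z ?GH"
        by (simp_all only: D(3) is_idealD(2)[OF W])
      then show ?case by (simp only: imageI)
    qed
  qed
  interpret P: ideal "ideal_prod Q (q ` ideal_gen Z G) (q ` ideal_gen Z H)" Q
    by (intro ideal_prod_is_ideal image_ideal[OF q] ideal_gen_is_ideal[OF Z])
  have "is_ideal {a. q a \<in> ideal_prod Q (q ` ideal_gen Z G) (q ` ideal_gen Z H)}"
    unfolding is_ideal_def using D(3,4,7,8) by (auto intro: P.I_l_closed)
  moreover have "Z \<subseteq> {a. q a \<in> ideal_prod Q (q ` ideal_gen Z G) (q ` ideal_gen Z H)}" 
    by (intro subsetI CollectI) (simp only: D(6)[THEN iffD2] P.zero_closed)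
  moreover have "q (g * h) \<in> ideal_prod Q (q ` ideal_gen Z G) (q ` ideal_gen Z H)" if "g \<in> G" "h \<in> H" for g h
    unfolding D(4) using that ideal_gen_supset[OF Z G] ideal_gen_supset[OF Z H] by (intro ideal_prod.prod) auto
  ultimately show "q ` ideal_gen Z ?GH \<subseteq> ideal_prod Q (q ` ideal_gen Z G) (q ` ideal_gen Z H)"
    using ideal_gen_minimal[of "{a. q a \<in> ideal_prod Q (q ` ideal_gen Z G) (q ` ideal_gen Z H)}" Z ?GH] by blast
qed

lemma module_restrict_scalars:
  assumes R: "cring R" and Q: "cring Q" and h: "h \<in> ring_hom R Q"
  shows "module R (restrict_scalars h Q)"
proof -
  interpret Q: cring Q by (rule Q)
  note h = ring_hom_memE[OF h]
  show ?thesis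
    by (rule module_criteria[OF R])
      (auto simp: restrict_scalars_def h Q.a_ac Q.m_assoc Q.l_distr Q.r_distr
        intro: Q.r_neg bexI[of _ "\<ominus>\<^bsub>Q\<^esub> _"])
qed

section \<open>The closed fiber\<close>

text \<open>\<open>presents V \<sigma> \<pi> Z\<close>: the module \<open>V\<close> is the quotient of the type \<open>'a\<close> by \<open>Z\<close>, through \<open>\<pi>\<close>;
  scalars act on \<open>'a\<close> through \<open>\<sigma>\<close>.\<close>

definition presents :: "('r::comm_ring_1, 'v, 'z) module_scheme \<Rightarrow> ('r \<Rightarrow> 'a::comm_ring_1) \<Rightarrow> ('a \<Rightarrow> 'v) \<Rightarrow> 'a set \<Rightarrow> bool" where
  "presents V \<sigma> \<pi> Z \<longleftrightarrow> module type_ring V \<and> range \<pi> = carrier V \<and> (\<forall>a b. \<pi> (a + b) = \<pi> a \<oplus>\<^bsub>V\<^esub> \<pi> b) \<and>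
     (\<forall>c a. \<pi> (\<sigma> c * a) = c \<odot>\<^bsub>V\<^esub> \<pi> a) \<and> (\<forall>a. \<pi> a = \<zero>\<^bsub>V\<^esub> \<longleftrightarrow> a \<in> Z)"

lemma presentsD:
  assumes "presents V \<sigma> \<pi> Z"
  shows "module type_ring V" "range \<pi> = carrier V" "\<pi> (a + b) = \<pi> a \<oplus>\<^bsub>V\<^esub> \<pi> b" "\<pi> (\<sigma> c * a) = c \<odot>\<^bsub>V\<^esub> \<pi> a"
    "\<pi> a = \<zero>\<^bsub>V\<^esub> \<longleftrightarrow> a \<in> Z" "\<pi> a \<in> carrier V" "\<pi> 0 = \<zero>\<^bsub>V\<^esub>" "\<pi> a = \<pi> b \<longleftrightarrow> a - b \<in> Z"
proof -
  show m: "module type_ring V" using assms by (simp add: presents_def)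
  interpret module type_ring V by (rule m)
  show 2: "range \<pi> = carrier V" and 3: "\<pi> (a + b) = \<pi> a \<oplus>\<^bsub>V\<^esub> \<pi> b" and "\<pi> (\<sigma> c * a) = c \<odot>\<^bsub>V\<^esub> \<pi> a"
    and 5: "\<pi> a = \<zero>\<^bsub>V\<^esub> \<longleftrightarrow> a \<in> Z" for a b c
    using assms by (auto simp: presents_def)
  show 6: "\<pi> a \<in> carrier V" for a using 2 by auto
  have "\<pi> 0 \<oplus>\<^bsub>V\<^esub> \<pi> 0 = \<pi> 0" using 3[of 0 0] by simp
  then show "\<pi> 0 = \<zero>\<^bsub>V\<^esub>" using 6 by (metis M.add.r_cancel_one)
  have "\<pi> a = \<pi> (a - b) \<oplus>\<^bsub>V\<^esub> \<pi> b" using 3[of "a - b" b] by simp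
  then show "\<pi> a = \<pi> b \<longleftrightarrow> a - b \<in> Z" 
    using 5[of "a - b"] M.add.r_cancel_one[of "\<pi> b" "\<pi> (a - b)"] 6 by simp
qed

lemma presents_sum:
  fixes c :: "nat \<Rightarrow> 'r::comm_ring_1"
  assumes p: "presents V \<sigma> \<pi> Z"
  shows "\<pi> (\<Sum>i<n. \<sigma> (c i) * b i) = finsum V (\<lambda>i. c i \<odot>\<^bsub>V\<^esub> \<pi> (b i)) {..<n}"
proof -
  interpret module type_ring V by (rule presentsD(1)[OF p])
  note D = presentsD[OF p]
  have cl: "c i \<odot>\<^bsub>V\<^esub> \<pi> (b i) \<in> carrier V" for i by (rule smult_closed) (simp_all add: D(6))
  show ?thesis
  proof (induction n)
    case 0
    then show ?case by (simp add: D(7))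
  next
    case (Suc n)
    have "finsum V (\<lambda>i. c i \<odot>\<^bsub>V\<^esub> \<pi> (b i)) {..<Suc n} = c n \<odot>\<^bsub>V\<^esub> \<pi> (b n) \<oplus>\<^bsub>V\<^esub> finsum V (\<lambda>i. c i \<odot>\<^bsub>V\<^esub> \<pi> (b i)) {..<n}"
      unfolding lessThan_Suc using cl by (subst finsum_insert) auto
    then show ?case using Suc by (simp add: D(3,4) add.commute[of "sum _ _"])
  qed
qed

lemma presents_indep_iff:
  fixes b :: "nat \<Rightarrow> 'a::comm_ring_1" and \<sigma> :: "'r::comm_ring_1 \<Rightarrow> 'a"
  assumes p: "presents V \<sigma> \<pi> Z"
  shows "family_indep type_ring V n (\<lambda>i. \<pi> (b i)) \<longleftrightarrow> (\<forall>c. (\<Sum>i<n. \<sigma> (c i) * b i) \<in> Z \<longrightarrow> (\<forall>i<n. c i = 0))"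
  unfolding family_indep_def presents_sum[OF p, symmetric] presentsD(5)[OF p] by simp

lemma presents_gen_iff:
  fixes b :: "nat \<Rightarrow> 'a::comm_ring_1" and \<sigma> :: "'r::comm_ring_1 \<Rightarrow> 'a"
  assumes p: "presents V \<sigma> \<pi> Z"
  shows "family_gen type_ring V n (\<lambda>i. \<pi> (b i)) \<longleftrightarrow> (\<forall>a. \<exists>c. a - (\<Sum>i<n. \<sigma> (c i) * b i) \<in> Z)"
  unfolding family_gen_def presents_sum[OF p, symmetric] presentsD(2)[OF p, symmetric] presentsD(8)[OF p, symmetric]
  by simp

lemma presents_lift: "presents V \<sigma> \<pi> Z \<Longrightarrow> e ` {..<n::nat} \<subseteq> carrier V \<Longrightarrow> \<exists>b. \<forall>i<n. e i = \<pi> (b i)"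
proof -
  assume p: "presents V \<sigma> \<pi> Z" and e: "e ` {..<n} \<subseteq> carrier V"
  have "\<forall>i. \<exists>b. i < n \<longrightarrow> e i = \<pi> b" using e unfolding presentsD(2)[OF p, symmetric] by blast
  then show ?thesis by (rule choice[THEN exE]) blast
qed

lemma family_cong:
  assumes "\<And>i. i < n \<Longrightarrow> e i = e' i" "module R M" "e ` {..<n} \<subseteq> carrier M"
  shows "family_indep R M n e \<longleftrightarrow> family_indep R M n e'" "family_gen R M n e \<longleftrightarrow> family_gen R M n e'"
proof -
  interpret module R M by fact
  have *: "finsum M (\<lambda>i. c i \<odot>\<^bsub>M\<^esub> e i) {..<n} = finsum M (\<lambda>i. c i \<odot>\<^bsub>M\<^esub> e' i) {..<n}" if c: "c \<in> {..<n} \<rightarrow> carrier R" for c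
  proof (rule finsum_cong'[OF refl])
    show "(\<lambda>i. c i \<odot>\<^bsub>M\<^esub> e' i) \<in> {..<n} \<rightarrow> carrier M"
      using c assms(3) assms(1)[symmetric] by (auto intro!: smult_closed)
  qed (use assms(1) in simp)
  show "family_indep R M n e \<longleftrightarrow> family_indep R M n e'"
    unfolding family_indep_def using * by simp
  show "family_gen R M n e \<longleftrightarrow> family_gen R M n e'"
    unfolding family_gen_def using * by simp
qed

lemma presents_restrict_scalars:
  assumes q: "quot_map Q q Z" and \<sigma>: "is_ring_hom \<sigma>"
  shows "presents (restrict_scalars (\<lambda>c. q (\<sigma> c)) Q) \<sigma> q Z"
proof -
  have "(\<lambda>c. q (\<sigma> c)) \<in> ring_hom type_ring Q"
    by (rule ring_hom_memI) (simp_all add: quot_mapD[OF q] is_ring_homD[OF \<sigma>])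
  then have "module type_ring (restrict_scalars (\<lambda>c. q (\<sigma> c)) Q)"
    by (rule module_restrict_scalars[OF cring_type_ring quot_mapD(1)[OF q]])
  then show ?thesis
    unfolding presents_def by (simp add: restrict_scalars_def quot_mapD(2-4,6)[OF q])
qed

lemma ideal_gen_0_single: "ideal_gen {0} {F} = {a. F dvd a}"
proof (intro equalityI subsetI CollectI)
  fix a show "a \<in> ideal_gen {0} {F} \<Longrightarrow> F dvd a" by (auto simp: ideal_gen_def)
  assume "a \<in> {a. F dvd a}"
  then obtain k where "a = F * k" by (auto elim: dvdE)
  then show "a \<in> ideal_gen {0} {F}"
    using ideal_genI[of 0 "{0}" "\<lambda>_. k" "{F}"] by (simp add: mult.commute)
qed

lemma quot_map_type_Quot:
  assumes "finite G"
  shows "quot_map (type_ring Quot (Idl\<^bsub>type_ring\<^esub> G)) (\<lambda>a. Idl\<^bsub>type_ring\<^esub> G +>\<^bsub>type_ring\<^esub> a) (ideal_gen {0} G)"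
proof -
  interpret cring "type_ring :: 'a ring" by (rule cring_type_ring)
  have "quot_map (type_ring Quot (Idl\<^bsub>type_ring\<^esub> G)) (\<lambda>a. Idl\<^bsub>type_ring\<^esub> G +>\<^bsub>type_ring\<^esub> a) {a. a \<in> Idl\<^bsub>type_ring\<^esub> G}"
    by (rule quot_map_Quot[OF quot_map_id]) (simp add: genideal_ideal)
  moreover have "Idl\<^bsub>type_ring\<^esub> G = ideal_gen {0} G"
    using genideal_quot[OF quot_map_id assms] by simp
  ultimately show ?thesis by simp
qed

lemma quot_map_OX: "quot_map (OX F) (OX_class F) {a. F dvd a}"
  using quot_map_type_Quot[of "{F}"] unfolding OX_def OX_class_def ideal_gen_0_single by simp

lemma quot_map_germ: "quot_map (germ_ring f) (germ_class f) {a. f dvd a}"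
  using quot_map_type_Quot[of "{f}"] unfolding germ_ring_def germ_class_def ideal_gen_0_single by simp

abbreviation kconst :: "'k::comm_ring_1 \<Rightarrow> 'k fps fps" where "kconst c \<equiv> fps_const (fps_const c)"

lemma kconst_hom: "is_ring_hom (kconst :: 'k::comm_ring_1 \<Rightarrow> _)"
  by (rule is_ring_hom_comp[OF is_ring_hom_fps_const is_ring_hom_fps_const])

text \<open>\<open>f\<close> and its derivatives vanish at the origin, so the value there is well
  defined on \<open>Def1 f\<close>. A generating family has to represent 1, hence not all of its
  members vanish at the origin.\<close>

lemma represents_Def1_basis_origin:
  fixes f :: "'k::field fps fps"
  assumes basis: "represents_Def1_basis f \<delta>"
    and f0: "f $ 0 $ 0 = 0" "deriv_x f $ 0 $ 0 = 0" "deriv_y f $ 0 $ 0 = 0"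
  shows "\<exists>i<length \<delta>. \<delta> ! i $ 0 $ 0 \<noteq> 0"
proof -
  note g = quot_map_germ[of f]
  interpret G: cring "germ_ring f" by (rule quot_mapD(1)[OF g])
  let ?Z = "ideal_gen {a. f dvd a} {deriv_x f, deriv_y f}"
  have Def1: "Def1_ideal f = germ_class f ` ?Z"
    unfolding Def1_ideal_def using genideal_quot[OF g, of "{deriv_x f, deriv_y f}"] by simp
  note Zid = ideal_gen_is_ideal[OF quot_map_is_ideal[OF g], of "{deriv_x f, deriv_y f}"]
  have "quot_map (germ_ring f Quot Def1_ideal f) (Def1_class f) {a. germ_class f a \<in> Def1_ideal f}"
    unfolding Def1_class_def by (rule quot_map_Quot[OF g]) (simp add: Def1 image_ideal[OF g Zid])
  moreover have "{a. germ_class f a \<in> Def1_ideal f} = ?Z"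
    unfolding Def1 using image_mem_iff[OF g Zid] ideal_gen_supset[OF quot_map_is_ideal[OF g]] by auto
  ultimately have "presents (Def1 f) kconst (Def1_class f) ?Z"
    unfolding Def1_def using presents_restrict_scalars[OF _ kconst_hom] by auto
  note p = this
  interpret M: module type_ring "Def1 f" by (rule presentsD(1)[OF p])
  have "family_gen type_ring (Def1 f) (length \<delta>) (\<lambda>i. Def1_class f (\<delta> ! i))"
    using basis unfolding represents_Def1_basis_def by (subst (asm) M.free_basis_iff) auto
  then obtain c where c: "1 - (\<Sum>i<length \<delta>. kconst (c i) * \<delta> ! i) \<in> ?Z"
    unfolding presents_gen_iff[OF p] by blast
  have "is_ideal {a :: 'k fps fps. a $ 0 $ 0 = 0}" by (auto simp: is_ideal_def)
  then have "?Z \<subseteq> {a. a $ 0 $ 0 = 0}" by (rule ideal_gen_minimal) (use f0 in \<open>auto simp: dvd_def\<close>)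
  with c have "(1 - (\<Sum>i<length \<delta>. kconst (c i) * \<delta> ! i)) $ 0 $ 0 = 0" by blast
  then have "(\<Sum>i<length \<delta>. c i * \<delta> ! i $ 0 $ 0) = 1" by (simp add: fps_sum_nth)
  then have "(\<Sum>i<length \<delta>. c i * \<delta> ! i $ 0 $ 0) \<noteq> 0" by simp
  then show ?thesis by (rule sum.not_neutral_contains_not_neutral) auto
qed

definition fiber_ideal :: "'k::field fps fps \<Rightarrow> 'k fps fps \<Rightarrow> 'k fps fps set" where
  "fiber_ideal f h = {a. \<exists>u w. a = f * u + h * w}"

text \<open>As \<open>t\<close> is killed in the closed fiber, membership in the ideal depends only
  on coefficients at \<open>t = 0\<close>.\<close>

lemma closed_fiber_presents:
  fixes F h :: "'k::field fps fps fps"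
  defines "J \<equiv> closed_fiber_ideal F <+>\<^bsub>OX F\<^esub> Idl\<^bsub>OX F\<^esub> {OX_class F h}"
  shows "presents (restrict_scalars (\<lambda>c. J +>\<^bsub>OX F\<^esub> OX_class F (fps_const (kconst c))) (OX F Quot J))
     (\<lambda>c. fps_const (kconst c)) (\<lambda>g. J +>\<^bsub>OX F\<^esub> OX_class F g) {a. a $ 0 \<in> fiber_ideal (F $ 0) (h $ 0)}"
proof -
  note q = quot_map_OX[of F]
  interpret cring "OX F" by (rule quot_mapD(1)[OF q])
  let ?Z = "{a. F dvd a}"
  note Z = quot_map_is_ideal[OF q]
  note W1 = ideal_gen_is_ideal[OF Z, of "{fps_X}"] and W2 = ideal_gen_is_ideal[OF Z, of "{h}"]
  have 1: "closed_fiber_ideal F = OX_class F ` ideal_gen ?Z {fps_X}"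
    unfolding closed_fiber_ideal_def using genideal_quot[OF q, of "{fps_X}"] by simp
  have 2: "Idl\<^bsub>OX F\<^esub> {OX_class F h} = OX_class F ` ideal_gen ?Z {h}"
    using genideal_quot[OF q, of "{h}"] by simp
  have J: "ideal J (OX F)"
    unfolding J_def 1 2 by (intro add_ideals image_ideal[OF q] W1 W2)
  have "OX_class F a \<in> J \<longleftrightarrow> a $ 0 \<in> fiber_ideal (F $ 0) (h $ 0)" for a
  proof
    assume "OX_class F a \<in> J"
    then obtain b c where bc: "b \<in> ideal_gen ?Z {fps_X}" "c \<in> ideal_gen ?Z {h}"
      "OX_class F a = OX_class F b \<oplus>\<^bsub>OX F\<^esub> OX_class F c"
      unfolding J_def 1 2 set_add_def' by blast
    from bc(3) have "F dvd a - (b + c)" by (simp only: quot_mapD(3)[OF q, symmetric]) (simp add: quot_mapD(10)[OF q])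
    moreover from bc obtain z u z' u' where "F dvd z" "b = z + u * fps_X" "F dvd z'" "c = z' + u' * h"
      by (auto simp: ideal_gen_def)
    ultimately obtain v v' v'' where "a - (b + c) = F * v" "b = F * v' + u * fps_X" "c = F * v'' + u' * h"
      by (auto elim!: dvdE)
    then have "a = F * (v + v' + v'') + u * fps_X + h * u'" by (simp add: algebra_simps)
    then have "a $ 0 = F $ 0 * (v + v' + v'') $ 0 + h $ 0 * u' $ 0" by simp
    then show "a $ 0 \<in> fiber_ideal (F $ 0) (h $ 0)" unfolding fiber_ideal_def by blast
  next
    assume "a $ 0 \<in> fiber_ideal (F $ 0) (h $ 0)"
    then obtain u w where uw: "a $ 0 = F $ 0 * u + h $ 0 * w" by (auto simp: fiber_ideal_def)
    define r where "r = a - F * fps_const u - h * fps_const w"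
    have "r = fps_X * fps_shift 1 r" by (rule fps_eq_X_mult) (simp add: r_def uw)
    then have "F * fps_const u + r \<in> ideal_gen ?Z {fps_X}"
      using ideal_genI[of "F * fps_const u" ?Z "\<lambda>_. fps_shift 1 r" "{fps_X}"] by (simp add: mult.commute)
    moreover have "0 + fps_const w * h \<in> ideal_gen ?Z {h}"
      using ideal_genI[of 0 ?Z "\<lambda>_. fps_const w" "{h}"] by simp
    moreover have "a = (F * fps_const u + r) + (0 + fps_const w * h)" by (simp add: r_def mult.commute)
    then have "OX_class F a = OX_class F (F * fps_const u + r) \<oplus>\<^bsub>OX F\<^esub> OX_class F (0 + fps_const w * h)"
      by (simp only: quot_mapD(3)[OF q])
    ultimately show "OX_class F a \<in> J" unfolding J_def 1 2 set_add_def' by blast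
  qed
  then have "quot_map (OX F Quot J) (\<lambda>g. J +>\<^bsub>OX F\<^esub> OX_class F g) {a. a $ 0 \<in> fiber_ideal (F $ 0) (h $ 0)}"
    using quot_map_Quot[OF q J] by simp
  then show ?thesis
    by (rule presents_restrict_scalars) (rule is_ring_hom_comp[OF is_ring_hom_fps_const kconst_hom])
qed

definition fiber_indep :: "'k::field fps fps \<Rightarrow> 'k fps fps \<Rightarrow> nat \<Rightarrow> (nat \<Rightarrow> 'k fps fps) \<Rightarrow> bool" where
  "fiber_indep f h n b \<longleftrightarrow> (\<forall>c. (\<Sum>i<n. kconst (c i) * b i) \<in> fiber_ideal f h \<longrightarrow> (\<forall>i<n. c i = 0))"

definition fiber_gen :: "'k::field fps fps \<Rightarrow> 'k fps fps \<Rightarrow> nat \<Rightarrow> (nat \<Rightarrow> 'k fps fps) \<Rightarrow> bool" where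
  "fiber_gen f h n b \<longleftrightarrow> (\<forall>a. \<exists>c. a - (\<Sum>i<n. kconst (c i) * b i) \<in> fiber_ideal f h)"

lemma closed_fiber_dim:
  fixes F h :: "'k::field fps fps fps"
  defines "d \<equiv> closed_fiber_dim F (Idl\<^bsub>OX F\<^esub> {OX_class F h})"
  shows closed_fiber_dim_ge: "fiber_indep (F $ 0) (h $ 0) n b \<Longrightarrow> enat n \<le> d"
    and closed_fiber_dim_le: "fiber_gen (F $ 0) (h $ 0) n b \<Longrightarrow> d \<le> enat n"
    and closed_fiber_dim_basis: "d = enat n \<Longrightarrow> \<exists>b. fiber_indep (F $ 0) (h $ 0) n b \<and> fiber_gen (F $ 0) (h $ 0) n b"
proof -
  define J where "J = closed_fiber_ideal F <+>\<^bsub>OX F\<^esub> Idl\<^bsub>OX F\<^esub> {OX_class F h}"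
  define V where "V = restrict_scalars (\<lambda>c. J +>\<^bsub>OX F\<^esub> OX_class F (fps_const (kconst c))) (OX F Quot J)"
  define \<pi> where "\<pi> g = J +>\<^bsub>OX F\<^esub> OX_class F g" for g
  have p: "presents V (\<lambda>c. fps_const (kconst c)) \<pi> {a. a $ 0 \<in> fiber_ideal (F $ 0) (h $ 0)}"
    unfolding V_def \<pi>_def[abs_def] J_def by (rule closed_fiber_presents)
  have d: "d = vdim type_ring V"
    unfolding d_def closed_fiber_dim_def V_def J_def Let_def ..
  interpret F: Ring.field "type_ring :: 'k ring" by (rule field_type_ring)
  interpret vectorspace type_ring V
    unfolding vectorspace_def using presentsD(1)[OF p] F.field_axioms by simp
  have sub: "(\<lambda>i. \<pi> (b i)) ` {..<n} \<subseteq> carrier V" for b using presentsD(6)[OF p] by auto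
  have ind: "fiber_indep (F $ 0) (h $ 0) n (\<lambda>i. b i $ 0) \<longleftrightarrow> family_indep type_ring V n (\<lambda>i. \<pi> (b i))" for n b
    unfolding presents_indep_iff[OF p] by (simp add: fiber_indep_def fps_sum_nth)
  have gen: "fiber_gen (F $ 0) (h $ 0) n (\<lambda>i. b i $ 0) \<longleftrightarrow> family_gen type_ring V n (\<lambda>i. \<pi> (b i))" for n b
  proof
    assume g: "fiber_gen (F $ 0) (h $ 0) n (\<lambda>i. b i $ 0)"
    show "family_gen type_ring V n (\<lambda>i. \<pi> (b i))"
      unfolding presents_gen_iff[OF p]
    proof
      fix a :: "'k fps fps fps"
      show "\<exists>c. a - (\<Sum>i<n. fps_const (kconst (c i)) * b i) \<in> {a. a $ 0 \<in> fiber_ideal (F $ 0) (h $ 0)}"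
        using g[unfolded fiber_gen_def, rule_format, of "a $ 0"] by (simp add: fps_sum_nth)
    qed
  next
    assume g: "family_gen type_ring V n (\<lambda>i. \<pi> (b i))"
    show "fiber_gen (F $ 0) (h $ 0) n (\<lambda>i. b i $ 0)"
      unfolding fiber_gen_def
    proof
      fix a :: "'k fps fps"
      show "\<exists>c. a - (\<Sum>i<n. kconst (c i) * b i $ 0) \<in> fiber_ideal (F $ 0) (h $ 0)"
        using g[unfolded presents_gen_iff[OF p], rule_format, of "fps_const a"] by (simp add: fps_sum_nth)
    qed
  qed
  show "enat n \<le> d" if "fiber_indep (F $ 0) (h $ 0) n b"
    unfolding d using that ind[of n "\<lambda>i. fps_const (b i)"] by (intro vdim_ge[OF sub]) simp
  show "d \<le> enat n" if "fiber_gen (F $ 0) (h $ 0) n b"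
    unfolding d using that gen[of n "\<lambda>i. fps_const (b i)"] by (intro vdim_le[OF sub]) simp
  show "\<exists>b. fiber_indep (F $ 0) (h $ 0) n b \<and> fiber_gen (F $ 0) (h $ 0) n b" if "d = enat n"
  proof -
    from that have "vdim type_ring V = enat n" unfolding d .
    then obtain e where e: "e ` {..<n} \<subseteq> carrier V" "family_indep type_ring V n e" "family_gen type_ring V n e"
      by (rule vdim_basis)
    obtain b where b: "\<And>i. i < n \<Longrightarrow> e i = \<pi> (b i)" using presents_lift[OF p e(1)] by blast
    from family_cong[OF b presentsD(1)[OF p] e(1)] e(2,3)
    have "family_indep type_ring V n (\<lambda>i. \<pi> (b i))" "family_gen type_ring V n (\<lambda>i. \<pi> (b i))" by simp_all
    then show ?thesis using ind gen by blast
  qed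
qed

section \<open>Jets along the diagonal\<close>

text \<open>Completeness and separatedness with respect to \<open>z\<close>, in the form needed to
  substitute \<open>z\<close> for a variable: \<open>b i\<close> is the tail
  \<open>\<Sum>l. a (i + l) z^l\<close>.\<close>

definition adic :: "'a::comm_ring_1 \<Rightarrow> bool" where
  "adic z \<longleftrightarrow> (\<forall>a. \<exists>b. \<forall>i::nat. b i = a i + z * b (Suc i)) \<and> (\<forall>c. (\<forall>n. z ^ n dvd c) \<longrightarrow> c = 0)"

lemma adic_solution: "adic z \<Longrightarrow> \<exists>b. \<forall>i::nat. b i = a i + z * b (Suc i)"
  unfolding adic_def by (drule conjunct1) (erule allE)

lemma adic_separated: "adic z \<Longrightarrow> (\<And>n. z ^ n dvd c) \<Longrightarrow> c = 0"
  unfolding adic_def by (drule conjunct2) simp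

lemma adic_fps_X: "adic (fps_X :: 'a::comm_ring_1 fps)"
  unfolding adic_def
proof (intro conjI allI impI)
  show "\<exists>b. \<forall>i. b i = a i + fps_X * b (Suc i)" for a :: "nat \<Rightarrow> 'a fps"
    using X_power_series_solution[of 1 a] by simp
qed (auto intro: fps_X_power_dvd_imp_0)

lemma adic_fps_const:
  assumes z: "adic z"
  shows "adic (fps_const z)"
  unfolding adic_def
proof (intro conjI allI impI)
  fix a :: "nat \<Rightarrow> 'a fps"
  have "\<forall>n. \<exists>b. \<forall>i. b i = a i $ n + z * b (Suc i)" by (intro allI adic_solution[OF z])
  from choice[OF this] obtain b where b: "\<And>n i. b n i = a i $ n + z * b n (Suc i)" by blast
  have "Abs_fps (\<lambda>n. b n i) = a i + fps_const z * Abs_fps (\<lambda>n. b n (Suc i))" for i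
    by (intro fps_ext) (simp, rule b)
  then show "\<exists>b. \<forall>i. b i = a i + fps_const z * b (Suc i)"
    by (intro exI[of _ "\<lambda>i. Abs_fps (\<lambda>n. b n i)"]) blast
next
  fix c assume c: "\<forall>n. fps_const z ^ n dvd c"
  show "c = 0"
  proof (rule fps_ext)
    fix m
    have "z ^ n dvd c $ m" for n
    proof -
      obtain d where "c = fps_const z ^ n * d" using c by blast
      then have "c $ m = z ^ n * d $ m" by (simp add: fps_const_power)
      then show ?thesis by simp
    qed
    then show "c $ m = 0 $ m" using adic_separated[OF z] by simp
  qed
qed

text \<open>Horner's scheme: the later tails are the coefficients of the quotient by
  \<open>fps_X - z\<close>, and the first one is the value at \<open>z\<close>.\<close>

lemma adic_seq_division:
  fixes z :: "'a::comm_ring_1"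
  assumes "\<And>i. b i = h $ i + z * b (Suc i)"
  shows "h = (fps_X - fps_const z) * Abs_fps (\<lambda>i. b (Suc i)) + fps_const (b 0)"
proof (rule fps_ext)
  fix n
  have *: "h $ i = b i - z * b (Suc i)" for i using assms[of i] by (simp add: eq_diff_eq)
  show "h $ n = ((fps_X - fps_const z) * Abs_fps (\<lambda>i. b (Suc i)) + fps_const (b 0)) $ n"
    by (cases n) (simp_all add: * left_diff_distrib)
qed

lemma adic_division_unique:
  fixes z :: "'a::comm_ring_1"
  assumes z: "adic z" and dvd: "fps_X - fps_const z dvd fps_const r"
  shows "r = 0"
proof -
  from dvd obtain q where eq: "fps_const r = (fps_X - fps_const z) * q" ..
  have q: "q $ i = z * q $ Suc i" for i
    using arg_cong[OF eq, of "\<lambda>h. h $ Suc i"] by (simp add: left_diff_distrib)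
  have "q $ i = z ^ n * q $ (i + n)" for i n
  proof (induction n)
    case (Suc n)
    then have "q $ i = z ^ n * (z * q $ Suc (i + n))" using q[of "i + n"] by (simp only:)
    then show ?case by (simp add: mult_ac)
  qed simp
  then have "z ^ n dvd q $ i" for i n by (metis dvd_triv_left)
  then have "q $ i = 0" for i using adic_separated[OF z] by blast
  then have "q = 0" by (simp add: fps_eq_iff)
  then show "r = 0" using eq by simp
qed

text \<open>Substitution of \<open>z\<close> as the remainder modulo \<open>fps_X - z\<close>, which
  exists and is unique for adic \<open>z\<close>. As a remainder it is visibly a ring
  homomorphism.\<close>

definition eval_at :: "'a::comm_ring_1 \<Rightarrow> 'a fps \<Rightarrow> 'a" where
  "eval_at z h = (THE r. fps_X - fps_const z dvd h - fps_const r)"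

lemma eval_at_eqI:
  assumes z: "adic z" and dvd: "fps_X - fps_const z dvd h - fps_const r"
  shows "eval_at z h = r"
  unfolding eval_at_def
proof (rule the_equality)
  fix r' assume "fps_X - fps_const z dvd h - fps_const r'"
  from dvd_diff[OF dvd this] have "fps_X - fps_const z dvd fps_const (r' - r)" by (simp add: fps_const_sub[symmetric] del: fps_const_sub)
  then show "r' = r" using adic_division_unique[OF z] by fastforce
qed (rule dvd)

lemma eval_at_seq:
  assumes z: "adic z" and b: "\<And>i. b i = h $ i + z * b (Suc i)"
  shows "eval_at z h = b 0"
proof (rule eval_at_eqI[OF z])
  from adic_seq_division[of b h z, OF b] show "fps_X - fps_const z dvd h - fps_const (b 0)"
    by (metis add_diff_cancel_right' dvd_triv_left)
qed

lemma eval_at_dvd: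
  assumes z: "adic z"
  shows "fps_X - fps_const z dvd h - fps_const (eval_at z h)"
proof -
  obtain b where b: "\<And>i. b i = h $ i + z * b (Suc i)" using adic_solution[OF z, of "\<lambda>i. h $ i"] by blast
  from adic_seq_division[of b h z, OF b] have "fps_X - fps_const z dvd h - fps_const (b 0)"
    by (metis add_diff_cancel_right' dvd_triv_left)
  then show ?thesis using eval_at_eqI[OF z] by simp
qed

lemma eval_at_hom: assumes z: "adic z" shows "is_ring_hom (eval_at z)"
proof -
  note d = eval_at_dvd[OF z]
  have "eval_at z 1 = 1" by (rule eval_at_eqI[OF z]) simp
  moreover have "eval_at z (a + b) = eval_at z a + eval_at z b" for a b
    by (rule eval_at_eqI[OF z]) (use dvd_add[OF d[of a] d[of b]] in \<open>simp add: fps_const_add[symmetric] add_diff_add del: fps_const_add\<close>)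
  moreover have "eval_at z (a * b) = eval_at z a * eval_at z b" for a b
  proof (rule eval_at_eqI[OF z])
    have "a * b - fps_const (eval_at z a * eval_at z b) =
      (a - fps_const (eval_at z a)) * b + fps_const (eval_at z a) * (b - fps_const (eval_at z b))"
      by (simp add: fps_const_mult[symmetric] algebra_simps del: fps_const_mult)
    then show "fps_X - fps_const z dvd a * b - fps_const (eval_at z a * eval_at z b)"
      using d[of a] d[of b] by simp
  qed
  ultimately show ?thesis by (simp add: is_ring_hom_def)
qed

lemma eval_at_const: "adic z \<Longrightarrow> eval_at z (fps_const r) = r"
  by (rule eval_at_eqI) simp_all

abbreviation x_coord :: "'k::comm_ring_1 fps fps fps" where
  "x_coord \<equiv> fps_const var_x"

lemma adic_coords: "adic (x_coord :: 'k::comm_ring_1 fps fps fps)" "adic (fps_const (y_coord :: 'k fps fps fps))"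
  by (simp_all add: var_x_def adic_fps_const adic_fps_X)

text \<open>Restriction of a function of \<open>x, y, t, x', y'\<close> to the diagonal \<open>x' = x\<close>, \<open>y' = y\<close>.\<close>

definition on_diagonal :: "'k::comm_ring_1 fps fps fps fps fps \<Rightarrow> 'k fps fps fps" where
  "on_diagonal h = eval_at x_coord (eval_at (fps_const y_coord) h)"

lemma on_diagonal_hom: "is_ring_hom on_diagonal"
proof -
  have "is_ring_hom (\<lambda>h. eval_at x_coord (eval_at (fps_const y_coord) h))"
    by (rule is_ring_hom_comp[OF eval_at_hom[OF adic_coords(1)] eval_at_hom[OF adic_coords(2)]])
  then show ?thesis by (simp add: on_diagonal_def[abs_def])
qed

lemmas on_diagonal_simps = is_ring_homD[OF on_diagonal_hom]

definition dX :: "'k::field fps fps fps fps fps" where "dX = right_copy (fps_const var_x) - left_copy (fps_const var_x)"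
definition dY :: "'k::field fps fps fps fps fps" where "dY = right_copy (fps_const var_y) - left_copy (fps_const var_y)"

lemma OB_embed_nth: "OB_embed c $ n $ j $ i = (if j = 0 \<and> i = 0 then c $ n else 0)"
  by (simp add: OB_embed_def)

lemma right_copy_nth: "right_copy g $ j $ i $ n $ j' $ i' = (if j' = 0 \<and> i' = 0 then g $ n $ j $ i else 0)"
  by (simp add: right_copy_def OB_embed_nth)

lemma fps5_ext: "(\<And>j i n j' i'. f $ j $ i $ n $ j' $ i' = g $ j $ i $ n $ j' $ i') \<Longrightarrow> f = (g :: 'k::zero fps fps fps fps fps)"
  by (simp add: fps_eq_iff)

lemma right_copy_coords:
  "right_copy (fps_const var_x) = (fps_const fps_X :: 'a::field fps fps fps fps fps)"
  "right_copy (fps_const var_y) = (fps_X :: 'a fps fps fps fps fps)"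
proof -
  show "right_copy (fps_const var_x) = (fps_const fps_X :: 'a fps fps fps fps fps)"
    by (rule fps5_ext) (auto simp: right_copy_nth var_x_def fps_X_nth fps_one_nth)
  show "right_copy (fps_const var_y) = (fps_X :: 'a fps fps fps fps fps)"
  proof (rule fps5_ext)
    fix j i n j' i'
    show "right_copy (fps_const var_y) $ j $ i $ n $ j' $ i' = (fps_X :: 'a fps fps fps fps fps) $ j $ i $ n $ j' $ i'"
      by (cases "j = 1"; cases "i = 0"; cases "n = 0"; cases "j' = 0"; simp add: right_copy_nth var_y_def fps_one_nth)
  qed
qed

lemma dX_dY: "dX = fps_const (fps_X - fps_const x_coord)" "dY = fps_X - fps_const (fps_const y_coord)"
  unfolding dX_def dY_def right_copy_coords by (simp_all add: left_copy_def var_y_def)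

lemma left_copy_hom: "is_ring_hom left_copy"
  by (simp add: left_copy_def is_ring_hom_def)

lemma on_diagonal_left: "on_diagonal (left_copy g) = g"
  by (simp add: on_diagonal_def left_copy_def eval_at_const adic_coords)

lemma on_diagonal_dX: "on_diagonal dX = 0"
proof -
  have "eval_at x_coord (fps_X - fps_const x_coord) = (0 :: 'a fps fps fps)"
    by (rule eval_at_eqI) (simp_all add: adic_coords)
  then show ?thesis by (simp add: on_diagonal_def dX_dY eval_at_const adic_coords del: fps_const_sub)
qed

lemma on_diagonal_dY: "on_diagonal dY = 0"
proof -
  have "eval_at (fps_const y_coord) (fps_X - fps_const (fps_const y_coord)) = (0 :: 'a fps fps fps fps)"
    by (rule eval_at_eqI) (simp_all add: adic_coords)
  then show ?thesis
    by (simp add: on_diagonal_def dX_dY is_ring_homD(4)[OF eval_at_hom] adic_coords)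
qed

text \<open>Hadamard's lemma, by division by \<open>dY\<close> and then of the remainder by the
  linear series in \<open>dX\<close>.\<close>

lemma hadamard: "\<exists>a b. h = left_copy (on_diagonal h) + dX * a + dY * b"
proof -
  let ?r = "eval_at (fps_const y_coord) h"
  obtain b where b: "h - fps_const ?r = dY * b"
    using eval_at_dvd[OF adic_coords(2), of h] unfolding dX_dY by (auto elim: dvdE)
  obtain a where a: "?r - fps_const (eval_at x_coord ?r) = (fps_X - fps_const x_coord) * a"
    using eval_at_dvd[OF adic_coords(1), of ?r] by (auto elim: dvdE)
  from arg_cong[OF a, of fps_const] have "fps_const ?r - left_copy (on_diagonal h) = dX * fps_const a"
    by (simp add: dX_dY left_copy_def on_diagonal_def)
  with b have "h = left_copy (on_diagonal h) + dX * fps_const a + dY * b" by (simp add: algebra_simps)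
  then show ?thesis by blast
qed

lemma on_diagonal_right: "on_diagonal (right_copy g) = g"
proof -
  \<comment> \<open>Horner tails of the two substitutions: \<open>b j\<close> sums
    \<open>y^l\<close> times the coefficients of \<open>g\<close> at \<open>y^(j + l)\<close>, and
    \<open>c i\<close> sums \<open>x^m\<close> times those at \<open>x^(i + m)\<close>.\<close>
  define b where "b j = Abs_fps (\<lambda>i. Abs_fps (\<lambda>n. Abs_fps (\<lambda>l. fps_const (g $ n $ (j + l) $ i))))" for j
  define c where "c i = Abs_fps (\<lambda>n. Abs_fps (\<lambda>l. Abs_fps (\<lambda>m. g $ n $ l $ (i + m))))" for i
  have "eval_at (fps_const y_coord) (right_copy g) = b 0"
  proof (rule eval_at_seq[OF adic_coords(2)])
    fix j
    show "b j = right_copy g $ j + fps_const y_coord * b (Suc j)"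
    proof (intro fps_ext)
      fix i n l m
      show "b j $ i $ n $ l $ m = (right_copy g $ j + fps_const y_coord * b (Suc j)) $ i $ n $ l $ m"
        by (cases l; cases m) (simp_all add: b_def right_copy_nth)
    qed
  qed
  moreover have "eval_at x_coord (b 0) = c 0"
  proof (rule eval_at_seq[OF adic_coords(1)])
    fix i
    show "c i = b 0 $ i + x_coord * c (Suc i)"
    proof (intro fps_ext)
      fix n l m
      show "c i $ n $ l $ m = (b 0 $ i + x_coord * c (Suc i)) $ n $ l $ m"
        by (cases m) (simp_all add: b_def c_def var_x_def)
    qed
  qed
  moreover have "c 0 = g" by (intro fps_ext) (simp add: c_def)
  ultimately show ?thesis by (simp add: on_diagonal_def)
qed

abbreviation Dx' :: "'k::comm_ring_1 fps fps fps fps fps \<Rightarrow> 'k fps fps fps fps fps" where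
  "Dx' \<equiv> fps_map fps_deriv"

abbreviation Dy' :: "'k::comm_ring_1 fps fps fps fps fps \<Rightarrow> 'k fps fps fps fps fps" where
  "Dy' \<equiv> fps_deriv"

lemmas Dx'_simps = is_derivationD[OF is_derivation_fps_map[OF is_derivation_fps_deriv]]
lemmas Dy'_simps = is_derivationD[OF is_derivation_fps_deriv]

lemma Dx'_right: "Dx' (right_copy g) = right_copy (Dx g)"
  by (rule fps5_ext) (simp add: right_copy_nth fps_mult_of_nat_nth del: of_nat_Suc of_nat_add)

lemma Dy'_right: "Dy' (right_copy g) = right_copy (Dy g)"
  by (rule fps5_ext) (simp add: right_copy_nth fps_mult_of_nat_nth del: of_nat_Suc of_nat_add)

lemma D'_left: "Dx' (left_copy g) = 0" "Dy' (left_copy g) = 0"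
  by (auto simp: left_copy_def fps_eq_iff)

lemma D'_dX: "Dx' dX = 1" "Dy' dX = 0" "Dx' dY = 0" "Dy' dY = 1"
proof -
  show "Dx' dX = (1 :: 'a fps fps fps fps fps)" by (auto simp: dX_dY fps_eq_iff fps_one_nth)
qed (auto simp: dX_dY fps_eq_iff)

definition taylor :: "nat \<Rightarrow> 'k::field_char_0 fps fps fps fps fps \<Rightarrow> 'k fps fps fps" where
  "taylor m h = vec6 (on_diagonal h) (on_diagonal (Dx' h)) (on_diagonal (Dy' h))
     (\<iota> half * on_diagonal (Dx' (Dx' h))) (on_diagonal (Dx' (Dy' h))) (\<iota> half * on_diagonal (Dy' (Dy' h))) m"

definition jet_monomial :: "nat \<Rightarrow> 'k::field_char_0 fps fps fps fps fps" where
  "jet_monomial = vec6 1 dX dY (dX * dX) (dX * dY) (dY * dY)"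

lemmas jet_simps = on_diagonal_simps(2,3,4,5,6) on_diagonal_left on_diagonal_dX on_diagonal_dY D'_left D'_dX
  Dx'_simps(1-6) Dy'_simps(1-6)

lemma taylor_add: "m < 6 \<Longrightarrow> taylor m (a + b) = taylor m a + taylor m b"
  by (drule less_6_cases, elim disjE) (simp_all add: taylor_def jet_simps distrib_left)

lemma taylor_left: "m < 6 \<Longrightarrow> taylor m (left_copy c * h) = c * taylor m h"
  by (drule less_6_cases, elim disjE) (simp_all add: taylor_def jet_simps mult.left_commute)

lemma taylor_mult:
  "taylor 0 (a * b) = taylor 0 a * taylor 0 b"
  "taylor 1 (a * b) = taylor 1 a * taylor 0 b + taylor 0 a * taylor 1 b"
  "taylor 2 (a * b) = taylor 2 a * taylor 0 b + taylor 0 a * taylor 2 b"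
  "taylor 3 (a * b) = taylor 3 a * taylor 0 b + taylor 1 a * taylor 1 b + taylor 0 a * taylor 3 b"
  "taylor 4 (a * b) = taylor 4 a * taylor 0 b + taylor 1 a * taylor 2 b + taylor 2 a * taylor 1 b + taylor 0 a * taylor 4 b"
  "taylor 5 (a * b) = taylor 5 a * taylor 0 b + taylor 2 a * taylor 2 b + taylor 0 a * taylor 5 b"
proof -
  show "taylor 3 (a * b) = taylor 3 a * taylor 0 b + taylor 1 a * taylor 1 b + taylor 0 a * taylor 3 b"
    by (rule eq_by_lincomb(1)[where ca = "on_diagonal (Dx' a) * on_diagonal (Dx' b)", OF two_half])
      (simp add: taylor_def jet_simps is_ring_hom_numeral[OF on_diagonal_hom] algebra_simps)
  show "taylor 5 (a * b) = taylor 5 a * taylor 0 b + taylor 2 a * taylor 2 b + taylor 0 a * taylor 5 b"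
    by (rule eq_by_lincomb(1)[where ca = "on_diagonal (Dy' a) * on_diagonal (Dy' b)", OF two_half])
      (simp add: taylor_def jet_simps is_ring_hom_numeral[OF on_diagonal_hom] algebra_simps)
qed (simp_all add: taylor_def jet_simps algebra_simps)

lemma taylor_coords:
  "taylor 0 dX = 0" "taylor 1 dX = 1" "taylor 2 dX = 0" "taylor 3 dX = 0" "taylor 4 dX = 0" "taylor 5 dX = 0"
  "taylor 0 dY = 0" "taylor 1 dY = 0" "taylor 2 dY = 1" "taylor 3 dY = 0" "taylor 4 dY = 0" "taylor 5 dY = 0"
  "taylor 0 1 = 1" "taylor 1 1 = 0" "taylor 2 1 = 0" "taylor 3 1 = 0" "taylor 4 1 = 0" "taylor 5 1 = 0"
  by (simp_all add: taylor_def jet_simps on_diagonal_simps(1))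

lemma taylor_right:
  "taylor 0 (right_copy g) = g" "taylor 1 (right_copy g) = Dx g" "taylor 2 (right_copy g) = Dy g"
  "taylor 3 (right_copy g) = \<iota> half * Dx (Dx g)" "taylor 4 (right_copy g) = Dx (Dy g)"
  "taylor 5 (right_copy g) = \<iota> half * Dy (Dy g)"
  by (simp_all add: taylor_def Dx'_right Dy'_right on_diagonal_right)

lemma taylor_jet_monomial:
  assumes "m < 6" "k < 6"
  shows "taylor m (jet_monomial k) = (if m = k then 1 else 0)"
  using less_6_cases[OF assms(1)] less_6_cases[OF assms(2)]
  by (elim disjE) (simp_all add: jet_monomial_def taylor_mult[unfolded One_nat_def] taylor_coords[unfolded One_nat_def])

lemma taylor_cubic:
  assumes "m < 6" "a \<in> {dX, dY}" "b \<in> {dX, dY}" "c \<in> {dX, dY}"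
  shows "taylor m (a * b * c * w) = 0"
proof -
  have 0: "taylor 0 a = 0" "taylor 0 b = 0" "taylor 0 c = 0" using assms taylor_coords by auto
  show ?thesis
    using less_6_cases[OF assms(1)] by (elim disjE) (simp_all add: taylor_mult[unfolded One_nat_def] 0)
qed

lemma sum_less_6: "(\<Sum>i<6. g i) = g (0::nat) + g 1 + g 2 + g 3 + g 4 + (g 5 :: 'a::comm_monoid_add)"
  by (simp add: lessThan_nat_numeral add.commute add.left_commute)

text \<open>Three rounds of \<open>hadamard\<close> expand \<open>h\<close> up to cubic terms. Since
  \<open>taylor\<close> kills cubic terms and separates the jet monomials, applying it to the
  expansion identifies the coefficients.\<close>

lemma taylor_expansion:
  assumes Z: "is_ideal Z" and cubic: "\<And>a b c. a \<in> {dX, dY} \<Longrightarrow> b \<in> {dX, dY} \<Longrightarrow> c \<in> {dX, dY} \<Longrightarrow> a * b * c \<in> Z"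
  shows "h - (\<Sum>m<6. left_copy (taylor m h) * jet_monomial m) \<in> Z"
proof -
  obtain a b where h: "h = left_copy (on_diagonal h) + dX * a + dY * b" using hadamard by blast
  obtain a1 a2 where a: "a = left_copy (on_diagonal a) + dX * a1 + dY * a2" using hadamard by blast
  obtain b1 b2 where b: "b = left_copy (on_diagonal b) + dX * b1 + dY * b2" using hadamard by blast
  obtain a11 a12 where a1: "a1 = left_copy (on_diagonal a1) + dX * a11 + dY * a12" using hadamard by blast
  obtain a21 a22 where a2: "a2 = left_copy (on_diagonal a2) + dX * a21 + dY * a22" using hadamard by blast
  obtain b11 b12 where b1: "b1 = left_copy (on_diagonal b1) + dX * b11 + dY * b12" using hadamard by blast
  obtain b21 b22 where b2: "b2 = left_copy (on_diagonal b2) + dX * b21 + dY * b22" using hadamard by blast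
  define c where "c = vec6 (on_diagonal h) (on_diagonal a) (on_diagonal b) (on_diagonal a1)
    (on_diagonal a2 + on_diagonal b1) (on_diagonal b2)"
  define r where "r = dX * dX * dX * a11 + dX * dX * dY * (a12 + a21 + b11) + dX * dY * dY * (a22 + b12 + b21) + dY * dY * dY * b22"
  have hr: "h = (\<Sum>m<6. left_copy (c m) * jet_monomial m) + r"
    apply (subst h, subst a, subst b, subst a1, subst a2, subst b1, subst b2)
    apply (simp add: sum_less_6 c_def jet_monomial_def r_def is_ring_homD(2)[OF left_copy_hom] algebra_simps)
    done
  have r0: "taylor m r = 0" if "m < 6" for m
    unfolding r_def by (simp only: taylor_add[OF that]) (simp add: taylor_cubic[OF that])
  have "taylor m h = c m" if m: "m < 6" for m
  proof -
    have "taylor m h = (\<Sum>k<6. c k * taylor m (jet_monomial k)) + taylor m r"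
      by (subst hr) (simp only: sum_less_6 taylor_add[OF m] taylor_left[OF m])
    also have "(\<Sum>k<6. c k * taylor m (jet_monomial k)) = (\<Sum>k<6. if k = m then c k else 0)"
      by (intro sum.cong refl) (use m in \<open>simp add: taylor_jet_monomial\<close>)
    also have "\<dots> = c m" using m by simp
    finally show ?thesis using r0[OF m] by simp
  qed
  then have "(\<Sum>m<6. left_copy (taylor m h) * jet_monomial m) = (\<Sum>m<6. left_copy (c m) * jet_monomial m)"
    by (intro sum.cong) auto
  then have "h - (\<Sum>m<6. left_copy (taylor m h) * jet_monomial m) = r" using hr by (metis add_diff_cancel_left')
  moreover have "r \<in> Z"
    unfolding r_def by (intro is_idealD(2)[OF Z] is_idealD(4)[OF Z] cubic) auto
  ultimately show ?thesis by simp
qed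

definition jet_functional :: "(nat \<Rightarrow> 'k::field_char_0 fps fps fps) \<Rightarrow> 'k fps fps fps fps fps \<Rightarrow> 'k fps fps fps" where
  "jet_functional D h = (\<Sum>m<6. taylor m h * D m)"

lemma jet_functional_simps:
  "jet_functional D (a + b) = jet_functional D a + jet_functional D b"
  "jet_functional D (left_copy c * h) = c * jet_functional D h"
  by (simp_all add: jet_functional_def taylor_add taylor_left sum.distrib sum_distrib_left distrib_right mult.assoc)

lemma jet_functional_monomial: "k < 6 \<Longrightarrow> jet_functional D (jet_monomial k) = D k"
proof -
  assume k: "k < 6"
  have "jet_functional D (jet_monomial k) = (\<Sum>m<6. if m = k then D m else 0)"
    unfolding jet_functional_def by (intro sum.cong refl) (use k in \<open>simp add: taylor_jet_monomial\<close>)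
  then show ?thesis using k by simp
qed

text \<open>Leibniz rule: the three brackets are the conditions of \<open>jet_ker\<close>, and the
  choices 1, \<open>dX\<close>, \<open>dY\<close> of \<open>h\<close> recover them one at a time
  modulo \<open>F\<close>.\<close>

lemma jet_functional_right:
  "jet_functional D (right_copy F * h) = F * jet_functional D h +
     taylor 0 h * (Dx F * D 1 + Dy F * D 2 + \<iota> half * Dx (Dx F) * D 3 + Dx (Dy F) * D 4 + \<iota> half * Dy (Dy F) * D 5) +
     taylor 1 h * (Dx F * D 3 + Dy F * D 4) + taylor 2 h * (Dx F * D 4 + Dy F * D 5)"
  unfolding jet_functional_def sum_less_6 taylor_mult taylor_right by (simp add: algebra_simps)

section \<open>The dual of the principal parts\<close>

lemma module_dual:
  assumes R: "cring R" and M: "module R M"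
  shows "module R (dual_module R M)"
proof -
  interpret R: cring R by (rule R)
  interpret M: module R M by (rule M)
  let ?D = "dual_module R M"
  have hom: "\<phi> \<in> module_hom R M (restrict_scalars (\<lambda>c. c) R) \<longleftrightarrow>
      \<phi> \<in> carrier M \<rightarrow> carrier R \<and> (\<forall>x\<in>carrier M. \<forall>y\<in>carrier M. \<phi> (x \<oplus>\<^bsub>M\<^esub> y) = \<phi> x \<oplus>\<^bsub>R\<^esub> \<phi> y) \<and>
      (\<forall>c\<in>carrier R. \<forall>x\<in>carrier M. \<phi> (c \<odot>\<^bsub>M\<^esub> x) = c \<otimes>\<^bsub>R\<^esub> \<phi> x)" for \<phi>
    unfolding module_hom_def restrict_scalars_def by auto
  have car: "\<phi> \<in> carrier ?D \<longleftrightarrow> \<phi> \<in> carrier M \<rightarrow> carrier R \<and> (\<forall>x\<in>carrier M. \<forall>y\<in>carrier M. \<phi> (x \<oplus>\<^bsub>M\<^esub> y) = \<phi> x \<oplus>\<^bsub>R\<^esub> \<phi> y) \<and>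
      (\<forall>c\<in>carrier R. \<forall>x\<in>carrier M. \<phi> (c \<odot>\<^bsub>M\<^esub> x) = c \<otimes>\<^bsub>R\<^esub> \<phi> x) \<and> \<phi> \<in> extensional (carrier M)" for \<phi>
    unfolding dual_module_def using hom by auto
  have val: "\<phi> \<in> carrier ?D \<Longrightarrow> x \<in> carrier M \<Longrightarrow> \<phi> x \<in> carrier R" for \<phi> x
    unfolding car by auto
  have ext: "\<phi> \<in> carrier ?D \<Longrightarrow> \<phi> \<in> extensional (carrier M)" for \<phi> unfolding car by blast
  have ops: "\<zero>\<^bsub>?D\<^esub> = (\<lambda>x\<in>carrier M. \<zero>\<^bsub>R\<^esub>)" "\<phi> \<oplus>\<^bsub>?D\<^esub> \<psi> = (\<lambda>x\<in>carrier M. \<phi> x \<oplus>\<^bsub>R\<^esub> \<psi> x)"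
    "c \<odot>\<^bsub>?D\<^esub> \<phi> = (\<lambda>x\<in>carrier M. c \<otimes>\<^bsub>R\<^esub> \<phi> x)" for \<phi> \<psi> c
    by (simp_all add: dual_module_def)
  have zero: "\<zero>\<^bsub>?D\<^esub> \<in> carrier ?D" unfolding car ops by auto
  have add: "\<phi> \<oplus>\<^bsub>?D\<^esub> \<psi> \<in> carrier ?D" if "\<phi> \<in> carrier ?D" "\<psi> \<in> carrier ?D" for \<phi> \<psi>
    using that val[OF that(1)] val[OF that(2)] unfolding car ops
    by (auto simp: R.a_assoc R.a_comm R.a_lcomm R.r_distr)
  have smult: "c \<odot>\<^bsub>?D\<^esub> \<phi> \<in> carrier ?D" if "c \<in> carrier R" "\<phi> \<in> carrier ?D" for c \<phi>
    using that val[OF that(2)] unfolding car ops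
    by (auto simp: R.m_assoc R.m_comm R.m_lcomm R.r_distr)
  have neg: "\<phi> \<oplus>\<^bsub>?D\<^esub> (\<ominus>\<^bsub>R\<^esub> \<one>\<^bsub>R\<^esub> \<odot>\<^bsub>?D\<^esub> \<phi>) = \<zero>\<^bsub>?D\<^esub>" if "\<phi> \<in> carrier ?D" for \<phi>
    unfolding ops by (rule restrict_ext) (use val[OF that] in \<open>simp add: R.l_minus R.r_neg\<close>)
  show ?thesis
  proof (rule module_criteria[OF R zero])
    show "\<forall>v w. v \<in> carrier ?D \<and> w \<in> carrier ?D \<longrightarrow> v \<oplus>\<^bsub>?D\<^esub> w \<in> carrier ?D" using add by blast
    show "\<forall>v\<in>carrier ?D. \<exists>n\<in>carrier ?D. v \<oplus>\<^bsub>?D\<^esub> n = \<zero>\<^bsub>?D\<^esub>" using neg smult by (meson R.a_inv_closed R.one_closed)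
    show "\<forall>c v. c \<in> carrier R \<and> v \<in> carrier ?D \<longrightarrow> c \<odot>\<^bsub>?D\<^esub> v \<in> carrier ?D" using smult by blast
    show "\<forall>v w. v \<in> carrier ?D \<and> w \<in> carrier ?D \<longrightarrow> v \<oplus>\<^bsub>?D\<^esub> w = w \<oplus>\<^bsub>?D\<^esub> v"
      unfolding ops by (auto intro!: restrict_ext R.a_comm val)
    show "\<forall>v w x. v \<in> carrier ?D \<and> w \<in> carrier ?D \<and> x \<in> carrier ?D \<longrightarrow>
        v \<oplus>\<^bsub>?D\<^esub> w \<oplus>\<^bsub>?D\<^esub> x = v \<oplus>\<^bsub>?D\<^esub> (w \<oplus>\<^bsub>?D\<^esub> x)"
      unfolding ops by (auto intro!: restrict_ext R.a_assoc val)
    show "\<forall>v\<in>carrier ?D. v \<oplus>\<^bsub>?D\<^esub> \<zero>\<^bsub>?D\<^esub> = v"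
      unfolding ops using ext by (auto intro!: extensionalityI[of _ "carrier M"] simp: val)
    show "\<forall>a b v. a \<in> carrier R \<and> b \<in> carrier R \<and> v \<in> carrier ?D \<longrightarrow>
        a \<otimes>\<^bsub>R\<^esub> b \<odot>\<^bsub>?D\<^esub> v = a \<odot>\<^bsub>?D\<^esub> (b \<odot>\<^bsub>?D\<^esub> v)"
      unfolding ops by (auto intro!: restrict_ext simp: R.m_assoc val)
    show "\<forall>v\<in>carrier ?D. \<one>\<^bsub>R\<^esub> \<odot>\<^bsub>?D\<^esub> v = v"
      unfolding ops using ext by (auto intro!: extensionalityI[of _ "carrier M"] simp: val)
    show "\<forall>a b v. a \<in> carrier R \<and> b \<in> carrier R \<and> v \<in> carrier ?D \<longrightarrow>
        (a \<oplus>\<^bsub>R\<^esub> b) \<odot>\<^bsub>?D\<^esub> v = a \<odot>\<^bsub>?D\<^esub> v \<oplus>\<^bsub>?D\<^esub> b \<odot>\<^bsub>?D\<^esub> v"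
      unfolding ops by (auto intro!: restrict_ext simp: R.l_distr val)
    show "\<forall>a v w. a \<in> carrier R \<and> v \<in> carrier ?D \<and> w \<in> carrier ?D \<longrightarrow>
        a \<odot>\<^bsub>?D\<^esub> (v \<oplus>\<^bsub>?D\<^esub> w) = a \<odot>\<^bsub>?D\<^esub> v \<oplus>\<^bsub>?D\<^esub> a \<odot>\<^bsub>?D\<^esub> w"
      unfolding ops by (auto intro!: restrict_ext simp: R.r_distr val)
  qed
qed

section \<open>Determinants in a ring and in its quotients\<close>

definition type_det :: "nat \<Rightarrow> (nat \<Rightarrow> nat \<Rightarrow> 'a::comm_ring_1) \<Rightarrow> 'a" where
  "type_det n M = (\<Sum>p | p permutes {..<n}. of_int (sign p) * (\<Prod>i<n. M i (p i)))"

lemma ring_det_quot: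
  assumes q: "quot_map Q q Z" and N: "\<And>i j. i < n \<Longrightarrow> j < n \<Longrightarrow> N i j = q (M i j)"
  shows "ring_det Q n N = q (type_det n M)"
proof -
  interpret cring Q by (rule quot_mapD(1)[OF q])
  note D = quot_mapD[OF q]
  have prod: "finprod Q (\<lambda>i. q (w i)) I = q (prod w I)" if "finite I" for w and I :: "'i set"
    using that by induction (simp_all add: D(4,5,7))
  have sum: "finsum Q (\<lambda>i. q (w i)) I = q (sum w I)" if "finite I" for w and I :: "'i set"
    using that by induction (simp_all add: D(3,7,8))
  have sgn: "add_pow Q (sign p :: int) (q a) = q (of_int (sign p) * a)" for p :: "nat \<Rightarrow> nat" and a
    by (cases p rule: sign_cases) (simp_all add: add.int_pow_neg[of _ 1] D(7,9))
  have "ring_det Q n N = ring_det Q n (\<lambda>i j. q (M i j))"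
    unfolding ring_det_def
  proof (rule finsum_cong'[OF refl])
    fix p assume "p \<in> {p. p permutes {..<n}}"
    then have "p i < n" if "i < n" for i using that permutes_in_image[of p "{..<n}" i] by simp
    then have "finprod Q (\<lambda>i. N i (p i)) {..<n} = finprod Q (\<lambda>i. q (M i (p i))) {..<n}"
      using N by (intro finprod_cong') (auto simp: D(7))
    then show "add_pow Q (sign p :: int) (finprod Q (\<lambda>i. N i (p i)) {..<n}) =
        add_pow Q (sign p :: int) (finprod Q (\<lambda>i. q (M i (p i))) {..<n})" by simp
  qed (simp add: prod sgn D(7))
  then show ?thesis
    unfolding ring_det_def type_det_def by (simp add: prod sgn sum finite_permutations)
qed

lemma type_det_3: "type_det 3 M = M 0 0 * M 1 1 * M 2 2 + M 0 1 * M 1 2 * M 2 0 + M 0 2 * M 1 0 * M 2 1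
   - M 0 0 * M 1 2 * M 2 1 - M 0 1 * M 1 0 * M 2 2 - M 0 2 * M 1 1 * M 2 0"
proof -
  have set: "{..<3::nat} = insert 0 (insert 1 (insert 2 {}))" by auto
  show ?thesis
    unfolding type_det_def set
    by (subst sum_over_permutations_insert, simp, simp)+
      (simp add: permutes_sing sign_compose permutation_swap_id sign_swap_id sign_id transpose_def algebra_simps)
qed

lemma type_det_mult_3:
  "type_det 3 (\<lambda>i j. \<Sum>k<3. A i k * B k j) = type_det 3 A * type_det 3 (B :: nat \<Rightarrow> nat \<Rightarrow> 'a::comm_ring_1)"
  unfolding type_det_3 sum_less_3 by (simp add: algebra_simps)

lemma type_det_3_cong:
  assumes "\<And>i j. i < 3 \<Longrightarrow> j < 3 \<Longrightarrow> F dvd M i j - N i j"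
  shows "F dvd type_det 3 M - type_det 3 (N :: nat \<Rightarrow> nat \<Rightarrow> 'a::comm_ring_1)"
proof -
  have "F dvd a * b * c - a' * b' * c'" if "F dvd a - a'" "F dvd b - b'" "F dvd c - c'" for a b c a' b' c' :: 'a
  proof -
    have "a * b * c - a' * b' * c' = (a - a') * b * c + a' * (b - b') * c + a' * b' * (c - c')"
      by (simp add: algebra_simps)
    then show ?thesis using that by simp
  qed
  note t = this[OF assms assms assms]
  have "F dvd (M 0 0 * M 1 1 * M 2 2 - N 0 0 * N 1 1 * N 2 2) + (M 0 1 * M 1 2 * M 2 0 - N 0 1 * N 1 2 * N 2 0)
      + (M 0 2 * M 1 0 * M 2 1 - N 0 2 * N 1 0 * N 2 1)
      - (M 0 0 * M 1 2 * M 2 1 - N 0 0 * N 1 2 * N 2 1) - (M 0 1 * M 1 0 * M 2 2 - N 0 1 * N 1 0 * N 2 2)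
      - (M 0 2 * M 1 1 * M 2 0 - N 0 2 * N 1 1 * N 2 0)"
    by (intro dvd_add dvd_diff t) simp_all
  then show ?thesis unfolding type_det_3 by (simp add: algebra_simps)
qed

lemma finite_products: "finite G \<Longrightarrow> finite H \<Longrightarrow> finite {g * h | g h. g \<in> G \<and> h \<in> H}"
  using finite_image_set2[of "\<lambda>g. g \<in> G" "\<lambda>h. h \<in> H" "(*)"] by simp

definition cubics :: "'k::field_char_0 fps fps fps fps fps set" where
  "cubics = {a * b * c | a b c. a \<in> {dX, dY} \<and> b \<in> {dX, dY} \<and> c \<in> {dX, dY}}"

text \<open>The representatives of zero in the third principal parts, where the cube of the diagonal
  ideal is divided out.\<close>

definition pp_zero :: "'k::field_char_0 fps fps fps \<Rightarrow> 'k fps fps fps fps fps set" where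
  "pp_zero F = ideal_gen (ideal_gen {0} {left_copy F, right_copy F}) cubics"

definition pp_class :: "'k::field_char_0 fps fps fps \<Rightarrow> 'k fps fps fps fps fps \<Rightarrow> 'k fps fps fps fps fps set set" where
  "pp_class F h = diagonal_power 3 F +>\<^bsub>OXX F\<^esub> OXX_class F h"

lemma quot_map_OXX: "quot_map (OXX F) (OXX_class F) (ideal_gen {0} {left_copy F, right_copy F})"
  using quot_map_type_Quot[of "{left_copy F, right_copy F}"] unfolding OXX_def OXX_class_def OXX_ideal_def by simp

lemma diagonal_power_3:
  fixes F :: "'k::field_char_0 fps fps fps"
  shows "diagonal_power 3 F = OXX_class F ` pp_zero F"
proof -
  note q = quot_map_OXX[of F]
  interpret cring "OXX F" by (rule quot_mapD(1)[OF q])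
  let ?Z = "ideal_gen {0} {left_copy F, right_copy F}"
  note Zi = quot_map_is_ideal[OF q]
  have "{OXX_class F (right_copy (fps_const v) - left_copy (fps_const v)) | v. v \<in> {var_x, var_y}} = OXX_class F ` {dX, dY}"
    by (auto simp: dX_def dY_def)
  then have I: "diagonal_ideal F = OXX_class F ` ideal_gen ?Z {dX, dY}"
    unfolding diagonal_ideal_def using genideal_quot[OF q, of "{dX, dY}"] by simp
  have ideal: "ideal (diagonal_ideal F) (OXX F)"
    unfolding I by (intro image_ideal[OF q] ideal_gen_is_ideal[OF Zi])
  \<comment> \<open>Powers in the monoid of ideals start from the unit ideal, the whole carrier,
    which has to be absorbed.\<close>
  have one: "ideal_prod (OXX F) (carrier (OXX F)) (diagonal_ideal F) = diagonal_ideal F"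
    using ideal_prod_commute[OF oneideal ideal] ideal_prod_one[OF ideal] by simp
  have "diagonal_power 3 F = ideal_prod (OXX F) (ideal_prod (OXX F) (diagonal_ideal F) (diagonal_ideal F)) (diagonal_ideal F)"
    unfolding diagonal_power_def by (simp add: numeral_3_eq_3 ideals_set_def one)
  also have "\<dots> = OXX_class F ` ideal_gen ?Z {g * h | g h. g \<in> {g * h | g h. g \<in> {dX, dY} \<and> h \<in> {dX, dY}} \<and> h \<in> {dX, dY}}"
  proof -
    let ?GG = "{g * h | g h. g \<in> {dX, dY :: 'k fps fps fps fps fps} \<and> h \<in> {dX, dY}}"
    have fin: "finite ?GG" by (rule finite_products) simp_all
    have "ideal_prod (OXX F) (diagonal_ideal F) (diagonal_ideal F) = OXX_class F ` ideal_gen ?Z ?GG"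
      unfolding I by (rule ideal_prod_quot[OF q]) simp_all
    then show ?thesis
      unfolding I by (simp only:) (rule ideal_prod_quot[OF q fin], simp)
  qed
  also have "{g * h | g h. g \<in> {g * h | g h. g \<in> {dX, dY} \<and> h \<in> {dX, dY}} \<and> h \<in> {dX, dY}} = cubics"
    unfolding cubics_def by blast
  finally show ?thesis by (simp add: pp_zero_def)
qed

lemma finite_cubics: "finite cubics"
proof -
  have "cubics = (\<lambda>(a, b, c). a * b * c) ` ({dX, dY} \<times> {dX, dY} \<times> {dX, dY})"
    unfolding cubics_def by force
  then show ?thesis by (metis finite.emptyI finite.insertI finite_cartesian_product finite_imageI)
qed

lemma pp_zero_ideal: "is_ideal (pp_zero F)"
  unfolding pp_zero_def by (rule ideal_gen_is_ideal[OF quot_map_is_ideal[OF quot_map_OXX]])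

lemma pp_zero_supset:
  "left_copy F \<in> pp_zero F" "right_copy F \<in> pp_zero F" "cubics \<subseteq> pp_zero F"
  "ideal_gen {0} {left_copy F, right_copy F} \<subseteq> pp_zero F"
proof -
  note Zi = quot_map_is_ideal[OF quot_map_OXX[of F]]
  have "is_ideal {0 :: 'a fps fps fps fps fps}" by (simp add: is_ideal_def)
  from ideal_gen_supset[OF this, of "{left_copy F, right_copy F}"]
  have "{left_copy F, right_copy F} \<subseteq> ideal_gen {0} {left_copy F, right_copy F}" by simp
  with ideal_gen_supset[OF Zi finite_cubics]
  show "left_copy F \<in> pp_zero F" "right_copy F \<in> pp_zero F" "cubics \<subseteq> pp_zero F"
    "ideal_gen {0} {left_copy F, right_copy F} \<subseteq> pp_zero F" unfolding pp_zero_def by auto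
qed

lemma pp_zero_minimal:
  assumes "is_ideal W" "left_copy F \<in> W" "right_copy F \<in> W" "cubics \<subseteq> W"
  shows "pp_zero F \<subseteq> W"
  unfolding pp_zero_def using assms is_idealD(1)[OF assms(1)]
  by (intro ideal_gen_minimal) auto

lemma quot_map_pp: "quot_map (OXX F Quot diagonal_power 3 F) (pp_class F) (pp_zero F)"
proof -
  note q = quot_map_OXX[of F]
  have "quot_map (OXX F Quot diagonal_power 3 F) (pp_class F) {h. OXX_class F h \<in> diagonal_power 3 F}"
    unfolding pp_class_def[abs_def]
    by (rule quot_map_Quot[OF q]) (simp add: diagonal_power_3 image_ideal[OF q pp_zero_ideal])
  moreover have "{h. OXX_class F h \<in> diagonal_power 3 F} = pp_zero F"
    unfolding diagonal_power_3 using image_mem_iff[OF q pp_zero_ideal pp_zero_supset(4)] by auto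
  ultimately show ?thesis by simp
qed

lemma left_factor_class:
  fixes F :: "'k::field_char_0 fps fps fps"
  shows "left_factor 3 F (OX_class F g) = pp_class F (left_copy g)"
proof -
  note q = quot_map_OXX[of F]
  interpret cring "type_ring :: 'k fps fps fps ring" by (rule cring_type_ring)
  have I: "Idl\<^bsub>type_ring\<^esub> {F} = {a. F dvd a}"
    using genideal_quot[OF quot_map_id, of "{F}"] ideal_gen_0_single[of F] by simp
  have mem: "g' \<in> OX_class F g \<longleftrightarrow> F dvd g' - g" for g'
  proof -
    have "g' \<in> OX_class F g \<longleftrightarrow> (\<exists>h. F dvd h \<and> g' = h + g)" unfolding OX_class_def I a_r_coset_def' by auto
    also have "\<dots> \<longleftrightarrow> F dvd g' - g" by (metis add_diff_cancel_right' diff_add_cancel)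
    finally show ?thesis .
  qed
  then have "F dvd (SOME g'. g' \<in> OX_class F g) - g" using someI[of "\<lambda>g'. g' \<in> OX_class F g" g] by simp
  then obtain u where u: "(SOME g'. g' \<in> OX_class F g) - g = F * u" ..
  have "left_copy (SOME g'. g' \<in> OX_class F g) - left_copy g = left_copy F * left_copy u"
    using u by (metis is_ring_homD(3,6)[OF left_copy_hom])
  also have "\<dots> \<in> pp_zero F" by (intro is_idealD(4)[OF pp_zero_ideal] pp_zero_supset)
  finally show ?thesis
    unfolding left_factor_def pp_class_def[symmetric] quot_mapD(10)[OF quot_map_pp] .
qed

lemma module_pp:
  fixes F :: "'k::field_char_0 fps fps fps"
  shows "module (OX F) (principal_parts 3 F)"
  unfolding principal_parts_def
proof (rule module_restrict_scalars)
  show "cring (OX F)" "cring (OXX F Quot diagonal_power 3 F)"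
    by (rule quot_mapD(1)[OF quot_map_OX] quot_mapD(1)[OF quot_map_pp])+
  note q = quot_map_OX[of F] and q' = quot_map_pp[of F]
  have rep: "\<exists>g. x = OX_class F g" if "x \<in> carrier (OX F)" for x
    using that quot_mapD(2)[OF q] by (metis rangeE)
  show "left_factor 3 F \<in> ring_hom (OX F) (OXX F Quot diagonal_power 3 F)"
  proof (rule ring_hom_memI)
    fix x y assume "x \<in> carrier (OX F)" "y \<in> carrier (OX F)"
    then obtain a b where [simp]: "x = OX_class F a" "y = OX_class F b" using rep by blast
    show "left_factor 3 F x \<in> carrier (OXX F Quot diagonal_power 3 F)" by (simp add: left_factor_class quot_mapD(7)[OF q'])
    show "left_factor 3 F (x \<otimes>\<^bsub>OX F\<^esub> y) = left_factor 3 F x \<otimes>\<^bsub>OXX F Quot diagonal_power 3 F\<^esub> left_factor 3 F y"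
      by (simp add: quot_mapD(4)[OF q, symmetric] left_factor_class quot_mapD(4)[OF q', symmetric] is_ring_homD[OF left_copy_hom])
    show "left_factor 3 F (x \<oplus>\<^bsub>OX F\<^esub> y) = left_factor 3 F x \<oplus>\<^bsub>OXX F Quot diagonal_power 3 F\<^esub> left_factor 3 F y"
      by (simp add: quot_mapD(3)[OF q, symmetric] left_factor_class quot_mapD(3)[OF q', symmetric] is_ring_homD[OF left_copy_hom])
  next
    show "left_factor 3 F \<one>\<^bsub>OX F\<^esub> = \<one>\<^bsub>OXX F Quot diagonal_power 3 F\<^esub>"
      by (simp add: quot_mapD(5)[OF q, symmetric] left_factor_class quot_mapD(5)[OF q', symmetric] is_ring_homD[OF left_copy_hom])
  qed
qed

lemma pp_simps:
  fixes F :: "'k::field_char_0 fps fps fps"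
  shows
  "carrier (principal_parts 3 F) = range (pp_class F)"
  "pp_class F a \<oplus>\<^bsub>principal_parts 3 F\<^esub> pp_class F b = pp_class F (a + b)"
  "OX_class F g \<odot>\<^bsub>principal_parts 3 F\<^esub> pp_class F a = pp_class F (left_copy g * a)"
  using quot_mapD(2-4)[OF quot_map_pp[of F]]
  by (simp_all add: principal_parts_def restrict_scalars_def left_factor_class)

lemma jet_functional_vanishes:
  assumes D: "jet_ker F F D" and h: "h \<in> pp_zero F"
  shows "F dvd jet_functional D h"
proof -
  \<comment> \<open>\<open>W\<close> is closed under multiples by construction, so it is an ideal
    and only the generators of \<open>pp_zero F\<close> have to be tested.\<close>
  define W where "W = {h. \<forall>w. F dvd jet_functional D (h * w)}"
  have "is_ideal W"
    unfolding is_ideal_def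
  proof (intro conjI ballI allI)
    have "jet_functional D 0 = 0" using jet_functional_simps(1)[of D 0 0] by simp
    then show "0 \<in> W" by (simp add: W_def)
  qed (auto simp: W_def distrib_right jet_functional_simps mult.assoc mult.left_commute)
  moreover have "left_copy F \<in> W" by (simp add: W_def jet_functional_simps)
  moreover have "right_copy F \<in> W"
    using D unfolding jet_ker_def by (auto simp: W_def jet_functional_right intro!: dvd_add)
  moreover have "cubics \<subseteq> W"
  proof
    fix z :: "'a fps fps fps fps fps" assume "z \<in> cubics"
    then obtain a b c where "z = a * b * c" "a \<in> {dX, dY}" "b \<in> {dX, dY}" "c \<in> {dX, dY}"
      unfolding cubics_def by blast
    then have "jet_functional D (z * w) = 0" for w
      unfolding jet_functional_def by (intro sum.neutral ballI) (simp only: taylor_cubic lessThan_iff mult_zero_left)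
    then show "z \<in> W" by (simp add: W_def)
  qed
  ultimately have "pp_zero F \<subseteq> W" by (rule pp_zero_minimal)
  with h have "F dvd jet_functional D (h * 1)" unfolding W_def by blast
  then show ?thesis by simp
qed

text \<open>The value is taken on a chosen representative; for \<open>D\<close> in
  \<open>jet_ker F F\<close> it does not depend on the choice
  (\<open>dual_elt_class\<close>).\<close>

definition dual_elt :: "'k::field_char_0 fps fps fps \<Rightarrow> (nat \<Rightarrow> 'k fps fps fps) \<Rightarrow>
    'k fps fps fps fps fps set set \<Rightarrow> 'k fps fps fps set" where
  "dual_elt F D = (\<lambda>x\<in>carrier (principal_parts 3 F). OX_class F (jet_functional D (SOME h. pp_class F h = x)))"

lemma dual_elt_class:
  assumes D: "jet_ker F F D"
  shows "dual_elt F D (pp_class F h) = OX_class F (jet_functional D h)"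
proof -
  define h' where "h' = (SOME h'. pp_class F h' = pp_class F h)"
  have "pp_class F h' = pp_class F h" unfolding h'_def by (rule someI[of _ h]) simp
  then have "h' - h \<in> pp_zero F" by (simp only: quot_mapD(10)[OF quot_map_pp])
  from jet_functional_vanishes[OF D this] have "F dvd jet_functional D (h' - h)" .
  moreover have "jet_functional D h' = jet_functional D (h' - h) + jet_functional D h"
    by (simp flip: jet_functional_simps(1))
  ultimately have "F dvd jet_functional D h' - jet_functional D h" by simp
  then have "OX_class F (jet_functional D h') = OX_class F (jet_functional D h)"
    by (simp add: quot_mapD(10)[OF quot_map_OX])
  then show ?thesis by (simp add: dual_elt_def pp_simps h'_def)
qed

abbreviation pp_dual :: "'k::field_char_0 fps fps fps \<Rightarrow> ('k fps fps fps set, 'k fps fps fps fps fps set set \<Rightarrow> 'k fps fps fps set) module" where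
  "pp_dual F \<equiv> dual_module (OX F) (principal_parts 3 F)"

lemma OX_rep: "x \<in> carrier (OX F) \<Longrightarrow> \<exists>g. x = OX_class F g"
  using quot_mapD(2)[OF quot_map_OX] by (metis rangeE)

lemma pp_dual_carrier:
  "\<phi> \<in> carrier (pp_dual F) \<longleftrightarrow> \<phi> \<in> extensional (range (pp_class F)) \<and> (\<forall>h. \<phi> (pp_class F h) \<in> carrier (OX F)) \<and>
     (\<forall>a b. \<phi> (pp_class F (a + b)) = \<phi> (pp_class F a) \<oplus>\<^bsub>OX F\<^esub> \<phi> (pp_class F b)) \<and>
     (\<forall>g a. \<phi> (pp_class F (left_copy g * a)) = OX_class F g \<otimes>\<^bsub>OX F\<^esub> \<phi> (pp_class F a))"
  unfolding dual_module_def module_hom_def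
  by (auto simp: pp_simps restrict_scalars_def quot_mapD(2)[OF quot_map_OX, symmetric] simp flip: pp_simps(2,3))

lemma dual_elt_carrier:
  assumes D: "jet_ker F F D"
  shows "dual_elt F D \<in> carrier (pp_dual F)"
  unfolding pp_dual_carrier dual_elt_class[OF D] jet_functional_simps
  by (simp add: quot_mapD(3,4,7)[OF quot_map_OX]) (simp add: dual_elt_def pp_simps)

lemma dual_elt_eqI:
  assumes "\<phi> \<in> carrier (pp_dual F)" "\<psi> \<in> carrier (pp_dual F)" "\<And>h. \<phi> (pp_class F h) = \<psi> (pp_class F h)"
  shows "\<phi> = \<psi>"
  using assms by (intro extensionalityI[of _ "range (pp_class F)"]) (auto simp: pp_dual_carrier)

lemma jet_functional_linear:
  "jet_functional (\<lambda>m. \<Sum>i\<in>I. g i * D i m) h = (\<Sum>i\<in>I. g i * jet_functional (D i) h)"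
  unfolding jet_functional_def sum_distrib_left sum.swap[of _ I] by (intro sum.cong refl) (simp add: mult_ac)

lemma dual_elt_eq_iff:
  assumes D: "jet_ker F F D" and D': "jet_ker F F D'"
  shows "dual_elt F D = dual_elt F D' \<longleftrightarrow> (\<forall>m<6. F dvd D m - D' m)"
proof
  assume eq: "dual_elt F D = dual_elt F D'"
  show "\<forall>m<6. F dvd D m - D' m"
  proof (intro allI impI)
    fix m :: nat assume m: "m < 6"
    from fun_cong[OF eq, of "pp_class F (jet_monomial m)"] show "F dvd D m - D' m"
      unfolding dual_elt_class[OF D] dual_elt_class[OF D'] jet_functional_monomial[OF m]
      by (simp add: quot_mapD(10)[OF quot_map_OX])
  qed
next
  assume eq: "\<forall>m<6. F dvd D m - D' m"
  show "dual_elt F D = dual_elt F D'"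
  proof (rule dual_elt_eqI[OF dual_elt_carrier[OF D] dual_elt_carrier[OF D']])
    fix h
    have "jet_functional D h - jet_functional D' h = (\<Sum>m<6. taylor m h * (D m - D' m))"
      by (simp add: jet_functional_def sum_subtractf right_diff_distrib)
    also have "F dvd \<dots>" using eq by (intro dvd_sum) auto
    finally show "dual_elt F D (pp_class F h) = dual_elt F D' (pp_class F h)"
      unfolding dual_elt_class[OF D] dual_elt_class[OF D'] by (simp add: quot_mapD(10)[OF quot_map_OX])
  qed
qed

lemma jet_ker_sum:
  assumes "\<And>i. i \<in> I \<Longrightarrow> jet_ker F F (D i)"
  shows "jet_ker F F (\<lambda>m. \<Sum>i\<in>I. g i * D i m)"
proof -
  have 2: "F dvd a * (\<Sum>i\<in>I. g i * D i m) + b * (\<Sum>i\<in>I. g i * D i m')"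
    if "\<And>i. i \<in> I \<Longrightarrow> F dvd a * D i m + b * D i m'" for a b m m'
  proof -
    have "a * (\<Sum>i\<in>I. g i * D i m) + b * (\<Sum>i\<in>I. g i * D i m') = (\<Sum>i\<in>I. g i * (a * D i m + b * D i m'))"
      by (simp add: sum_distrib_left sum.distrib[symmetric] algebra_simps)
    then show ?thesis using that by (simp add: dvd_sum)
  qed
  have "Dx F * (\<Sum>i\<in>I. g i * D i 1) + Dy F * (\<Sum>i\<in>I. g i * D i 2) + \<iota> half * Dx (Dx F) * (\<Sum>i\<in>I. g i * D i 3) +
      Dx (Dy F) * (\<Sum>i\<in>I. g i * D i 4) + \<iota> half * Dy (Dy F) * (\<Sum>i\<in>I. g i * D i 5) =
    (\<Sum>i\<in>I. g i * (Dx F * D i 1 + Dy F * D i 2 + \<iota> half * Dx (Dx F) * D i 3 + Dx (Dy F) * D i 4 + \<iota> half * Dy (Dy F) * D i 5))"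
    by (simp add: sum_distrib_left sum.distrib[symmetric] algebra_simps)
  moreover have "F dvd \<dots>" using assms by (intro dvd_sum) (auto simp: jet_ker_def)
  ultimately show ?thesis using assms unfolding jet_ker_def by (auto intro!: 2)
qed

text \<open>\<open>D\<close> lists the values on the jet monomials, and linearity with the Taylor
  expansion determines all others. Annihilation of \<open>right_copy F\<close> times 1,
  \<open>dX\<close> and \<open>dY\<close> gives the three conditions on \<open>D\<close>.\<close>

lemma dual_elt_surj:
  assumes \<phi>: "\<phi> \<in> carrier (pp_dual F)"
  obtains D where "jet_ker F F D" "\<phi> = dual_elt F D"
proof -
  note q = quot_map_OX[of F]
  interpret cring "OX F" by (rule quot_mapD(1)[OF q])
  have "\<forall>m. \<exists>d. \<phi> (pp_class F (jet_monomial m)) = OX_class F d"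
    using \<phi> OX_rep unfolding pp_dual_carrier by blast
  from choice[OF this] obtain D where D: "\<And>m. \<phi> (pp_class F (jet_monomial m)) = OX_class F (D m)" by blast
  have add: "\<phi> (pp_class F (a + b)) = \<phi> (pp_class F a) \<oplus>\<^bsub>OX F\<^esub> \<phi> (pp_class F b)"
    and smult: "\<phi> (pp_class F (left_copy g * a)) = OX_class F g \<otimes>\<^bsub>OX F\<^esub> \<phi> (pp_class F a)" for a b g
    using \<phi> unfolding pp_dual_carrier by blast+
  have val: "\<phi> (pp_class F h) = OX_class F (jet_functional D h)" for h
  proof -
    have "h - (\<Sum>m<6. left_copy (taylor m h) * jet_monomial m) \<in> pp_zero F"
      by (rule taylor_expansion[OF pp_zero_ideal]) (use pp_zero_supset(3)[of F] in \<open>auto simp: cubics_def\<close>)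
    then have "pp_class F h = pp_class F (\<Sum>m<6. left_copy (taylor m h) * jet_monomial m)"
      by (simp only: quot_mapD(10)[OF quot_map_pp])
    then show ?thesis
      unfolding jet_functional_def sum_less_6
      by (simp only: add smult D quot_mapD(3,4)[OF q])
  qed
  have zero: "F dvd jet_functional D h" if "h \<in> pp_zero F" for h
  proof -
    have "pp_class F h = pp_class F 0" using that by (simp add: quot_mapD(10)[OF quot_map_pp])
    then have "OX_class F (jet_functional D h) = OX_class F (jet_functional D 0)" by (metis val)
    moreover have "jet_functional D 0 = 0" using jet_functional_simps(1)[of D 0 0] by simp
    ultimately show ?thesis by (simp add: quot_mapD(10)[OF q])
  qed
  have r: "F dvd jet_functional D (right_copy F * w)" for w
    by (rule zero) (intro is_idealD(4)[OF pp_zero_ideal] pp_zero_supset)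
  have "jet_ker F F D"
    using r[of 1] r[of dX] r[of dY]
    unfolding jet_ker_def jet_functional_right taylor_coords by (simp add: dvd_add_right_iff)
  moreover have "\<phi> = dual_elt F D"
    by (rule dual_elt_eqI[OF \<phi> dual_elt_carrier[OF calculation]]) (simp only: val dual_elt_class[OF calculation])
  ultimately show thesis by (rule that)
qed

lemma dual_elt_finsum:
  fixes n :: nat
  assumes D: "\<And>i. i < n \<Longrightarrow> jet_ker F F (D i)"
  shows "finsum (pp_dual F) (\<lambda>i. OX_class F (g i) \<odot>\<^bsub>pp_dual F\<^esub> dual_elt F (D i)) {..<n} =
    dual_elt F (\<lambda>m. \<Sum>i<n. g i * D i m)"
  using assms
proof (induction n)
  note q = quot_map_OX[of F]
  interpret cring "OX F" by (rule quot_mapD(1)[OF q])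
  interpret M: module "OX F" "pp_dual F" by (rule module_dual[OF quot_mapD(1)[OF q] module_pp])
  {
    case 0
    have z: "jet_ker F F (\<lambda>m. \<Sum>i<(0::nat). g i * D i m)" by (rule jet_ker_sum) simp
    have "\<zero>\<^bsub>pp_dual F\<^esub> = dual_elt F (\<lambda>m. \<Sum>i<(0::nat). g i * D i m)"
    proof (rule dual_elt_eqI[OF M.M.zero_closed dual_elt_carrier[OF z]])
      fix h
      have "\<zero>\<^bsub>pp_dual F\<^esub> (pp_class F h) = \<zero>\<^bsub>OX F\<^esub>" by (simp add: dual_module_def pp_simps)
      then show "\<zero>\<^bsub>pp_dual F\<^esub> (pp_class F h) = dual_elt F (\<lambda>m. \<Sum>i<(0::nat). g i * D i m) (pp_class F h)"
        unfolding dual_elt_class[OF z] jet_functional_linear by (simp add: quot_mapD(8)[OF q])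
    qed
    then show ?case by simp
  next
    case (Suc n)
    have k: "jet_ker F F (\<lambda>m. \<Sum>i<n. g i * D i m)" "jet_ker F F (\<lambda>m. \<Sum>i<Suc n. g i * D i m)" "jet_ker F F (D n)"
      by (rule jet_ker_sum, use Suc.prems in simp)+ (use Suc.prems in simp)
    have cl: "OX_class F (g i) \<odot>\<^bsub>pp_dual F\<^esub> dual_elt F (D i) \<in> carrier (pp_dual F)" if "i < Suc n" for i
      by (intro M.smult_closed dual_elt_carrier Suc.prems quot_mapD(7)[OF q] that)
    have "finsum (pp_dual F) (\<lambda>i. OX_class F (g i) \<odot>\<^bsub>pp_dual F\<^esub> dual_elt F (D i)) {..<Suc n} =
      OX_class F (g n) \<odot>\<^bsub>pp_dual F\<^esub> dual_elt F (D n) \<oplus>\<^bsub>pp_dual F\<^esub> dual_elt F (\<lambda>m. \<Sum>i<n. g i * D i m)"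
      unfolding lessThan_Suc using cl Suc by (subst M.finsum_insert) auto
    also have "\<dots> = dual_elt F (\<lambda>m. \<Sum>i<Suc n. g i * D i m)"
    proof (rule dual_elt_eqI)
      fix h
      have "(OX_class F (g n) \<odot>\<^bsub>pp_dual F\<^esub> dual_elt F (D n) \<oplus>\<^bsub>pp_dual F\<^esub> dual_elt F (\<lambda>m. \<Sum>i<n. g i * D i m)) (pp_class F h) =
        OX_class F (g n) \<otimes>\<^bsub>OX F\<^esub> dual_elt F (D n) (pp_class F h) \<oplus>\<^bsub>OX F\<^esub> dual_elt F (\<lambda>m. \<Sum>i<n. g i * D i m) (pp_class F h)"
        by (simp add: dual_module_def pp_simps)
      also have "\<dots> = dual_elt F (\<lambda>m. \<Sum>i<Suc n. g i * D i m) (pp_class F h)"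
        unfolding dual_elt_class[OF k(1)] dual_elt_class[OF k(2)] dual_elt_class[OF k(3)] jet_functional_linear
        by (simp only: quot_mapD(3,4)[OF q, symmetric] sum.lessThan_Suc add.commute)
      finally show "(OX_class F (g n) \<odot>\<^bsub>pp_dual F\<^esub> dual_elt F (D n) \<oplus>\<^bsub>pp_dual F\<^esub> dual_elt F (\<lambda>m. \<Sum>i<n. g i * D i m)) (pp_class F h) =
         dual_elt F (\<lambda>m. \<Sum>i<Suc n. g i * D i m) (pp_class F h)" .
    qed (intro M.M.add.m_closed cl dual_elt_carrier k lessI)+
    finally show ?case .
  }
qed

text \<open>Turns freeness of the dual into congruences modulo \<open>F\<close>. That
  \<open>F\<close> is not a unit makes the ring nontrivial, so that bases as sets and as families
  agree.\<close>

lemma dual_basis_iff: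
  fixes F :: "'k::field_char_0 fps fps fps"
  assumes F: "\<not> F dvd 1" and D: "\<And>i. i < 3 \<Longrightarrow> jet_ker F F (D i)" and e: "\<And>i. i < 3 \<Longrightarrow> e i = dual_elt F (D i)"
  shows "dual_basis 3 F e \<longleftrightarrow> basis_mod F (jet_ker F F) D"
proof -
  note q = quot_map_OX[of F]
  interpret R: cring "OX F" by (rule quot_mapD(1)[OF q])
  interpret M: module "OX F" "pp_dual F" by (rule module_dual[OF quot_mapD(1)[OF q] module_pp])
  have nz: "\<one>\<^bsub>OX F\<^esub> \<noteq> \<zero>\<^bsub>OX F\<^esub>" using quot_mapD(6)[OF q, of 1] F by (simp add: quot_mapD(5)[OF q])
  have cl: "e ` {..<3} \<subseteq> carrier (pp_dual F)" using dual_elt_carrier[OF D] e by auto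
  let ?e = "\<lambda>i. dual_elt F (D i)"
  have rep: "\<exists>g. \<forall>i<3. c i = OX_class F (g i)" if "c \<in> {..<3::nat} \<rightarrow> carrier (OX F)" for c
  proof -
    have "\<forall>i. \<exists>g. i < 3 \<longrightarrow> c i = OX_class F g" using that OX_rep by (metis PiE lessThan_iff)
    then show ?thesis by (rule choice[THEN exE]) blast
  qed
  have fs: "finsum (pp_dual F) (\<lambda>i. c i \<odot>\<^bsub>pp_dual F\<^esub> e i) {..<3} = dual_elt F (\<lambda>m. \<Sum>i<3. g i * D i m)"
    if "\<forall>i<3. c i = OX_class F (g i)" for c g
  proof -
    have "finsum (pp_dual F) (\<lambda>i. c i \<odot>\<^bsub>pp_dual F\<^esub> e i) {..<3} = finsum (pp_dual F) (\<lambda>i. OX_class F (g i) \<odot>\<^bsub>pp_dual F\<^esub> ?e i) {..<3}"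
      using that e dual_elt_carrier[OF D] quot_mapD(7)[OF q] by (intro M.finsum_cong') (auto intro!: M.smult_closed)
    then show ?thesis using dual_elt_finsum[of 3 F D g] D by simp
  qed
  have k: "jet_ker F F (\<lambda>m. \<Sum>i<3. g i * D i m)" for g by (rule jet_ker_sum) (use D in auto)
  have k0: "jet_ker F F (\<lambda>_. 0)" by (simp add: jet_ker_def)
  have zero: "\<zero>\<^bsub>pp_dual F\<^esub> = dual_elt F (\<lambda>_. 0)"
    using fs[of "\<lambda>_. \<zero>\<^bsub>OX F\<^esub>" "\<lambda>_. 0"] cl by (simp add: quot_mapD(8)[OF q] M.finsum_zero image_subset_iff cong: M.finsum_cong)
  have ind: "family_indep (OX F) (pp_dual F) 3 e \<longleftrightarrow> (\<forall>c. (\<forall>m<6. F dvd (\<Sum>i<3. c i * D i m)) \<longrightarrow> (\<forall>i<3. F dvd c i))"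
  proof
    assume i: "family_indep (OX F) (pp_dual F) 3 e"
    show "\<forall>c. (\<forall>m<6. F dvd (\<Sum>i<3. c i * D i m)) \<longrightarrow> (\<forall>i<3. F dvd c i)"
    proof (intro allI impI)
      fix g and i :: nat assume g: "\<forall>m<6. F dvd (\<Sum>i<3. g i * D i m)" and "i < 3"
      then have "dual_elt F (\<lambda>m. \<Sum>i<3. g i * D i m) = \<zero>\<^bsub>pp_dual F\<^esub>"
        unfolding zero dual_elt_eq_iff[OF k k0] by simp
      then have "finsum (pp_dual F) (\<lambda>i. OX_class F (g i) \<odot>\<^bsub>pp_dual F\<^esub> e i) {..<3} = \<zero>\<^bsub>pp_dual F\<^esub>"
        using fs[of "\<lambda>i. OX_class F (g i)" g] by simp
      from family_indepD[OF i _ this \<open>i < 3\<close>] have "OX_class F (g i) = \<zero>\<^bsub>OX F\<^esub>"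
        by (simp add: quot_mapD(7)[OF q])
      then show "F dvd g i" by (simp add: quot_mapD(6)[OF q])
    qed
  next
    assume i: "\<forall>c. (\<forall>m<6. F dvd (\<Sum>i<3. c i * D i m)) \<longrightarrow> (\<forall>i<3. F dvd c i)"
    show "family_indep (OX F) (pp_dual F) 3 e"
      unfolding family_indep_def
    proof (intro ballI impI)
      fix c assume c: "c \<in> {..<3} \<rightarrow> carrier (OX F)"
        and 0: "finsum (pp_dual F) (\<lambda>i. c i \<odot>\<^bsub>pp_dual F\<^esub> e i) {..<3} = \<zero>\<^bsub>pp_dual F\<^esub>"
      obtain g where g: "\<forall>i<3. c i = OX_class F (g i)" using rep[OF c] by blast
      have "\<forall>m<6. F dvd (\<Sum>i<3. g i * D i m)"
        using 0 unfolding fs[OF g] zero dual_elt_eq_iff[OF k k0] by simp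
      then have "\<forall>i<3. F dvd g i" using i by blast
      then show "\<forall>i<3. c i = \<zero>\<^bsub>OX F\<^esub>" using g by (simp add: quot_mapD(6)[OF q])
    qed
  qed
  have gen: "family_gen (OX F) (pp_dual F) 3 e \<longleftrightarrow> (\<forall>v. jet_ker F F v \<longrightarrow> (\<exists>c. \<forall>m<6. F dvd v m - (\<Sum>i<3. c i * D i m)))"
  proof
    assume g: "family_gen (OX F) (pp_dual F) 3 e"
    show "\<forall>v. jet_ker F F v \<longrightarrow> (\<exists>c. \<forall>m<6. F dvd v m - (\<Sum>i<3. c i * D i m))"
    proof (intro allI impI)
      fix v assume v: "jet_ker F F v"
      obtain c where c: "c \<in> {..<3} \<rightarrow> carrier (OX F)"
        and eq: "dual_elt F v = finsum (pp_dual F) (\<lambda>i. c i \<odot>\<^bsub>pp_dual F\<^esub> e i) {..<3}"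
        using g dual_elt_carrier[OF v] by (rule family_genE)
      obtain g where g: "\<forall>i<3. c i = OX_class F (g i)" using rep[OF c] by blast
      from eq show "\<exists>c. \<forall>m<6. F dvd v m - (\<Sum>i<3. c i * D i m)"
        unfolding fs[OF g] dual_elt_eq_iff[OF v k] by (rule exI[where x = g])
    qed
  next
    assume s: "\<forall>v. jet_ker F F v \<longrightarrow> (\<exists>c. \<forall>m<6. F dvd v m - (\<Sum>i<3. c i * D i m))"
    show "family_gen (OX F) (pp_dual F) 3 e"
      unfolding family_gen_def
    proof
      fix \<phi> assume "\<phi> \<in> carrier (pp_dual F)"
      then obtain v where v: "jet_ker F F v" "\<phi> = dual_elt F v" by (rule dual_elt_surj)
      from s[rule_format, OF v(1)] obtain g where "\<forall>m<6. F dvd v m - (\<Sum>i<3. g i * D i m)" ..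
      then have "\<phi> = finsum (pp_dual F) (\<lambda>i. OX_class F (g i) \<odot>\<^bsub>pp_dual F\<^esub> e i) {..<3}"
        using fs[of "\<lambda>i. OX_class F (g i)" g] v dual_elt_eq_iff[OF v(1) k] by simp
      then show "\<exists>c\<in>{..<3} \<rightarrow> carrier (OX F). \<phi> = finsum (pp_dual F) (\<lambda>i. c i \<odot>\<^bsub>pp_dual F\<^esub> e i) {..<3}"
        by (intro bexI[of _ "\<lambda>i. OX_class F (g i)"]) (auto simp: quot_mapD(7)[OF q])
    qed
  qed
  show ?thesis
    unfolding dual_basis_def M.free_basis_iff[OF nz] ind gen basis_mod_def using cl D by auto
qed

lemma dual_basis_lift:
  fixes F :: "'k::field_char_0 fps fps fps"
  assumes F: "\<not> F dvd 1" and e: "dual_basis 3 F e"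
  obtains D where "basis_mod F (jet_ker F F) D" "\<And>i. i < 3 \<Longrightarrow> e i = dual_elt F (D i)"
proof -
  have "e ` {..<3} \<subseteq> carrier (pp_dual F)" using e by (simp add: dual_basis_def free_basis_def)
  then have "\<exists>D. jet_ker F F D \<and> e i = dual_elt F D" if "i < 3" for i
    using dual_elt_surj[of "e i" F] that by blast
  then have "\<forall>i. \<exists>D. i < 3 \<longrightarrow> jet_ker F F D \<and> e i = dual_elt F D" by blast
  from choice[OF this] obtain D where D: "\<And>i. i < 3 \<Longrightarrow> jet_ker F F (D i)" "\<And>i. i < 3 \<Longrightarrow> e i = dual_elt F (D i)" by blast
  with dual_basis_iff[OF F, of D e] e that show thesis by blast
qed

lemma inflection_ideal_eq:
  fixes F :: "'k::field_char_0 fps fps fps"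
  assumes D: "\<And>i. i < 3 \<Longrightarrow> jet_ker F F (D i)" and e: "\<And>i. i < 3 \<Longrightarrow> e i = dual_elt F (D i)"
    and \<tau>: "\<And>j. j < 3 \<Longrightarrow> \<tau> j = pp_class F (h j)"
  shows "inflection_ideal 3 F e \<tau> = Idl\<^bsub>OX F\<^esub> {OX_class F (type_det 3 (\<lambda>i j. jet_functional (D i) (h j)))}"
  unfolding inflection_ideal_def
  using ring_det_quot[OF quot_map_OX, of 3 "\<lambda>i j. e i (\<tau> j)" F "\<lambda>i j. jet_functional (D i) (h j)"]
  by (simp add: e \<tau> dual_elt_class[OF D])

section \<open>Colength on the singular fiber\<close>

text \<open>Hides the Weierstrass data \<open>\<beta>\<close> and \<open>p\<close>: from here on
  only the reduction of the frame at \<open>t = 0\<close> and the fact that it is a basis are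
  used.\<close>

lemma family_frame:
  fixes F :: "'k::field_char_0 fps fps fps"
  assumes F: "F $ 0 = cusp s" and s: "s > 0"
  defines "a1 \<equiv> fps_const (fps_deriv (fps_X ^ s) :: 'k fps)"
    and "a2 \<equiv> fps_const (fps_deriv (fps_deriv (fps_X ^ s)) :: 'k fps)"
  obtains E where "\<And>D. basis_mod F (jet_ker F F) D \<Longrightarrow> basis_mod F (jet_ker F F) E"
    "F $ 1 $ 0 $ 0 \<noteq> 0 \<Longrightarrow> basis_mod F (jet_ker F F) E"
    "\<And>m. m < 6 \<Longrightarrow> E 0 m $ 0 = vec6 1 0 0 0 0 0 m"
    "\<And>m. m < 6 \<Longrightarrow> E 1 m $ 0 = vec6 0 (2 * fps_X) a1 0 0 0 m"
    "\<And>m. m < 6 \<Longrightarrow> E 2 m $ 0 = vec6 0 a1 (a2 * fps_X) (4 * (fps_X * fps_X)) (2 * a1 * fps_X) (a1 * a1) m"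
proof -
  obtain \<beta> p V where w: "F * V = (y_coord - \<iota> \<beta>)\<^sup>2 - \<iota> p" "V $ 0 = 1" "\<beta> $ 0 = 0" "p $ 0 = fps_X ^ s"
    using family_weierstrass[OF F s] .
  show thesis
    by (rule that[of "frame \<beta> p", OF basis_imp_basis[OF F s w] general_basis[OF F s w]
        frame_closed_fiber[OF F s w, folded a1_def a2_def]])
qed

text \<open>The normal form \<open>P + Q y\<close> modulo \<open>cusp s\<close>, with
  \<open>P\<close> and \<open>Q\<close> in k[[x]].\<close>

definition lin :: "'a::comm_ring_1 fps \<Rightarrow> 'a fps \<Rightarrow> 'a fps fps" where
  "lin P Q = fps_const P + fps_const Q * fps_X"

lemma lin_add: "lin P Q + lin P' Q' = lin (P + P') (Q + Q')"
  by (simp add: lin_def fps_const_add[symmetric] algebra_simps del: fps_const_add)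

lemma lin_diff: "lin P Q - lin P' Q' = lin (P - P') (Q - Q')"
  by (simp add: lin_def fps_const_sub[symmetric] algebra_simps del: fps_const_sub)

lemma cusp_dvd_lin_mult: "cusp s dvd lin P Q * lin P' Q' - lin (P * P' + fps_X ^ s * Q * Q') (P * Q' + Q * P')"
proof (rule dvdI)
  show "lin P Q * lin P' Q' - lin (P * P' + fps_X ^ s * Q * Q') (P * Q' + Q * P') = cusp s * fps_const (Q * Q')"
    unfolding lin_def cusp_def
    by (simp add: fps_const_add[symmetric] fps_const_mult[symmetric] power2_eq_square algebra_simps
        del: fps_const_add fps_const_mult)
qed

lemma cusp_lin_ex: "s > 0 \<Longrightarrow> \<exists>P Q. cusp s dvd g - lin P Q"
  using cusp_division[of s g] unfolding lin_def by (metis add_diff_cancel_right' dvd_triv_left)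

lemma cusp_lin_unique: "s > 0 \<Longrightarrow> cusp s dvd lin P Q \<Longrightarrow> P = 0 \<and> Q = 0"
  using cusp_mult_linear[of s _ P Q] linear_eq_0[of P Q] unfolding lin_def by (metis dvdE mult_zero_right)

lemma cusp_lin_eq: "s > 0 \<Longrightarrow> cusp s dvd lin P Q - lin P' Q' \<Longrightarrow> P = P' \<and> Q = Q'"
  unfolding lin_diff by (drule (1) cusp_lin_unique) simp

lemma fiber_ideal_is_ideal: "is_ideal (fiber_ideal f h)"
  unfolding is_ideal_def
proof (intro conjI ballI allI)
  show "0 \<in> fiber_ideal f h" unfolding fiber_ideal_def by (intro CollectI exI[of _ 0]) simp
  fix a b assume "a \<in> fiber_ideal f h" "b \<in> fiber_ideal f h"
  then obtain u w u' w' where "a = f * u + h * w" "b = f * u' + h * w'" unfolding fiber_ideal_def by blast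
  then have "a + b = f * (u + u') + h * (w + w')" by (simp add: algebra_simps)
  then show "a + b \<in> fiber_ideal f h" unfolding fiber_ideal_def by blast
next
  fix a c assume "a \<in> fiber_ideal f h"
  then obtain u w where "a = f * u + h * w" unfolding fiber_ideal_def by blast
  then have "c * a = f * (c * u) + h * (c * w)" by (simp add: algebra_simps)
  then show "c * a \<in> fiber_ideal f h" unfolding fiber_ideal_def by blast
qed

lemma fiber_ideal_gens: "f dvd a \<Longrightarrow> a \<in> fiber_ideal f h" "h \<in> fiber_ideal f h"
  unfolding fiber_ideal_def by (auto elim!: dvdE intro: exI[of _ 0] exI[of _ 1])
    (metis add.left_neutral add.right_neutral mult.right_neutral mult_zero_right)+

definition lin_monomial :: "nat \<Rightarrow> nat \<Rightarrow> 'k::field fps fps" where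
  "lin_monomial n0 i = (if i < n0 then fps_const (fps_X ^ i) else fps_const (fps_X ^ (i - n0)) * fps_X)"

lemma sum_lin_monomial:
  fixes c :: "nat \<Rightarrow> 'k::field"
  shows "(\<Sum>i<n0 + n1. kconst (c i) * lin_monomial n0 i) =
    lin (Abs_fps (\<lambda>i. if i < n0 then c i else 0)) (Abs_fps (\<lambda>i. if i < n1 then c (n0 + i) else 0))"
proof -
  have "(\<Sum>i<m. fps_const (c' i) * fps_X ^ i) = Abs_fps (\<lambda>i. if i < m then c' i else 0)" for m and c' :: "nat \<Rightarrow> 'k"
    by (rule fps_ext) (simp add: fps_sum_nth fps_X_power_nth if_distrib cong: if_cong)
  note 1 = this[symmetric]
  have cs: "fps_const (sum w I) = (\<Sum>i\<in>I. fps_const (w i))" for w :: "nat \<Rightarrow> 'k fps" and I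
    by (rule is_ring_homD(7)[OF is_ring_hom_fps_const])
  have "(\<Sum>i<n0 + n1. kconst (c i) * lin_monomial n0 i) =
    (\<Sum>i<n0. kconst (c i) * lin_monomial n0 i) + (\<Sum>i<n1. kconst (c (n0 + i)) * lin_monomial n0 (n0 + i))"
    by (induction n1) (simp_all add: add.assoc)
  also have "\<dots> = lin (\<Sum>i<n0. fps_const (c i) * fps_X ^ i) (\<Sum>i<n1. fps_const (c (n0 + i)) * fps_X ^ i)"
    unfolding lin_def cs sum_distrib_right
    by (simp add: lin_monomial_def fps_const_mult[symmetric] mult.assoc del: fps_const_mult)
  finally show ?thesis unfolding 1 .
qed

lemma fps_eq_0_of_bounds: "fps_X ^ n dvd (z :: 'k::field fps) \<Longrightarrow> (\<And>i. i \<ge> n \<Longrightarrow> z $ i = 0) \<Longrightarrow> z = 0"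
proof (rule fps_ext)
  fix i assume "fps_X ^ n dvd z" and *: "\<And>i. i \<ge> n \<Longrightarrow> z $ i = 0"
  then obtain w where "z = fps_X ^ n * w" by blast
  then show "z $ i = 0 $ i" using * by (cases "i < n") (simp_all add: fps_X_power_mult_nth)
qed

text \<open>In normal form an element of the ideal is a product of \<open>P + Q y\<close> with some
  \<open>u + v y\<close>. The last hypothesis excludes nonzero products with coordinates of degree
  below \<open>n0\<close> and \<open>n1\<close>.\<close>

lemma fiber_indep_lin_monomial:
  fixes h :: "'k::field fps fps"
  assumes s: "s > 0" and h: "cusp s dvd h - lin P Q"
    and *: "\<And>u v. (\<And>i. i \<ge> n0 \<Longrightarrow> (P * u + fps_X ^ s * Q * v) $ i = 0) \<Longrightarrow> (\<And>i. i \<ge> n1 \<Longrightarrow> (P * v + Q * u) $ i = 0) \<Longrightarrow>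
      P * u + fps_X ^ s * Q * v = 0 \<and> P * v + Q * u = 0"
  shows "fiber_indep (cusp s) h (n0 + n1) (lin_monomial n0)"
  unfolding fiber_indep_def sum_lin_monomial
proof (intro allI impI)
  fix c :: "nat \<Rightarrow> 'k" and i
  let ?\<alpha> = "Abs_fps (\<lambda>i. if i < n0 then c i else 0)" and ?\<beta> = "Abs_fps (\<lambda>i. if i < n1 then c (n0 + i) else 0)"
  assume "lin ?\<alpha> ?\<beta> \<in> fiber_ideal (cusp s) h" and i: "i < n0 + n1"
  then obtain u w where uw: "lin ?\<alpha> ?\<beta> = cusp s * u + h * w" unfolding fiber_ideal_def by blast
  obtain u' v' where w: "cusp s dvd w - lin u' v'" using cusp_lin_ex[OF s] by blast
  have "lin ?\<alpha> ?\<beta> - lin (P * u' + fps_X ^ s * Q * v') (P * v' + Q * u') =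
    cusp s * u + (h - lin P Q) * w + lin P Q * (w - lin u' v') +
    (lin P Q * lin u' v' - lin (P * u' + fps_X ^ s * Q * v') (P * v' + Q * u'))"
    unfolding uw by (simp add: algebra_simps)
  also have "cusp s dvd \<dots>" using h w cusp_dvd_lin_mult by (intro dvd_add) auto
  finally have eq: "?\<alpha> = P * u' + fps_X ^ s * Q * v'" "?\<beta> = P * v' + Q * u'"
    using cusp_lin_eq[OF s] by blast+
  have "?\<alpha> = 0 \<and> ?\<beta> = 0" unfolding eq by (rule *) (simp_all flip: eq)
  then have "?\<alpha> $ i = 0" "?\<beta> $ (i - n0) = 0" by simp_all
  moreover have "i - n0 < n1 \<and> n0 + (i - n0) = i" if "\<not> i < n0" using i that by auto
  ultimately show "c i = 0" by (cases "i < n0") auto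
qed

text \<open>The colength of \<open>P + Q y\<close> in \<open>k[[x,y]]/(y\<^sup>2 - x\<^sup>s)\<close> is the order of the norm \<open>P\<^sup>2 - x\<^sup>s Q\<^sup>2\<close>.\<close>

lemma colength_lower:
  fixes P Q :: "'k::field fps"
  assumes s: "s > 0" and h: "cusp s dvd h - lin P Q" and P: "fps_X ^ a dvd P" and Q: "fps_X ^ b dvd Q"
    and N: "N \<le> 2 * a" "N \<le> 2 * b + s"
  shows "\<exists>n b. N \<le> n \<and> fiber_indep (cusp s) h n b"
proof (cases "fps_X ^ a dvd Q")
  case True
  \<comment> \<open>Here both coordinates of every product are divisible by \<open>x^a\<close>, so
    the \<open>2 a\<close> monomials \<open>x^i\<close> and \<open>x^i y\<close> with
    \<open>i < a\<close> stay independent.\<close>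
  have "fiber_indep (cusp s) h (a + a) (lin_monomial a)"
  proof (rule fiber_indep_lin_monomial[OF s h])
    fix u v
    have "fps_X ^ a dvd P * u + fps_X ^ s * Q * v" "fps_X ^ a dvd P * v + Q * u" using True P by auto
    moreover assume "\<And>i. i \<ge> a \<Longrightarrow> (P * u + fps_X ^ s * Q * v) $ i = 0" "\<And>i. i \<ge> a \<Longrightarrow> (P * v + Q * u) $ i = 0"
    ultimately show "P * u + fps_X ^ s * Q * v = 0 \<and> P * v + Q * u = 0"
      using fps_eq_0_of_bounds by blast
  qed
  then show ?thesis using N by (intro exI conjI) auto
next
  case False
  then have Q0: "Q \<noteq> 0" by auto
  define b' Q1 where "b' = subdegree Q" and "Q1 = unit_factor Q"
  have Q1: "Q = fps_X ^ b' * Q1" using subdegree_decompose[of Q] by (simp add: b'_def Q1_def mult.commute)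
  have "Q1 $ 0 \<noteq> 0" using Q0 by (simp add: Q1_def)
  then have inv: "inverse Q1 * Q1 = 1" by (rule inverse_mult_eq_1)
  have b'a: "b' < a"
  proof (rule ccontr)
    assume "\<not> b' < a"
    then have "fps_X ^ a dvd Q" unfolding Q1 by (intro dvd_mult2 le_imp_power_dvd) simp
    with False show False by simp
  qed
  obtain P1 where P1: "P = fps_X ^ a * P1" using P ..
  have bb': "b \<le> b'"
  proof -
    obtain w where w: "Q = fps_X ^ b * w" using Q ..
    then have "w \<noteq> 0" using Q0 by auto
    then show ?thesis unfolding b'_def w by (simp add: subdegree_mult)
  qed
  \<comment> \<open>With \<open>b'\<close> the exact order of \<open>Q\<close>, vanishing of the
    \<open>y\<close>-coordinate of the product gives \<open>u = - P v / Q\<close>. The other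
    coordinate is then \<open>- (P^2 - x^s Q^2) v / Q\<close>, of order at least
    \<open>min (2 a) (2 b' + s) - b'\<close>.\<close>
  let ?n0 = "min (2 * a - b') (b' + s)"
  have "fiber_indep (cusp s) h (?n0 + b') (lin_monomial ?n0)"
  proof (rule fiber_indep_lin_monomial[OF s h])
    fix u v
    assume 0: "\<And>i. i \<ge> ?n0 \<Longrightarrow> (P * u + fps_X ^ s * Q * v) $ i = 0" and 1: "\<And>i. i \<ge> b' \<Longrightarrow> (P * v + Q * u) $ i = 0"
    have ab: "fps_X ^ a = fps_X ^ b' * (fps_X ^ (a - b') :: 'k fps)" using b'a by (simp add: power_add[symmetric])
    have eq: "P * v + Q * u = fps_X ^ b' * (fps_X ^ (a - b') * P1 * v + Q1 * u)"
      unfolding P1 Q1 ab by (simp add: algebra_simps)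
    have z: "P * v + Q * u = 0" by (rule fps_eq_0_of_bounds[OF _ 1]) (unfold eq, rule dvd_triv_left)
    then have "Q1 * u = - (fps_X ^ (a - b') * P1 * v)" unfolding eq by (simp add: eq_neg_iff_add_eq_0 add.commute)
    then have "inverse Q1 * (Q1 * u) = inverse Q1 * - (fps_X ^ (a - b') * P1 * v)" by simp
    also have "inverse Q1 * (Q1 * u) = u" by (simp only: mult.assoc[symmetric] inv mult_1_left)
    finally have u: "u = fps_X ^ (a - b') * (- (inverse Q1 * P1 * v))" by (simp add: mult_ac)
    have "P * u = fps_X ^ (a + (a - b')) * (P1 * (- (inverse Q1 * P1 * v)))"
      unfolding P1 power_add by (subst u) (simp add: mult_ac)
    then have "fps_X ^ (2 * a - b') dvd P * u" using b'a by (simp add: mult_2)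
    then have 2: "fps_X ^ ?n0 dvd P * u" by (rule dvd_trans[OF le_imp_power_dvd[OF min.cobounded1]])
    have "fps_X ^ (b' + s) dvd fps_X ^ s * Q * v" unfolding Q1 power_add by (simp add: mult_ac)
    then have "fps_X ^ ?n0 dvd fps_X ^ s * Q * v" by (rule dvd_trans[OF le_imp_power_dvd[OF min.cobounded2]])
    with 2 have "fps_X ^ ?n0 dvd P * u + fps_X ^ s * Q * v" by (rule dvd_add)
    from fps_eq_0_of_bounds[OF this 0] z show "P * u + fps_X ^ s * Q * v = 0 \<and> P * v + Q * u = 0" by simp
  qed
  moreover have "N \<le> ?n0 + b'" using N bb' b'a by linarith
  ultimately show ?thesis by blast
qed

text \<open>With \<open>x^n0\<close> and \<open>x^n1 y\<close> in the ideal, both coordinates of a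
  normal form can be truncated at these exponents.\<close>

lemma fiber_gen_lin_monomial:
  fixes h :: "'k::field fps fps"
  assumes s: "s > 0" and 0: "lin (fps_X ^ n0) 0 \<in> fiber_ideal (cusp s) h" and 1: "lin 0 (fps_X ^ n1) \<in> fiber_ideal (cusp s) h"
  shows "fiber_gen (cusp s) h (n0 + n1) (lin_monomial n0)"
  unfolding fiber_gen_def
proof
  fix a :: "'k fps fps"
  note I = fiber_ideal_is_ideal[of "cusp s" h]
  obtain \<alpha> \<beta> where a: "cusp s dvd a - lin \<alpha> \<beta>" using cusp_lin_ex[OF s] by blast
  define c where "c i = (if i < n0 then \<alpha> $ i else \<beta> $ (i - n0))" for i
  have *: "z = Abs_fps (\<lambda>i. if i < n then z $ i else 0) + fps_X ^ n * fps_shift n z" for z :: "'k fps" and n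
    by (rule fps_ext) (simp add: fps_X_power_mult_nth)
  let ?\<alpha> = "Abs_fps (\<lambda>i. if i < n0 then \<alpha> $ i else 0)" and ?\<beta> = "Abs_fps (\<lambda>i. if i < n1 then \<beta> $ i else 0)"
  have c: "(\<Sum>i<n0 + n1. kconst (c i) * lin_monomial n0 i) = lin ?\<alpha> ?\<beta>"
    unfolding sum_lin_monomial by (intro arg_cong2[of _ _ _ _ lin]) (simp_all add: c_def fps_eq_iff)
  have "\<alpha> - ?\<alpha> = fps_X ^ n0 * fps_shift n0 \<alpha>" using *[of \<alpha> n0] by (metis add_diff_cancel_left')
  moreover have "\<beta> - ?\<beta> = fps_X ^ n1 * fps_shift n1 \<beta>" using *[of \<beta> n1] by (metis add_diff_cancel_left')
  ultimately have "lin \<alpha> \<beta> - lin ?\<alpha> ?\<beta> = lin (fps_X ^ n0) 0 * fps_const (fps_shift n0 \<alpha>) + lin 0 (fps_X ^ n1) * fps_const (fps_shift n1 \<beta>)"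
    unfolding lin_diff by (simp only:) (simp add: lin_def fps_const_mult[symmetric] mult_ac del: fps_const_mult)
  also have "\<dots> \<in> fiber_ideal (cusp s) h" using 0 1 by (intro is_idealD(2)[OF I] is_idealD(4)[OF I])
  finally have "(a - lin \<alpha> \<beta>) + (lin \<alpha> \<beta> - lin ?\<alpha> ?\<beta>) \<in> fiber_ideal (cusp s) h"
    using fiber_ideal_gens(1)[OF a] is_idealD(2)[OF I] by blast
  then show "\<exists>c. a - (\<Sum>i<n0 + n1. kconst (c i) * lin_monomial n0 i) \<in> fiber_ideal (cusp s) h"
    using c by (intro exI[of _ c]) simp
qed

text \<open>Records separate orders for the two coordinates of the normal form; the bound
  \<open>s\<close> on \<open>Q\<close> is the one reached by \<open>y^3 = x^s y\<close>.\<close>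

definition order_ideal :: "nat \<Rightarrow> nat \<Rightarrow> 'k::field fps fps set" where
  "order_ideal s a = {h. \<exists>P Q. cusp s dvd h - lin P Q \<and> fps_X ^ a dvd P \<and> fps_X ^ s dvd Q}"

lemma order_idealI: "cusp s dvd h - lin P Q \<Longrightarrow> fps_X ^ a dvd P \<Longrightarrow> fps_X ^ s dvd Q \<Longrightarrow> h \<in> order_ideal s a"
  unfolding order_ideal_def by blast

text \<open>Multiplication by \<open>y\<close> sends \<open>(P, Q)\<close> to
  \<open>(x^s Q, P)\<close>, and the two bounds on \<open>a\<close> are what keeps the
  orders.\<close>

lemma order_ideal_is_ideal:
  assumes s: "s > 0" and a: "s \<le> a" "a \<le> 2 * s"
  shows "is_ideal (order_ideal s a :: 'k::field fps fps set)"
  unfolding is_ideal_def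
proof (intro conjI ballI allI)
  show "(0 :: 'k fps fps) \<in> order_ideal s a" unfolding order_ideal_def by (intro CollectI exI[of _ 0]) (simp add: lin_def)
  fix x y :: "'k fps fps" assume "x \<in> order_ideal s a" "y \<in> order_ideal s a"
  then obtain P Q P' Q' where *: "cusp s dvd x - lin P Q" "fps_X ^ a dvd P" "fps_X ^ s dvd Q"
    "cusp s dvd y - lin P' Q'" "fps_X ^ a dvd P'" "fps_X ^ s dvd Q'" unfolding order_ideal_def by blast
  have eq: "(x + y) - lin (P + P') (Q + Q') = (x - lin P Q) + (y - lin P' Q')"
    unfolding lin_add[symmetric] by (simp add: algebra_simps)
  have "cusp s dvd (x + y) - lin (P + P') (Q + Q')" unfolding eq using * by (intro dvd_add)
  then show "x + y \<in> order_ideal s a" by (rule order_idealI) (intro dvd_add *)+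
next
  fix x c :: "'k fps fps" assume "x \<in> order_ideal s a"
  then obtain P Q where *: "cusp s dvd x - lin P Q" "fps_X ^ a dvd P" "fps_X ^ s dvd Q" unfolding order_ideal_def by blast
  obtain u v where c: "cusp s dvd c - lin u v" using cusp_lin_ex[OF s] by blast
  let ?l = "lin (P * u + fps_X ^ s * Q * v) (P * v + Q * u)"
  have "c * x - ?l = c * (x - lin P Q) + (c - lin u v) * lin P Q + (lin P Q * lin u v - ?l)" by (simp add: algebra_simps)
  also have "cusp s dvd \<dots>" using * c cusp_dvd_lin_mult by (intro dvd_add) auto
  finally have 1: "cusp s dvd c * x - ?l" .
  have "fps_X ^ (2 * s) dvd fps_X ^ s * Q" unfolding mult_2 power_add using *(3) by (rule mult_dvd_mono[OF dvd_refl])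
  then have "fps_X ^ a dvd fps_X ^ s * Q" by (rule dvd_trans[OF le_imp_power_dvd[OF a(2)]])
  moreover have "fps_X ^ s dvd P" using *(2) by (rule dvd_trans[OF le_imp_power_dvd[OF a(1)]])
  ultimately show "c * x \<in> order_ideal s a" using *(2,3)
    by (intro order_idealI[OF 1] dvd_add; blast intro: dvd_mult2)
qed

lemma cusp_dvd_order_ideal: "cusp s dvd x \<Longrightarrow> x \<in> order_ideal s a"
  unfolding order_ideal_def by (intro CollectI exI[of _ 0]) (simp add: lin_def)

lemma cusp_dvd_y2: "cusp s dvd fps_X * fps_X - fps_const (fps_X ^ s)"
  by (simp add: cusp_def power2_eq_square)

lemma deriv_X_power:
  "fps_deriv (fps_X ^ s) = fps_const (of_nat s) * (fps_X ^ (s - 1) :: 'k::field_char_0 fps)"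
  "fps_deriv (fps_deriv (fps_X ^ s)) = fps_const (of_nat s * of_nat (s - 1)) * (fps_X ^ (s - 2) :: 'k::field_char_0 fps)"
proof -
  show 1: "fps_deriv (fps_X ^ s) = fps_const (of_nat s) * (fps_X ^ (s - 1) :: 'k fps)" for s
    by (simp add: fps_deriv_power)
  show "fps_deriv (fps_deriv (fps_X ^ s)) = fps_const (of_nat s * of_nat (s - 1)) * (fps_X ^ (s - 2) :: 'k fps)"
    unfolding 1 by (simp add: fps_deriv_mult 1 mult.assoc[symmetric] numeral_2_eq_2)
qed

text \<open>The least order of the coordinate free of \<open>y\<close> among the minors of the
  frame. It comes from \<open>s (s - 2) x^(2 s - 2)\<close>; this term vanishes for
  \<open>s = 2\<close>, where \<open>a1 y^2\<close> and \<open>a1^3\<close> have order 3.\<close>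

definition min_order :: "nat \<Rightarrow> nat" where "min_order s = (if s = 2 then 3 else 2 * s - 2)"

context
  fixes s :: nat and a1 a2 :: "'k::field_char_0 fps fps"
  assumes s: "s \<ge> 2"
  defines "a1 \<equiv> fps_const (fps_deriv (fps_X ^ s))" and "a2 \<equiv> fps_const (fps_deriv (fps_deriv (fps_X ^ s)))"
begin

lemma min_order_ideal: "is_ideal (order_ideal s (min_order s) :: 'k fps fps set)"
  using s by (intro order_ideal_is_ideal) (auto simp: min_order_def)

text \<open>On \<open>y^2 = x^s\<close> the expression is \<open>2 s (s - 1) - s^2\<close> times
  \<open>x^(2 s - 2)\<close>.\<close>

lemma hessian_lin:
  "cusp s dvd (2 * a2 * (fps_X * fps_X) - a1 * a1) - lin (fps_const (of_nat s * (of_nat s - 2)) * fps_X ^ (2 * s - 2)) 0"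
proof -
  have e: "s - 2 + s = 2 * s - 2" "s - 1 + (s - 1) = 2 * s - 2" using s by auto
  have n: "of_nat (s - 1) = (of_nat s - 1 :: 'k)" using s by (simp add: of_nat_diff)
  have 1: "a2 * fps_const (fps_X ^ s) = fps_const (fps_const (of_nat s * (of_nat s - 1)) * fps_X ^ (2 * s - 2))"
    unfolding a2_def deriv_X_power(2) n by (simp add: mult.assoc power_add[symmetric] e)
  have 2: "a1 * a1 = fps_const (fps_const (of_nat s * of_nat s) * fps_X ^ (2 * s - 2))"
    unfolding a1_def deriv_X_power e(2)[symmetric] power_add by (simp add: fps_const_mult[symmetric] mult_ac del: fps_const_mult)
  have "2 * (a2 * fps_const (fps_X ^ s)) - a1 * a1 = lin (fps_const (of_nat s * (of_nat s - 2)) * fps_X ^ (2 * s - 2)) 0"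
  proof -
    have "fps_const (of_nat s * (of_nat s - 2)) = 2 * fps_const (of_nat s * (of_nat s - 1)) - fps_const (of_nat s * of_nat s :: 'k)"
      by (simp add: numeral_fps_const algebra_simps)
    then have "fps_const (of_nat s * (of_nat s - 2)) * fps_X ^ (2 * s - 2) =
      2 * (fps_const (of_nat s * (of_nat s - 1)) * fps_X ^ (2 * s - 2)) - fps_const (of_nat s * of_nat s :: 'k) * fps_X ^ (2 * s - 2)"
      by (simp only: left_diff_distrib mult.assoc)
    then have "fps_const (fps_const (of_nat s * (of_nat s - 2)) * fps_X ^ (2 * s - 2)) =
      2 * fps_const (fps_const (of_nat s * (of_nat s - 1)) * fps_X ^ (2 * s - 2)) - fps_const (fps_const (of_nat s * of_nat s :: 'k) * fps_X ^ (2 * s - 2))"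
      by (simp only: is_ring_homD[OF is_ring_hom_fps_const] is_ring_hom_numeral[OF is_ring_hom_fps_const])
    then show ?thesis unfolding 1 2 lin_def by simp
  qed
  then have "(2 * a2 * (fps_X * fps_X) - a1 * a1) - lin (fps_const (of_nat s * (of_nat s - 2)) * fps_X ^ (2 * s - 2)) 0 =
    2 * a2 * (fps_X * fps_X - fps_const (fps_X ^ s))" by (simp add: algebra_simps)
  then show ?thesis using dvd_mult[OF cusp_dvd_y2[of s, where 'a = 'k]] by simp
qed

lemma cube_lin: "cusp s dvd fps_X * (fps_X * fps_X) - lin 0 (fps_X ^ s :: 'k fps)"
proof -
  have "fps_X * (fps_X * fps_X) - lin 0 (fps_X ^ s) = fps_X * (fps_X * fps_X - fps_const (fps_X ^ s :: 'k fps))"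
    by (simp add: lin_def algebra_simps)
  then show ?thesis using dvd_mult[OF cusp_dvd_y2[of s, where 'a = 'k]] by simp
qed

lemma minors_order:
  "2 * a2 * (fps_X * fps_X) - a1 * a1 \<in> order_ideal s (min_order s)"
  "fps_X * (fps_X * fps_X) \<in> (order_ideal s (min_order s) :: 'k fps fps set)"
  "a1 * (fps_X * fps_X) \<in> order_ideal s (min_order s)"
  "a1 * a1 * fps_X \<in> order_ideal s (min_order s)"
  "a1 * a1 * a1 \<in> order_ideal s (min_order s)"
proof -
  have dvd: "fps_X ^ m dvd (fps_const c * fps_X ^ n :: 'k fps)" if "m \<le> n" for m n c
    using that by (intro dvd_mult le_imp_power_dvd)
  show "2 * a2 * (fps_X * fps_X) - a1 * a1 \<in> order_ideal s (min_order s)"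
  proof -
    have "fps_X ^ min_order s dvd (fps_const (of_nat s * (of_nat s - 2)) * fps_X ^ (2 * s - 2) :: 'k fps)"
      by (cases "s = 2") (auto simp: min_order_def intro: dvd)
    with hessian_lin show ?thesis by (rule order_idealI) simp
  qed
  show "fps_X * (fps_X * fps_X) \<in> (order_ideal s (min_order s) :: 'k fps fps set)"
    by (rule order_idealI[OF cube_lin]) simp_all
  have e: "a1 = fps_const (fps_const (of_nat s) * fps_X ^ (s - 1))" by (simp only: a1_def deriv_X_power)
  show "a1 * (fps_X * fps_X) \<in> order_ideal s (min_order s)"
  proof -
    have "a1 * (fps_X * fps_X) - lin (fps_const (of_nat s) * fps_X ^ (s - 1 + s)) 0 = a1 * (fps_X * fps_X - fps_const (fps_X ^ s))"
      unfolding e power_add by (simp add: lin_def right_diff_distrib mult.assoc)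
    then have "cusp s dvd a1 * (fps_X * fps_X) - lin (fps_const (of_nat s) * fps_X ^ (s - 1 + s)) 0" using dvd_mult[OF cusp_dvd_y2[of s, where 'a = 'k]] by simp
    moreover have "fps_X ^ min_order s dvd (fps_const (of_nat s) * fps_X ^ (s - 1 + s) :: 'k fps)"
      by (rule dvd) (use s in \<open>auto simp: min_order_def\<close>)
    ultimately show ?thesis by (rule order_idealI) simp
  qed
  show "a1 * a1 * fps_X \<in> order_ideal s (min_order s)"
  proof -
    have "a1 * a1 * fps_X = lin 0 (fps_const (of_nat s * of_nat s) * fps_X ^ (s - 1 + (s - 1)))"
      unfolding e power_add by (simp add: lin_def fps_const_mult[symmetric] mult_ac del: fps_const_mult)
    moreover have "fps_X ^ s dvd (fps_const (of_nat s * of_nat s) * fps_X ^ (s - 1 + (s - 1)) :: 'k fps)"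
      by (rule dvd) (use s in auto)
    ultimately show ?thesis by (intro order_idealI[where P = 0]) simp_all
  qed
  show "a1 * a1 * a1 \<in> order_ideal s (min_order s)"
  proof -
    have "a1 * a1 * a1 = lin (fps_const (of_nat s * of_nat s * of_nat s) * fps_X ^ (s - 1 + (s - 1) + (s - 1))) 0"
      unfolding e power_add by (simp add: lin_def fps_const_mult[symmetric] mult_ac del: fps_const_mult)
    moreover have "fps_X ^ min_order s dvd (fps_const (of_nat s * of_nat s * of_nat s) * fps_X ^ (s - 1 + (s - 1) + (s - 1)) :: 'k fps)"
      by (rule dvd) (use s in \<open>auto simp: min_order_def\<close>)
    ultimately show ?thesis by (intro order_idealI[where Q = 0]) simp_all
  qed
qed

text \<open>Expansion along the row of the operator 1 leaves minors of the other two rows. By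
  bilinearity these are combinations of the minors of the coefficient matrix, which are up to
  constants the five products in \<open>minors_order\<close>.\<close>

lemma frame_det_order:
  fixes t :: "nat \<Rightarrow> nat \<Rightarrow> 'k fps fps"
  assumes "\<And>j. M 0 j = t 0 j" "\<And>j. M 1 j = 2 * fps_X * t 1 j + a1 * t 2 j"
    "\<And>j. M 2 j = a1 * t 1 j + a2 * fps_X * t 2 j + 4 * (fps_X * fps_X) * t 3 j + 2 * a1 * fps_X * t 4 j + a1 * a1 * t 5 j"
  shows "type_det 3 M \<in> order_ideal s (min_order s)"
proof -
  note I = min_order_ideal
  have minor: "M 1 j * M 2 k - M 1 k * M 2 j \<in> order_ideal s (min_order s)" for j k
  proof -
    have "M 1 j * M 2 k - M 1 k * M 2 j =
      (2 * a2 * (fps_X * fps_X) - a1 * a1) * (t 1 j * t 2 k - t 1 k * t 2 j) +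
      fps_X * (fps_X * fps_X) * (8 * (t 1 j * t 3 k - t 1 k * t 3 j)) +
      a1 * (fps_X * fps_X) * (4 * (t 1 j * t 4 k - t 1 k * t 4 j) + 4 * (t 2 j * t 3 k - t 2 k * t 3 j)) +
      a1 * a1 * fps_X * (2 * (t 1 j * t 5 k - t 1 k * t 5 j) + 2 * (t 2 j * t 4 k - t 2 k * t 4 j)) +
      a1 * a1 * a1 * (t 2 j * t 5 k - t 2 k * t 5 j)"
      unfolding assms by (simp add: algebra_simps)
    also have "\<dots> \<in> order_ideal s (min_order s)"
      by (intro is_idealD(2)[OF I] is_idealD(4)[OF I] minors_order)
    finally show ?thesis .
  qed
  have "type_det 3 M = t 0 0 * (M 1 1 * M 2 2 - M 1 2 * M 2 1) + t 0 1 * (M 1 2 * M 2 0 - M 1 0 * M 2 2) +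
    t 0 2 * (M 1 0 * M 2 1 - M 1 1 * M 2 0)"
    unfolding type_det_3 assms(1) by (simp add: algebra_simps)
  also have "\<dots> \<in> order_ideal s (min_order s)"
    by (intro is_idealD(2)[OF I] is_idealD(3)[OF I] minor)
  finally show ?thesis .
qed

end

section \<open>The minimal degeneracy\<close>

definition inflection_count :: "nat \<Rightarrow> nat" where
  "inflection_count s = (if s = 2 then 6 else if s = 3 then 8 else 3 * s)"

lemma family_nonunit:
  fixes F :: "'k::field_char_0 fps fps fps"
  assumes F: "F $ 0 = cusp s" and s: "s > 0"
  shows "\<not> F dvd 1"
proof
  assume "F dvd 1"
  then obtain k where "1 = F * k" ..
  then have "(F * k) $ 0 $ 0 $ 0 = (1 :: 'k fps fps fps) $ 0 $ 0 $ 0" by simp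
  then show False using s by (simp add: F cusp_nth)
qed

text \<open>A matrix \<open>C\<close> expresses the given basis through the frame, so modulo
  \<open>F\<close> the determinant is that of \<open>C\<close> times that of the frame, and the
  order ideal absorbs the factor.\<close>

lemma degeneracy_lower:
  fixes F :: "'k::field_char_0 fps fps fps"
  assumes F: "F $ 0 = cusp s" and s: "s \<ge> 2" and e: "dual_basis 3 F e"
    and \<tau>: "\<tau> \<in> {..<3} \<rightarrow> carrier (principal_parts 3 F)"
  shows "enat (inflection_count s) \<le> closed_fiber_dim F (inflection_ideal 3 F e \<tau>)"
proof -
  have s0: "s > 0" using s by simp
  obtain D where D: "basis_mod F (jet_ker F F) D" "\<And>i. i < 3 \<Longrightarrow> e i = dual_elt F (D i)"
    by (rule dual_basis_lift[OF family_nonunit[OF F s0] e]) blast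
  have Dk: "\<And>i. i < 3 \<Longrightarrow> jet_ker F F (D i)" using D(1) by (simp add: basis_mod_def)
  have "\<forall>j. \<exists>h. j < 3 \<longrightarrow> \<tau> j = pp_class F h" using \<tau> unfolding pp_simps by blast
  from choice[OF this] obtain h where h: "\<And>j. j < 3 \<Longrightarrow> \<tau> j = pp_class F (h j)" by blast
  define M where "M i j = jet_functional (D i) (h j)" for i j
  have I: "inflection_ideal 3 F e \<tau> = Idl\<^bsub>OX F\<^esub> {OX_class F (type_det 3 M)}"
    using inflection_ideal_eq[OF Dk D(2) h] by (simp add: M_def[abs_def])
  let ?a1 = "fps_const (fps_deriv (fps_X ^ s)) :: 'k fps fps"
  let ?a2 = "fps_const (fps_deriv (fps_deriv (fps_X ^ s))) :: 'k fps fps"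
  obtain E where E: "basis_mod F (jet_ker F F) E"
    and E0: "\<And>m. m < 6 \<Longrightarrow> E 0 m $ 0 = vec6 1 0 0 0 0 0 m"
    and E1: "\<And>m. m < 6 \<Longrightarrow> E 1 m $ 0 = vec6 0 (2 * fps_X) ?a1 0 0 0 m"
    and E2: "\<And>m. m < 6 \<Longrightarrow> E 2 m $ 0 = vec6 0 ?a1 (?a2 * fps_X) (4 * (fps_X * fps_X)) (2 * ?a1 * fps_X) (?a1 * ?a1) m"
    using family_frame[OF F s0] D(1) by metis
  have "\<exists>c. \<forall>m<6. F dvd D i m - (\<Sum>k<3. c k * E k m)" if "i < 3" for i
    using E Dk[OF that] unfolding basis_mod_def by blast
  then have "\<forall>i. \<exists>c. i < 3 \<longrightarrow> (\<forall>m<6. F dvd D i m - (\<Sum>k<3. c k * E k m))" by blast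
  from choice[OF this] obtain C where C: "\<And>i m. i < 3 \<Longrightarrow> m < 6 \<Longrightarrow> F dvd D i m - (\<Sum>k<3. C i k * E k m)" by blast
  define Y where "Y k j = jet_functional (E k) (h j)" for k j
  have "F dvd type_det 3 M - type_det 3 (\<lambda>i j. \<Sum>k<3. C i k * Y k j)"
  proof (rule type_det_3_cong)
    fix i j :: nat assume i: "i < 3"
    have "M i j - (\<Sum>k<3. C i k * Y k j) = (\<Sum>m<6. taylor m (h j) * (D i m - (\<Sum>k<3. C i k * E k m)))"
      unfolding M_def Y_def jet_functional_linear[symmetric]
      by (simp add: jet_functional_def sum_subtractf right_diff_distrib)
    also have "F dvd \<dots>" using C[OF i] by (intro dvd_sum dvd_mult) auto
    finally show "F dvd M i j - (\<Sum>k<3. C i k * Y k j)" .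
  qed
  then obtain u where u: "type_det 3 M = type_det 3 C * type_det 3 Y + F * u"
    unfolding type_det_mult_3 by (metis add.commute diff_add_cancel dvdE)
  have Y0: "type_det 3 Y $ 0 = type_det 3 (\<lambda>i j. Y i j $ 0)" by (simp add: type_det_3)
  have "type_det 3 (\<lambda>i j. Y i j $ 0) \<in> order_ideal s (min_order s)"
  proof (rule frame_det_order[OF s, of _ "\<lambda>m j. taylor m (h j) $ 0"])
    fix j
    have *: "Y i j $ 0 = (\<Sum>m<6. taylor m (h j) $ 0 * E i m $ 0)" for i
      by (simp add: Y_def jet_functional_def fps_sum_nth)
    show "Y 0 j $ 0 = taylor 0 (h j) $ 0"
      "Y 1 j $ 0 = 2 * fps_X * taylor 1 (h j) $ 0 + ?a1 * taylor 2 (h j) $ 0"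
      "Y 2 j $ 0 = ?a1 * taylor 1 (h j) $ 0 + ?a2 * fps_X * taylor 2 (h j) $ 0 + 4 * (fps_X * fps_X) * taylor 3 (h j) $ 0 +
        2 * ?a1 * fps_X * taylor 4 (h j) $ 0 + ?a1 * ?a1 * taylor 5 (h j) $ 0"
      unfolding * sum_less_6 by (simp_all add: E0 E1[unfolded One_nat_def] E2 mult_ac)
  qed
  then have "type_det 3 C $ 0 * type_det 3 Y $ 0 \<in> order_ideal s (min_order s)"
    unfolding Y0 by (rule is_idealD(3)[OF min_order_ideal[OF s]])
  moreover have "cusp s * u $ 0 \<in> order_ideal s (min_order s)" by (rule cusp_dvd_order_ideal) simp
  ultimately have "type_det 3 C $ 0 * type_det 3 Y $ 0 + cusp s * u $ 0 \<in> order_ideal s (min_order s)"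
    by (rule is_idealD(2)[OF min_order_ideal[OF s]])
  then have "type_det 3 M $ 0 \<in> order_ideal s (min_order s)" by (simp add: u F)
  then obtain P Q where PQ: "cusp s dvd type_det 3 M $ 0 - lin P Q" "fps_X ^ min_order s dvd P" "fps_X ^ s dvd Q"
    unfolding order_ideal_def by blast
  \<comment> \<open>The cases of the first bound are \<open>6 = 2 * 3\<close>,
    \<open>8 = 2 * 4\<close>, and \<open>3 s \<le> 4 s - 4\<close> for
    \<open>s \<ge> 4\<close>.\<close>
  have "inflection_count s \<le> 2 * min_order s" "inflection_count s \<le> 2 * s + s"
    using s by (auto simp: inflection_count_def min_order_def)
  from colength_lower[OF s0 PQ this] obtain n b where n: "inflection_count s \<le> n" "fiber_indep (cusp s) (type_det 3 M $ 0) n b"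
    by blast
  then have "enat n \<le> closed_fiber_dim F (inflection_ideal 3 F e \<tau>)"
    unfolding I using closed_fiber_dim_ge[of F "type_det 3 M"] by (simp add: F)
  then show ?thesis using n(1) by (meson enat_ord_simps(1) order_trans)
qed

lemma degeneracy_attained:
  fixes F :: "'k::field_char_0 fps fps fps"
  assumes F: "F $ 0 = cusp s" and s: "s \<ge> 2" and F1: "F $ 1 $ 0 $ 0 \<noteq> 0"
  obtains e \<tau> where "dual_basis 3 F e" "\<tau> \<in> {..<3} \<rightarrow> carrier (principal_parts 3 F)"
    "closed_fiber_dim F (inflection_ideal 3 F e \<tau>) = enat (inflection_count s)"
proof -
  have s0: "s > 0" using s by simp
  let ?a1 = "fps_const (fps_deriv (fps_X ^ s)) :: 'k fps fps"
  let ?a2 = "fps_const (fps_deriv (fps_deriv (fps_X ^ s))) :: 'k fps fps"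
  obtain E where E: "basis_mod F (jet_ker F F) E"
    and E0: "\<And>m. m < 6 \<Longrightarrow> E 0 m $ 0 = vec6 1 0 0 0 0 0 m"
    and E1: "\<And>m. m < 6 \<Longrightarrow> E 1 m $ 0 = vec6 0 (2 * fps_X) ?a1 0 0 0 m"
    and E2: "\<And>m. m < 6 \<Longrightarrow> E 2 m $ 0 = vec6 0 ?a1 (?a2 * fps_X) (4 * (fps_X * fps_X)) (2 * ?a1 * fps_X) (?a1 * ?a1) m"
    using family_frame[OF F s0] F1 by metis
  have Ek: "\<And>i. i < 3 \<Longrightarrow> jet_ker F F (E i)" using E by (simp add: basis_mod_def)
  define e where "e i = dual_elt F (E i)" for i
  \<comment> \<open>The monomials 1, dX, dY select the minor \<open>s (s - 2) x^(2 s - 2)\<close>,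
    optimal for \<open>s = 3\<close>; the monomials 1, dX, dX^2 select \<open>8 y^3\<close>, optimal
    otherwise.\<close>
  define k :: "nat \<Rightarrow> nat" where "k j = [0, 1, if s = 3 then 2 else 3] ! j" for j
  define \<tau> where "\<tau> j = pp_class F (jet_monomial (k j))" for j
  have e: "dual_basis 3 F e" using dual_basis_iff[OF family_nonunit[OF F s0] Ek, where e = e] E by (simp add: e_def)
  have \<tau>: "\<tau> \<in> {..<3} \<rightarrow> carrier (principal_parts 3 F)" by (simp add: \<tau>_def pp_simps)
  define h where "h = type_det 3 (\<lambda>i j. jet_functional (E i) (jet_monomial (k j)))"
  have I: "inflection_ideal 3 F e \<tau> = Idl\<^bsub>OX F\<^esub> {OX_class F h}"
    unfolding h_def by (rule inflection_ideal_eq[OF Ek]) (simp_all add: e_def \<tau>_def)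
  have k: "k 0 = 0" "k (Suc 0) = 1" "k 2 = (if s = 3 then 2 else 3)" by (simp_all add: k_def)
  have h0: "h $ 0 = (if s = 3 then 2 * ?a2 * (fps_X * fps_X) - ?a1 * ?a1 else 8 * (fps_X * (fps_X * fps_X)))"
    unfolding h_def type_det_3
    by (simp add: k jet_functional_monomial E0 E1[unfolded One_nat_def] E2)
  note Id = fiber_ideal_is_ideal[of "cusp s" "h $ 0"]
  have hI: "lin P Q \<in> fiber_ideal (cusp s) (h $ 0)" if "cusp s dvd g * h $ 0 - lin P Q" for P Q g
  proof -
    have "g * h $ 0 - (g * h $ 0 - lin P Q) \<in> fiber_ideal (cusp s) (h $ 0)"
      by (intro is_idealD(6)[OF Id] is_idealD(3)[OF Id] fiber_ideal_gens that)
    then show ?thesis by simp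
  qed
  have "\<exists>b. fiber_gen (cusp s) (h $ 0) (inflection_count s) b"
  proof (cases "s = 3")
    case True
    \<comment> \<open>On the closed fiber the determinant is \<open>3 x^4\<close>, so
      \<open>x^4\<close> and \<open>x^4 y\<close> lie in the ideal and \<open>4 + 4\<close>
      monomials span.\<close>
    have a: "cusp s dvd h $ 0 - lin (fps_const 3 * fps_X ^ 4) 0"
      using hessian_lin[OF s, where 'k = 'k] unfolding h0 by (simp add: True)
    have *: "cusp s dvd g * h $ 0 - lin P Q" if "g * lin (fps_const 3 * fps_X ^ 4) 0 = lin P Q" for g P Q
      using dvd_mult[OF a, of g] that by (simp add: right_diff_distrib)
    have 3: "fps_const (1 / 3) * (fps_const 3 * z) = z" for z :: "'k fps" by (simp add: mult.assoc[symmetric])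
    have "lin (fps_X ^ 4) 0 \<in> fiber_ideal (cusp s) (h $ 0)"
      by (rule hI[of "lin (fps_const (1/3)) 0"], rule *) (simp add: lin_def 3)
    moreover have "lin 0 (fps_X ^ 4) \<in> fiber_ideal (cusp s) (h $ 0)"
      by (rule hI[of "lin 0 (fps_const (1/3))"], rule *) (simp add: lin_def 3 mult_ac)
    ultimately have "fiber_gen (cusp s) (h $ 0) (4 + 4) (lin_monomial 4)"
      by (rule fiber_gen_lin_monomial[OF s0])
    then show ?thesis using True by (auto simp: inflection_count_def)
  next
    case False
    have cube: "cusp s dvd fps_X * (fps_X * fps_X) - lin 0 (fps_X ^ s :: 'k fps)" by (rule cube_lin[OF s])
    have h: "h $ 0 = 8 * (fps_X * (fps_X * fps_X))" using False h0 by simp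
    have 8: "kconst (1 / 8) * (8 * z) = z" for z :: "'k fps fps"
    proof -
      have "kconst (1 / 8) * (8 :: 'k fps fps) = 1" by (simp add: numeral_fps_const)
      then show ?thesis by (simp add: mult.assoc[symmetric])
    qed
    \<comment> \<open>Up to a unit the determinant is \<open>y^3 = x^s y\<close>. Multiplication by
      \<open>y\<close> puts \<open>x^(2 s)\<close> in the ideal as well, so \<open>2 s + s\<close>
      monomials span.\<close>
    have 1: "lin 0 (fps_X ^ s) \<in> fiber_ideal (cusp s) (h $ 0)"
      by (rule hI[of "kconst (1/8)"]) (simp only: h 8 cube)
    have "lin (fps_X ^ (2 * s)) 0 \<in> fiber_ideal (cusp s) (h $ 0)"
    proof -
      have "lin (fps_X ^ (2 * s)) 0 = fps_X * lin 0 (fps_X ^ s) - fps_const (fps_X ^ s) * (fps_X * fps_X - fps_const (fps_X ^ s :: 'k fps))"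
      proof -
        have "lin (z * z) 0 = fps_X * lin 0 z - fps_const z * (fps_X * fps_X - fps_const z)" for z :: "'k fps"
          by (simp add: lin_def algebra_simps)
        then show ?thesis unfolding mult_2 power_add .
      qed
      also have "\<dots> \<in> fiber_ideal (cusp s) (h $ 0)"
        by (intro is_idealD(6)[OF Id] is_idealD(3)[OF Id] 1 fiber_ideal_gens cusp_dvd_y2)
      finally show ?thesis .
    qed
    from fiber_gen_lin_monomial[OF s0 this 1] have "\<exists>b. fiber_gen (cusp s) (h $ 0) (2 * s + s) b" by blast
    moreover have "2 * s + s = inflection_count s" using False by (simp add: inflection_count_def)
    ultimately show ?thesis by simp
  qed
  then have "closed_fiber_dim F (inflection_ideal 3 F e \<tau>) \<le> enat (inflection_count s)"
    unfolding I using closed_fiber_dim_le[of F h] by (auto simp: F)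
  with degeneracy_lower[OF F s e \<tau>] show thesis by (intro that[OF e \<tau>]) (rule antisym)
qed

section \<open>Base change\<close>

lemma
  assumes L: "module R L" and N: "submodule R N L"
  shows quot_module_module: "module R (quot_module L N)"
    and quot_module_add: "x \<in> carrier L \<Longrightarrow> y \<in> carrier L \<Longrightarrow> (N +>\<^bsub>L\<^esub> x) \<oplus>\<^bsub>quot_module L N\<^esub> (N +>\<^bsub>L\<^esub> y) = N +>\<^bsub>L\<^esub> (x \<oplus>\<^bsub>L\<^esub> y)"
    and quot_module_smult: "c \<in> carrier R \<Longrightarrow> x \<in> carrier L \<Longrightarrow> c \<odot>\<^bsub>quot_module L N\<^esub> (N +>\<^bsub>L\<^esub> x) = N +>\<^bsub>L\<^esub> (c \<odot>\<^bsub>L\<^esub> x)"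
    and quot_module_carrier: "carrier (quot_module L N) = (\<lambda>x. N +>\<^bsub>L\<^esub> x) ` carrier L"
    and quot_module_zero: "x \<in> carrier L \<Longrightarrow> N +>\<^bsub>L\<^esub> x = \<zero>\<^bsub>quot_module L N\<^esub> \<longleftrightarrow> x \<in> N"
proof -
  interpret L: module R L by (rule L)
  interpret N: submodule R N L by (rule N)
  let ?V = "quot_module L N"
  have sub: "N \<subseteq> carrier L" by (rule N.subset)
  have neg: "\<ominus>\<^bsub>L\<^esub> x \<in> N" if "x \<in> N" for x
  proof -
    have "\<ominus>\<^bsub>L\<^esub> x = (\<ominus>\<^bsub>R\<^esub> \<one>\<^bsub>R\<^esub>) \<odot>\<^bsub>L\<^esub> x" using that sub by (simp add: L.smult_l_minus subsetD)
    then show ?thesis using N.smult_closed[OF _ that, of "\<ominus>\<^bsub>R\<^esub> \<one>\<^bsub>R\<^esub>"] by simp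
  qed
  have "subgroup N (add_monoid L)"
    by (rule subgroup.intro) (use sub neg in \<open>auto simp flip: a_inv_def\<close>)
  then have "additive_subgroup N L" by (rule additive_subgroupI)
  then interpret A: abelian_subgroup N L by (rule abelian_subgroupI3) (rule L.abelian_group_axioms)
  have car: "carrier ?V = (\<lambda>x. N +>\<^bsub>L\<^esub> x) ` carrier L"
    unfolding quot_module_def A_RCOSETS_def' by auto
  have zero: "\<zero>\<^bsub>?V\<^esub> = N" "N +>\<^bsub>L\<^esub> \<zero>\<^bsub>L\<^esub> = N" using sub by (simp_all add: quot_module_def)
  have add: "(N +>\<^bsub>L\<^esub> x) \<oplus>\<^bsub>?V\<^esub> (N +>\<^bsub>L\<^esub> y) = N +>\<^bsub>L\<^esub> (x \<oplus>\<^bsub>L\<^esub> y)" if "x \<in> carrier L" "y \<in> carrier L" for x y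
    using A.a_rcos_sum[OF that] by (simp add: quot_module_def)
  have absorb: "N +>\<^bsub>L\<^esub> (n \<oplus>\<^bsub>L\<^esub> z) = N +>\<^bsub>L\<^esub> z" if "n \<in> N" "z \<in> carrier L" for n z
    using A.a_rcos_const[OF that(1)] L.a_coset_add_assoc[of N n z] that sub by (simp add: subsetD)
  have smult: "c \<odot>\<^bsub>?V\<^esub> (N +>\<^bsub>L\<^esub> x) = N +>\<^bsub>L\<^esub> (c \<odot>\<^bsub>L\<^esub> x)" if c: "c \<in> carrier R" and x: "x \<in> carrier L" for c x
  proof -
    \<comment> \<open>Scalar multiplication of a coset is defined by a union over its elements; all
      cosets in this union coincide.\<close>
    have "N +>\<^bsub>L\<^esub> (c \<odot>\<^bsub>L\<^esub> y) = N +>\<^bsub>L\<^esub> (c \<odot>\<^bsub>L\<^esub> x)" if "y \<in> N +>\<^bsub>L\<^esub> x" for y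
    proof -
      from that obtain n where n: "n \<in> N" "y = n \<oplus>\<^bsub>L\<^esub> x" unfolding a_r_coset_def' by auto
      then have "c \<odot>\<^bsub>L\<^esub> y = c \<odot>\<^bsub>L\<^esub> n \<oplus>\<^bsub>L\<^esub> c \<odot>\<^bsub>L\<^esub> x" using c x sub by (simp add: L.smult_r_distr subsetD)
      then show ?thesis using absorb[OF N.smult_closed[OF c n(1)]] c x by simp
    qed
    moreover have "x \<in> N +>\<^bsub>L\<^esub> x" by (rule A.a_rcos_self[OF x])
    ultimately have "(\<Union>y\<in>N +>\<^bsub>L\<^esub> x. N +>\<^bsub>L\<^esub> (c \<odot>\<^bsub>L\<^esub> y)) = N +>\<^bsub>L\<^esub> (c \<odot>\<^bsub>L\<^esub> x)" by blast
    then show ?thesis by (simp add: quot_module_def)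
  qed
  show "module R ?V"
  proof (rule module_criteria[OF L.is_cring])
    show "\<zero>\<^bsub>?V\<^esub> \<in> carrier ?V" unfolding zero(1) car using zero(2) L.zero_closed by (metis imageI)
    show "\<forall>v w. v \<in> carrier ?V \<and> w \<in> carrier ?V \<longrightarrow> v \<oplus>\<^bsub>?V\<^esub> w \<in> carrier ?V"
      unfolding car by (auto simp: add)
    show "\<forall>v\<in>carrier ?V. \<exists>n\<in>carrier ?V. v \<oplus>\<^bsub>?V\<^esub> n = \<zero>\<^bsub>?V\<^esub>"
    proof
      fix v assume "v \<in> carrier ?V"
      then obtain x where x: "x \<in> carrier L" "v = N +>\<^bsub>L\<^esub> x" unfolding car by auto
      then have "v \<oplus>\<^bsub>?V\<^esub> (N +>\<^bsub>L\<^esub> (\<ominus>\<^bsub>L\<^esub> x)) = \<zero>\<^bsub>?V\<^esub>" using zero by (simp add: add L.M.r_neg)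
      then show "\<exists>n\<in>carrier ?V. v \<oplus>\<^bsub>?V\<^esub> n = \<zero>\<^bsub>?V\<^esub>" unfolding car using x by blast
    qed
    show "\<forall>c v. c \<in> carrier R \<and> v \<in> carrier ?V \<longrightarrow> c \<odot>\<^bsub>?V\<^esub> v \<in> carrier ?V"
      unfolding car by (auto simp: smult)
    show "\<forall>v w. v \<in> carrier ?V \<and> w \<in> carrier ?V \<longrightarrow> v \<oplus>\<^bsub>?V\<^esub> w = w \<oplus>\<^bsub>?V\<^esub> v"
      unfolding car by (auto simp: add L.M.a_comm)
    show "\<forall>v w x. v \<in> carrier ?V \<and> w \<in> carrier ?V \<and> x \<in> carrier ?V \<longrightarrow>
        v \<oplus>\<^bsub>?V\<^esub> w \<oplus>\<^bsub>?V\<^esub> x = v \<oplus>\<^bsub>?V\<^esub> (w \<oplus>\<^bsub>?V\<^esub> x)"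
      unfolding car by (auto simp: add L.M.a_assoc)
    show "\<forall>v\<in>carrier ?V. v \<oplus>\<^bsub>?V\<^esub> \<zero>\<^bsub>?V\<^esub> = v"
    proof
      fix v assume "v \<in> carrier ?V"
      then obtain x where x: "x \<in> carrier L" "v = N +>\<^bsub>L\<^esub> x" unfolding car by auto
      then show "v \<oplus>\<^bsub>?V\<^esub> \<zero>\<^bsub>?V\<^esub> = v" using add[OF x(1) L.zero_closed] zero by simp
    qed
    show "\<forall>a b v. a \<in> carrier R \<and> b \<in> carrier R \<and> v \<in> carrier ?V \<longrightarrow>
        a \<otimes>\<^bsub>R\<^esub> b \<odot>\<^bsub>?V\<^esub> v = a \<odot>\<^bsub>?V\<^esub> (b \<odot>\<^bsub>?V\<^esub> v)"
      unfolding car by (auto simp: smult L.smult_assoc1)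
    show "\<forall>v\<in>carrier ?V. \<one>\<^bsub>R\<^esub> \<odot>\<^bsub>?V\<^esub> v = v" unfolding car by (auto simp: smult)
    show "\<forall>a b v. a \<in> carrier R \<and> b \<in> carrier R \<and> v \<in> carrier ?V \<longrightarrow>
        (a \<oplus>\<^bsub>R\<^esub> b) \<odot>\<^bsub>?V\<^esub> v = a \<odot>\<^bsub>?V\<^esub> v \<oplus>\<^bsub>?V\<^esub> b \<odot>\<^bsub>?V\<^esub> v"
      unfolding car by (auto simp: smult add L.smult_l_distr)
    show "\<forall>a v w. a \<in> carrier R \<and> v \<in> carrier ?V \<and> w \<in> carrier ?V \<longrightarrow>
        a \<odot>\<^bsub>?V\<^esub> (v \<oplus>\<^bsub>?V\<^esub> w) = a \<odot>\<^bsub>?V\<^esub> v \<oplus>\<^bsub>?V\<^esub> a \<odot>\<^bsub>?V\<^esub> w"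
      unfolding car by (auto simp: smult add L.smult_r_distr)
  qed
  show "N +>\<^bsub>L\<^esub> x = \<zero>\<^bsub>?V\<^esub> \<longleftrightarrow> x \<in> N" if "x \<in> carrier L"
    unfolding zero using A.a_rcos_self[OF that] A.a_rcos_const by blast
  show "(N +>\<^bsub>L\<^esub> x) \<oplus>\<^bsub>?V\<^esub> (N +>\<^bsub>L\<^esub> y) = N +>\<^bsub>L\<^esub> (x \<oplus>\<^bsub>L\<^esub> y)" if "x \<in> carrier L" "y \<in> carrier L"
    using that by (rule add)
  show "c \<odot>\<^bsub>?V\<^esub> (N +>\<^bsub>L\<^esub> x) = N +>\<^bsub>L\<^esub> (c \<odot>\<^bsub>L\<^esub> x)" if "c \<in> carrier R" "x \<in> carrier L"
    using that by (rule smult)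
  show "carrier ?V = (\<lambda>x. N +>\<^bsub>L\<^esub> x) ` carrier L" by (rule car)
qed


lemma free_module_simps:
  fixes B :: "'b set"
  defines "L \<equiv> free_module (type_ring :: 'k::comm_ring_1 ring) B"
  shows "\<phi> \<in> carrier L \<longleftrightarrow> finite {x. \<phi> x \<noteq> 0} \<and> {x. \<phi> x \<noteq> 0} \<subseteq> B"
    "\<phi> \<oplus>\<^bsub>L\<^esub> \<psi> = (\<lambda>x. \<phi> x + \<psi> x)" "c \<odot>\<^bsub>L\<^esub> \<phi> = (\<lambda>x. c * \<phi> x)" "\<zero>\<^bsub>L\<^esub> = (\<lambda>_. 0)"
  by (simp_all add: L_def free_module_def)

lemma module_free_module:
  fixes B :: "'b set"
  defines "L \<equiv> free_module (type_ring :: 'k::comm_ring_1 ring) B"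
  shows "module type_ring L" and "\<phi> \<in> carrier L \<Longrightarrow> \<psi> \<in> carrier L \<Longrightarrow> \<phi> \<ominus>\<^bsub>L\<^esub> \<psi> = (\<lambda>x. \<phi> x - \<psi> x)"
proof -
  note simps = free_module_simps[where 'k='k and B=B, folded L_def]
  have uminus: "(\<lambda>x. - \<phi> x) \<in> carrier L" if "\<phi> \<in> carrier L" for \<phi> using that by (simp add: simps)
  have add: "(\<lambda>x. \<phi> x + \<psi> x) \<in> carrier L" if "\<phi> \<in> carrier L" "\<psi> \<in> carrier L" for \<phi> \<psi>
  proof -
    have "{x. \<phi> x + \<psi> x \<noteq> 0} \<subseteq> {x. \<phi> x \<noteq> 0} \<union> {x. \<psi> x \<noteq> 0}" by auto
    then show ?thesis using that unfolding simps by (meson finite_Un finite_subset le_sup_iff subset_trans)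
  qed
  have smult: "(\<lambda>x. c * \<phi> x) \<in> carrier L" if "\<phi> \<in> carrier L" for c \<phi>
  proof -
    have "{x. c * \<phi> x \<noteq> 0} \<subseteq> {x. \<phi> x \<noteq> 0}" by auto
    then show ?thesis using that unfolding simps by (meson finite_subset subset_trans)
  qed
  have inv: "\<exists>w\<in>carrier L. v \<oplus>\<^bsub>L\<^esub> w = \<zero>\<^bsub>L\<^esub>" if "v \<in> carrier L" for v
    by (rule bexI[OF _ uminus[OF that]]) (simp add: simps)
  show m: "module type_ring L"
  proof (rule module_criteria[OF cring_type_ring])
    show "\<zero>\<^bsub>L\<^esub> \<in> carrier L" by (simp add: simps)
    show "\<forall>v w. v \<in> carrier L \<and> w \<in> carrier L \<longrightarrow> v \<oplus>\<^bsub>L\<^esub> w \<in> carrier L" using add by (simp add: simps(2))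
    show "\<forall>v\<in>carrier L. \<exists>w\<in>carrier L. v \<oplus>\<^bsub>L\<^esub> w = \<zero>\<^bsub>L\<^esub>" using inv by blast
    show "\<forall>c v. c \<in> carrier type_ring \<and> v \<in> carrier L \<longrightarrow> c \<odot>\<^bsub>L\<^esub> v \<in> carrier L" using smult by (simp add: simps(3))
  qed (simp_all add: simps(2-) algebra_simps)
  interpret module type_ring L by (rule m)
  assume \<phi>: "\<phi> \<in> carrier L" and \<psi>: "\<psi> \<in> carrier L"
  have "(\<lambda>x. - \<psi> x) \<oplus>\<^bsub>L\<^esub> \<psi> = \<zero>\<^bsub>L\<^esub>" by (simp add: simps(2,4))
  from M.minus_equality[OF this \<psi> uminus[OF \<psi>]] have "\<ominus>\<^bsub>L\<^esub> \<psi> = (\<lambda>x. - \<psi> x)" by simp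
  then show "\<phi> \<ominus>\<^bsub>L\<^esub> \<psi> = (\<lambda>x. \<phi> x - \<psi> x)" by (simp add: a_minus_def simps(2))
qed

lemma (in module) finsum_unique_coeffs:
  assumes e: "e ` {..<n::nat} \<subseteq> carrier M" and ind: "family_indep R M n e"
    and c: "c \<in> {..<n} \<rightarrow> carrier R" and d: "d \<in> {..<n} \<rightarrow> carrier R"
    and eq: "finsum M (\<lambda>i. c i \<odot>\<^bsub>M\<^esub> e i) {..<n} = finsum M (\<lambda>i. d i \<odot>\<^bsub>M\<^esub> e i) {..<n}" and i: "i < n"
  shows "c i = d i"
proof -
  have cl: "(\<lambda>i. b i \<odot>\<^bsub>M\<^esub> e i) \<in> {..<n} \<rightarrow> carrier M" if "b \<in> {..<n} \<rightarrow> carrier R" for b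
    using e that by (auto intro!: smult_closed)
  have m: "(\<lambda>i. c i \<ominus> d i) \<in> {..<n} \<rightarrow> carrier R" using c d by (auto intro!: R.minus_closed)
  have "finsum M (\<lambda>i. c i \<odot>\<^bsub>M\<^esub> e i) {..<n} = finsum M (\<lambda>i. (c i \<ominus> d i) \<odot>\<^bsub>M\<^esub> e i \<oplus>\<^bsub>M\<^esub> d i \<odot>\<^bsub>M\<^esub> e i) {..<n}"
  proof (rule M.finsum_cong')
    fix i assume "i \<in> {..<n}"
    then have *: "c i \<in> carrier R" "d i \<in> carrier R" "e i \<in> carrier M" using c d e by auto
    then have "(c i \<ominus> d i) \<oplus> d i = c i" by (simp add: a_minus_def R.a_assoc R.l_neg)
    then show "c i \<odot>\<^bsub>M\<^esub> e i = (c i \<ominus> d i) \<odot>\<^bsub>M\<^esub> e i \<oplus>\<^bsub>M\<^esub> d i \<odot>\<^bsub>M\<^esub> e i"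
      using * by (simp flip: smult_l_distr)
  qed (use cl[OF m] cl[OF d] in auto)
  also have "\<dots> = finsum M (\<lambda>i. (c i \<ominus> d i) \<odot>\<^bsub>M\<^esub> e i) {..<n} \<oplus>\<^bsub>M\<^esub> finsum M (\<lambda>i. d i \<odot>\<^bsub>M\<^esub> e i) {..<n}"
    by (rule M.finsum_addf[OF cl[OF m] cl[OF d]])
  finally have "finsum M (\<lambda>i. (c i \<ominus> d i) \<odot>\<^bsub>M\<^esub> e i) {..<n} = \<zero>\<^bsub>M\<^esub>"
    unfolding eq using M.finsum_closed[OF cl[OF m]] M.finsum_closed[OF cl[OF d]] by (metis M.add.r_cancel_one)
  from family_indepD[OF ind m this i] have "c i \<ominus> d i = \<zero>" .
  then show ?thesis using c d i by (simp add: R.r_right_minus_eq Pi_iff)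
qed

text \<open>The coordinates \<open>co\<close> with respect to the basis extend linearly to
  \<open>ev\<close> on the free module. \<open>ev\<close> vanishes on the relations, which gives
  independence; the relations reduce every symbol to those of the basis, which gives
  generation.\<close>

lemma vdim_base_change:
  fixes M :: "('r::comm_ring_1, 'v, 'z) module_scheme" and g :: "'r \<Rightarrow> 'k::field"
  assumes M: "module type_ring M" and g: "is_ring_hom g" and e: "e ` {..<n} \<subseteq> carrier M"
    and ind: "family_indep type_ring M n e" and gen: "family_gen type_ring M n e"
  shows "vdim (type_ring :: 'k ring) (base_change type_ring type_ring g M) = enat n"
proof -
  interpret M: module type_ring M by (rule M)
  define L where "L = free_module (type_ring :: 'k ring) (carrier M)"
  note simps = free_module_simps[where 'k='k and B="carrier M", folded L_def]
  note Lmodule = module_free_module[where 'k='k and B="carrier M", folded L_def]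
  interpret L: module type_ring L by (rule Lmodule(1))
  let ?gen = "free_gen (type_ring :: 'k ring)"
  have gen_eq: "?gen x = (\<lambda>y. if y = x then 1 else 0)" for x :: 'v by (auto simp: free_gen_def)
  have gen_car: "?gen x \<in> carrier L" if "x \<in> carrier M" for x using that by (simp add: simps gen_eq)
  have e_car: "e i \<in> carrier M" if "i < n" for i using e that by auto
  have "\<forall>x\<in>carrier M. \<exists>c. x = finsum M (\<lambda>i. c i \<odot>\<^bsub>M\<^esub> e i) {..<n}" using gen unfolding family_gen_def by blast
  from bchoice[OF this] obtain co where co: "\<And>x. x \<in> carrier M \<Longrightarrow> x = finsum M (\<lambda>i. co x i \<odot>\<^bsub>M\<^esub> e i) {..<n}"
    by blast
  have cl: "(\<lambda>i. b i \<odot>\<^bsub>M\<^esub> e i) \<in> {..<n} \<rightarrow> carrier M" for b using e by (auto intro!: M.smult_closed)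
  have co_eqI: "co x i = c i" if "x \<in> carrier M" "x = finsum M (\<lambda>i. c i \<odot>\<^bsub>M\<^esub> e i) {..<n}" "i < n" for x c i
    by (rule M.finsum_unique_coeffs[OF e ind _ _ _ that(3)]) (use co[OF that(1)] that(2) in auto)
  have co_add: "co (x \<oplus>\<^bsub>M\<^esub> y) i = co x i + co y i" if "x \<in> carrier M" "y \<in> carrier M" "i < n" for x y i
  proof (rule co_eqI)
    have "x \<oplus>\<^bsub>M\<^esub> y = finsum M (\<lambda>i. co x i \<odot>\<^bsub>M\<^esub> e i) {..<n} \<oplus>\<^bsub>M\<^esub> finsum M (\<lambda>i. co y i \<odot>\<^bsub>M\<^esub> e i) {..<n}"
      using co[OF that(1)] co[OF that(2)] by simp
    also have "\<dots> = finsum M (\<lambda>i. co x i \<odot>\<^bsub>M\<^esub> e i \<oplus>\<^bsub>M\<^esub> co y i \<odot>\<^bsub>M\<^esub> e i) {..<n}"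
      by (rule M.M.finsum_addf[OF cl cl, symmetric])
    also have "\<dots> = finsum M (\<lambda>i. (co x i + co y i) \<odot>\<^bsub>M\<^esub> e i) {..<n}"
      using M.smult_l_distr[OF _ _ e_car] by (intro M.M.finsum_cong' cl refl) simp
    finally show "x \<oplus>\<^bsub>M\<^esub> y = finsum M (\<lambda>i. (co x i + co y i) \<odot>\<^bsub>M\<^esub> e i) {..<n}" .
  qed (use that in auto)
  have co_smult: "co (r \<odot>\<^bsub>M\<^esub> x) i = r * co x i" if "x \<in> carrier M" "i < n" for r x i
  proof (rule co_eqI)
    have "r \<odot>\<^bsub>M\<^esub> x = r \<odot>\<^bsub>M\<^esub> finsum M (\<lambda>i. co x i \<odot>\<^bsub>M\<^esub> e i) {..<n}" using co[OF that(1)] by simp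
    also have "\<dots> = finsum M (\<lambda>i. r \<odot>\<^bsub>M\<^esub> (co x i \<odot>\<^bsub>M\<^esub> e i)) {..<n}"
      by (rule M.finsum_smult_ldistr[OF _ _ cl]) simp_all
    also have "\<dots> = finsum M (\<lambda>i. (r * co x i) \<odot>\<^bsub>M\<^esub> e i) {..<n}"
      using M.smult_assoc1[OF _ _ e_car] by (intro M.M.finsum_cong' cl refl) simp
    finally show "r \<odot>\<^bsub>M\<^esub> x = finsum M (\<lambda>i. (r * co x i) \<odot>\<^bsub>M\<^esub> e i) {..<n}" .
  qed (use that M.smult_closed in auto)
  have co_e: "co (e j) i = (if i = j then 1 else 0)" if "j < n" "i < n" for i j
  proof (rule co_eqI[OF e_car[OF that(1)] _ that(2)])
    have "finsum M (\<lambda>i. (if i = j then 1 else 0) \<odot>\<^bsub>M\<^esub> e i) {..<n} = finsum M (\<lambda>i. if j = i then e i else \<zero>\<^bsub>M\<^esub>) {..<n}"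
      using M.smult_one e_car M.smult_l_null by (intro M.M.finsum_cong') auto
    also have "\<dots> = e j" using that e_car by (subst M.M.finsum_singleton) auto
    finally show "e j = finsum M (\<lambda>i. (if i = j then 1 else 0) \<odot>\<^bsub>M\<^esub> e i) {..<n}" by simp
  qed

  define ev where "ev = (\<lambda>\<phi> i. \<Sum>x\<in>{x. \<phi> x \<noteq> 0}. \<phi> x * g (co x i))"
  have ev: "ev \<phi> i = (\<Sum>x\<in>T. \<phi> x * g (co x i))" if "finite T" "{x. \<phi> x \<noteq> 0} \<subseteq> T" for T \<phi> i
    unfolding ev_def by (rule sum.mono_neutral_left) (use that in auto)
  have ev_add: "ev (\<lambda>x. \<phi> x + \<psi> x) i = ev \<phi> i + ev \<psi> i" if "\<phi> \<in> carrier L" "\<psi> \<in> carrier L" for \<phi> \<psi> i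
  proof -
    have T: "finite ({x. \<phi> x \<noteq> 0} \<union> {x. \<psi> x \<noteq> 0})" using that by (simp add: simps)
    show ?thesis by (subst (1 2 3) ev[OF T]) (auto simp: sum.distrib[symmetric] algebra_simps)
  qed
  have ev_smult: "ev (\<lambda>x. c * \<phi> x) i = c * ev \<phi> i" if "\<phi> \<in> carrier L" for c \<phi> i
  proof -
    have T: "finite {x. \<phi> x \<noteq> 0}" using that by (simp add: simps)
    show ?thesis by (subst (1 2) ev[OF T]) (auto simp: sum_distrib_left mult.assoc)
  qed
  have ev_gen: "ev (?gen x) i = g (co x i)" for x i
    by (subst ev[of "{x}"]) (auto simp: gen_eq)
  have ev_diff: "ev (\<lambda>x. \<phi> x - \<psi> x) i = ev \<phi> i - ev \<psi> i" if "\<phi> \<in> carrier L" "\<psi> \<in> carrier L" for \<phi> \<psi> i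
    using ev_add[OF that(1) L.smult_closed[OF _ that(2), of "- 1"]] ev_smult[OF that(2), of "- 1"] by (simp add: simps(3))

  define rels where "rels =
            {(?gen (x \<oplus>\<^bsub>M\<^esub> y) \<ominus>\<^bsub>L\<^esub> ?gen x) \<ominus>\<^bsub>L\<^esub> ?gen y | x y. x \<in> carrier M \<and> y \<in> carrier M} \<union>
            {?gen (r \<odot>\<^bsub>M\<^esub> x) \<ominus>\<^bsub>L\<^esub> (g r \<odot>\<^bsub>L\<^esub> ?gen x) | r x. r \<in> carrier type_ring \<and> x \<in> carrier M}"
  have rels: "rels \<subseteq> {\<phi> \<in> carrier L. \<forall>i<n. ev \<phi> i = 0}"
  proof -
    have 1: "(?gen (x \<oplus>\<^bsub>M\<^esub> y) \<ominus>\<^bsub>L\<^esub> ?gen x) \<ominus>\<^bsub>L\<^esub> ?gen y \<in> {\<phi> \<in> carrier L. \<forall>i<n. ev \<phi> i = 0}"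
      if "x \<in> carrier M" "y \<in> carrier M" for x y
    proof -
      note c = gen_car[OF that(1)] gen_car[OF that(2)] gen_car[OF M.M.a_closed[OF that]]
      have c': "?gen (x \<oplus>\<^bsub>M\<^esub> y) \<ominus>\<^bsub>L\<^esub> ?gen x \<in> carrier L" by (rule L.M.minus_closed) fact+
      have "(?gen (x \<oplus>\<^bsub>M\<^esub> y) \<ominus>\<^bsub>L\<^esub> ?gen x) \<ominus>\<^bsub>L\<^esub> ?gen y \<in> carrier L" using c c' L.M.minus_closed by blast
      moreover have "ev ((?gen (x \<oplus>\<^bsub>M\<^esub> y) \<ominus>\<^bsub>L\<^esub> ?gen x) \<ominus>\<^bsub>L\<^esub> ?gen y) i = 0" if "i < n" for i
        unfolding Lmodule(2)[OF c' c(2)] ev_diff[OF c' c(2)]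
        unfolding Lmodule(2)[OF c(3) c(1)] ev_diff[OF c(3) c(1)]
        using that co_add[OF \<open>x \<in> carrier M\<close> \<open>y \<in> carrier M\<close>] by (simp add: ev_gen is_ring_homD[OF g])
      ultimately show ?thesis by blast
    qed
    have 2: "?gen (r \<odot>\<^bsub>M\<^esub> x) \<ominus>\<^bsub>L\<^esub> (g r \<odot>\<^bsub>L\<^esub> ?gen x) \<in> {\<phi> \<in> carrier L. \<forall>i<n. ev \<phi> i = 0}" if "x \<in> carrier M" for r x
    proof -
      have c: "?gen (r \<odot>\<^bsub>M\<^esub> x) \<in> carrier L" by (rule gen_car) (simp add: M.smult_closed that)
      have c': "g r \<odot>\<^bsub>L\<^esub> ?gen x \<in> carrier L" by (rule L.smult_closed) (simp_all add: gen_car that)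
      have "ev (?gen (r \<odot>\<^bsub>M\<^esub> x) \<ominus>\<^bsub>L\<^esub> (g r \<odot>\<^bsub>L\<^esub> ?gen x)) i = 0" if "i < n" for i
        unfolding Lmodule(2)[OF c c'] ev_diff[OF c c']
        using that co_smult[OF \<open>x \<in> carrier M\<close> that] ev_smult[OF gen_car[OF \<open>x \<in> carrier M\<close>]]
        by (simp add: ev_gen is_ring_homD[OF g] simps(3))
      then show ?thesis using L.M.minus_closed[OF c c'] by blast
    qed
    show ?thesis unfolding rels_def using 1 2 by blast
  qed
  then have rels_car: "rels \<subseteq> carrier L" by blast
  define S where "S = module.span type_ring L rels"
  have S: "submodule type_ring S L" unfolding S_def by (rule L.span_is_submodule[OF rels_car])
  interpret S: submodule type_ring S L by (rule S)
  have rels_S: "rels \<subseteq> S" unfolding S_def by (rule L.in_own_span[OF rels_car])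
  have S_add: "(\<lambda>x. \<phi> x + \<psi> x) \<in> S" if "\<phi> \<in> S" "\<psi> \<in> S" for \<phi> \<psi>
    using S.m_closed[of \<phi> \<psi>] that by (simp add: simps(2))
  have S_smult: "(\<lambda>x. c * \<phi> x) \<in> S" if "\<phi> \<in> S" for c \<phi>
    using S.smult_closed[of c \<phi>] that by (simp add: simps(3))
  have S_zero: "(\<lambda>_. 0) \<in> S" using S.zero_closed by (simp add: simps(4))
  have S_sum: "(\<lambda>x. \<Sum>i\<in>I. \<phi> i x) \<in> S" if "finite I" "\<And>i. i \<in> I \<Longrightarrow> \<phi> i \<in> S" for I :: "'v set" and \<phi>
    using that by (induction I rule: finite_induct) (auto simp: S_zero intro: S_add)
  have S_ev: "ev \<phi> i = 0" if "\<phi> \<in> S" "i < n" for \<phi> i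
  proof -
    have "submodule type_ring {\<phi> \<in> carrier L. \<forall>i<n. ev \<phi> i = 0} L"
    proof (unfold_locales)
      show "\<phi> \<oplus>\<^bsub>L\<^esub> \<psi> \<in> {\<phi> \<in> carrier L. \<forall>i<n. ev \<phi> i = 0}"
        if "\<phi> \<in> {\<phi> \<in> carrier L. \<forall>i<n. ev \<phi> i = 0}" "\<psi> \<in> {\<phi> \<in> carrier L. \<forall>i<n. ev \<phi> i = 0}" for \<phi> \<psi>
        using that L.M.a_closed[of \<phi> \<psi>] by (simp add: simps(2) ev_add)
      show "c \<odot>\<^bsub>L\<^esub> \<phi> \<in> {\<phi> \<in> carrier L. \<forall>i<n. ev \<phi> i = 0}"
        if "\<phi> \<in> {\<phi> \<in> carrier L. \<forall>i<n. ev \<phi> i = 0}" for c \<phi>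
        using that L.smult_closed[of c \<phi>] by (simp add: simps(3) ev_smult)
    qed (use L.M.zero_closed in \<open>auto simp: simps(4) ev_def\<close>)
    from L.span_is_subset[OF rels this] show ?thesis using that unfolding S_def by blast
  qed
  have rel1: "(\<lambda>z. ?gen (x \<oplus>\<^bsub>M\<^esub> y) z - ?gen x z - ?gen y z) \<in> S" if "x \<in> carrier M" "y \<in> carrier M" for x y
  proof -
    note c = gen_car[OF that(1)] gen_car[OF that(2)] gen_car[OF M.M.a_closed[OF that]]
    have c': "?gen (x \<oplus>\<^bsub>M\<^esub> y) \<ominus>\<^bsub>L\<^esub> ?gen x \<in> carrier L" by (rule L.M.minus_closed) fact+
    have "(?gen (x \<oplus>\<^bsub>M\<^esub> y) \<ominus>\<^bsub>L\<^esub> ?gen x) \<ominus>\<^bsub>L\<^esub> ?gen y \<in> S" using rels_S that unfolding rels_def by blast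
    then show ?thesis unfolding Lmodule(2)[OF c' c(2)] unfolding Lmodule(2)[OF c(3) c(1)] .
  qed
  have rel2: "(\<lambda>z. ?gen (r \<odot>\<^bsub>M\<^esub> x) z - g r * ?gen x z) \<in> S" if "x \<in> carrier M" for r x
  proof -
    have c: "?gen (r \<odot>\<^bsub>M\<^esub> x) \<in> carrier L" by (rule gen_car) (simp add: M.smult_closed that)
    have c': "g r \<odot>\<^bsub>L\<^esub> ?gen x \<in> carrier L" by (rule L.smult_closed) (simp_all add: gen_car that)
    have "?gen (r \<odot>\<^bsub>M\<^esub> x) \<ominus>\<^bsub>L\<^esub> (g r \<odot>\<^bsub>L\<^esub> ?gen x) \<in> S" using rels_S that unfolding rels_def by auto
    then show ?thesis unfolding Lmodule(2)[OF c c'] by (simp only: simps(3))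
  qed
  have gen_finsum: "(\<lambda>z. ?gen (finsum M (\<lambda>i. c i \<odot>\<^bsub>M\<^esub> e i) {..<m}) z - (\<Sum>i<m. g (c i) * ?gen (e i) z)) \<in> S"
    if "m \<le> n" for c m
    using that
  proof (induction m)
    case 0
    \<comment> \<open>The additivity relation for \<open>0 + 0\<close> is the negative of the symbol
      of 0, so this symbol lies in \<open>S\<close>.\<close>
    have "(\<lambda>z. - 1 * (?gen (\<zero>\<^bsub>M\<^esub> \<oplus>\<^bsub>M\<^esub> \<zero>\<^bsub>M\<^esub>) z - ?gen \<zero>\<^bsub>M\<^esub> z - ?gen \<zero>\<^bsub>M\<^esub> z)) \<in> S" by (intro S_smult rel1) simp_all
    then show ?case by simp
  next
    case (Suc m)
    let ?x = "finsum M (\<lambda>i. c i \<odot>\<^bsub>M\<^esub> e i) {..<m}" and ?y = "c m \<odot>\<^bsub>M\<^esub> e m"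
    have x: "?x \<in> carrier M" using e_car Suc.prems by (intro M.M.finsum_closed) (auto intro!: M.smult_closed)
    have y: "?y \<in> carrier M" using e_car Suc.prems by (intro M.smult_closed) auto
    have eq: "finsum M (\<lambda>i. c i \<odot>\<^bsub>M\<^esub> e i) {..<Suc m} = ?x \<oplus>\<^bsub>M\<^esub> ?y"
      unfolding lessThan_Suc using x y e_car Suc.prems M.M.a_comm
      by (subst M.M.finsum_insert) (auto intro!: M.smult_closed)
    have em: "e m \<in> carrier M" and m: "m \<le> n" using e_car Suc.prems by auto
    from S_add[OF S_add[OF rel1[OF x y] rel2[OF em, of "c m"]] Suc.IH[OF m]]
    show ?case unfolding eq by (simp add: algebra_simps)
  qed
  have reduce: "(\<lambda>z. \<phi> z - (\<Sum>i<n. ev \<phi> i * ?gen (e i) z)) \<in> S" if \<phi>: "\<phi> \<in> carrier L" for \<phi>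
  proof -
    let ?T = "{x. \<phi> x \<noteq> 0}"
    have T: "finite ?T" "?T \<subseteq> carrier M" using \<phi> by (auto simp: simps)
    have "(\<lambda>z. \<Sum>x\<in>?T. \<phi> x * (?gen x z - (\<Sum>i<n. g (co x i) * ?gen (e i) z))) \<in> S"
    proof (intro S_sum S_smult T)
      fix x assume "x \<in> ?T"
      then have "x \<in> carrier M" using T by blast
      then show "(\<lambda>z. ?gen x z - (\<Sum>i<n. g (co x i) * ?gen (e i) z)) \<in> S"
        using gen_finsum[OF order_refl, of "co x"] co[symmetric] by simp
    qed
    moreover have "(\<Sum>x\<in>?T. \<phi> x * (?gen x z - (\<Sum>i<n. g (co x i) * ?gen (e i) z))) = \<phi> z - (\<Sum>i<n. ev \<phi> i * ?gen (e i) z)" for z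
    proof -
      have "(\<Sum>x\<in>?T. \<phi> x * ?gen x z) = (\<Sum>x\<in>?T. if z = x then \<phi> x else 0)" by (intro sum.cong) (auto simp: gen_eq)
      also have "\<dots> = \<phi> z" using T by (simp add: sum.delta')
      finally have "(\<Sum>x\<in>?T. \<phi> x * ?gen x z) = \<phi> z" .
      moreover have "(\<Sum>x\<in>?T. \<phi> x * (\<Sum>i<n. g (co x i) * ?gen (e i) z)) = (\<Sum>i<n. ev \<phi> i * ?gen (e i) z)"
        unfolding ev_def sum_distrib_left sum_distrib_right by (subst sum.swap) (simp add: mult.assoc)
      ultimately show ?thesis by (simp add: right_diff_distrib sum_subtractf)
    qed
    ultimately show ?thesis by simp
  qed

  define V where "V = quot_module L S"
  define q where "q = (\<lambda>\<phi>. S +>\<^bsub>L\<^esub> \<phi>)"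
  have q_add: "q \<phi> \<oplus>\<^bsub>V\<^esub> q \<psi> = q (\<lambda>x. \<phi> x + \<psi> x)" if "\<phi> \<in> carrier L" "\<psi> \<in> carrier L" for \<phi> \<psi>
    using quot_module_add[OF Lmodule(1) S that] by (simp add: V_def q_def simps(2))
  have q_smult: "c \<odot>\<^bsub>V\<^esub> q \<phi> = q (\<lambda>x. c * \<phi> x)" if "\<phi> \<in> carrier L" for c \<phi>
    using quot_module_smult[OF Lmodule(1) S _ that, of c] by (simp add: V_def q_def simps(3))
  have q_car: "carrier V = q ` carrier L"
    using quot_module_carrier[OF Lmodule(1) S] by (simp add: V_def q_def)
  have q_zero: "q \<phi> = \<zero>\<^bsub>V\<^esub> \<longleftrightarrow> \<phi> \<in> S" if "\<phi> \<in> carrier L" for \<phi>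
    using quot_module_zero[OF Lmodule(1) S that] by (simp add: V_def q_def)
  have Vmod: "module type_ring V" unfolding V_def by (rule quot_module_module[OF Lmodule(1) S])
  interpret F: field "type_ring :: 'k ring" by (rule field_type_ring)
  interpret V: vectorspace type_ring V unfolding vectorspace_def using Vmod F.field_axioms by simp
  have sub: "S \<subseteq> carrier L" by (rule S.subset)
  define comb where "comb = (\<lambda>m (c :: nat \<Rightarrow> 'k) z. \<Sum>i<m. c i * ?gen (e i) z)"
  have comb: "comb m c \<in> carrier L \<and> q (comb m c) = finsum V (\<lambda>i. c i \<odot>\<^bsub>V\<^esub> q (?gen (e i))) {..<m}"
    if "m \<le> n" for m c
    using that
  proof (induction m)
    case 0
    have "(\<lambda>_. 0) \<in> carrier L" using L.M.zero_closed by (simp add: simps(4))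
    then show ?case using q_zero[of "\<lambda>_. 0"] S_zero by (simp add: comb_def)
  next
    case (Suc m)
    have IH: "comb m c \<in> carrier L" "q (comb m c) = finsum V (\<lambda>i. c i \<odot>\<^bsub>V\<^esub> q (?gen (e i))) {..<m}"
      using Suc by auto
    have gm: "?gen (e m) \<in> carrier L" using e_car Suc.prems by (intro gen_car) auto
    have cm: "(\<lambda>z. c m * ?gen (e m) z) \<in> carrier L" using L.smult_closed[OF _ gm, of "c m"] by (simp add: simps(3))
    have eq: "comb (Suc m) c = (\<lambda>z. c m * ?gen (e m) z + comb m c z)" by (simp add: comb_def fun_eq_iff add.commute)
    have clV: "c i \<odot>\<^bsub>V\<^esub> q (?gen (e i)) \<in> carrier V" if "i < Suc m" for i
      using that Suc.prems by (intro V.smult_closed) (auto simp: q_car intro!: gen_car e_car)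
    have "finsum V (\<lambda>i. c i \<odot>\<^bsub>V\<^esub> q (?gen (e i))) {..<Suc m}
        = c m \<odot>\<^bsub>V\<^esub> q (?gen (e m)) \<oplus>\<^bsub>V\<^esub> finsum V (\<lambda>i. c i \<odot>\<^bsub>V\<^esub> q (?gen (e i))) {..<m}"
      unfolding lessThan_Suc using clV by (subst V.M.finsum_insert) auto
    also have "\<dots> = q (comb (Suc m) c)"
      unfolding IH(2)[symmetric] q_smult[OF gm] q_add[OF cm IH(1)] eq ..
    finally show ?case using L.M.a_closed[OF cm IH(1)] by (simp add: eq simps(2))
  qed
  have E: "(\<lambda>i. q (?gen (e i))) ` {..<n} \<subseteq> carrier V" by (auto simp: q_car intro!: gen_car e_car)
  have ev_comb: "ev (comb m c) i = (\<Sum>j<m. c j * g (co (e j) i))" if "m \<le> n" for m c i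
    using that
  proof (induction m)
    case 0
    then show ?case by (simp add: comb_def ev_def)
  next
    case (Suc m)
    have gm: "?gen (e m) \<in> carrier L" using e_car Suc.prems by (intro gen_car) auto
    have cm: "(\<lambda>z. c m * ?gen (e m) z) \<in> carrier L" using L.smult_closed[OF _ gm, of "c m"] by (simp add: simps(3))
    have eq: "comb (Suc m) c = (\<lambda>z. c m * ?gen (e m) z + comb m c z)" by (simp add: comb_def fun_eq_iff add.commute)
    have "comb m c \<in> carrier L" using comb[of m c] Suc.prems by simp
    from ev_add[OF cm this] show ?case using Suc unfolding eq by (simp add: ev_smult[OF gm] ev_gen)
  qed
  have "family_indep type_ring V n (\<lambda>i. q (?gen (e i)))"
    unfolding family_indep_def
  proof (intro ballI impI allI)
    fix c :: "nat \<Rightarrow> 'k" and i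
    assume "finsum V (\<lambda>i. c i \<odot>\<^bsub>V\<^esub> q (?gen (e i))) {..<n} = \<zero>\<^bsub>V\<^esub>" and i: "i < n"
    then have "comb n c \<in> S" using comb[of n c] q_zero[of "comb n c"] by auto
    then have "ev (comb n c) i = 0" using S_ev i by blast
    moreover have "ev (comb n c) i = (\<Sum>j<n. if i = j then c j else 0)"
      unfolding ev_comb[OF order_refl] using i by (intro sum.cong) (auto simp: co_e is_ring_homD[OF g])
    ultimately show "c i = \<zero>\<^bsub>type_ring\<^esub>" using i by simp
  qed
  moreover have "family_gen type_ring V n (\<lambda>i. q (?gen (e i)))"
    unfolding family_gen_def
  proof
    fix v assume "v \<in> carrier V"
    then obtain \<phi> where \<phi>: "\<phi> \<in> carrier L" "v = q \<phi>" by (auto simp: q_car)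
    let ?d = "\<lambda>z. \<phi> z - comb n (ev \<phi>) z"
    have d: "?d \<in> S" using reduce[OF \<phi>(1)] by (simp add: comb_def)
    have dc: "?d \<in> carrier L" using d sub by blast
    have c: "comb n (ev \<phi>) \<in> carrier L" "q (comb n (ev \<phi>)) = finsum V (\<lambda>i. ev \<phi> i \<odot>\<^bsub>V\<^esub> q (?gen (e i))) {..<n}"
      using comb[of n "ev \<phi>"] by auto
    have "q \<phi> = q ?d \<oplus>\<^bsub>V\<^esub> q (comb n (ev \<phi>))" unfolding q_add[OF dc c(1)] by simp
    also have "\<dots> = q (comb n (ev \<phi>))" using q_zero[OF dc] d c(1) by (simp add: q_car)
    finally show "\<exists>ca\<in>{..<n} \<rightarrow> carrier type_ring. v = finsum V (\<lambda>i. ca i \<odot>\<^bsub>V\<^esub> q (?gen (e i))) {..<n}"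
      unfolding \<phi>(2) c(2) by (intro bexI[of _ "ev \<phi>"]) auto
  qed
  moreover have "base_change type_ring type_ring g M = V"
    unfolding base_change_def Let_def V_def S_def rels_def L_def ..
  ultimately show ?thesis using V.vdim_ge[OF E] V.vdim_le[OF E] by (auto intro: antisym)
qed

section \<open>The generic fiber\<close>

text \<open>Finite colength makes \<open>1, x, ..., x^n\<close> dependent modulo the ideal, so the
  ideal contains a nonzero \<open>P\<close> in k[[x]]. If \<open>h g\<close> vanishes on the curve
  then so does \<open>P g\<close>, and the ring of the curve is free over k[[x]].\<close>

lemma cusp_fiber_regular:
  fixes h :: "'k::field fps fps"
  assumes s: "s > 0" and gen: "fiber_gen (cusp s) h n b" and dvd: "cusp s dvd h * g"
  shows "cusp s dvd g"
proof -
  have "\<not> fiber_indep (cusp s) h (Suc n) (\<lambda>i. fps_const (fps_X ^ i))"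
  proof
    assume "fiber_indep (cusp s) h (Suc n) (\<lambda>i. fps_const (fps_X ^ i))"
    \<comment> \<open>The dimension of a constant family compares the independent family of
      \<open>n + 1\<close> elements with the \<open>n\<close> generators.\<close>
    then have "enat (Suc n) \<le> closed_fiber_dim (fps_const (cusp s)) (Idl\<^bsub>OX (fps_const (cusp s))\<^esub> {OX_class (fps_const (cusp s)) (fps_const h)})"
      by (intro closed_fiber_dim_ge) simp
    also have "\<dots> \<le> enat n" using gen by (intro closed_fiber_dim_le) simp
    finally have "enat (Suc n) \<le> enat n" .
    then show False by simp
  qed
  then obtain c i where c: "(\<Sum>i<Suc n. kconst (c i) * fps_const (fps_X ^ i)) \<in> fiber_ideal (cusp s) h"
    "i < Suc n" "c i \<noteq> 0" unfolding fiber_indep_def by blast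
  define P where "P = (\<Sum>i<Suc n. fps_const (c i) * fps_X ^ i)"
  have "P $ i = (\<Sum>j<Suc n. if i = j then c j else 0)"
    unfolding P_def fps_sum_nth by (intro sum.cong) (auto simp: fps_X_power_nth)
  also have "\<dots> = c i" using c(2) by (simp only: sum.delta' finite_lessThan lessThan_iff if_True)
  finally have P: "P \<noteq> 0" using c(3) by auto
  have "(\<Sum>i<Suc n. kconst (c i) * fps_const (fps_X ^ i)) = fps_const P"
    unfolding P_def is_ring_homD(7)[OF is_ring_hom_fps_const] by (simp only: fps_const_mult)
  with c(1) obtain u w where uw: "fps_const P = cusp s * u + h * w" unfolding fiber_ideal_def by auto
  obtain p r where pr: "cusp s dvd g - lin p r" using cusp_lin_ex[OF s] by blast
  have "lin (P * p) (P * r) = fps_const P * lin p r" by (simp add: lin_def algebra_simps flip: fps_const_mult)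
  also have "\<dots> = cusp s * (u * g) + w * (h * g) - fps_const P * (g - lin p r)" by (simp add: uw algebra_simps)
  also have "cusp s dvd \<dots>" by (rule dvd_diff[OF dvd_add[OF dvd_triv_left dvd_mult[OF dvd]] dvd_mult[OF pr]])
  finally have "P * p = 0 \<and> P * r = 0" by (rule cusp_lin_unique[OF s])
  with P have "lin p r = 0" by (simp add: lin_def)
  with pr show ?thesis by simp
qed

text \<open>\<open>F $ 0\<close> and \<open>h $ 0\<close> form a regular sequence, so their only
  syzygies are the Koszul ones. Hence a k-basis of the closed fiber lifts to a k[[t]]-basis of the
  quotient of the family, and base change preserves the rank.\<close>

lemma geometric_generic_dim_principal:
  fixes F h :: "'k::field fps fps fps"
  assumes ind: "fiber_indep (F $ 0) (h $ 0) n b" and gen: "fiber_gen (F $ 0) (h $ 0) n b"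
    and F0: "F $ 0 \<noteq> 0" and reg: "\<And>g. F $ 0 dvd h $ 0 * g \<Longrightarrow> F $ 0 dvd g"
  shows "geometric_generic_dim F (Idl\<^bsub>OX F\<^esub> {OX_class F h}) = enat n"
proof -
  note q = quot_map_OX[of F]
  let ?Z = "{a. F dvd a}"
  define I where "I = Idl\<^bsub>OX F\<^esub> {OX_class F h}"
  note W = ideal_gen_is_ideal[OF quot_map_is_ideal[OF q], of "{h}"]
  have I: "I = OX_class F ` ideal_gen ?Z {h}"
    unfolding I_def using genideal_quot[OF q, of "{h}"] by simp
  have Iid: "ideal I (OX F)" unfolding I by (rule image_ideal[OF q W])
  have "OX_class F a \<in> I \<longleftrightarrow> (\<exists>u w. a = F * u + h * w)" for a
  proof -
    have "OX_class F a \<in> I \<longleftrightarrow> a \<in> ideal_gen ?Z {h}"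
      unfolding I by (rule image_mem_iff[OF q W]) (use ideal_gen_supset[OF quot_map_is_ideal[OF q]] in blast)
    also have "\<dots> \<longleftrightarrow> (\<exists>u w. a = F * u + h * w)"
    proof
      assume "a \<in> ideal_gen ?Z {h}"
      then obtain z u where zu: "F dvd z" "a = z + u * h" by (auto simp: ideal_gen_def)
      then obtain v where "z = F * v" by blast
      with zu(2) have "a = F * v + h * u" by (simp add: mult.commute)
      then show "\<exists>u w. a = F * u + h * w" by blast
    next
      assume "\<exists>u w. a = F * u + h * w"
      then obtain u w where "a = F * u + h * w" by blast
      then show "a \<in> ideal_gen ?Z {h}"
        using ideal_genI[of "F * u" ?Z "\<lambda>_. w" "{h}"] by (simp add: mult.commute)
    qed
    finally show ?thesis .
  qed
  then have "quot_map (OX F Quot I) (\<lambda>a. I +>\<^bsub>OX F\<^esub> OX_class F a) {a. \<exists>u w. a = F * u + h * w}"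
    using quot_map_Quot[OF q Iid] by simp
  moreover have embed: "OB_embed = fps_map (kconst :: 'k \<Rightarrow> _)" by (simp add: fun_eq_iff OB_embed_def fps_map_def)
  have "is_ring_hom (OB_embed :: 'k fps \<Rightarrow> _)"
    unfolding embed by (rule is_ring_hom_fps_map[OF kconst_hom])
  ultimately have p: "presents (restrict_scalars (\<lambda>c. I +>\<^bsub>OX F\<^esub> OX_class F (OB_embed c)) (OX F Quot I))
      OB_embed (\<lambda>a. I +>\<^bsub>OX F\<^esub> OX_class F a) {a. \<exists>u w. a = F * u + h * w}"
    by (rule presents_restrict_scalars)
  \<comment> \<open>The span of the basis of the closed fiber, used as the set of remainders for the
    division by \<open>F\<close> and \<open>h\<close> in powers of \<open>t\<close>.\<close>
  define S where "S = {\<Sum>i<n. kconst (c i) * b i | c. True}"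
  have embed_nth: "(\<Sum>i<n. OB_embed (c i) * fps_const (b i)) $ m = (\<Sum>i<n. kconst (c i $ m) * b i)" for c m
    by (simp add: fps_sum_nth OB_embed_def)
  let ?b = "\<lambda>i. I +>\<^bsub>OX F\<^esub> OX_class F (fps_const (b i))"
  let ?V = "restrict_scalars (\<lambda>c. I +>\<^bsub>OX F\<^esub> OX_class F (OB_embed c)) (OX F Quot I)"
  have "family_indep type_ring ?V n ?b"
    unfolding presents_indep_iff[OF p]
  proof (intro allI impI)
    fix c :: "nat \<Rightarrow> 'k fps" and i
    assume "(\<Sum>i<n. OB_embed (c i) * fps_const (b i)) \<in> {a. \<exists>u w. a = F * u + h * w}" and i: "i < n"
    then obtain u w where uw: "(\<Sum>i<n. OB_embed (c i) * fps_const (b i)) = F * u + h * w" by blast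
    have "F * u + h * w = 0"
    proof (rule fps_division2_unique)
      show "(F * u + h * w) $ m \<in> S" for m unfolding uw[symmetric] embed_nth S_def by (intro CollectI exI[of _ "\<lambda>i. c i $ m"]) simp
      fix x y assume "F $ 0 * x + h $ 0 * y \<in> S"
      then obtain d where d: "F $ 0 * x + h $ 0 * y = (\<Sum>i<n. kconst (d i) * b i)" unfolding S_def by blast
      have "(\<Sum>i<n. kconst (d i) * b i) \<in> fiber_ideal (F $ 0) (h $ 0)"
        unfolding fiber_ideal_def by (intro CollectI exI[of _ x] exI[of _ y]) (rule d[symmetric])
      then have "d i = 0" if "i < n" for i using ind that unfolding fiber_indep_def by blast
      then have 0: "F $ 0 * x + h $ 0 * y = 0" unfolding d by (intro sum.neutral) auto
      then have "h $ 0 * y = F $ 0 * (- x)" by (simp add: eq_neg_iff_add_eq_0 add.commute)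
      then have "F $ 0 dvd h $ 0 * y" by (rule dvdI)
      then obtain v where v: "y = F $ 0 * v" using reg by blast
      then have "F $ 0 * (x + h $ 0 * v) = 0" using 0 by (simp add: algebra_simps)
      then have "x = - (h $ 0 * v)" using F0 by (simp add: eq_neg_iff_add_eq_0)
      with v show "\<exists>v. y = F $ 0 * v \<and> x = - (h $ 0 * v)" by blast
    qed
    then have z: "(\<Sum>i<n. kconst (c i $ m) * b i) = 0" for m unfolding embed_nth[symmetric] uw by simp
    have "c i $ m = 0" for m
    proof -
      have "(\<Sum>i<n. kconst (c i $ m) * b i) \<in> fiber_ideal (F $ 0) (h $ 0)"
        unfolding z by (rule is_idealD(1)[OF fiber_ideal_is_ideal])
      then show ?thesis using ind[unfolded fiber_indep_def, THEN spec, of "\<lambda>i. c i $ m"] i by blast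
    qed
    then show "c i = 0" by (simp add: fps_eq_iff)
  qed
  moreover have "family_gen type_ring ?V n ?b"
    unfolding presents_gen_iff[OF p]
  proof
    fix a :: "'k fps fps fps"
    have "\<exists>x y. g - F $ 0 * x - h $ 0 * y \<in> S" for g
    proof -
      obtain d where "g - (\<Sum>i<n. kconst (d i) * b i) \<in> fiber_ideal (F $ 0) (h $ 0)"
        using gen unfolding fiber_gen_def by blast
      then obtain x y where "g - (\<Sum>i<n. kconst (d i) * b i) = F $ 0 * x + h $ 0 * y" unfolding fiber_ideal_def by blast
      then have "g - F $ 0 * x - h $ 0 * y = (\<Sum>i<n. kconst (d i) * b i)" by (simp add: algebra_simps)
      then show ?thesis unfolding S_def by blast
    qed
    from fps_division2[where G=a, OF this] obtain x y where xy: "\<And>m. (a - F * x - h * y) $ m \<in> S" by blast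
    then have "\<forall>m. \<exists>d. (a - F * x - h * y) $ m = (\<Sum>i<n. kconst (d i) * b i)" unfolding S_def by blast
    from choice[OF this] obtain d where d: "\<And>m. (a - F * x - h * y) $ m = (\<Sum>i<n. kconst (d m i) * b i)" by blast
    have "a - F * x - h * y = (\<Sum>i<n. OB_embed (Abs_fps (\<lambda>m. d m i)) * fps_const (b i))"
    proof (rule fps_ext)
      fix m show "(a - F * x - h * y) $ m = (\<Sum>i<n. OB_embed (Abs_fps (\<lambda>m. d m i)) * fps_const (b i)) $ m"
        unfolding embed_nth d by simp
    qed
    then have "a - (\<Sum>i<n. OB_embed (Abs_fps (\<lambda>m. d m i)) * fps_const (b i)) = F * x + h * y" by (simp add: algebra_simps)
    then show "\<exists>c. a - (\<Sum>i<n. OB_embed (c i) * fps_const (b i)) \<in> {a. \<exists>u w. a = F * u + h * w}"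
      by (intro exI[of _ "\<lambda>i. Abs_fps (\<lambda>m. d m i)"] CollectI exI[of _ x] exI[of _ y])
  qed
  moreover have "is_ring_hom (\<lambda>c :: 'k fps. to_ac (fps_to_fls c))"
    by (simp add: is_ring_hom_def fls_times_fps_to_fls)
  moreover have "?b ` {..<n} \<subseteq> carrier ?V" using presentsD(6)[OF p] by auto
  ultimately show ?thesis
    unfolding geometric_generic_dim_def I_def[symmetric] by (intro vdim_base_change presentsD(1)[OF p])
qed

lemma inflection_ideal_principal:
  fixes F :: "'k::field_char_0 fps fps fps"
  assumes F: "\<not> F dvd 1" and e: "dual_basis 3 F e" and \<tau>: "\<tau> \<in> {..<3} \<rightarrow> carrier (principal_parts 3 F)"
  obtains h where "inflection_ideal 3 F e \<tau> = Idl\<^bsub>OX F\<^esub> {OX_class F h}"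
proof -
  obtain D where D: "basis_mod F (jet_ker F F) D" "\<And>i. i < 3 \<Longrightarrow> e i = dual_elt F (D i)"
    by (rule dual_basis_lift[OF F e]) blast
  have Dk: "\<And>i. i < 3 \<Longrightarrow> jet_ker F F (D i)" using D(1) by (simp add: basis_mod_def)
  have "\<forall>j. \<exists>h. j < 3 \<longrightarrow> \<tau> j = pp_class F h" using \<tau> unfolding pp_simps by blast
  from choice[OF this] obtain h where h: "\<And>j. j < 3 \<Longrightarrow> \<tau> j = pp_class F (h j)" by blast
  show thesis by (rule that[OF inflection_ideal_eq[OF Dk D(2) h]])
qed

lemma geometric_generic_dim_inflection:
  fixes F :: "'k::field_char_0 fps fps fps"
  assumes F: "F $ 0 = cusp s" and s: "s > 0" and e: "dual_basis 3 F e"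
    and \<tau>: "\<tau> \<in> {..<3} \<rightarrow> carrier (principal_parts 3 F)"
    and dim: "closed_fiber_dim F (inflection_ideal 3 F e \<tau>) = enat n"
  shows "geometric_generic_dim F (inflection_ideal 3 F e \<tau>) = enat n"
proof -
  obtain h where h: "inflection_ideal 3 F e \<tau> = Idl\<^bsub>OX F\<^esub> {OX_class F h}"
    using inflection_ideal_principal[OF family_nonunit[OF F s] e \<tau>] .
  obtain b where b: "fiber_indep (F $ 0) (h $ 0) n b" "fiber_gen (F $ 0) (h $ 0) n b"
    using closed_fiber_dim_basis dim unfolding h by blast
  have "F $ 0 \<noteq> 0" unfolding F by (rule notI, drule arg_cong[of _ _ "\<lambda>g. g $ 0"]) (simp add: cusp_nth)
  from geometric_generic_dim_principal[OF b this] show ?thesis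
    unfolding h using cusp_fiber_regular[OF s b(2)[unfolded F]] unfolding F by blast
qed

section \<open>Dense open sets of deformation parameters\<close>

lemma poly_funs_line:
  fixes a b :: "'k::field list"
  assumes "p \<in> poly_funs d"
  shows "\<exists>P. \<forall>z. p (map (\<lambda>i. a ! i + z * (b ! i - a ! i)) [0..<d]) = poly P z"
  using assms
proof induction
  case (const c)
  show ?case by (rule exI[of _ "[:c:]"]) simp
next
  case (coord i)
  then show ?case by (intro exI[of _ "[:a ! i, b ! i - a ! i:]"]) simp
next
  case (add p q)
  then obtain P Q where "\<forall>z. p (map (\<lambda>i. a ! i + z * (b ! i - a ! i)) [0..<d]) = poly P z"
    "\<forall>z. q (map (\<lambda>i. a ! i + z * (b ! i - a ! i)) [0..<d]) = poly Q z" by blast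
  then show ?case by (intro exI[of _ "P + Q"]) simp
next
  case (mult p q)
  then obtain P Q where "\<forall>z. p (map (\<lambda>i. a ! i + z * (b ! i - a ! i)) [0..<d]) = poly P z"
    "\<forall>z. q (map (\<lambda>i. a ! i + z * (b ! i - a ! i)) [0..<d]) = poly Q z" by blast
  then show ?case by (intro exI[of _ "P * Q"]) simp
qed

text \<open>On the line joining a point where \<open>p\<close> does not vanish to a point of the
  given open set, both conditions become nonvanishing of polynomials in one variable. An infinite
  field has a point outside the zeros of their product.\<close>

lemma zariski_dense_nonvanishing:
  fixes b :: "'k::field_char_0 list"
  assumes p: "p \<in> poly_funs d" and b: "length b = d" "p b \<noteq> 0"
  shows "zariski_dense d {a. length a = d \<and> p a \<noteq> 0}"
  unfolding zariski_dense_def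
proof (intro allI impI)
  fix V :: "'k list set" assume V: "zariski_open d V \<and> V \<noteq> {}"
  then obtain A a where A: "A \<subseteq> poly_funs d" "V = {a. length a = d \<and> (\<exists>p\<in>A. p a \<noteq> 0)}" "a \<in> V"
    unfolding zariski_open_def by blast
  then obtain r where r: "r \<in> A" "r a \<noteq> 0" "length a = d" by blast
  let ?l = "\<lambda>z. map (\<lambda>i. a ! i + z * (b ! i - a ! i)) [0..<d]"
  obtain P where P: "\<And>z. p (?l z) = poly P z" using poly_funs_line[OF p, of a b] by blast
  obtain R where R: "\<And>z. r (?l z) = poly R z" using poly_funs_line[of r d a b] r A by blast
  have "?l 1 = b" "?l 0 = a" using b(1) r(3) by (auto intro: nth_equalityI)
  then have "poly P 1 \<noteq> 0" "poly R 0 \<noteq> 0" using P[of 1] R[of 0] b r by simp_all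
  then have "P * R \<noteq> 0" by auto
  then have "finite {z. poly (P * R) z = 0}" by (rule poly_roots_finite)
  then obtain z where "poly (P * R) z \<noteq> 0" using infinite_UNIV_char_0[where 'a='k] by (metis (mono_tags) UNIV_eq_I mem_Collect_eq)
  then have "p (?l z) \<noteq> 0" "r (?l z) \<noteq> 0" using P R by simp_all
  then have "?l z \<in> {a. length a = d \<and> p a \<noteq> 0} \<inter> V" unfolding A(2) using r(1) by auto
  then show "{a. length a = d \<and> p a \<noteq> 0} \<inter> V \<noteq> {}" by blast
qed

lemma linear_poly_funs: "m \<le> d \<Longrightarrow> (\<lambda>a. \<Sum>i<m. a ! i * c i) \<in> poly_funs d"
proof (induction m)
  case 0
  then show ?case using poly_funs.const[of 0] by simp
next
  case (Suc m)
  then have "(\<lambda>a. (\<Sum>i<m. a ! i * c i) + a ! m * c m) \<in> poly_funs d"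
    by (intro poly_funs.add poly_funs.mult poly_funs.coord poly_funs.const) auto
  then show ?case by simp
qed

theorem theorem6p7p1:
  fixes s :: nat
    and f :: "'k::{alg_closed_field, field_char_0} fps fps"
    and \<delta> :: "'k fps fps list"
    and N :: enat
  assumes "s \<ge> 2"
    and "f = var_y ^ 2 - var_x ^ s"
    and "represents_Def1_basis f \<delta>"
    and "N = (if s = 2 then 6 else if s = 3 then 8 else enat (3 * s))"
  shows "automatic_degeneracy 3 f \<delta> = N \<and> limiting_inflection_number 3 f \<delta> N"
proof -
  note s = assms(1)
  have s0: "s > 0" using s by simp
  have f: "f = cusp s" by (simp add: assms(2) cusp_def var_x_def var_y_def fps_const_power)
  have N: "N = enat (inflection_count s)"
    by (simp add: assms(4) inflection_count_def numeral_eq_enat)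
  define d where "d = length \<delta>"
  \<comment> \<open>\<open>l a\<close> is the value at the origin of the coefficient of
    \<open>t\<close> in the equation. Its nonvanishing makes that coefficient a unit and defines the
    general deformations.\<close>
  define l where "l a = (\<Sum>i<d. a ! i * \<delta> ! i $ 0 $ 0)" for a
  have F0: "deformation_eqn f \<delta> a $ 0 = cusp s" for a by (simp add: deformation_eqn_def f)
  have F1: "deformation_eqn f \<delta> a $ 1 $ 0 $ 0 = l a" for a
    by (simp add: deformation_eqn_def l_def d_def fps_sum_nth)
  have "f $ 0 $ 0 = 0" "deriv_x f $ 0 $ 0 = 0" "deriv_y f $ 0 $ 0 = 0"
    using s by (simp_all add: f deriv_x_def deriv_y_def cusp_nth fps_X_power_nth)
  from represents_Def1_basis_origin[OF assms(3) this] obtain j where j: "j < d" "\<delta> ! j $ 0 $ 0 \<noteq> 0"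
    unfolding d_def by blast
  \<comment> \<open>The unit vector belonging to a \<open>\<delta> ! j\<close> that does not vanish
    at the origin: a deformation with \<open>l b \<noteq> 0\<close>, which makes the open set
    nonempty.\<close>
  define b where "b = (replicate d 0)[j := 1 :: 'k]"
  have "l b = (\<Sum>i<d. if j = i then \<delta> ! i $ 0 $ 0 else 0)"
    unfolding l_def by (intro sum.cong) (auto simp: b_def)
  then have b: "length b = d" "l b \<noteq> 0" using j by (auto simp: b_def)
  have AD: "automatic_degeneracy 3 f \<delta> = N"
    unfolding automatic_degeneracy_def
  proof (rule antisym)
    have "deformation_eqn f \<delta> b $ 1 $ 0 $ 0 \<noteq> 0" using b(2) F1 by simp
    from degeneracy_attained[OF F0[of b] s this] obtain e \<tau> where "dual_basis 3 (deformation_eqn f \<delta> b) e"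
      "\<tau> \<in> {..<3} \<rightarrow> carrier (principal_parts 3 (deformation_eqn f \<delta> b))"
      "N = closed_fiber_dim (deformation_eqn f \<delta> b) (inflection_ideal 3 (deformation_eqn f \<delta> b) e \<tau>)"
      unfolding N by metis
    then show "Inf {closed_fiber_dim F (inflection_ideal 3 F e \<tau>) | F a e \<tau>.
            length a = length \<delta> \<and> F = deformation_eqn f \<delta> a \<and> dual_basis 3 F e \<and>
            \<tau> \<in> {..<3} \<rightarrow> carrier (principal_parts 3 F)} \<le> N"
      using b(1) unfolding d_def by (intro Inf_lower) blast
    show "N \<le> Inf {closed_fiber_dim F (inflection_ideal 3 F e \<tau>) | F a e \<tau>.
            length a = length \<delta> \<and> F = deformation_eqn f \<delta> a \<and> dual_basis 3 F e \<and>
            \<tau> \<in> {..<3} \<rightarrow> carrier (principal_parts 3 F)}"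
      unfolding N using degeneracy_lower[OF F0 s] by (intro Inf_greatest) blast
  qed
  have lp: "l \<in> poly_funs d" unfolding l_def[abs_def] by (rule linear_poly_funs) simp
  have "limiting_inflection_number 3 f \<delta> N"
    unfolding limiting_inflection_number_def d_def[symmetric]
  proof (intro exI[of _ "{a. length a = d \<and> l a \<noteq> 0}"] conjI ballI allI impI)
    show "zariski_open d {a. length a = d \<and> l a \<noteq> 0}"
      unfolding zariski_open_def using lp by (intro exI[of _ "{l}"]) simp
    show "zariski_dense d {a. length a = d \<and> l a \<noteq> 0}"
      by (rule zariski_dense_nonvanishing[OF lp b])
    fix a assume "a \<in> {a. length a = d \<and> l a \<noteq> 0}"
    then have "deformation_eqn f \<delta> a $ 1 $ 0 $ 0 \<noteq> 0" using F1 by simp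
    from degeneracy_attained[OF F0[of a] s this] show "\<exists>e \<tau>. attains_degeneracy 3 f \<delta> a e \<tau>"
      unfolding attains_degeneracy_def Let_def AD N by blast
  next
    fix a e \<tau> assume "attains_degeneracy 3 f \<delta> a e \<tau>"
    then show "let F = deformation_eqn f \<delta> a in geometric_generic_dim F (inflection_ideal 3 F e \<tau>) = N"
      unfolding attains_degeneracy_def Let_def AD N
      using geometric_generic_dim_inflection[OF F0[of a] s0] by blast
  qed
  with AD show ?thesis by blast
qed

end
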